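(* Let $h_0$ be a smooth $(\mathbb S^1)^n$-invariant Hermitian metric on $\mathcal O(1)$ over $\mathbb P^n$ such that $\omega_0=c_1(\mathcal O(1),h_0)$ is a Kähler form. There exists $N\in\mathbb N$ such that $$\mathcal F_{m\omega_0}(u)\le c''_m\qquad\text{for all }u\in\mathcal H_{m\omega_0,0}\text{ and all }m\ge N,$$ where $c''_m$ is a real constant depending only on $m$ and $\omega_0$.
   Context: Metrics $h$ are written so that $h(s,s)=\|s\|^2$; $c_1(L,h)=-dd^c\log h(s,s)$ for a local holomorphic frame $s$, $dd^c=\frac i{2\pi}\partial\bar\partial$. For an ample line bundle $L$ on a compact Kähler manifold $X$ of dimension $n$, with a smooth metric $h_L$ such that $\omega=c_1(L,h_L)$ is Kähler and with $H^0(X,L\otimes K_X)\neq0$, let $\mathcal H_\omega=\{u\in\mathcal C^\infty(X): dd^cu+\omega>0\}$, identified with the set of smooth positively curved metrics on $L$ via $u\mapsto h_Le^{-u}$. For $u\in\mathcal H_\omega$ and $V=\int_X\omega^n/n!$, set $$\mathcal E_\omega(u)=\frac1{(n+1)!\,V}\sum_{j=0}^n\int_Xu\,(dd^cu+\omega)^j\wedge\omega^{n-j},\qquad \mathcal L_\omega(u)=-\frac1{N_L}\log\det\big(\langle s_i,s_j\rangle_u\big)_{1\le i,j\le N_L},$$ where $N_L=\dim H^0(X,L\otimes K_X)$, $\langle\cdot,\cdot\rangle_u$ is the $L^2$ product on $H^0(X,L\otimes K_X)$ given by the metric $h_Le^{-u}$ on $L$, the metric on $K_X$ induced by $\omega$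 and the volume form $\omega^n$, and $(s_i)$ is a basis orthonormal for $\langle\cdot,\cdot\rangle_0$. Put $\mathcal F_\omega=\mathcal E_\omega-\mathcal L_\omega$. Here $\mathcal F_{m\omega_0}$ is this functional for $X=\mathbb P^n$, $L=\mathcal O(m)$, $h_L=h_0^m$, $\omega=m\omega_0$, and $\mathcal H_{m\omega_0,0}$ is the subset of $\mathcal H_{m\omega_0}$ corresponding to the positive $\mathcal C^\infty$ metrics on $\mathcal O(m)$ invariant under the compact torus $(\mathbb S^1)^n$. *)

theory Defs
  imports
    "HOL-Analysis.Analysis"
    "HOL-Library.Function_Algebras"
    "Jordan_Normal_Form.Determinant"
begin

no_notation Matrix.vec_index (infixl "$" 100)

primrec Ck :: "nat \<Rightarrow> ('a::real_normed_vector \<Rightarrow> 'b::real_normed_vector) \<Rightarrow> bool" where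
  "Ck 0 f \<longleftrightarrow> continuous_on UNIV f"
| "Ck (Suc k) f \<longleftrightarrow> (\<forall>x. f differentiable (at x)) \<and>
     (\<forall>v. Ck k (\<lambda>x. frechet_derivative f (at x) v))"

definition smooth :: "('a::real_normed_vector \<Rightarrow> 'b::real_normed_vector) \<Rightarrow> bool" where
  "smooth f \<longleftrightarrow> (\<forall>k. Ck k f)"

definition holomorphic :: "(complex^'n \<Rightarrow> complex) \<Rightarrow> bool" where
  "holomorphic f \<longleftrightarrow>
     (\<forall>w. \<exists>D. (f has_derivative D) (at w) \<and> (\<forall>c v. D (c *s v) = c * D v))"

text \<open>The Wirtinger operators \<open>\<partial>/\<partial>z\<^sub>k\<close> and \<open>\<partial>/\<partial>\<close>conj\<open>(z\<^sub>k)\<close>.\<close>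

definition dz :: "'n::finite \<Rightarrow> (complex^'n \<Rightarrow> complex) \<Rightarrow> complex^'n \<Rightarrow> complex" where
  "dz k f w = (frechet_derivative f (at w) (axis k 1)
               - \<i> * frechet_derivative f (at w) (axis k \<i>)) / 2"

definition dzbar :: "'n::finite \<Rightarrow> (complex^'n \<Rightarrow> complex) \<Rightarrow> complex^'n \<Rightarrow> complex" where
  "dzbar k f w = (frechet_derivative f (at w) (axis k 1)
                  + \<i> * frechet_derivative f (at w) (axis k \<i>)) / 2"

text \<open>A \<open>(1,1)\<close>-form at a point of \<open>C^n\<close> is represented by the matrix \<open>A\<close> of its coefficients in
  \<open>\<Sum>\<^sub>j\<^sub>k A\<^sub>j\<^sub>k (i/2) dz\<^sub>j \<and> \<close>conj\<open>(dz\<^sub>k)\<close>, and an \<open>(n,n)\<close>-form by its coefficient with respect to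
  \<open>(i/2) dz\<^sub>1 \<and> \<close>conj\<open>(dz\<^sub>1) \<and> \<dots> \<and> (i/2) dz\<^sub>n \<and> \<close>conj\<open>(dz\<^sub>n)\<close>, which is Lebesgue measure.  Since
  \<open>dd\<^sup>c f = (i/2\<pi>) \<Sum>\<^sub>j\<^sub>k f\<^sub>j\<^sub>k dz\<^sub>j \<and> \<close>conj\<open>(dz\<^sub>k)\<close>, its coefficients in this convention are
  \<open>f\<^sub>j\<^sub>k / \<pi>\<close>.\<close>

definition ddc :: "(complex^'n \<Rightarrow> real) \<Rightarrow> complex^'n \<Rightarrow> complex^'n^'n" where
  "ddc f w = (\<chi> j k. dz j (dzbar k (\<lambda>x. of_real (f x))) w / of_real pi)"

definition positive_form :: "complex^'n^'n \<Rightarrow> bool" where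
  "positive_form A \<longleftrightarrow> (\<forall>j k. A $ k $ j = cnj (A $ j $ k)) \<and>
     (\<forall>v. v \<noteq> 0 \<longrightarrow> 0 < Re (\<Sum>j\<in>UNIV. \<Sum>k\<in>UNIV. A $ j $ k * v $ j * cnj (v $ k)))"

text \<open>The wedge product of \<open>n\<close> forms of type \<open>(1,1)\<close>.  Expanding the product, only the terms survive
  in which the \<open>dz\<close>-factors are permuted by some \<open>p\<close> and the conjugate factors by some \<open>q\<close>; putting
  them back in order produces the two signs.\<close>

definition wedge_top :: "('n \<Rightarrow> complex^'n^'n) \<Rightarrow> complex" where
  "wedge_top A = (\<Sum>p | p permutes UNIV. \<Sum>q | q permutes UNIV.
     of_int (sign p) * of_int (sign q) * (\<Prod>k\<in>UNIV. A k $ p k $ q k))"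

text \<open>\<open>A\<^sup>j \<and> B\<^sup>n\<^sup>-\<^sup>j\<close> for \<open>j \<le> n\<close>; \<open>to_nat_on UNIV\<close> enumerates the \<open>n\<close> slots as \<open>0, \<dots>, n - 1\<close>.\<close>

definition wedge_powers :: "nat \<Rightarrow> complex^'n^'n \<Rightarrow> complex^'n^'n \<Rightarrow> complex" where
  "wedge_powers j A B = wedge_top (\<lambda>k. if to_nat_on (UNIV :: 'n set) k < j then A else B)"

text \<open>Homogeneous coordinates are indexed by \<open>'n option\<close>, where \<open>None\<close> is the index \<open>0\<close>, so that the
  dimension is \<open>CARD('n)\<close>.\<close>

typedef (overloaded) 'n projective_space =
  "{l :: (complex^('n::finite option)) set. \<exists>z. z \<noteq> 0 \<and> l = range (\<lambda>c. c *s z)}"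
  by (rule exI[of _ "range (\<lambda>c. c *s (axis None 1))"]) (auto intro!: exI[of _ "axis None 1"])

definition line :: "complex^('n::finite option) \<Rightarrow> 'n projective_space" where
  "line z = Abs_projective_space (range (\<lambda>c. c *s z))"

text \<open>The coordinates on the chart \<open>z\<^sub>i \<noteq> 0\<close> are the quotients \<open>z\<^sub>j / z\<^sub>i\<close> for \<open>j \<noteq> i\<close>.  They are
  indexed by \<open>'n\<close> as follows: \<open>k\<close> stands for \<open>j = Some k\<close>, except that for \<open>i = Some k\<close> it stands for
  \<open>j = None\<close>.\<close>

definition chart_lift :: "'n::finite option \<Rightarrow> complex^'n \<Rightarrow> complex^('n option)" where
  "chart_lift i w = (\<chi> j. if j = i then 1 else case j of Some k \<Rightarrow> w $ k | None \<Rightarrow> w $ the i)"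

definition chart_coord :: "'n::finite option \<Rightarrow> complex^('n option) \<Rightarrow> complex^'n" where
  "chart_coord i z = (\<chi> k. z $ (if i = Some k then None else Some k) / z $ i)"

definition chart :: "'n::finite option \<Rightarrow> complex^'n \<Rightarrow> 'n projective_space" where
  "chart i w = line (chart_lift i w)"

definition transition :: "'n::finite option \<Rightarrow> 'n option \<Rightarrow> complex^'n \<Rightarrow> complex^'n" where
  "transition i j w = chart_coord j (chart_lift i w)"

definition smooth_function :: "('n::finite projective_space \<Rightarrow> real) \<Rightarrow> bool" where
  "smooth_function u \<longleftrightarrow> (\<forall>i. smooth (\<lambda>w. u (chart i w)))"

text \<open>The fibre of \<open>O(m)\<close> over a line \<open>l\<close> is the space of functions on \<open>l\<close> that are homogeneous of
  degree \<open>m\<close>.  A Hermitian metric on \<open>O(m)\<close> is given by the function \<open>h\<close> such that \<open>h z\<close>, for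
  \<open>z \<noteq> 0\<close>, is the squared norm of the element of the fibre over \<open>line z\<close> which takes the value \<open>1\<close> at
  \<open>z\<close>.  Thus \<open>h(s,s)\<close> at \<open>line z\<close> is \<open>\<bar>s(z)\<bar>\<^sup>2 h z\<close>; in particular, for the local frame
  \<open>e\<^sub>i = z\<^sub>i^m\<close> on the \<open>i\<close>-th chart, \<open>h(e\<^sub>i,e\<^sub>i)\<close> is \<open>h (chart_lift i w)\<close>.  Powers and products of metrics
  are powers and products of these functions.  The value \<open>h 0\<close> is irrelevant.\<close>

definition smooth_metric :: "nat \<Rightarrow> (complex^('n::finite option) \<Rightarrow> real) \<Rightarrow> bool" where
  "smooth_metric m h \<longleftrightarrow>
     (\<forall>z. z \<noteq> 0 \<longrightarrow> 0 < h z) \<and>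
     (\<forall>c z. c \<noteq> 0 \<longrightarrow> z \<noteq> 0 \<longrightarrow> h (c *s z) = h z / norm c ^ (2 * m)) \<and>
     (\<forall>i. smooth (\<lambda>w. h (chart_lift i w)))"

text \<open>A global \<open>(1,1)\<close>-form is given by its coefficient matrices in all the charts.\<close>

definition curvature :: "(complex^('n::finite option) \<Rightarrow> real) \<Rightarrow> 'n option \<Rightarrow> complex^'n \<Rightarrow> complex^'n^'n" where
  "curvature h i w = - ddc (\<lambda>x. ln (h (chart_lift i x))) w"

definition ddc_function :: "('n::finite projective_space \<Rightarrow> real) \<Rightarrow> 'n option \<Rightarrow> complex^'n \<Rightarrow> complex^'n^'n" where
  "ddc_function u i w = ddc (\<lambda>x. u (chart i x)) w"

definition kaehler :: "('n option \<Rightarrow> complex^'n \<Rightarrow> complex^'n^'n) \<Rightarrow> bool" where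
  "kaehler \<alpha> \<longleftrightarrow> (\<forall>i w. positive_form (\<alpha> i w))"

definition torus_action :: "complex^'n \<Rightarrow> complex^('n::finite option) \<Rightarrow> complex^('n option)" where
  "torus_action t z = (\<chi> j. case j of None \<Rightarrow> z $ None | Some k \<Rightarrow> t $ k * z $ Some k)"

definition torus_invariant :: "(complex^('n::finite option) \<Rightarrow> real) \<Rightarrow> bool" where
  "torus_invariant h \<longleftrightarrow>
     (\<forall>t z. (\<forall>k. norm (t $ k) = 1) \<longrightarrow> z \<noteq> 0 \<longrightarrow> h (torus_action t z) = h z)"

text \<open>In the rest of the theory \<open>h\<close> is the reference metric \<open>h\<^sub>L\<close> and \<open>\<omega> = curvature h\<close>.\<close>

definition twist :: "(complex^('n::finite option) \<Rightarrow> real) \<Rightarrow> ('n projective_space \<Rightarrow> real)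
    \<Rightarrow> complex^('n option) \<Rightarrow> real" where
  "twist h u z = h z * exp (- u (line z))"

definition potentials :: "(complex^('n::finite option) \<Rightarrow> real) \<Rightarrow> ('n projective_space \<Rightarrow> real) set" where
  "potentials h = {u. smooth_function u \<and> kaehler (\<lambda>i w. ddc_function u i w + curvature h i w)}"

definition invariant_potentials :: "(complex^('n::finite option) \<Rightarrow> real) \<Rightarrow> ('n projective_space \<Rightarrow> real) set" where
  "invariant_potentials h = {u \<in> potentials h. torus_invariant (twist h u)}"

text \<open>A section is given by its coefficients \<open>s i\<close> with respect to the frames
  \<open>e\<^sub>i \<otimes> dw\<^sub>1 \<and> \<dots> \<and> dw\<^sub>n\<close> of the charts.  On the overlap of the charts \<open>i\<close> and \<open>j\<close>,
  \<open>e\<^sub>j = (z\<^sub>j/z\<^sub>i)^m e\<^sub>i\<close>, and the frames of the canonical bundle differ by the Jacobian determinant of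
  the transition map.\<close>

definition jacobian :: "(complex^'n \<Rightarrow> complex^'n) \<Rightarrow> complex^'n \<Rightarrow> complex" where
  "jacobian T w = Determinants.det (\<chi> l k. dz k (\<lambda>x. T x $ l) w)"

definition adjoint_sections :: "nat \<Rightarrow> ('n::finite option \<Rightarrow> complex^'n \<Rightarrow> complex) set" where
  "adjoint_sections m = {s. (\<forall>i. holomorphic (s i)) \<and>
     (\<forall>i j w. chart_lift i w $ j \<noteq> 0 \<longrightarrow>
        s i w = s j (transition i j w) * (chart_lift i w $ j) ^ m * jacobian (transition i j) w)}"

interpretation sections: vector_space
  "\<lambda>(c::complex) (s :: 'n::finite option \<Rightarrow> complex^'n \<Rightarrow> complex) i w. c * s i w"
  by unfold_locales (auto simp: fun_eq_iff algebra_simps)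

text \<open>The metric on \<open>K\<close> induced by \<open>\<omega>\<close> gives \<open>dw\<^sub>1 \<and> \<dots> \<and> dw\<^sub>n\<close> the squared norm
  \<open>1 / det A\<close>, where \<open>A\<close> is the matrix of \<open>\<omega>\<close>, i.e. the Gram determinant of \<open>dw\<^sub>1, \<dots>, dw\<^sub>n\<close> for
  the dual metric.  Other normalizations of this metric change it by a constant factor, which
  cancels in \<open>log_gram\<close>.  Integrals over projective space are computed in the
  chart \<open>None\<close>, whose complement is a null set.\<close>

definition l2_product :: "(complex^('n::finite option) \<Rightarrow> real) \<Rightarrow> ('n projective_space \<Rightarrow> real)
    \<Rightarrow> ('n option \<Rightarrow> complex^'n \<Rightarrow> complex) \<Rightarrow> ('n option \<Rightarrow> complex^'n \<Rightarrow> complex) \<Rightarrow> complex" where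
  "l2_product h u s t = (LINT w|lborel.
     s None w * cnj (t None w) * of_real (twist h u (chart_lift None w))
       * inverse (Determinants.det (curvature h None w))
       * wedge_top (\<lambda>_. curvature h None w))"

definition orthonormal_basis :: "nat \<Rightarrow> (complex^('n::finite option) \<Rightarrow> real) \<Rightarrow> nat
    \<Rightarrow> (nat \<Rightarrow> 'n option \<Rightarrow> complex^'n \<Rightarrow> complex) \<Rightarrow> bool" where
  "orthonormal_basis m h N s \<longleftrightarrow>
     inj_on s {..<N} \<and> sections.independent (s ` {..<N}) \<and>
     sections.span (s ` {..<N}) = adjoint_sections m \<and>
     (\<forall>i<N. \<forall>j<N. l2_product h (\<lambda>_. 0) (s i) (s j) = (if i = j then 1 else 0))"

definition volume :: "(complex^('n::finite option) \<Rightarrow> real) \<Rightarrow> real" where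
  "volume h = (LINT w|lborel. Re (wedge_top (\<lambda>_. curvature h None w))) / fact CARD('n)"

definition energy :: "(complex^('n::finite option) \<Rightarrow> real) \<Rightarrow> ('n projective_space \<Rightarrow> real) \<Rightarrow> real" where
  "energy h u = 1 / (fact (CARD('n) + 1) * volume h) *
     (\<Sum>j=0..CARD('n). LINT w|lborel. u (chart None w) *
        Re (wedge_powers j (ddc_function u None w + curvature h None w) (curvature h None w)))"

text \<open>The Gram determinant does not depend on the chosen orthonormal basis: another choice conjugates the
  Gram matrix by a unitary matrix.  The functional is meaningful only if there are non-zero sections.\<close>

definition log_gram :: "nat \<Rightarrow> (complex^('n::finite option) \<Rightarrow> real) \<Rightarrow> ('n projective_space \<Rightarrow> real) \<Rightarrow> real" where
  "log_gram m h u =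
     (let N = sections.dim (adjoint_sections m :: ('n option \<Rightarrow> complex^'n \<Rightarrow> complex) set);
          s = (SOME s. orthonormal_basis m h N s)
      in - (1 / real N) *
           ln (Re (Determinant.det (Matrix.mat N N (\<lambda>(i, j). l2_product h u (s i) (s j))))))"

definition ding_functional :: "nat \<Rightarrow> (complex^('n::finite option) \<Rightarrow> real) \<Rightarrow> ('n projective_space \<Rightarrow> real) \<Rightarrow> real" where
  "ding_functional m h u = energy h u - log_gram m h u"

end

theory Submission
  imports Defs "HOL-Complex_Analysis.Cauchy_Integral_Formula"
begin

text \<open>In the coordinates \<open>x\<^sub>k = log \<bar>w\<^sub>k\<bar>\<^sup>2\<close> an invariant positive metric on \<open>O(m)\<close> is a convex function \<open>\<phi>\<close> on
  \<open>R^n\<close> at bounded distance from \<open>m max(0, x\<^sub>1, \<dots>, x\<^sub>n)\<close>, whose gradient is a bijection onto the open simplex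
  \<open>p\<^sub>k > 0, \<Sum> p\<^sub>k < m\<close>, of volume \<open>V\<close>.  Differentiating along \<open>\<phi> + t u\<close> shows that the energy of \<open>u\<close> is
  \<open>(\<integral>\<psi> - \<integral>\<psi>\<^sub>u) / V\<close>, where \<open>\<psi>\<close> and \<open>\<psi>\<^sub>u\<close> are the Legendre transforms of \<open>\<phi>\<close> and \<open>\<phi>\<^sub>u = \<phi> + u\<close>.

  With \<open>d = m - n - 1\<close>, the sections of \<open>O(m) \<otimes> K\<close> are spanned by the monomials \<open>w\<^sup>\<beta>\<close> of degree at most \<open>d\<close>, which are
  orthogonal and have squared norms proportional to \<open>\<integral> exp (x \<bullet> (\<beta> + 1) - \<phi>\<^sub>u x) dx\<close>; the Gram determinant is
  the product of the ratios of these norms for \<open>u\<close> and for \<open>0\<close>.  The point \<open>\<beta> + 1\<close> is the barycentre of a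
  Dirichlet density \<open>q\<^sub>\<beta>\<close> on the simplex, and convexity bounds the integral by \<open>K\<^sub>\<beta> exp (\<integral> q\<^sub>\<beta> \<psi>\<^sub>u)\<close> with
  \<open>K\<^sub>\<beta>\<close> independent of \<open>u\<close>.  By the multinomial theorem the average of the \<open>q\<^sub>\<beta>\<close> is the uniform density
  \<open>1/V\<close>, so that the terms \<open>\<integral>\<psi>\<^sub>u / V\<close> cancel.  Finally, the resulting bound depends only on the
  curvature: metrics of equal curvature have potentials that differ by a constant, which does not affect it.\<close>

section \<open>Logarithmic coordinates\<close>

text \<open>The integral bound must carry the mean of \<open>legendre\<close> with coefficient
  exactly one and a constant blind to the potential; any other coefficient would spoil the
  cancellation against the energy. The obstacle is the Jensen gap between this mean and the value at
  the barycentre, for which no bound uniform in the potential is available. The value at the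
  barycentre controls only the maximum of the integrand; its decay is paid for by the gap, and a
  convex combination of the two estimates keeps the coefficient of the gap at most one. The point
  \<beta> + 1 arises twice: the density exp (x_1 + ... + x_n) of the logarithmic coordinates shifts
  the exponent \<beta> by one, and a Dirichlet density with exponents \<beta> has means proportional
  to \<beta> + 1. The factor is one because the n + 1 numbers \<beta>_j + 1 add up to m. The energy
  is handled without differentiating the maximisers in \<open>t\<close>: minus the value of
  \<open>u\<close> at the maximiser is a subgradient in \<open>t\<close> of the Legendre transform,
  and a continuous family of subgradients integrates to the difference.\<close>

lemma Basis_vec_prod:
  "(\<Prod>b\<in>(Basis::('a::euclidean_space^'n) set). f b) = (\<Prod>k\<in>UNIV. \<Prod>u\<in>Basis. f (axis k u))"
proof -
  have "(\<Prod>b\<in>(Basis::('a^'n) set). f b) = (\<Prod>k\<in>UNIV. prod f (axis k ` (Basis::'a set)))"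
    unfolding Basis_vec_def
    by (subst prod.UNION_disjoint[symmetric]) (auto simp: axis_eq_axis intro!: prod.cong)
  also have "\<dots> = (\<Prod>k\<in>UNIV. \<Prod>u\<in>Basis. f (axis k u))"
    by (intro prod.cong refl, subst prod.reindex) (auto simp: inj_on_def axis_eq_axis)
  finally show ?thesis .
qed

section \<open>Lebesgue measure on a space of vectors as a product measure\<close>

lemma measurable_vec_lambda:
  assumes "\<And>k. (\<lambda>x. f x k) \<in> borel_measurable M"
  shows "(\<lambda>x. (\<chi> k. f x k) :: 'a::euclidean_space^'n) \<in> borel_measurable M"
proof (subst borel_measurable_euclidean_space, intro ballI)
  fix b :: "'a^'n" assume "b \<in> Basis"
  then obtain k u where b: "b = axis k u" by (auto simp: Basis_vec_def)
  show "(\<lambda>x. (\<chi> k. f x k) \<bullet> b) \<in> borel_measurable M"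
    unfolding b inner_axis using assms[of k] by simp
qed

lemma measurable_vec_nth [measurable]:
  "(\<lambda>x::'a::euclidean_space^'n. x $ k) \<in> borel_measurable borel"
  by (intro borel_measurable_continuous_onI continuous_intros)

lemma lborel_vec_eq_distr:
  "(lborel :: ('a::euclidean_space^'n) measure) = distr (PiM UNIV (\<lambda>_. lborel)) borel (\<lambda>f. \<chi> k. f k)"
proof (rule lborel_eqI)
  interpret product_sigma_finite "\<lambda>_::'n. lborel :: 'a measure" ..
  fix l u :: "'a^'n" assume lu: "\<And>b. b \<in> Basis \<Longrightarrow> l \<bullet> b \<le> u \<bullet> b"
  have meas: "(\<lambda>f. (\<chi> k. f k) :: 'a^'n) \<in> borel_measurable (PiM (UNIV::'n set) (\<lambda>_. lborel))"
    by (rule measurable_vec_lambda) measurable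
  have lu': "l $ k \<bullet> b \<le> u $ k \<bullet> b" if "b \<in> Basis" for k b
    using lu[of "axis k b"] that by (auto simp: Basis_vec_def inner_axis)
  have pre: "(\<lambda>f. \<chi> k. f k) -` box l u \<inter> space (PiM UNIV (\<lambda>_. lborel)) = PiE UNIV (\<lambda>k. box (l $ k) (u $ k))"
    by (auto simp: space_PiM mem_box Basis_vec_def inner_axis PiE_iff)
  have "emeasure (distr (PiM UNIV (\<lambda>_. lborel)) borel (\<lambda>f. \<chi> k. f k)) (box l u)
      = (\<Prod>k\<in>UNIV. emeasure lborel (box (l $ k) (u $ k)))"
    by (subst emeasure_distr[OF meas]) (auto simp: pre emeasure_PiM)
  also have "\<dots> = (\<Prod>k\<in>UNIV. ennreal (\<Prod>b\<in>Basis. (u $ k - l $ k) \<bullet> b))"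
    using lu' by (intro prod.cong refl emeasure_lborel_box) auto
  also have "\<dots> = ennreal (\<Prod>b\<in>Basis. (u - l) \<bullet> b)"
    unfolding Basis_vec_prod using lu'
    by (subst prod_ennreal) (auto simp: inner_axis inner_diff_left intro!: prod_nonneg)
  finally show "emeasure (distr (PiM UNIV (\<lambda>_. lborel)) borel (\<lambda>f. \<chi> k. f k)) (box l u)
     = ennreal (\<Prod>b\<in>Basis. (u - l) \<bullet> b)" .
qed auto

lemma nn_integral_vec_prod:
  fixes f :: "'n::finite \<Rightarrow> 'a::euclidean_space \<Rightarrow> ennreal"
  assumes [measurable]: "\<And>k. f k \<in> borel_measurable borel"
  shows "(\<integral>\<^sup>+x. (\<Prod>k\<in>UNIV. f k (x $ k)) \<partial>lborel) = (\<Prod>k\<in>UNIV. \<integral>\<^sup>+x. f k x \<partial>lborel)"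
proof -
  interpret product_sigma_finite "\<lambda>_::'n. lborel :: 'a measure" ..
  have meas: "(\<lambda>f. (\<chi> k. f k) :: 'a^'n) \<in> borel_measurable (PiM (UNIV::'n set) (\<lambda>_. lborel))"
    by (rule measurable_vec_lambda) measurable
  have m: "(\<lambda>x::'a^'n. \<Prod>k\<in>UNIV. f k (x $ k)) \<in> borel_measurable borel"
    by measurable
  have "(\<integral>\<^sup>+x. (\<Prod>k\<in>UNIV. f k (x $ k)) \<partial>(lborel::('a^'n) measure)) = 
      (\<integral>\<^sup>+g. (\<Prod>k\<in>UNIV. f k (g k)) \<partial>(PiM UNIV (\<lambda>_. lborel)))"
    by (subst lborel_vec_eq_distr, subst nn_integral_distr[OF meas]) (use m in simp_all)
  also have "\<dots> = (\<Prod>k\<in>UNIV. \<integral>\<^sup>+x. f k x \<partial>lborel)"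
    by (rule product_nn_integral_prod) auto
  finally show ?thesis .
qed

section \<open>The image of Lebesgue measure under the logarithmic coordinates\<close>

lemma emeasure_lnsq:
  "emeasure lborel {z::complex. ln ((norm z)\<^sup>2) \<le> a} = ennreal (pi * exp a)"
proof -
  have "emeasure lborel {z::complex. ln ((norm z)\<^sup>2) \<le> a} = emeasure lborel (cball (0::complex) (exp (a/2)))"
  proof (rule emeasure_eq_AE)
    \<comment> \<open>At the origin the logarithm has no meaningful value, so the set is compared
      with the disc of radius exp (a/2) only away from it.\<close>
    have "AE z in lborel. (z::complex) \<noteq> 0"
      by (rule AE_lborel_singleton)
    then show "AE z in lborel. (z \<in> {z::complex. ln ((norm z)\<^sup>2) \<le> a}) = (z \<in> cball 0 (exp (a/2)))"
    proof eventually_elim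
      case (elim z)
      then have "ln ((norm z)\<^sup>2) \<le> a \<longleftrightarrow> (norm z)\<^sup>2 \<le> exp a"
        by (metis exp_le_cancel_iff exp_ln zero_less_norm_iff zero_less_power)
      also have "exp a = (exp (a/2))\<^sup>2" by (simp add: exp_double[symmetric])
      finally show ?case by (simp add: abs_le_square_iff[symmetric])
    qed
  qed measurable
  also have "\<dots> = ennreal (pi * exp a)"
    by (subst emeasure_cball) (auto simp: unit_ball_vol_2 exp_double[symmetric] ennreal_mult'')
  finally show ?thesis .
qed

lemma nn_integral_exp_atMost:
  assumes "c \<ge> 0"
  shows "(\<integral>\<^sup>+x. ennreal (c * exp x) * indicator {..a} x \<partial>lborel) = ennreal (c * exp a)"
proof -
  have "(\<integral>\<^sup>+x. ennreal (c * exp x) * indicator {..a} x \<partial>lborel) =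
      (\<integral>\<^sup>+x. ennreal (c * exp (-x)) * indicator {..a} (-x) \<partial>lborel)"
    by (subst nn_integral_real_affine[where c="-1" and t=0]) auto
  also have "\<dots> = (\<integral>\<^sup>+x. ennreal (c * exp (-x)) * indicator {-a..} x \<partial>lborel)"
    by (intro nn_integral_cong) (auto simp: indicator_def)
  also have "\<dots> = ennreal (0 - (- c * exp (- (-a))))"
  proof (rule nn_integral_FTC_atLeast)
    show "((\<lambda>x. - c * exp (-x)) \<longlongrightarrow> 0) at_top"
      by (rule tendsto_mult_right_zero, rule filterlim_compose[OF exp_at_bot filterlim_uminus_at_bot_at_top])
    show "DERIV (\<lambda>x. - c * exp (-x)) x :> c * exp (-x)" for x
      by (auto intro!: derivative_eq_intros)
  qed (use assms in auto)
  finally show ?thesis by simp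
qed

definition log_sq :: "complex^'n \<Rightarrow> real^'n" where
  "log_sq w = (\<chi> k. ln ((norm (w $ k))\<^sup>2))"

lemma measurable_log_sq [measurable]: "log_sq \<in> borel_measurable borel"
  unfolding log_sq_def by (rule measurable_vec_lambda) measurable

text \<open>Lower orthants generate the Borel sets and are closed under intersection, and on them
  both measures factor over the coordinates. In one coordinate the value is pi exp a: the area of
  the disc |z|^2 \<le> exp a on one side, the integral of pi exp x over x \<le> a on the other. The
  measures are infinite, hence the exhaustion by the orthants with corner (i, ..., i).\<close>

lemma distr_log_sq:
  "distr lborel borel (log_sq :: complex^'n \<Rightarrow> real^'n) = 
    density lborel (\<lambda>x. ennreal (pi ^ CARD('n) * exp (\<Sum>k\<in>UNIV. x $ k)))"
  (is "?M = ?N")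
proof (rule measure_eqI_generator_eq[where E = "range (\<lambda>a::real^'n. {..a})" and A = "\<lambda>i::nat. {..(\<chi> k. real i)}"])
  have le: "(\<lambda>x. indicator {..a} x :: ennreal) = (\<lambda>x. \<Prod>k\<in>UNIV. indicator {..a$k} (x$k))" for a :: "real^'n"
  proof
    fix x :: "real^'n"
    show "indicator {..a} x = (\<Prod>k\<in>UNIV. indicator {..a$k} (x$k) :: ennreal)"
    proof (cases "x \<le> a")
      case False
      then obtain k where "\<not> x $ k \<le> a $ k" by (auto simp: Finite_Cartesian_Product.less_eq_vec_def)
      then have "(\<Prod>k\<in>UNIV. indicator {..a$k} (x$k) :: ennreal) = 0"
        by (intro prod_zero) (auto simp: indicator_def)
      then show ?thesis using False by simp
    qed (auto simp: Finite_Cartesian_Product.less_eq_vec_def)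
  qed
  have M: "emeasure ?M {..a} = (\<Prod>k\<in>UNIV. ennreal (pi * exp (a$k)))" for a
  proof -
    have "emeasure ?M {..a} = (\<integral>\<^sup>+w. indicator {..a} (log_sq w) \<partial>lborel)"
      by (subst nn_integral_indicator[symmetric]) (auto simp: nn_integral_distr simp del: nn_integral_indicator)
    also have "\<dots> = (\<integral>\<^sup>+w. (\<Prod>k\<in>UNIV. indicator {z. ln ((norm z)\<^sup>2) \<le> a$k} (w$k)) \<partial>(lborel :: (complex^'n) measure))"
      unfolding le by (intro nn_integral_cong prod.cong) (auto simp: log_sq_def indicator_def)
    also have "\<dots> = (\<Prod>k\<in>UNIV. ennreal (pi * exp (a$k)))"
      by (subst nn_integral_vec_prod) (auto simp: emeasure_lnsq)
    finally show ?thesis .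
  qed
  have N: "emeasure ?N {..a} = (\<Prod>k\<in>UNIV. ennreal (pi * exp (a$k)))" for a
  proof -
    have "emeasure ?N {..a} = (\<integral>\<^sup>+x. ennreal (pi ^ CARD('n) * exp (\<Sum>k\<in>UNIV. x $ k)) * indicator {..a} x \<partial>lborel)"
      by (subst emeasure_density) auto
    also have "\<dots> = (\<integral>\<^sup>+x. (\<Prod>k\<in>UNIV. ennreal (pi * exp (x$k)) * indicator {..a$k} (x$k)) \<partial>(lborel :: (real^'n) measure))"
      unfolding le by (intro nn_integral_cong)
        (simp add: prod.distrib prod_ennreal exp_sum)
    also have "\<dots> = (\<Prod>k\<in>UNIV. ennreal (pi * exp (a$k)))"
      by (subst nn_integral_vec_prod) (auto simp: nn_integral_exp_atMost)
    finally show ?thesis .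
  qed
  show "emeasure ?M X = emeasure ?N X" if "X \<in> range (\<lambda>a::real^'n. {..a})" for X
    using that M N by auto
  show "emeasure ?M {..(\<chi> k. real i)} \<noteq> \<infinity>" for i
    unfolding M by (simp add: prod_ennreal ennreal_power)
  show "Int_stable (range (\<lambda>a::real^'n. {..a}))"
  proof (rule Int_stableI_image)
    fix a b :: "real^'n"
    have "{..a} \<inter> {..b} = {..(\<chi> k. min (a$k) (b$k))}"
      by (auto simp: Finite_Cartesian_Product.less_eq_vec_def)
    then show "\<exists>c\<in>UNIV. {..a} \<inter> {..b} = {..c}" by auto
  qed
  show "sets ?M = sigma_sets UNIV (range (\<lambda>a::real^'n. {..a}))" "sets ?N = sigma_sets UNIV (range (\<lambda>a::real^'n. {..a}))"
    by (auto simp: borel_eq_atMost)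
  show "(\<Union>i::nat. {..((\<chi> k. real i) :: real^'n)}) = UNIV"
  proof -
    have "x \<in> {..(\<chi> k. real (nat \<lceil>Max (range (\<lambda>j. x $ j))\<rceil>))}" for x :: "real^'n"
    proof -
      have "x $ k \<le> real (nat \<lceil>Max (range (\<lambda>j. x $ j))\<rceil>)" for k
      proof -
        have "x $ k \<le> Max (range (\<lambda>j. x $ j))" by (rule Max_ge) auto
        also have "\<dots> \<le> real (nat \<lceil>Max (range (\<lambda>j. x $ j))\<rceil>)" by (rule real_nat_ceiling_ge)
        finally show ?thesis .
      qed
      then show ?thesis by (simp add: Finite_Cartesian_Product.less_eq_vec_def)
    qed
    then show ?thesis by blast
  qed
qed auto

lemma AE_nonzero_coords: "AE w in (lborel :: (complex^'n) measure). \<forall>k. w $ k \<noteq> 0"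
proof -
  have "emeasure lborel {w::complex^'n. w $ k = 0} = 0" for k
  proof -
    have *: "(\<integral>\<^sup>+x. indicator {0} (x::complex) \<partial>lborel) = 0"
      by (subst nn_integral_indicator) auto
    have "emeasure lborel {w::complex^'n. w $ k = 0} = (\<integral>\<^sup>+w. indicator {w::complex^'n. w $ k = 0} w \<partial>lborel)"
      by (subst nn_integral_indicator) auto
    also have "\<dots> = (\<integral>\<^sup>+w. (\<Prod>j\<in>UNIV. (if j = k then indicator {0} else (\<lambda>_. 1)) (w$j)) \<partial>(lborel :: (complex^'n) measure))"
    proof (rule nn_integral_cong)
      fix w :: "complex^'n"
      have "(\<Prod>j\<in>UNIV. (if j = k then indicator {0} else (\<lambda>_. 1)) (w$j)) = (\<Prod>j\<in>UNIV. (if j = k then indicator {0} (w$k) else (1::ennreal)))"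
        by (intro prod.cong) auto
      also have "\<dots> = indicator {w. w $ k = 0} w" by (simp add: indicator_def)
      finally show "indicator {w. w $ k = 0} w = (\<Prod>j\<in>UNIV. (if j = k then indicator {0} else (\<lambda>_. (1::ennreal))) (w$j))" ..
    qed
    also have "\<dots> = 0"
    proof (subst nn_integral_vec_prod)
      show "(\<Prod>j\<in>(UNIV::'n set). \<integral>\<^sup>+x. (if j = k then indicator {0::complex} else (\<lambda>_. 1)) x \<partial>lborel) = (0::ennreal)"
        by (rule prod_zero) (use * in \<open>auto intro!: bexI[of _ k]\<close>)
    qed auto
    finally show ?thesis .
  qed
  then have "AE w in (lborel :: (complex^'n) measure). w $ k \<noteq> 0" for k
    by (subst AE_iff_measurable[OF _ refl]) auto
  then show ?thesis by (simp add: AE_all_countable)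
qed

text \<open>The point with positive real coordinates in the torus orbit over \<open>x\<close>: a
  right inverse of \<open>log_sq\<close>.\<close>

definition exp_half :: "real^'n \<Rightarrow> complex^'n" where
  "exp_half x = (\<chi> k. of_real (exp (x $ k / 2)))"

lemma log_sq_exp_half [simp]: "log_sq (exp_half x) = x"
  by (simp add: log_sq_def exp_half_def vec_eq_iff exp_double[symmetric])

lemma norm_exp_half_log_sq: 
  assumes "w $ k \<noteq> 0" 
  shows "norm (exp_half (log_sq w) $ k) = norm (w $ k)"
proof -
  have "norm (exp_half (log_sq w) $ k) = exp (ln ((norm (w$k))\<^sup>2) / 2)"
    by (simp add: exp_half_def log_sq_def)
  also have "\<dots> = exp (ln (norm (w$k)))" using assms by (simp add: ln_realpow)
  finally show ?thesis using assms by simp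
qed

lemma
  fixes F :: "real^'n \<Rightarrow> 'b::{banach, second_countable_topology}"
  assumes F: "F \<in> borel_measurable borel" and f: "f \<in> borel_measurable borel"
    and eq: "\<And>w. (\<forall>k. w $ k \<noteq> 0) \<Longrightarrow> f w = F (log_sq w)"
  shows integral_log_sq: "(LINT w|lborel. f w) =
      (LINT x|lborel. (pi ^ CARD('n) * exp (\<Sum>k\<in>UNIV. x $ k)) *\<^sub>R F x)"
    and integrable_log_sq: "integrable lborel f \<longleftrightarrow>
      integrable lborel (\<lambda>x. (pi ^ CARD('n) * exp (\<Sum>k\<in>UNIV. x $ k)) *\<^sub>R F x)"
proof -
  have ae: "AE w in lborel. f w = F (log_sq w)"
    using AE_nonzero_coords by eventually_elim (rule eq)
  have "(LINT w|lborel. f w) = (LINT w|lborel. F (log_sq w))"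
    by (rule integral_cong_AE) (use ae F f in \<open>auto intro: measurable_compose[OF measurable_log_sq]\<close>)
  also have "\<dots> = (LINT x|distr lborel borel log_sq. F x)"
    by (subst integral_distr) (use F in auto)
  also have "\<dots> = (LINT x|lborel. (pi ^ CARD('n) * exp (\<Sum>k\<in>UNIV. x $ k)) *\<^sub>R F x)"
    unfolding distr_log_sq by (subst integral_density) (use F in auto)
  finally show "(LINT w|lborel. f w) =
      (LINT x|lborel. (pi ^ CARD('n) * exp (\<Sum>k\<in>UNIV. x $ k)) *\<^sub>R F x)" .
  have "integrable lborel f \<longleftrightarrow> integrable lborel (\<lambda>w. F (log_sq w))"
    by (rule integrable_cong_AE) (use ae F f in \<open>auto intro: measurable_compose[OF measurable_log_sq]\<close>)
  also have "\<dots> \<longleftrightarrow> integrable (distr lborel borel log_sq) F"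
    by (subst integrable_distr_eq) (use F in auto)
  also have "\<dots> \<longleftrightarrow> integrable lborel (\<lambda>x. (pi ^ CARD('n) * exp (\<Sum>k\<in>UNIV. x $ k)) *\<^sub>R F x)"
    unfolding distr_log_sq by (subst integrable_density) (use F in auto)
  finally show "integrable lborel f \<longleftrightarrow>
      integrable lborel (\<lambda>x. (pi ^ CARD('n) * exp (\<Sum>k\<in>UNIV. x $ k)) *\<^sub>R F x)" .
qed

section \<open>Change of variables\<close>

text \<open>The change of variables theorem of the library needs a well-ordered index type; every finite type
  has a well-ordered copy.\<close>

typedef 'a wo = "UNIV :: 'a set" morphisms unwo wo by auto

lemma unwo_wo [simp]: "unwo (wo x) = x" by (simp add: wo_inverse)
lemma wo_unwo [simp]: "wo (unwo x) = x" by (simp add: unwo_inverse)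
lemma bij_unwo: "bij unwo" by (rule bij_betw_byWitness[where f' = wo]) auto
lemma bij_wo: "bij wo" by (rule bij_betw_byWitness[where f' = unwo]) auto

instance wo :: (finite) finite
proof
  have "finite (range (wo :: 'a \<Rightarrow> 'a wo))" by simp
  then show "finite (UNIV :: 'a wo set)" by (metis bij_is_surj bij_wo)
qed

instantiation wo :: (finite) wellorder
begin

definition less_eq_wo :: "'a wo \<Rightarrow> 'a wo \<Rightarrow> bool" where
  "less_eq_wo x y \<longleftrightarrow> to_nat_on UNIV (unwo x) \<le> to_nat_on UNIV (unwo y)"

definition less_wo :: "'a wo \<Rightarrow> 'a wo \<Rightarrow> bool" where
  "less_wo x y \<longleftrightarrow> to_nat_on UNIV (unwo x) < to_nat_on UNIV (unwo y)"

instance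
proof
  fix x y z :: "'a wo"
  show "x \<le> y \<Longrightarrow> y \<le> x \<Longrightarrow> x = y"
    by (simp add: less_eq_wo_def unwo_inject)
  show "P x" if "\<And>x. (\<And>y. y < x \<Longrightarrow> P y) \<Longrightarrow> P x" for P and x :: "'a wo"
    by (induction x rule: measure_induct_rule[where f = "\<lambda>x. to_nat_on UNIV (unwo x)"])
       (use that in \<open>auto simp: less_wo_def\<close>)
qed (auto simp: less_eq_wo_def less_wo_def)

end

text \<open>The conjugate lives on another type, so the signs are compared by induction over
  transpositions, which conjugation sends to transpositions.\<close>

lemma sign_conj:
  fixes \<pi> :: "'a::finite \<Rightarrow> 'b::finite"
  assumes \<pi>: "bij \<pi>" and p: "p permutes UNIV"
  shows "sign (\<pi> \<circ> p \<circ> inv_into UNIV \<pi>) = sign p"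
  using finite_class.finite_UNIV p
proof (induction rule: permutes_rev_induct)
  case id
  then show ?case using \<pi> by (simp add: bij_is_surj o_def surj_f_inv_f)
next
  case (swap a b p)
  have tr: "\<pi> \<circ> Transposition.transpose a b \<circ> inv_into UNIV \<pi> = Transposition.transpose (\<pi> a) (\<pi> b)"
  proof
    fix x
    obtain y where "x = \<pi> y" using \<pi> by (metis bij_pointE)
    then show "(\<pi> \<circ> Transposition.transpose a b \<circ> inv_into UNIV \<pi>) x = Transposition.transpose (\<pi> a) (\<pi> b) x"
      using \<pi> by (simp add: bij_is_inj Transposition.transpose_def inj_eq)
  qed
  have "\<pi> \<circ> (p \<circ> Transposition.transpose a b) \<circ> inv_into UNIV \<pi> = (\<pi> \<circ> p \<circ> inv_into UNIV \<pi>) \<circ> Transposition.transpose (\<pi> a) (\<pi> b)"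
    unfolding tr[symmetric] using \<pi> by (auto simp: fun_eq_iff bij_is_inj)
  moreover have "permutation p" "permutation (\<pi> \<circ> p \<circ> inv_into UNIV \<pi>)"
    using swap \<pi> by (auto simp: permutation intro!: bij_comp bij_imp_bij_inv dest: permutes_bij)
  ultimately have "sign (\<pi> \<circ> (p \<circ> Transposition.transpose a b) \<circ> inv_into UNIV \<pi>) = sign (\<pi> \<circ> p \<circ> inv_into UNIV \<pi>) * sign (Transposition.transpose (\<pi> a) (\<pi> b))"
    and "sign (p \<circ> Transposition.transpose a b) = sign p * sign (Transposition.transpose a b)"
    by (simp_all only: sign_compose permutation_swap_id)
  then show ?case
    using swap \<pi> by (simp only: sign_swap_id bij_is_inj inj_eq)
qed

lemma det_relabel:
  fixes A :: "'c::comm_ring_1^'n^'n" and \<pi> :: "'m::finite \<Rightarrow> 'n::finite"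
  assumes \<pi>: "bij \<pi>"
  shows "Determinants.det (\<chi> i j. A $ \<pi> i $ \<pi> j) = Determinants.det A"
proof -
  have "Determinants.det (\<chi> i j. A $ \<pi> i $ \<pi> j) = 
      (\<Sum>p | p permutes UNIV. of_int (sign p) * (\<Prod>i\<in>UNIV. A $ \<pi> i $ \<pi> (p i)))"
    unfolding Determinants.det_def by simp
  also have "\<dots> = (\<Sum>p | p permutes UNIV. of_int (sign p) * (\<Prod>i\<in>UNIV. A $ i $ p i))"
  proof (rule sum.reindex_bij_witness[where i = "\<lambda>q. inv_into UNIV \<pi> \<circ> q \<circ> \<pi>" and j = "\<lambda>p. \<pi> \<circ> p \<circ> inv_into UNIV \<pi>"])
    fix p :: "'m \<Rightarrow> 'm" assume "p \<in> {p. p permutes UNIV}"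
    then have p: "p permutes UNIV" by simp
    show "inv_into UNIV \<pi> \<circ> (\<pi> \<circ> p \<circ> inv_into UNIV \<pi>) \<circ> \<pi> = p"
      using \<pi> by (auto simp: fun_eq_iff bij_is_inj)
    show "\<pi> \<circ> p \<circ> inv_into UNIV \<pi> \<in> {p. p permutes UNIV}"
      using \<pi> p by (auto intro!: bij_imp_permutes bij_comp bij_imp_bij_inv dest: permutes_bij)
    have "(\<Prod>i\<in>UNIV. A $ i $ (\<pi> \<circ> p \<circ> inv_into UNIV \<pi>) i) = (\<Prod>i\<in>UNIV. A $ \<pi> i $ \<pi> (p i))"
      by (rule prod.reindex_bij_betw[OF \<pi>, symmetric, THEN trans]) (use \<pi> in \<open>simp add: bij_is_inj\<close>)
    then show "of_int (sign (\<pi> \<circ> p \<circ> inv_into UNIV \<pi>)) * (\<Prod>i\<in>UNIV. A $ i $ (\<pi> \<circ> p \<circ> inv_into UNIV \<pi>) i) =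
          of_int (sign p) * (\<Prod>i\<in>UNIV. A $ \<pi> i $ \<pi> (p i))"
      using sign_conj[OF \<pi> p] by simp
  next
    fix q :: "'n \<Rightarrow> 'n" assume "q \<in> {p. p permutes UNIV}"
    then show "\<pi> \<circ> (inv_into UNIV \<pi> \<circ> q \<circ> \<pi>) \<circ> inv_into UNIV \<pi> = q" "inv_into UNIV \<pi> \<circ> q \<circ> \<pi> \<in> {p. p permutes UNIV}"
      using \<pi> by (auto simp: fun_eq_iff bij_is_surj surj_f_inv_f
           intro!: bij_imp_permutes bij_comp bij_imp_bij_inv dest: permutes_bij)
  qed
  finally show ?thesis by (simp add: Determinants.det_def)
qed

definition relabel :: "('m \<Rightarrow> 'n) \<Rightarrow> 'a^'n \<Rightarrow> 'a^'m" where
  "relabel \<pi> x = (\<chi> i. x $ \<pi> i)"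

lemma relabel_nth [simp]: "relabel \<pi> x $ i = x $ \<pi> i"
  by (simp add: relabel_def)

lemma bounded_linear_relabel: "bounded_linear (relabel \<pi> :: real^'n::finite \<Rightarrow> real^'m::finite)"
  unfolding linear_conv_bounded_linear[symmetric] by (rule linearI) (auto simp: Finite_Cartesian_Product.vec_eq_iff)

lemma measurable_relabel [measurable]: "(relabel \<pi> :: real^'n::finite \<Rightarrow> real^'m::finite) \<in> borel_measurable borel"
  by (intro borel_measurable_continuous_onI linear_continuous_on bounded_linear_relabel)

lemma distr_relabel:
  fixes \<pi> :: "'m::finite \<Rightarrow> 'n::finite"
  assumes \<pi>: "bij \<pi>"
  shows "distr lborel borel (relabel \<pi> :: real^'n \<Rightarrow> real^'m) = lborel"
proof (rule lborel_eqI[symmetric])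
  fix l u :: "real^'m" assume lu: "\<And>b. b \<in> Basis \<Longrightarrow> l \<bullet> b \<le> u \<bullet> b"
  then have lu': "l $ i \<le> u $ i" for i
    using lu[of "axis i 1"] by (auto simp: Basis_vec_def inner_axis)
  let ?r = "relabel (inv_into UNIV \<pi>) :: real^'m \<Rightarrow> real^'n"
  have "(relabel \<pi> :: real^'n \<Rightarrow> real^'m) -` box l u = box (?r l) (?r u)"
  proof -
    have "(\<forall>i. l $ i < x $ \<pi> i \<and> x $ \<pi> i < u $ i) \<longleftrightarrow> (\<forall>k. l $ inv_into UNIV \<pi> k < x $ k \<and> x $ k < u $ inv_into UNIV \<pi> k)" for x :: "real^'n"
      using \<pi> by (metis bij_is_inj bij_is_surj inv_f_f surj_f_inv_f)
    then show ?thesis by (auto simp: mem_box_cart)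
  qed
  then have "emeasure (distr lborel borel (relabel \<pi> :: real^'n \<Rightarrow> real^'m)) (box l u) = emeasure lborel (box (?r l) (?r u))"
    by (subst emeasure_distr) auto
  also have "\<dots> = (\<Prod>b\<in>Basis. (?r u - ?r l) \<bullet> b)"
    using lu' by (intro emeasure_lborel_box) (auto simp: Basis_vec_def inner_axis)
  also have "(\<Prod>b\<in>Basis. (?r u - ?r l) \<bullet> b) = (\<Prod>k\<in>UNIV. u $ inv_into UNIV \<pi> k - l $ inv_into UNIV \<pi> k)"
    by (simp add: Basis_vec_prod inner_axis)
  also have "\<dots> = (\<Prod>k\<in>UNIV. u $ k - l $ k)"
    by (rule prod.reindex_bij_betw[OF bij_imp_bij_inv[OF \<pi>]])
  also have "\<dots> = (\<Prod>b\<in>Basis. (u - l) \<bullet> b)"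
    by (simp add: Basis_vec_prod inner_axis)
  finally show "emeasure (distr lborel borel (relabel \<pi> :: real^'n \<Rightarrow> real^'m)) (box l u) = (\<Prod>b\<in>Basis. (u - l) \<bullet> b)" .
qed auto

lemma change_of_variables_wo:
  fixes g :: "real^'m::{finite,wellorder} \<Rightarrow> real^'m::_" and f :: "real^'m::_ \<Rightarrow> real"
  assumes g: "\<And>x. (g has_derivative (\<lambda>v. H x *v v)) (at x)" and inj: "inj g"
    and f: "f absolutely_integrable_on (range g)"
  shows "(\<lambda>x. \<bar>Determinants.det (H x)\<bar> * f (g x)) absolutely_integrable_on UNIV \<and>
    integral UNIV (\<lambda>x. \<bar>Determinants.det (H x)\<bar> * f (g x)) = integral (range g) f"
proof -
  \<comment> \<open>The theorem on change of variables takes vector-valued integrands;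
    \<open>f\<close> becomes a vector with one component.\<close>
  let ?f = "\<lambda>x. (\<chi> i::1. f x)"
  have "?f absolutely_integrable_on (range g) \<and> integral (range g) ?f = Finite_Cartesian_Product.vec (integral (range g) f)"
    using f by (simp add: absolutely_integrable_on_1_iff integral_on_1_eq)
  then have "(\<lambda>x. \<bar>Determinants.det (matrix (\<lambda>v. H x *v v))\<bar> *\<^sub>R ?f (g x)) absolutely_integrable_on UNIV \<and>
      integral UNIV (\<lambda>x. \<bar>Determinants.det (matrix (\<lambda>v. H x *v v))\<bar> *\<^sub>R ?f (g x)) = Finite_Cartesian_Product.vec (integral (range g) f)"
    by (subst has_absolute_integral_change_of_variables) (use g inj in \<open>auto intro: has_derivative_at_withinI\<close>)
  then show ?thesis
    by (simp add: absolutely_integrable_on_1_iff integral_on_1_eq matrix_of_matrix_vector_mul Finite_Cartesian_Product.vec_eq_iff)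
qed

text \<open>Invariance of domain gives the open image and the continuous inverse from continuity and
  injectivity alone.\<close>

lemma continuous_inverse_derivative:
  fixes g :: "real^'n \<Rightarrow> real^'n"
  assumes g: "\<And>x. (g has_derivative (\<lambda>v. H x *v v)) (at x)" and inj: "inj g"
  shows "open (range g)" "continuous_on (range g) (inv_into UNIV g)"
proof -
  have c: "continuous_on UNIV g"
    by (rule has_derivative_continuous_on) (use g in \<open>auto intro: has_derivative_at_withinI\<close>)
  show "open (range g)"
    by (rule invariance_of_domain[OF c open_UNIV inj])
  obtain h where h: "homeomorphism UNIV (range g) g h"
    using invariance_of_domain_homeomorphism[OF open_UNIV c _ inj] by auto
  then have "inv_into UNIV g p = h p" if "p \<in> range g" for p
    using that inj by (auto simp: homeomorphism_def)
  moreover have "continuous_on (range g) h" using h by (simp add: homeomorphism_def)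
  ultimately show "continuous_on (range g) (inv_into UNIV g)" by (simp cong: continuous_on_cong)
qed

text \<open>Integrability is read off on the image side, where a bounded function lives on a bounded
  set, and carried back to the unbounded domain. In between, everything is conjugated by
  \<open>relabel\<close> to the well-ordered copy of the index type.\<close>

lemma change_of_variables_lborel:
  fixes g :: "real^'n \<Rightarrow> real^'n" and u :: "real^'n \<Rightarrow> real"
  assumes g: "\<And>x. (g has_derivative (\<lambda>v. H x *v v)) (at x)" and inj: "inj g"
    and H: "continuous_on UNIV H" and U: "bounded (range g)"
    and u: "continuous_on UNIV u" and u_bd: "\<And>x. \<bar>u x\<bar> \<le> B"
  shows "integrable lborel (\<lambda>x. \<bar>Determinants.det (H x)\<bar> * u x)"
    and "set_integrable lborel (range g) (\<lambda>p. u (inv_into UNIV g p))"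
    and "(LINT x|lborel. \<bar>Determinants.det (H x)\<bar> * u x) = (LINT p:range g|lborel. u (inv_into UNIV g p))"
proof -
  note oU = continuous_inverse_derivative(1)[OF g inj]
  note cU = continuous_inverse_derivative(2)[OF g inj]
  have fin: "emeasure lborel (range g) < \<infinity>" using U by (rule emeasure_bounded_finite)
  show int: "set_integrable lborel (range g) (\<lambda>p. u (inv_into UNIV g p))"
    unfolding set_integrable_def
  proof (rule integrableI_bounded_set[where A = "range g" and B = "\<bar>B\<bar>"])
    show "range g \<in> sets lborel" using oU by simp
    show "(\<lambda>p. indicat_real (range g) p *\<^sub>R u (inv_into UNIV g p)) \<in> borel_measurable lborel"
      using borel_measurable_continuous_on_indicator[OF _ continuous_on_compose2[OF u cU]] oU by simp
    show "emeasure lborel (range g) < \<infinity>" by (rule fin)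
    show "AE p in lborel. p \<in> range g \<longrightarrow> norm (indicat_real (range g) p *\<^sub>R u (inv_into UNIV g p)) \<le> \<bar>B\<bar>"
      by (auto intro!: AE_I2 order_trans[OF u_bd])
  qed auto
  let ?R = "relabel wo :: real^'n wo \<Rightarrow> real^'n" and ?S = "relabel unwo :: real^'n \<Rightarrow> real^'n wo"
  have RS [simp]: "?R (?S x) = x" "?S (?R y) = y" for x y by (auto simp: Finite_Cartesian_Product.vec_eq_iff)
  have "distr lborel borel ?R = lborel" by (rule distr_relabel[OF bij_wo])
  have tr_int: "integrable lborel F \<longleftrightarrow> integrable lborel (\<lambda>y. F (?R y))"
    if "F \<in> borel_measurable borel" for F :: "real^'n \<Rightarrow> real"
    by (subst distr_relabel[OF bij_wo, symmetric], subst integrable_distr_eq) (use that in auto)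
  have tr: "(LINT x|lborel. F x) = (LINT y|lborel. F (?R y))"
    if "F \<in> borel_measurable borel" for F :: "real^'n \<Rightarrow> real"
    by (subst distr_relabel[OF bij_wo, symmetric], subst integral_distr) (use that in auto)
  define g' where "g' = (\<lambda>y. ?S (g (?R y)))"
  define H' where "H' = (\<lambda>y. (\<chi> i j. H (?R y) $ unwo i $ unwo j) :: real^'n wo^'n wo)"
  have det: "Determinants.det (H' y) = Determinants.det (H (?R y))" for y
    unfolding H'_def by (rule det_relabel[OF bij_unwo])
  have mv: "?S (H (?R y) *v ?R v) = H' y *v v" for y v
  proof -
    have "(\<Sum>k\<in>UNIV. H (?R y) $ unwo i $ k * v $ wo k) = (\<Sum>j\<in>UNIV. H (?R y) $ unwo i $ unwo j * v $ j)" for i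
      using sum.reindex_bij_betw[OF bij_unwo, of "\<lambda>k. H (?R y) $ unwo i $ k * v $ wo k"] by simp
    then show ?thesis
      by (simp add: H'_def matrix_vector_mult_def Finite_Cartesian_Product.vec_eq_iff)
  qed
  have dg': "(g' has_derivative (\<lambda>v. H' y *v v)) (at y)" for y
  proof -
    have "(?R has_derivative ?R) (at y)" by (rule bounded_linear_imp_has_derivative[OF bounded_linear_relabel])
    from diff_chain_at[OF this g] have "((\<lambda>y. g (?R y)) has_derivative (\<lambda>v. H (?R y) *v ?R v)) (at y)" by (simp add: o_def)
    from bounded_linear.has_derivative[OF bounded_linear_relabel this]
    show ?thesis unfolding g'_def mv[symmetric] .
  qed
  have inj': "inj g'"
  proof (rule injI)
    fix y z assume "g' y = g' z"
    then have "g (?R y) = g (?R z)" unfolding g'_def by (metis RS(1))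
    then show "y = z" using inj by (metis RS(2) injD)
  qed
  define f where "f = (\<lambda>q. u (inv_into UNIV g (?R q)))"
  have rg: "q \<in> range g' \<longleftrightarrow> ?R q \<in> range g" for q
  proof
    assume "?R q \<in> range g"
    then obtain x where "?R q = g x" by auto
    then have "q = g' (?S x)" unfolding g'_def RS by (metis RS(2))
    then show "q \<in> range g'" by simp
  qed (auto simp: g'_def)
  have ind: "indicator (range g') q = indicator (range g) (?R q)" for q
    using rg by (simp add: indicator_def)
  have m1: "(\<lambda>p. indicator (range g) p *\<^sub>R u (inv_into UNIV g p)) \<in> borel_measurable borel"
    using int unfolding set_integrable_def by auto
  have "set_integrable lborel (range g') f"
    using int unfolding set_integrable_def f_def ind by (subst (asm) tr_int) (use m1 in auto)
  moreover have "set_lebesgue_integral lborel (range g') f = (LINT p:range g|lborel. u (inv_into UNIV g p))"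
    unfolding set_lebesgue_integral_def f_def ind by (subst tr) (use m1 in auto)
  ultimately have f: "f absolutely_integrable_on (range g')" and fi: "integral (range g') f = (LINT p:range g|lborel. u (inv_into UNIV g p))"
    using set_borel_integral_eq_integral[of "range g'" f]
    by (simp_all add: set_integrable_def integrable_completion)
  have fg: "f (g' y) = u (?R y)" for y unfolding f_def g'_def using inj by simp
  have m2: "(\<lambda>x. \<bar>Determinants.det (H x)\<bar> * u x) \<in> borel_measurable borel"
  proof (intro borel_measurable_continuous_onI continuous_intros u)
    show "continuous_on UNIV (\<lambda>x. Determinants.det (H x))"
      unfolding Determinants.det_def using H by (intro continuous_intros) auto
  qed
  have m3: "(\<lambda>y. \<bar>Determinants.det (H (?R y))\<bar> * u (?R y)) \<in> borel_measurable borel"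
    using measurable_compose[OF measurable_relabel m2] .
  have "(\<lambda>y. \<bar>Determinants.det (H (?R y))\<bar> * u (?R y)) absolutely_integrable_on UNIV" 
     and i2: "integral UNIV (\<lambda>y. \<bar>Determinants.det (H (?R y))\<bar> * u (?R y)) = (LINT p:range g|lborel. u (inv_into UNIV g p))"
    using change_of_variables_wo[OF dg' inj' f] fi by (auto simp: det fg)
  then have i1: "integrable lborel (\<lambda>y. \<bar>Determinants.det (H (?R y))\<bar> * u (?R y))"
    using m3 by (simp add: set_integrable_def integrable_completion)
  then show "integrable lborel (\<lambda>x. \<bar>Determinants.det (H x)\<bar> * u x)"
    by (subst tr_int[OF m2])
  show "(LINT x|lborel. \<bar>Determinants.det (H x)\<bar> * u x) = (LINT p:range g|lborel. u (inv_into UNIV g p))"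
    unfolding i2[symmetric] by (subst tr[OF m2]) (simp add: integral_lborel[OF i1, symmetric])
qed

section \<open>Toric potentials and their Legendre transforms\<close>

text \<open>The support function of the standard simplex. Multiplied by \<open>m\<close> it is the
  asymptotic model of every invariant potential on O(m).\<close>

definition pos_max :: "real^'n \<Rightarrow> real" where
  "pos_max x = Max (insert 0 (range (\<lambda>k. x $ k)))"

lemma pos_max_ge: "x $ k \<le> pos_max x" "0 \<le> pos_max x"
  unfolding pos_max_def by (rule Max_ge; simp)+

lemma pos_max_le: "(\<And>k. x $ k \<le> c) \<Longrightarrow> 0 \<le> c \<Longrightarrow> pos_max x \<le> c"
  by (auto simp: pos_max_def)

definition open_simplex :: "real \<Rightarrow> (real^'n) set" where
  "open_simplex m = {p. (\<forall>k. 0 < p $ k) \<and> (\<Sum>k\<in>UNIV. p $ k) < m}"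

lemma open_open_simplex: "open (open_simplex m :: (real^'n) set)"
proof -
  have "open_simplex m = (\<Inter>k. {p::real^'n. 0 < p $ k}) \<inter> {p. (\<Sum>k\<in>UNIV. p $ k) < m}"
    by (auto simp: open_simplex_def)
  moreover have "open \<dots>"
    by (intro open_Int open_INT ballI finite open_Collect_less continuous_intros)
  ultimately show ?thesis by simp
qed

lemma bounded_open_simplex: "bounded (open_simplex m :: (real^'n) set)"
proof (rule bounded_subset[OF bounded_cbox])
  show "open_simplex m \<subseteq> cbox 0 ((\<chi> k. m) :: real^'n)"
  proof
    fix p :: "real^'n" assume p: "p \<in> open_simplex m"
    have "p $ k \<le> (\<Sum>k\<in>UNIV. p $ k)" for k
      using p by (intro member_le_sum) (auto simp: open_simplex_def less_imp_le)
    then have "p $ k \<le> m" for k using p by (force simp: open_simplex_def intro: order_trans less_imp_le)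
    then show "p \<in> cbox 0 (\<chi> k. m)" using p by (auto simp: mem_box_cart open_simplex_def less_imp_le)
  qed
qed

lemma inner_le_pos_max:
  assumes "p \<in> open_simplex m"
  shows "x \<bullet> p \<le> m * pos_max x"
proof -
  have "x \<bullet> p = (\<Sum>k\<in>UNIV. x $ k * p $ k)" by (simp add: inner_vec_def)
  also have "\<dots> \<le> (\<Sum>k\<in>UNIV. pos_max x * p $ k)"
    using assms by (intro sum_mono mult_right_mono pos_max_ge) (auto simp: open_simplex_def less_imp_le)
  also have "\<dots> = (\<Sum>k\<in>UNIV. p $ k) * pos_max x" by (simp add: sum_distrib_left mult.commute)
  also have "\<dots> \<le> m * pos_max x"
    using assms by (intro mult_right_mono pos_max_ge) (auto simp: open_simplex_def less_imp_le)
  finally show ?thesis .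
qed

text \<open>The segment from the identity to \<open>A\<close> consists of positive definite, hence
  invertible, matrices, so the determinant keeps the sign it has at the identity.\<close>

lemma det_pos_of_pos_def:
  fixes A :: "real^'n^'n"
  assumes A: "\<And>v. v \<noteq> 0 \<Longrightarrow> 0 < v \<bullet> (A *v v)"
  shows "0 < Determinants.det A"
proof -
  define B where "B = (\<lambda>t. (1 - t) *\<^sub>R Finite_Cartesian_Product.mat 1 + t *\<^sub>R A)"
  have Bv: "B t *v v = (1 - t) *\<^sub>R v + t *\<^sub>R (A *v v)" for t v
    by (simp add: B_def matrix_vector_mult_add_rdistrib scaleR_matrix_vector_assoc[symmetric])
  have nz: "Determinants.det (B t) \<noteq> 0" if t: "0 \<le> t" "t \<le> 1" for t
  proof
    assume "Determinants.det (B t) = 0"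
    then obtain v where v: "v \<noteq> 0" "B t *v v = 0"
      using invertible_det_nz invertible_left_inverse matrix_left_invertible_ker by metis
    then have "0 = v \<bullet> (B t *v v)" by simp
    also have "\<dots> = (1 - t) * (v \<bullet> v) + t * (v \<bullet> (A *v v))" by (simp add: Bv inner_add_right)
    also have "\<dots> > 0"
    proof (cases "t = 0")
      case False
      then show ?thesis using t A[OF v(1)] by (intro add_nonneg_pos mult_nonneg_nonneg mult_pos_pos) auto
    qed (use v in auto)
    finally show False by simp
  qed
  have "continuous_on {0..1} (\<lambda>t. Determinants.det (B t))"
    unfolding Determinants.det_def B_def by (auto intro!: continuous_intros)
  moreover have "Determinants.det (B 0) = 1" "B 1 = A" by (auto simp: B_def)
  ultimately show ?thesis
    using IVT2'[of "\<lambda>t. Determinants.det (B t)" 1 0 0] nz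
    by (metis atLeastAtMost_iff le_less_linear less_imp_le zero_le_one zero_less_one order_refl)
qed

text \<open>\<open>g\<close> and \<open>H\<close> are the gradient and the Hessian of
  \<open>\<phi>\<close>. Convexity enters through \<open>pos_def\<close>, and \<open>growth\<close>
  is the trace left by the extension of the metric over the hyperplanes outside the torus: it alone
  determines the image of the gradient.\<close>

locale toric_potential =
  fixes \<phi> :: "real^'n::finite \<Rightarrow> real" and g :: "real^'n \<Rightarrow> real^'n" and H :: "real^'n \<Rightarrow> real^'n^'n"
    and m C :: real
  assumes m_pos: "0 < m"
    and \<phi>_deriv: "\<And>x. (\<phi> has_derivative (\<lambda>v. g x \<bullet> v)) (at x)"
    and g_deriv: "\<And>x. (g has_derivative (\<lambda>v. H x *v v)) (at x)"
    and continuous_H: "continuous_on UNIV H"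
    and pos_def: "\<And>x v. v \<noteq> 0 \<Longrightarrow> 0 < v \<bullet> (H x *v v)"
    and growth: "\<And>x. \<bar>\<phi> x - m * pos_max x\<bar> \<le> C"
begin

lemma continuous_\<phi>: "continuous_on UNIV \<phi>"
  by (rule has_derivative_continuous_on) (use \<phi>_deriv in \<open>auto intro: has_derivative_at_withinI\<close>)

lemma strict_monotone:
  assumes "x \<noteq> y"
  shows "0 < (g x - g y) \<bullet> (x - y)"
proof -
  let ?d = "x - y"
  let ?f = "\<lambda>s. g (y + s *\<^sub>R ?d) \<bullet> ?d"
  have "((\<lambda>s. y + s *\<^sub>R ?d) has_derivative (\<lambda>h. h *\<^sub>R ?d)) (at s)" for s
    by (auto intro!: derivative_eq_intros)
  from diff_chain_at[OF this g_deriv]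
  have "(?f has_derivative (\<lambda>h. (H (y + s *\<^sub>R ?d) *v (h *\<^sub>R ?d)) \<bullet> ?d)) (at s)" for s
    by (auto intro!: derivative_eq_intros simp: o_def)
  then have D: "DERIV ?f s :> ?d \<bullet> (H (y + s *\<^sub>R ?d) *v ?d)" for s
    unfolding has_field_derivative_def
    by (rule has_derivative_eq_rhs) (auto simp: matrix_vector_mult_scaleR inner_commute mult.commute)
  have "?f 0 < ?f 1"
    by (rule DERIV_pos_imp_increasing[of 0 1]) (use D pos_def[of ?d] assms in auto)
  then show ?thesis by (simp add: inner_diff_left)
qed

lemma inj_g: "inj g"
  by (rule injI) (use strict_monotone in force)

text \<open>The mean value theorem gives the slope at an intermediate point of the segment, which
  monotonicity of the gradient compares with the slope at \<open>x\<close>.\<close>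

lemma above_tangent: "\<phi> x + g x \<bullet> (y - x) \<le> \<phi> y"
proof (cases "x = y")
  case False
  let ?d = "y - x"
  let ?f = "\<lambda>s. \<phi> (x + s *\<^sub>R ?d)"
  have "((\<lambda>s. x + s *\<^sub>R ?d) has_derivative (\<lambda>h. h *\<^sub>R ?d)) (at s)" for s
    by (auto intro!: derivative_eq_intros)
  from diff_chain_at[OF this \<phi>_deriv]
  have "(?f has_derivative (\<lambda>h. g (x + s *\<^sub>R ?d) \<bullet> (h *\<^sub>R ?d))) (at s)" for s
    by (simp add: o_def)
  then have D: "DERIV ?f s :> g (x + s *\<^sub>R ?d) \<bullet> ?d" for s
    unfolding has_field_derivative_def by (rule has_derivative_eq_rhs) auto
  obtain s where s: "0 < s" "s < 1" "?f 1 - ?f 0 = (1 - 0) * (g (x + s *\<^sub>R ?d) \<bullet> ?d)"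
    using MVT2[of 0 1 ?f "\<lambda>s. g (x + s *\<^sub>R ?d) \<bullet> ?d"] D by auto
  have "0 < (g (x + s *\<^sub>R ?d) - g x) \<bullet> ((x + s *\<^sub>R ?d) - x)"
    using s False by (intro strict_monotone) auto
  then have "0 < s * ((g (x + s *\<^sub>R ?d) - g x) \<bullet> ?d)" by simp
  then have "0 < (g (x + s *\<^sub>R ?d) - g x) \<bullet> ?d" using s zero_less_mult_pos by blast
  then show ?thesis using s by (simp add: inner_diff_left)
qed auto

text \<open>The tangent plane at \<open>x\<close> lies below \<open>\<phi>\<close>. Along the ray in
  direction -e_k the upper bound of \<open>growth\<close> does not increase, and along (1, ..., 1)
  it increases at rate at most m; the slope of the tangent plane cannot exceed these rates.\<close>

lemma gradient_in_closed_simplex: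
  shows "0 \<le> g x $ k" "(\<Sum>k\<in>UNIV. g x $ k) \<le> m"
proof -
  define D where "D = m * pos_max x + C - \<phi> x"
  have unbounded: "c \<le> 0" if *: "\<And>s. 0 \<le> s \<Longrightarrow> s * c \<le> D" for c
  proof (rule ccontr)
    assume "\<not> c \<le> 0"
    then have "(\<bar>D\<bar> + 1) / c * c \<le> D" by (intro *) auto
    then show False using \<open>\<not> c \<le> 0\<close> by auto
  qed
  have "s * (- (g x $ k)) \<le> D" if s: "0 \<le> s" for s
  proof -
    have "\<phi> x + g x \<bullet> ((x - s *\<^sub>R axis k 1) - x) \<le> \<phi> (x - s *\<^sub>R axis k 1)" by (rule above_tangent)
    moreover have "g x \<bullet> ((x - s *\<^sub>R axis k 1) - x) = s * (- (g x $ k))" by (simp add: inner_axis)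
    moreover have "\<phi> (x - s *\<^sub>R axis k 1) \<le> m * pos_max (x - s *\<^sub>R axis k 1) + C" using growth[of "x - s *\<^sub>R axis k 1"] by (simp add: abs_le_iff)
    moreover have "pos_max (x - s *\<^sub>R axis k 1) \<le> pos_max x"
    proof (rule pos_max_le)
      fix j
      have "(x - s *\<^sub>R axis k 1) $ j \<le> x $ j" using s by (simp add: axis_def)
      then show "(x - s *\<^sub>R axis k 1) $ j \<le> pos_max x" using pos_max_ge(1)[of x j] by linarith
    qed (rule pos_max_ge)
    then have "m * pos_max (x - s *\<^sub>R axis k 1) \<le> m * pos_max x" using m_pos by simp
    ultimately show ?thesis unfolding D_def by linarith
  qed
  from unbounded[OF this] show "0 \<le> g x $ k" by simp
  have "s * ((\<Sum>k\<in>UNIV. g x $ k) - m) \<le> D" if s: "0 \<le> s" for s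
  proof -
    let ?y = "x + s *\<^sub>R (\<chi> k. 1)"
    have "\<phi> x + g x \<bullet> (?y - x) \<le> \<phi> ?y" by (rule above_tangent)
    moreover have "g x \<bullet> (?y - x) = s * (\<Sum>k\<in>UNIV. g x $ k)" by (simp add: inner_vec_def sum_distrib_left mult.commute)
    moreover have "\<phi> ?y \<le> m * pos_max ?y + C" using growth[of ?y] by (simp add: abs_le_iff)
    moreover have "pos_max ?y \<le> pos_max x + s"
      using s pos_max_ge[of x] by (intro pos_max_le) auto
    then have "m * pos_max ?y \<le> m * pos_max x + m * s" using m_pos by (simp flip: distrib_left)
    ultimately show ?thesis unfolding D_def right_diff_distrib mult.commute[of s m] by linarith
  qed
  from unbounded[OF this] show "(\<Sum>k\<in>UNIV. g x $ k) \<le> m" by simp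
qed

text \<open>If the gradient reached a facet at \<open>x\<close>, strict monotonicity in the
  direction -e_k or (1, ..., 1) would push it out of the closed simplex at the neighbouring
  point.\<close>

lemma gradient_in_simplex: "g x \<in> open_simplex m"
proof -
  have "0 < g x $ k" for k
  proof -
    have "0 < (g x - g (x - axis k 1)) \<bullet> (x - (x - axis k 1))"
      by (rule strict_monotone) (auto simp: axis_eq_0_iff)
    then have "g (x - axis k 1) $ k < g x $ k" by (simp add: inner_axis)
    then show ?thesis using gradient_in_closed_simplex(1)[of "x - axis k 1" k] by linarith
  qed
  moreover have "(\<Sum>k\<in>UNIV. g x $ k) < m"
  proof -
    let ?o = "(\<chi> k. 1) :: real^'n"
    have "?o \<noteq> 0" by (auto simp: Finite_Cartesian_Product.vec_eq_iff)
    then have "0 < (g (x + ?o) - g x) \<bullet> ((x + ?o) - x)" by (intro strict_monotone) auto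
    then have "(\<Sum>k\<in>UNIV. g x $ k) < (\<Sum>k\<in>UNIV. g (x + ?o) $ k)" by (simp add: inner_vec_def sum_subtractf)
    then show ?thesis using gradient_in_closed_simplex(2)[of "x + ?o"] by linarith
  qed
  ultimately show ?thesis by (simp add: open_simplex_def)
qed

text \<open>The difference of m \<open>pos_max\<close> x and x \<bullet> p is a combination of the
  nonnegative numbers \<open>pos_max\<close> x and \<open>pos_max\<close> x - x_k whose coefficients
  are the distances of \<open>p\<close> from the facets, m - \<Sum> p_k and p_k. All of them are at
  least \<open>e\<close>, while these numbers together bound the norm of \<open>x\<close>.\<close>

lemma coercive:
  assumes p: "p \<in> open_simplex m"
  obtains \<delta> where "0 < \<delta>" "\<And>x. \<delta> * norm x - C \<le> \<phi> x - x \<bullet> p"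
proof -
  define e where "e = Min (insert (m - (\<Sum>k\<in>UNIV. p $ k)) (range (\<lambda>k. p $ k)))"
  have e: "0 < e" using p by (auto simp: e_def open_simplex_def)
  moreover have "e \<le> m - (\<Sum>k\<in>UNIV. p $ k)" "\<And>k. e \<le> p $ k"
    unfolding e_def by (rule Min_le; simp)+
  ultimately have e: "0 < e" "e \<le> m - (\<Sum>k\<in>UNIV. p $ k)" "\<And>k. e \<le> p $ k" by auto
  let ?n = "real CARD('n)"
  have n: "1 \<le> ?n" by (simp add: Suc_leI)
  show ?thesis
  proof
    show "0 < e / ?n" using e n by simp
    fix x :: "real^'n"
    have "norm x \<le> (\<Sum>k\<in>UNIV. \<bar>x $ k\<bar>)" by (rule norm_le_l1_cart)
    also have "\<dots> \<le> (\<Sum>k\<in>UNIV. pos_max x + (pos_max x - x $ k))"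
      using pos_max_ge[of x] by (intro sum_mono) (smt (verit))
    finally have "norm x \<le> ?n * pos_max x + (\<Sum>k\<in>UNIV. pos_max x - x $ k)" by (simp only: sum.distrib sum_constant)
    then have "e / ?n * norm x \<le> e / ?n * (?n * pos_max x + (\<Sum>k\<in>UNIV. pos_max x - x $ k))"
      using e n by (intro mult_left_mono) auto
    also have "\<dots> = e * pos_max x + e / ?n * (\<Sum>k\<in>UNIV. pos_max x - x $ k)" by (simp add: distrib_left)
    also have "\<dots> \<le> (m - (\<Sum>k\<in>UNIV. p $ k)) * pos_max x + (\<Sum>k\<in>UNIV. p $ k * (pos_max x - x $ k))"
    proof (rule add_mono)
      show "e * pos_max x \<le> (m - (\<Sum>k\<in>UNIV. p $ k)) * pos_max x"
        using e by (intro mult_right_mono pos_max_ge) auto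
      have "e / ?n \<le> e" using n e by (simp add: field_simps)
      then have "e / ?n * (\<Sum>k\<in>UNIV. pos_max x - x $ k) \<le> e * (\<Sum>k\<in>UNIV. pos_max x - x $ k)"
        by (intro mult_right_mono sum_nonneg) (auto simp: pos_max_ge)
      also have "\<dots> \<le> (\<Sum>k\<in>UNIV. p $ k * (pos_max x - x $ k))"
        unfolding sum_distrib_left using e by (intro sum_mono mult_right_mono) (auto simp: pos_max_ge)
      finally show "e / ?n * (\<Sum>k\<in>UNIV. pos_max x - x $ k) \<le> (\<Sum>k\<in>UNIV. p $ k * (pos_max x - x $ k))" .
    qed
    also have "\<dots> = m * pos_max x - x \<bullet> p"
      by (simp add: inner_vec_def algebra_simps sum_subtractf sum_distrib_left sum_distrib_right)
    also have "\<dots> \<le> \<phi> x - x \<bullet> p + C" using growth[of x] by (simp add: abs_le_iff)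
    finally show "e / ?n * norm x - C \<le> \<phi> x - x \<bullet> p" by simp
  qed
qed

text \<open>For \<open>p\<close> in the simplex the function \<phi> x - x \<bullet> p is coercive,
  so it has a minimum, and there the gradient equals \<open>p\<close>.\<close>

lemma range_g: "range g = open_simplex m"
proof
  show "open_simplex m \<subseteq> range g"
  proof
    fix p :: "real^'n" assume p: "p \<in> open_simplex m"
    obtain \<delta> where \<delta>: "0 < \<delta>" "\<And>x. \<delta> * norm x - C \<le> \<phi> x - x \<bullet> p" using coercive[OF p] by blast
    let ?f = "\<lambda>x. \<phi> x - x \<bullet> p"
    \<comment> \<open>Outside the ball of this radius the coercive lower bound exceeds the value at
      0.\<close>
    define R where "R = (\<bar>\<phi> 0 + C\<bar> + 1) / \<delta>"
    have R: "0 \<le> R" using \<delta> by (simp add: R_def)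
    have "continuous_on (cball 0 R) ?f"
      by (intro continuous_intros continuous_on_subset[OF continuous_\<phi>]) auto
    then obtain x where x: "x \<in> cball 0 R" "\<And>y. y \<in> cball 0 R \<Longrightarrow> ?f x \<le> ?f y"
      using continuous_attains_inf[of "cball 0 R" ?f] R by (auto simp: compact_cball)
    have min: "?f x \<le> ?f y" for y
    proof (cases "y \<in> cball 0 R")
      case False
      then have "\<delta> * R < \<delta> * norm y" using \<delta> by simp
      then have "?f 0 \<le> ?f y" using \<delta>(2)[of y] \<delta>(1) by (simp add: R_def)
      then show ?thesis using x(2)[of 0] R by simp
    qed (use x in auto)
    have "(?f has_derivative (\<lambda>v. g x \<bullet> v - v \<bullet> p)) (at x)"
      by (auto intro!: derivative_eq_intros \<phi>_deriv)
    then have "(\<lambda>v. g x \<bullet> v - v \<bullet> p) = (\<lambda>v. 0)"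
      by (intro differential_zero_maxmin[OF UNIV_I open_UNIV]) (use min in auto)
    from fun_cong[OF this, of "g x - p"] have "(g x - p) \<bullet> (g x - p) = 0" 
      by (simp add: inner_diff_left inner_diff_right inner_commute)
    then have "g x = p" by simp
    then show "p \<in> range g" by auto
  qed
qed (use gradient_in_simplex in auto)

definition arg :: "real^'n \<Rightarrow> real^'n" where "arg = inv_into UNIV g"

text \<open>The supremum of x \<bullet> p - \<phi> x, written through the point that attains
  it.\<close>

definition legendre :: "real^'n \<Rightarrow> real" where "legendre p = arg p \<bullet> p - \<phi> (arg p)"

lemma g_arg: "p \<in> open_simplex m \<Longrightarrow> g (arg p) = p"
  unfolding arg_def by (rule f_inv_into_f) (simp add: range_g)

lemma legendre_ge: "p \<in> open_simplex m \<Longrightarrow> x \<bullet> p - \<phi> x \<le> legendre p"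
  using above_tangent[of "arg p" x] by (simp add: legendre_def g_arg inner_diff_right inner_commute)

text \<open>The lower bound tests the supremum at 0. For the upper bound, x \<bullet> p is at most m
  \<open>pos_max\<close> x, because \<open>pos_max\<close> is a support function, and this exceeds
  \<phi> x by at most C.\<close>

lemma legendre_bounds: 
  assumes "p \<in> open_simplex m"
  shows "- \<phi> 0 \<le> legendre p" "legendre p \<le> C"
proof -
  show "- \<phi> 0 \<le> legendre p" using legendre_ge[OF assms, of 0] by simp
  show "legendre p \<le> C"
    using inner_le_pos_max[OF assms, of "arg p"] growth[of "arg p"] by (simp add: legendre_def abs_le_iff)
qed

lemma continuous_on_arg: "continuous_on (open_simplex m) arg"
  using continuous_inverse_derivative(2)[OF g_deriv inj_g] by (simp add: range_g arg_def)

lemma continuous_on_legendre: "continuous_on (open_simplex m) legendre"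
  unfolding legendre_def
  by (intro continuous_intros continuous_on_arg continuous_on_compose2[OF continuous_\<phi>]) auto

lemma det_pos: "0 < Determinants.det (H x)"
  by (rule det_pos_of_pos_def) (rule pos_def)

lemma bounded_range_g: "bounded (range g)"
  by (simp add: range_g bounded_open_simplex)

text \<open>The gradient map pushes the real Monge-Ampere measure det (H x) dx forward to Lebesgue
  measure on the simplex.\<close>

lemma change_of_variables:
  fixes u :: "real^'n \<Rightarrow> real"
  assumes u: "continuous_on UNIV u" and u_bd: "\<And>x. \<bar>u x\<bar> \<le> B"
  shows "integrable lborel (\<lambda>x. Determinants.det (H x) * u x)"
    and "set_integrable lborel (open_simplex m) (\<lambda>p. u (arg p))"
    and "(LINT x|lborel. Determinants.det (H x) * u x) = (LINT p:open_simplex m|lborel. u (arg p))"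
  using change_of_variables_lborel[OF g_deriv inj_g continuous_H bounded_range_g u u_bd]
  by (simp_all only: range_g arg_def[symmetric] abs_of_pos[OF det_pos])

lemma set_integrable_legendre: "set_integrable lborel (open_simplex m) legendre"
  unfolding set_integrable_def
proof (rule integrableI_bounded_set[where A = "open_simplex m" and B = "\<bar>\<phi> 0\<bar> + \<bar>C\<bar>"])
  show "(open_simplex m :: (real^'n) set) \<in> sets lborel" by (simp add: borel_open open_open_simplex)
  show "(\<lambda>p. indicat_real (open_simplex m) p *\<^sub>R legendre p) \<in> borel_measurable lborel"
    using borel_measurable_continuous_on_indicator[OF borel_open[OF open_open_simplex] continuous_on_legendre] by simp
  show "emeasure lborel (open_simplex m :: (real^'n) set) < \<infinity>" by (rule emeasure_bounded_finite[OF bounded_open_simplex])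
  have "norm (indicat_real (open_simplex m) p *\<^sub>R legendre p) \<le> \<bar>\<phi> 0\<bar> + \<bar>C\<bar>" if "p \<in> open_simplex m" for p
    using legendre_bounds[OF that] that by simp
  then show "AE p in lborel. p \<in> open_simplex m \<longrightarrow> norm (indicat_real (open_simplex m) p *\<^sub>R legendre p) \<le> \<bar>\<phi> 0\<bar> + \<bar>C\<bar>"
    by auto
qed auto

end

section \<open>The energy along a segment of potentials\<close>

text \<open>The values at \<open>s\<close> and \<open>2 s\<close> are combined so that the leading coefficient cancels.\<close>

lemma integrable_coeffs_of_integrable_poly:
  fixes f :: "nat \<Rightarrow> 'a \<Rightarrow> real"
  assumes "\<And>s. 0 < s \<Longrightarrow> integrable M (\<lambda>x. \<Sum>j\<le>n. s ^ j * f j x)" and "j \<le> n"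
  shows "integrable M (f j)"
  using assms
proof (induction n arbitrary: f j)
  case 0
  from 0(1)[of 1] 0(2) show ?case by simp
next
  case (Suc n)
  have low: "integrable M (f j)" if j: "j \<le> n" for j
  proof -
    let ?c = "\<lambda>j. 2 ^ j - 2 ^ Suc n :: real"
    have "integrable M (\<lambda>x. ?c j * f j x)"
    proof (rule Suc.IH[OF _ j])
      fix s :: real assume s: "0 < s"
      have "integrable M (\<lambda>x. (\<Sum>j\<le>Suc n. (2 * s) ^ j * f j x) - 2 ^ Suc n * (\<Sum>j\<le>Suc n. s ^ j * f j x))"
        using s by (intro Bochner_Integration.integrable_diff integrable_mult_right Suc.prems(1)) auto
      moreover have "(\<Sum>j\<le>Suc n. (2 * s) ^ j * f j x) - 2 ^ Suc n * (\<Sum>j\<le>Suc n. s ^ j * f j x) =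
          (\<Sum>j\<le>n. s ^ j * (?c j * f j x))" for x
      proof -
        have "(\<Sum>j\<le>Suc n. (2 * s) ^ j * f j x) - 2 ^ Suc n * (\<Sum>j\<le>Suc n. s ^ j * f j x) =
            (\<Sum>j\<le>Suc n. s ^ j * (?c j * f j x))"
          unfolding sum_distrib_left sum_subtractf[symmetric]
          by (intro sum.cong refl) (simp add: power_mult_distrib algebra_simps)
        also have "\<dots> = (\<Sum>j\<le>n. s ^ j * (?c j * f j x))" by simp
        finally show ?thesis .
      qed
      ultimately show "integrable M (\<lambda>x. \<Sum>j\<le>n. s ^ j * (?c j * f j x))" by simp
    qed
    moreover have "(2::real) ^ j < 2 ^ Suc n" using j by (intro power_strict_increasing) auto
    then have "?c j \<noteq> 0" by simp
    ultimately show ?thesis by (simp add: integrable_mult_right_iff del: power_Suc)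
  qed
  show ?case
  proof (cases "j \<le> n")
    case False
    then have j: "j = Suc n" using Suc.prems by simp
    have "integrable M (\<lambda>x. (\<Sum>j\<le>Suc n. 1 ^ j * f j x) - (\<Sum>j\<le>n. f j x))"
      by (intro Bochner_Integration.integrable_diff Bochner_Integration.integrable_sum Suc.prems(1) low) auto
    then show ?thesis by (simp add: j)
  qed (rule low)
qed

section \<open>Bernstein polynomials and their integrals\<close>

definition bernstein :: "nat \<Rightarrow> nat \<Rightarrow> real \<Rightarrow> real" where
  "bernstein n j t = real (n choose j) * (t ^ j * (1 - t) ^ (n - j))"

lemma sum_bernstein: "(\<Sum>j\<le>n. bernstein n j t) = 1"
  using binomial_ring[of t "1 - t" n] by (simp add: bernstein_def mult.assoc)

lemma continuous_on_bernstein: "continuous_on S (bernstein n j)"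
  unfolding bernstein_def by (intro continuous_intros)

lemma bernstein_deriv:
  assumes j: "j < n"
  shows "(bernstein (Suc n) (Suc j) has_real_derivative
    real (Suc n) * (bernstein n j t - bernstein n (Suc j) t)) (at t within S)"
proof -
  have a: "real (Suc n choose Suc j) * real (Suc j) = real (Suc n) * real (n choose j)"
    by (metis Suc_times_binomial_eq mult.commute of_nat_mult)
  have b: "real (Suc n choose Suc j) * real (n - j) = real (Suc n) * real (n choose Suc j)"
  proof -
    have "(Suc n choose Suc j) * (Suc n - Suc j) = Suc n * (n choose Suc j)"
      using binomial_absorb_comp[of "Suc n" "Suc j"] by (simp add: mult.commute)
    then show ?thesis by (metis diff_Suc_Suc of_nat_mult)
  qed
  have "(bernstein (Suc n) (Suc j) has_real_derivative
      real (Suc n choose Suc j) * (real (Suc j) * t ^ j * (1 - t) ^ (n - j) - t ^ Suc j * (real (n - j) * (1 - t) ^ (n - j - 1)))) (at t within S)"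
  proof -
    have d1: "((\<lambda>t. t ^ Suc j) has_real_derivative real (Suc j) * t ^ j) (at t within S)"
      using DERIV_pow[of "Suc j" t S] by simp
    have d2: "((\<lambda>t. (1 - t) ^ (n - j)) has_real_derivative - (real (n - j) * (1 - t) ^ (n - j - 1))) (at t within S)"
      by (auto intro!: derivative_eq_intros)
    show ?thesis
      unfolding bernstein_def diff_Suc_Suc
      by (rule DERIV_cong[OF DERIV_cmult[OF DERIV_mult[OF d1 d2]]]) (simp only: mult_minus_right mult_minus_left diff_conv_add_uminus mult.commute mult.left_commute)
  qed
  also have "real (Suc n choose Suc j) * (real (Suc j) * t ^ j * (1 - t) ^ (n - j) - t ^ Suc j * (real (n - j) * (1 - t) ^ (n - j - 1)))
     = (real (Suc n choose Suc j) * real (Suc j)) * (t ^ j * (1 - t) ^ (n - j)) - (real (Suc n choose Suc j) * real (n - j)) * (t ^ Suc j * (1 - t) ^ (n - Suc j))"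
    by (simp add: algebra_simps)
  also have "\<dots> = real (Suc n) * (bernstein n j t - bernstein n (Suc j) t)"
    unfolding a b bernstein_def by (simp only: right_diff_distrib mult.assoc)
  finally show ?thesis .
qed

text \<open>By \<open>bernstein_deriv\<close> the difference of two consecutive polynomials has a
  primitive that vanishes at 0 and at 1, so all n + 1 integrals agree; they add up to 1.\<close>

lemma has_integral_bernstein:
  assumes "j \<le> n"
  shows "(bernstein n j has_integral 1 / real (Suc n)) {0..1}"
proof -
  define c where "c j = integral {0..1} (bernstein n j)" for j
  have int: "bernstein n j integrable_on {0..1}" for j
    by (intro integrable_continuous_interval continuous_on_bernstein)
  have step: "c j = c (Suc j)" if j: "j < n" for j
  proof -
    have "((\<lambda>t. real (Suc n) * (bernstein n j t - bernstein n (Suc j) t)) has_integral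
        (bernstein (Suc n) (Suc j) 1 - bernstein (Suc n) (Suc j) 0)) {0..1}"
      using bernstein_deriv[OF j] by (intro fundamental_theorem_of_calculus) (auto simp: has_real_derivative_iff_has_vector_derivative)
    moreover have "bernstein (Suc n) (Suc j) 1 - bernstein (Suc n) (Suc j) 0 = 0" using j by (simp add: bernstein_def)
    moreover have "((\<lambda>t. real (Suc n) * (bernstein n j t - bernstein n (Suc j) t)) has_integral real (Suc n) * (c j - c (Suc j))) {0..1}"
      unfolding c_def using int by (intro has_integral_mult_right has_integral_diff) auto
    ultimately have "real (Suc n) * (c j - c (Suc j)) = 0" by (metis has_integral_unique)
    then show ?thesis by simp
  qed
  have const: "c j = c 0" if "j \<le> n" for j using that by (induction j) (auto simp: step[symmetric])
  have "(\<Sum>j\<le>n. c j) = (\<Sum>j\<le>n. c 0)" by (intro sum.cong refl const) simp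
  then have "(\<Sum>j\<le>n. c j) = real (Suc n) * c 0" by simp
  moreover have "((\<lambda>t. \<Sum>j\<le>n. bernstein n j t) has_integral (\<Sum>j\<le>n. c j)) {0..1}"
    unfolding c_def by (intro has_integral_sum finite_atMost integrable_integral int)
  then have c1: "((\<lambda>t::real. 1::real) has_integral (\<Sum>j\<le>n. c j)) {0..1}"
    unfolding sum_bernstein .
  have "((\<lambda>t::real. 1::real) has_integral 1) {0..1}" using has_integral_const_real[of "1::real" 0 1] by simp
  from has_integral_unique[OF c1 this] have "(\<Sum>j\<le>n. c j) = 1" .
  ultimately have "real (Suc n) * c j = 1"
    using const[OF assms] by simp
  then have "c j = 1 / real (Suc n)" by (simp add: eq_divide_eq mult.commute)
  then show ?thesis using integrable_integral[OF int[of j]] by (simp add: c_def)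
qed

text \<open>\<open>G\<close> is a continuous choice of subgradients of \<open>F\<close>. Exchanging
  \<open>s\<close> and \<open>t\<close> in the hypothesis traps the difference quotient between G t
  and G s, so that \<open>F\<close> is differentiable with derivative \<open>G\<close>.\<close>

lemma fundamental_theorem_squeeze:
  fixes F G :: "real \<Rightarrow> real"
  assumes ab: "a \<le> b" and G: "continuous_on {a..b} G"
    and le: "\<And>s t. s \<in> {a..b} \<Longrightarrow> t \<in> {a..b} \<Longrightarrow> (s - t) * G t \<le> F s - F t"
  shows "(G has_integral (F b - F a)) {a..b}"
proof (rule fundamental_theorem_of_calculus[OF ab])
  fix t assume t: "t \<in> {a..b}"
  have bound: "norm ((F s - F t) / (s - t) - G t) \<le> \<bar>G s - G t\<bar>" if s: "s \<in> {a..b}" "s \<noteq> t" for s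
  proof -
    have 1: "(s - t) * G t \<le> F s - F t" and 2: "F s - F t \<le> (s - t) * G s"
      using le[OF s(1) t] le[OF t s(1)] by (auto simp: algebra_simps)
    define q where "q = (F s - F t) / (s - t)"
    have q: "F s - F t = (s - t) * q" using s by (simp add: q_def)
    consider "s > t" | "s < t" using s by linarith
    then have "(G t \<le> q \<and> q \<le> G s) \<or> (G s \<le> q \<and> q \<le> G t)"
      using 1 2 unfolding q by cases (auto simp: mult_le_cancel_left)
    then show ?thesis unfolding q_def[symmetric] by auto
  qed
  have "(G \<longlongrightarrow> G t) (at t within {a..b})" using G t by (auto simp: continuous_on_def)
  then have "((\<lambda>s. \<bar>G s - G t\<bar>) \<longlongrightarrow> 0) (at t within {a..b})"
    by (auto intro!: tendsto_eq_intros)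
  then have "((\<lambda>s. (F s - F t) / (s - t) - G t) \<longlongrightarrow> 0) (at t within {a..b})"
    by (rule Lim_null_comparison[rotated]) (use bound in \<open>auto simp: eventually_at_filter\<close>)
  then show "(F has_vector_derivative G t) (at t within {a..b})"
    by (simp add: has_real_derivative_iff_has_vector_derivative[symmetric] has_field_derivative_iff LIM_zero_iff)
qed

text \<open>The segment from \<phi> to \<phi> + u. In the Bernstein basis the coefficient
  \<open>mixed l\<close> of the determinant is the mixed discriminant of \<open>l\<close> copies of
  H + Hu and n - l copies of H, the real counterpart of a wedge product in the energy.\<close>

locale toric_pair = toric_potential \<phi> g H m C
  for \<phi> :: "real^'n::finite \<Rightarrow> real" and g H m C +
  fixes u :: "real^'n \<Rightarrow> real" and gu :: "real^'n \<Rightarrow> real^'n" and Hu :: "real^'n \<Rightarrow> real^'n^'n"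
    and B :: real and mixed :: "nat \<Rightarrow> real^'n \<Rightarrow> real"
  assumes u_deriv: "\<And>x. (u has_derivative (\<lambda>v. gu x \<bullet> v)) (at x)"
    and gu_deriv: "\<And>x. (gu has_derivative (\<lambda>v. Hu x *v v)) (at x)"
    and continuous_Hu: "continuous_on UNIV Hu"
    and pos_def_sum: "\<And>x v. v \<noteq> 0 \<Longrightarrow> 0 < v \<bullet> ((H x + Hu x) *v v)"
    and u_bound: "\<And>x. \<bar>u x\<bar> \<le> B"
    and continuous_mixed: "\<And>l. continuous_on UNIV (mixed l)"
    and det_mixed: "\<And>t x. Determinants.det ((1 - t) *\<^sub>R H x + t *\<^sub>R (H x + Hu x)) =
        (\<Sum>l\<le>CARD('n). bernstein CARD('n) l t * mixed l x)"
begin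

abbreviation "\<phi>t t x \<equiv> \<phi> x + t * u x"
abbreviation "gt t x \<equiv> g x + t *\<^sub>R gu x"
abbreviation "Ht t x \<equiv> (1 - t) *\<^sub>R H x + t *\<^sub>R (H x + Hu x)"

lemma continuous_u: "continuous_on UNIV u"
  by (rule has_derivative_continuous_on) (use u_deriv in \<open>auto intro: has_derivative_at_withinI\<close>)

lemma toric_potential_t:
  assumes t: "0 \<le> t" "t \<le> 1"
  shows "toric_potential (\<phi>t t) (gt t) (Ht t) m (C + B)"
proof
  show "0 < m" by (rule m_pos)
  show "(\<phi>t t has_derivative (\<lambda>v. gt t x \<bullet> v)) (at x)" for x
    by (auto intro!: derivative_eq_intros \<phi>_deriv u_deriv simp: inner_add_left)
  show "(gt t has_derivative (\<lambda>v. Ht t x *v v)) (at x)" for x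
    by (auto intro!: derivative_eq_intros g_deriv gu_deriv
      simp: matrix_vector_mult_add_rdistrib scaleR_matrix_vector_assoc[symmetric] algebra_simps)
  show "continuous_on UNIV (Ht t)" by (intro continuous_intros continuous_H continuous_Hu)
  show "0 < v \<bullet> (Ht t x *v v)" if "v \<noteq> 0" for x v
  proof -
    have "v \<bullet> (Ht t x *v v) = (1 - t) * (v \<bullet> (H x *v v)) + t * (v \<bullet> ((H x + Hu x) *v v))"
      by (simp add: matrix_vector_mult_add_rdistrib scaleR_matrix_vector_assoc[symmetric] inner_add_right distrib_left)
    moreover have "0 < (1 - t) * (v \<bullet> (H x *v v)) + t * (v \<bullet> ((H x + Hu x) *v v))"
    proof (cases "t = 0")
      case False
      then show ?thesis
        using t pos_def[OF that, of x] pos_def_sum[OF that, of x]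
        by (intro add_nonneg_pos mult_nonneg_nonneg mult_pos_pos) linarith+
    qed (use pos_def[OF that, of x] in simp)
    ultimately show ?thesis by simp
  qed
  show "\<bar>\<phi>t t x - m * pos_max x\<bar> \<le> C + B" for x
  proof -
    have "\<bar>t * u x\<bar> \<le> 1 * \<bar>u x\<bar>" unfolding abs_mult using t by (intro mult_right_mono) auto
    then show ?thesis using growth[of x] u_bound[of x] by linarith
  qed
qed

abbreviation "Lt t \<equiv> toric_potential.legendre (\<phi>t t) (gt t)"
abbreviation "At t \<equiv> toric_potential.arg (gt t)"

text \<open>Change of variables gives integrability only for the whole determinant at each
  \<open>t\<close>. Substituting t = s / (1 + s) and multiplying by (1 + s)^n turns the Bernstein
  expansion into an ordinary polynomial in s > 0, whose coefficients are then integrable one by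
  one.\<close>

lemma integrable_mixed:
  assumes "l \<le> CARD('n)"
  shows "integrable lborel (\<lambda>x. mixed l x * u x)"
proof -
  let ?n = "CARD('n)"
  have "integrable lborel (\<lambda>x. real (?n choose l) * (mixed l x * u x))"
  proof (rule integrable_coeffs_of_integrable_poly[OF _ assms])
    fix s :: real assume s: "0 < s"
    define t where "t = s / (1 + s)"
    have t: "0 \<le> t" "t \<le> 1" "1 - t = 1 / (1 + s)" using s by (auto simp: t_def field_simps)
    interpret T: toric_potential "\<phi>t t" "gt t" "Ht t" m "C + B" using t by (intro toric_potential_t)
    have "integrable lborel (\<lambda>x. (1 + s) ^ ?n * (Determinants.det (Ht t x) * u x))"
      by (intro integrable_mult_right T.change_of_variables(1)[OF continuous_u u_bound])
    moreover have "(1 + s) ^ ?n * (Determinants.det (Ht t x) * u x) = (\<Sum>j\<le>?n. s ^ j * (real (?n choose j) * (mixed j x * u x)))" for x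
      unfolding det_mixed sum_distrib_left sum_distrib_right
    proof (intro sum.cong refl)
      fix j assume j: "j \<in> {..?n}"
      have "(1 + s) ^ ?n * (t ^ j * (1 - t) ^ (?n - j)) = s ^ j"
      proof -
        have "(1 + s) ^ ?n = (1 + s) ^ j * (1 + s) ^ (?n - j)" using j by (simp flip: power_add)
        moreover have "t ^ j = s ^ j / (1 + s) ^ j" by (simp add: t_def power_divide)
        moreover have "(1 - t) ^ (?n - j) = 1 / (1 + s) ^ (?n - j)" by (simp add: t(3) power_divide)
        ultimately show ?thesis using s by simp
      qed
      moreover have "(1 + s) ^ ?n * (bernstein ?n j t * mixed j x * u x) =
          ((1 + s) ^ ?n * (t ^ j * (1 - t) ^ (?n - j))) * (real (?n choose j) * (mixed j x * u x))"
        by (simp only: bernstein_def mult_ac)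
      ultimately show "(1 + s) ^ ?n * (bernstein ?n j t * mixed j x * u x) = s ^ j * (real (?n choose j) * (mixed j x * u x))"
        by simp
    qed
    ultimately show "integrable lborel (\<lambda>x. \<Sum>j\<le>?n. s ^ j * (real (?n choose j) * (mixed j x * u x)))" by simp
  qed
  moreover have "real (?n choose l) \<noteq> 0" using assms by simp
  ultimately show ?thesis by (simp add: integrable_mult_right_iff)
qed

text \<open>\<open>G t\<close> is both the integral of \<open>u\<close> at the maximisers over the
  simplex and, by change of variables, a combination of the integrals \<open>W l\<close> with
  Bernstein coefficients. The first description makes it minus the derivative of the integral of the
  Legendre transform, the second makes its integral over [0, 1] the average of the
  \<open>W l\<close>.\<close>

theorem legendre_energy:
  "(LINT p:open_simplex m|lborel. legendre p) - (LINT p:open_simplex m|lborel. Lt 1 p) =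
    (\<Sum>l\<le>CARD('n). LINT x|lborel. mixed l x * u x) / real (Suc CARD('n))"
proof -
  let ?n = "CARD('n)"
  define W where "W l = (LINT x|lborel. mixed l x * u x)" for l
  define G where "G t = (\<Sum>l\<le>?n. bernstein ?n l t * W l)" for t
  define \<Psi> where "\<Psi> t = (LINT p:open_simplex m|lborel. Lt t p)" for t
  have G: "G t = (LINT p:open_simplex m|lborel. u (At t p))" if t: "0 \<le> t" "t \<le> 1" for t
  proof -
    interpret T: toric_potential "\<phi>t t" "gt t" "Ht t" m "C + B" using t by (intro toric_potential_t)
    have "(LINT p:open_simplex m|lborel. u (At t p)) = (LINT x|lborel. Determinants.det (Ht t x) * u x)"
      by (rule T.change_of_variables(3)[OF continuous_u u_bound, symmetric])
    also have "\<dots> = (LINT x|lborel. (\<Sum>l\<le>?n. bernstein ?n l t * (mixed l x * u x)))"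
      unfolding det_mixed sum_distrib_right mult.assoc ..
    also have "\<dots> = G t"
      unfolding G_def W_def using integrable_mixed by (subst Bochner_Integration.integral_sum) auto
    finally show ?thesis ..
  qed
  have ineq: "(s - t) * - G t \<le> \<Psi> s - \<Psi> t" if s: "s \<in> {0..1}" and t: "t \<in> {0..1}" for s t
  proof -
    interpret S: toric_potential "\<phi>t s" "gt s" "Ht s" m "C + B" using s by (intro toric_potential_t) auto
    interpret T: toric_potential "\<phi>t t" "gt t" "Ht t" m "C + B" using t by (intro toric_potential_t) auto
    note int = S.set_integrable_legendre T.set_integrable_legendre T.change_of_variables(2)[OF continuous_u u_bound]
    have "(LINT p:open_simplex m|lborel. (s - t) * - u (At t p)) \<le> (LINT p:open_simplex m|lborel. Lt s p - Lt t p)"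
    proof (rule set_integral_mono)
      show "set_integrable lborel (open_simplex m) (\<lambda>p. (s - t) * - u (At t p))"
        unfolding mult_minus_right mult_minus_left[symmetric] by (rule set_integrable_mult_right) (rule int(3))
      show "set_integrable lborel (open_simplex m) (\<lambda>p. Lt s p - Lt t p)"
        by (rule set_integral_diff(1)[OF int(1,2)])
      fix p :: "real^'n" assume p: "p \<in> open_simplex m"
      \<comment> \<open>The maximiser at time \<open>t\<close> is a test point for the supremum that
        defines the transform at time \<open>s\<close>.\<close>
      show "(s - t) * - u (At t p) \<le> Lt s p - Lt t p"
        using S.legendre_ge[OF p, of "At t p"] by (simp add: T.legendre_def algebra_simps)
    qed
    moreover have "(LINT p:open_simplex m|lborel. Lt s p - Lt t p) = \<Psi> s - \<Psi> t"
      unfolding \<Psi>_def by (rule set_integral_diff(2)[OF int(1,2)])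
    moreover have "(LINT p:open_simplex m|lborel. (s - t) * - u (At t p)) = (s - t) * - G t"
    proof -
      have Gt: "G t = (LINT p:open_simplex m|lborel. u (At t p))" using t by (intro G) auto
      show ?thesis
        unfolding Gt mult_minus_right mult_minus_left[symmetric] by (rule set_integral_mult_right)
    qed
    ultimately show ?thesis by simp
  qed
  have "((\<lambda>t. - G t) has_integral (\<Psi> 1 - \<Psi> 0)) {0..1}"
    by (rule fundamental_theorem_squeeze[OF _ _ ineq]) (auto simp: G_def intro!: continuous_intros continuous_on_bernstein)
  then have "((\<lambda>t. - (- G t)) has_integral - (\<Psi> 1 - \<Psi> 0)) {0..1}" by (rule has_integral_neg)
  then have "(G has_integral (\<Psi> 0 - \<Psi> 1)) {0..1}" by simp
  moreover have "(G has_integral (\<Sum>l\<le>?n. 1 / real (Suc ?n) * W l)) {0..1}"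
    unfolding G_def by (intro has_integral_sum has_integral_mult_left has_integral_bernstein) auto
  ultimately have "\<Psi> 0 - \<Psi> 1 = (\<Sum>l\<le>?n. 1 / real (Suc ?n) * W l)"
    by (simp add: has_integral_unique)
  moreover have "\<Psi> 0 = (LINT p:open_simplex m|lborel. legendre p)" by (simp add: \<Psi>_def)
  ultimately show ?thesis by (simp add: \<Psi>_def W_def sum_divide_distrib)
qed

end

section \<open>Exponential integrals of toric potentials\<close>

lemma nn_integral_exp_abs:
  assumes s: "0 < s"
  shows "(\<integral>\<^sup>+x. ennreal (exp (- s * \<bar>x\<bar>)) \<partial>lborel) < \<infinity>"
proof -
  let ?I = "\<integral>\<^sup>+x. ennreal (exp (- s * x)) * indicator {0..} x \<partial>lborel"
  have I: "?I = ennreal (0 - (- exp (- s * 0) / s))"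
  proof (rule nn_integral_FTC_atLeast)
    have "filterlim (\<lambda>x. - s * x) at_bot at_top"
      using s by (intro filterlim_tendsto_neg_mult_at_bot[OF tendsto_const]) (auto intro: filterlim_ident)
    from tendsto_minus[OF tendsto_divide[OF filterlim_compose[OF exp_at_bot this] tendsto_const[of s]]]
    show "((\<lambda>x. - exp (- s * x) / s) \<longlongrightarrow> 0) at_top" using s by simp
    show "DERIV (\<lambda>x. - exp (- s * x) / s) x :> exp (- s * x)" for x
      using s by (auto intro!: derivative_eq_intros)
  qed auto
  have "(\<integral>\<^sup>+x. ennreal (exp (- s * \<bar>x\<bar>)) \<partial>lborel) \<le>
      (\<integral>\<^sup>+x. ennreal (exp (- s * x)) * indicator {0..} x + ennreal (exp (- s * (-x))) * indicator {0..} (-x) \<partial>lborel)"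
    by (intro nn_integral_mono) (auto simp: indicator_def)
  also have "\<dots> = ?I + (\<integral>\<^sup>+x. ennreal (exp (- s * (-x))) * indicator {0..} (-x) \<partial>lborel)"
    by (rule nn_integral_add) auto
  also have "(\<integral>\<^sup>+x. ennreal (exp (- s * (-x))) * indicator {0..} (-x) \<partial>lborel) = ?I"
    by (subst (2) nn_integral_real_affine[where c="-1" and t=0]) auto
  finally show ?thesis unfolding I by (auto simp: less_top[symmetric] top_unique)
qed

lemma integrable_exp_l1:
  assumes s: "0 < s"
  shows "integrable lborel (\<lambda>y::real^'n. exp (- s * (\<Sum>k\<in>UNIV. \<bar>y $ k\<bar>)))"
proof (rule integrableI_nonneg)
  have "(\<integral>\<^sup>+y. ennreal (exp (- s * (\<Sum>k\<in>UNIV. \<bar>y $ k\<bar>))) \<partial>(lborel :: (real^'n) measure)) =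
     (\<integral>\<^sup>+y. (\<Prod>k\<in>UNIV. ennreal (exp (- s * \<bar>y $ k\<bar>))) \<partial>(lborel :: (real^'n) measure))"
  proof (rule nn_integral_cong)
    fix y :: "real^'n"
    have "exp (- s * (\<Sum>k\<in>UNIV. \<bar>y $ k\<bar>)) = (\<Prod>k\<in>UNIV. exp (- s * \<bar>y $ k\<bar>))"
      unfolding sum_distrib_left by (rule exp_sum) simp
    then show "ennreal (exp (- s * (\<Sum>k\<in>UNIV. \<bar>y $ k\<bar>))) = (\<Prod>k\<in>UNIV. ennreal (exp (- s * \<bar>y $ k\<bar>)))"
      by (simp only: prod_ennreal exp_ge_zero)
  qed
  also have "\<dots> = (\<Prod>k\<in>(UNIV :: 'n set). \<integral>\<^sup>+x. ennreal (exp (- s * \<bar>x\<bar>)) \<partial>lborel)"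
    by (rule nn_integral_vec_prod) auto
  also have "\<dots> < \<infinity>" using nn_integral_exp_abs[OF s] by (simp add: power_less_top_ennreal)
  finally show "(\<integral>\<^sup>+y. ennreal (exp (- s * (\<Sum>k\<in>UNIV. \<bar>y $ k\<bar>))) \<partial>(lborel :: (real^'n) measure)) < \<infinity>" .
qed auto

definition exp_l1_integral :: "'n::finite itself \<Rightarrow> real \<Rightarrow> real" where
  "exp_l1_integral _ s = (LINT y|lborel. exp (- s * (\<Sum>k\<in>UNIV. \<bar>(y::real^'n) $ k\<bar>)))"

lemma exp_l1_translate:
  fixes \<xi> :: "real^'n"
  assumes s: "0 < s"
  shows "integrable lborel (\<lambda>x. exp (- s * (\<Sum>k\<in>UNIV. \<bar>(x - \<xi>) $ k\<bar>)))"
    and "(LINT x|lborel. exp (- s * (\<Sum>k\<in>UNIV. \<bar>(x - \<xi>) $ k\<bar>))) = exp_l1_integral TYPE('n) s"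
proof -
  have t: "distr lborel borel ((+) \<xi>) = lborel" by (rule lborel_distr_plus)
  show "integrable lborel (\<lambda>x. exp (- s * (\<Sum>k\<in>UNIV. \<bar>(x - \<xi>) $ k\<bar>)))"
    by (subst t[symmetric], subst integrable_distr_eq) (use integrable_exp_l1[OF s] in auto)
  show "(LINT x|lborel. exp (- s * (\<Sum>k\<in>UNIV. \<bar>(x - \<xi>) $ k\<bar>))) = exp_l1_integral TYPE('n) s"
    by (subst t[symmetric], subst integral_distr) (auto simp: exp_l1_integral_def)
qed

text \<open>The integral of the exponential majorant below: r^n is the volume of a test cube, the
  argument of \<open>exp_l1_integral\<close> is the decay rate, and exp 1 pays for the 1 added to
  the Jensen gap.\<close>

definition kernel_const :: "'n::finite itself \<Rightarrow> real \<Rightarrow> real \<Rightarrow> real" where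
  "kernel_const T r c = exp 1 * exp_l1_integral T (min 1 (c * r ^ CARD('n)) * (r / 2))"

context toric_potential
begin

text \<open>Since \<open>q\<close> is a probability density with barycentre \<open>a\<close>,
  Jensen's inequality puts the mean of \<open>legendre\<close> above \<open>legendre a\<close>; the
  gap is \<open>A\<close>. The integrand is majorised by exp (legendre a + A + 1) times an
  exponential that decays in the distance from the maximiser \<xi>, at a rate that depends only on
  \<open>r\<close> and \<open>c\<close>. As legendre a + A is the mean, integration gives the
  bound.\<close>

lemma
  assumes a: "a \<in> open_simplex m"
    and q_meas [measurable]: "q \<in> borel_measurable borel"
    and q_nonneg: "\<And>p. 0 \<le> q p" and q_bound: "\<And>p. q p \<le> Q * indicator (open_simplex m) p"
    and q_mass: "(LINT p|lborel. q p) = 1"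
    and q_mean: "\<And>k. (LINT p|lborel. q p * p $ k) = a $ k"
    and r: "0 < r" and c: "0 < c"
    and q_cube: "\<And>p. (\<And>k. \<bar>p $ k - a $ k\<bar> \<le> 2 * r) \<Longrightarrow> p \<in> open_simplex m \<and> c \<le> q p"
  shows integrable_exp_\<phi>: "integrable lborel (\<lambda>x. exp (x \<bullet> a - \<phi> x))"
    and integral_exp_\<phi>_le: "(LINT x|lborel. exp (x \<bullet> a - \<phi> x)) \<le>
      kernel_const TYPE('n) r c * exp (LINT p|lborel. q p * legendre p)"
    and integrable_kernel_legendre: "integrable lborel (\<lambda>p. q p * legendre p)"
proof -
  let ?U = "open_simplex m :: (real^'n) set" and ?n = "CARD('n)"
  have U [measurable]: "?U \<in> sets borel" by (simp add: borel_open open_open_simplex)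
  have fin: "emeasure lborel ?U < \<infinity>" by (rule emeasure_bounded_finite[OF bounded_open_simplex])
  have q_out: "q p = 0" if "p \<notin> ?U" for p using q_nonneg[of p] q_bound[of p] that by simp
  have q_abs: "\<bar>q p\<bar> \<le> \<bar>Q\<bar>" for p using q_nonneg[of p] q_bound[of p] by (cases "p \<in> ?U") auto
  have int_q: "integrable lborel (\<lambda>p. q p * f p)"
    if [measurable]: "(\<lambda>p. indicator ?U p * f p) \<in> borel_measurable borel" and f: "\<And>p. p \<in> ?U \<Longrightarrow> \<bar>f p\<bar> \<le> B" for f :: "real^'n \<Rightarrow> real" and B
  proof (rule integrableI_bounded_set[where A = ?U and B = "\<bar>Q\<bar> * B"])
    have "(\<lambda>p. q p * f p) = (\<lambda>p. q p * (indicator ?U p * f p))" using q_out by (auto simp: fun_eq_iff indicator_def)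
    then show "(\<lambda>p. q p * f p) \<in> borel_measurable lborel" by simp
    show "AE p in lborel. p \<in> ?U \<longrightarrow> norm (q p * f p) \<le> \<bar>Q\<bar> * B"
      using q_abs f by (auto simp: abs_mult intro!: AE_I2 mult_mono)
  qed (use fin q_out in auto)
  have leg_meas: "(\<lambda>p. indicator ?U p * legendre p) \<in> borel_measurable borel"
    using borel_measurable_continuous_on_indicator[OF U continuous_on_legendre] by simp
  show int_leg: "integrable lborel (\<lambda>p. q p * legendre p)"
    by (rule int_q[OF leg_meas, where B = "\<bar>\<phi> 0\<bar> + \<bar>C\<bar>"]) (use legendre_bounds in force)
  obtain R where R: "\<And>p. p \<in> ?U \<Longrightarrow> norm p \<le> R" using bounded_open_simplex[of m] unfolding bounded_iff by blast
  have int_nth: "integrable lborel (\<lambda>p. q p * p $ k)" for k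
    by (rule int_q[where B = R]) (use R component_le_norm_cart order_trans in \<open>auto, blast\<close>)
  have int1: "integrable lborel q" using int_q[of "\<lambda>_. 1" 1] by simp
  define \<xi> where "\<xi> = arg a"
  \<comment> \<open>Removing the supporting plane at \<open>a\<close> leaves a nonnegative function with \<open>q\<close>-mean \<open>A\<close>; averaging the
    inequality \<open>x \<bullet> p - legendre p \<le> \<phi> x\<close> over small cubes in all orthants around \<open>a\<close> then shows that
    \<open>\<phi> x - x \<bullet> a\<close> grows linearly in the distance from \<open>\<xi>\<close>.\<close>
  define \<psi> where "\<psi> p = legendre p - legendre a - \<xi> \<bullet> (p - a)" for p
  have \<psi>: "0 \<le> \<psi> p" if "p \<in> ?U" for p
    using legendre_ge[OF that, of \<xi>] by (simp add: \<psi>_def legendre_def[of a] \<xi>_def inner_diff_right)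
  define A where "A = (LINT p|lborel. q p * legendre p) - legendre a"
  have q\<psi>_eq: "(\<lambda>p. q p * \<psi> p) = (\<lambda>p. q p * legendre p - legendre a * q p - (\<Sum>k\<in>UNIV. \<xi> $ k * (q p * p $ k - a $ k * q p)))"
    by (simp add: fun_eq_iff \<psi>_def inner_vec_def algebra_simps sum_distrib_left sum_distrib_right sum_subtractf)
  have int_\<psi>: "integrable lborel (\<lambda>p. q p * \<psi> p)"
    unfolding q\<psi>_eq by (intro Bochner_Integration.integrable_diff int_leg integrable_mult_right int1 Bochner_Integration.integrable_sum int_nth)
  have A: "(LINT p|lborel. q p * \<psi> p) = A"
    unfolding q\<psi>_eq using int_leg int1 int_nth
    by (simp add: Bochner_Integration.integral_diff Bochner_Integration.integral_sum q_mass q_mean A_def)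
  have A_nonneg: "0 \<le> A"
    unfolding A[symmetric] by (rule Bochner_Integration.integral_nonneg) (use \<psi> q_nonneg q_out in \<open>metis mult_nonneg_nonneg mult_zero_left order_refl\<close>)
  define V where "V = r ^ ?n"
  have V: "0 < V" using r by (simp add: V_def)
  \<comment> \<open>The weight of the decaying estimate in a convex combination with the plain bound
    by \<open>legendre a\<close>; it is small enough that the coefficient of A + 1 becomes at most
    one.\<close>
  define \<theta> where "\<theta> = min 1 (c * V)"
  have \<theta>: "0 < \<theta>" "\<theta> \<le> 1" "\<theta> / (c * V) \<le> 1" using V c by (auto simp: \<theta>_def field_simps)
  have key: "x \<bullet> a - \<phi> x \<le> legendre a + A + 1 - \<theta> * (r / 2) * (\<Sum>k\<in>UNIV. \<bar>(x - \<xi>) $ k\<bar>)" for x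
  proof -
    define y where "y = x - \<xi>"
    \<comment> \<open>The cube of side \<open>r\<close> about a + r sgn y, displaced from
      \<open>a\<close> towards \<open>y\<close>; coordinates with y_k = 0 are not displaced. It
      stays within 3r/2 of \<open>a\<close> in each coordinate, hence in the region where
      \<open>q\<close> is at least \<open>c\<close>.\<close>
    define l where "l = (\<chi> k. a $ k + r * sgn (y $ k) - r / 2)"
    define h where "h = (\<chi> k. a $ k + r * sgn (y $ k) + r / 2)"
    have near: "\<bar>p $ k - a $ k - r * sgn (y $ k)\<bar> \<le> r / 2" if "p \<in> cbox l h" for p k
    proof -
      have "l $ k \<le> p $ k" "p $ k \<le> h $ k" using that by (auto simp: mem_box_cart)
      then show ?thesis unfolding l_def h_def vec_lambda_beta by linarith
    qed
    have sub: "p \<in> ?U \<and> c \<le> q p" if p: "p \<in> cbox l h" for p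
    proof (rule q_cube)
      fix k
      have "\<bar>r * sgn (y $ k)\<bar> \<le> r" using r by (auto simp: abs_mult sgn_if)
      then show "\<bar>p $ k - a $ k\<bar> \<le> 2 * r" using near[OF p, of k] r by linarith
    qed
    have vol: "measure lborel (cbox l h) = V"
    proof -
      have "cbox l h \<noteq> {}" using r by (auto simp: interval_ne_empty_cart l_def h_def)
      then show ?thesis using r by (simp add: content_cbox_cart l_def h_def V_def)
    qed
    \<comment> \<open>Markov's inequality: \<open>q\<close> has mass at least c V on the cube, so a
      larger value of \<psi> throughout would force its mean up to A + 1.\<close>
    have "\<exists>p\<in>cbox l h. \<psi> p \<le> (A + 1) / (c * V)"
    proof (rule ccontr)
      assume "\<not> ?thesis"
      then have lower: "(A + 1) / (c * V) \<le> \<psi> p" if "p \<in> cbox l h" for p using that by force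
      have "(LINT p|lborel. ((A + 1) / V) * indicator (cbox l h) p) \<le> (LINT p|lborel. q p * \<psi> p)"
      proof (rule integral_mono[OF _ int_\<psi>])
        show "integrable lborel (\<lambda>p. ((A + 1) / V) * indicat_real (cbox l h) p)"
          by (intro integrable_mult_right integrable_real_indicator emeasure_bounded_finite bounded_cbox) simp
        fix p :: "real^'n"
        show "((A + 1) / V) * indicator (cbox l h) p \<le> q p * \<psi> p"
        proof (cases "p \<in> cbox l h")
          case True
          have "(A + 1) / V = c * ((A + 1) / (c * V))" using c V by (simp add: field_simps)
          also have "\<dots> \<le> q p * \<psi> p"
            using sub[OF True] lower[OF True] q_nonneg c V A_nonneg by (intro mult_mono) auto
          finally show ?thesis using True by simp
        next
          case False
          then show ?thesis using \<psi>[of p] q_nonneg[of p] q_out[of p] by (cases "p \<in> ?U") auto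
        qed
      qed
      then have "A + 1 \<le> A" using V vol by (simp add: A)
      then show False by simp
    qed
    then obtain p where p: "p \<in> cbox l h" "\<psi> p \<le> (A + 1) / (c * V)" by blast
    \<comment> \<open>Each coordinate of p - a is r sgn y_k up to an error of r / 2, so it has at
      least half the full pairing with y_k.\<close>
    have "y \<bullet> (p - a) \<ge> (r / 2) * (\<Sum>k\<in>UNIV. \<bar>y $ k\<bar>)"
      unfolding inner_vec_def sum_distrib_left
    proof (rule sum_mono)
      fix k
      define e where "e = p $ k - a $ k - r * sgn (y $ k)"
      have "y $ k * e \<ge> - (\<bar>y $ k\<bar> * (r / 2))"
        using mult_left_mono[OF near[OF p(1), of k] abs_ge_zero[of "y $ k"]] by (simp add: e_def[symmetric] abs_mult[symmetric] abs_le_iff)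
      moreover have "y $ k * (r * sgn (y $ k)) = r * \<bar>y $ k\<bar>" by (simp add: abs_sgn mult.left_commute)
      moreover have "y $ k * (p $ k - a $ k) = y $ k * e + y $ k * (r * sgn (y $ k))" by (simp add: e_def algebra_simps)
      moreover have "\<bar>y $ k\<bar> * (r / 2) = (r * \<bar>y $ k\<bar>) / 2" "r / 2 * \<bar>y $ k\<bar> = (r * \<bar>y $ k\<bar>) / 2" by simp_all
      ultimately show "r / 2 * \<bar>y $ k\<bar> \<le> y $ k \<bullet> (p - a) $ k"
        unfolding inner_real_def vector_minus_component by linarith
    qed
    moreover have "x \<bullet> p - \<phi> x \<le> legendre p" using legendre_ge sub[OF p(1)] by blast
    ultimately have lin: "x \<bullet> a - \<phi> x \<le> legendre a + (A + 1) / (c * V) - (r / 2) * (\<Sum>k\<in>UNIV. \<bar>y $ k\<bar>)"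
      using p(2) by (simp add: \<psi>_def y_def inner_diff_left inner_diff_right)
    have zero: "x \<bullet> a - \<phi> x \<le> legendre a" by (rule legendre_ge[OF a])
    \<comment> \<open>The first part is estimated by \<open>lin\<close>, which decays but has the
      coefficient 1 / (c V) at A + 1, the second by \<open>zero\<close>.\<close>
    have "x \<bullet> a - \<phi> x - legendre a = \<theta> * (x \<bullet> a - \<phi> x - legendre a) + (1 - \<theta>) * (x \<bullet> a - \<phi> x - legendre a)"
      by (simp add: algebra_simps)
    also have "\<dots> \<le> \<theta> * ((A + 1) / (c * V) - (r / 2) * (\<Sum>k\<in>UNIV. \<bar>y $ k\<bar>)) + (1 - \<theta>) * 0"
      using lin zero \<theta> by (intro add_mono mult_left_mono) auto
    also have "\<dots> = (\<theta> / (c * V)) * (A + 1) - \<theta> * (r / 2) * (\<Sum>k\<in>UNIV. \<bar>y $ k\<bar>)"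
      by (simp add: algebra_simps)
    also have "(\<theta> / (c * V)) * (A + 1) \<le> 1 * (A + 1)" using \<theta> A_nonneg by (intro mult_right_mono) auto
    finally show ?thesis by (simp add: y_def)
  qed
  let ?E = "\<lambda>x. exp (- (\<theta> * (r / 2)) * (\<Sum>k\<in>UNIV. \<bar>(x - \<xi>) $ k\<bar>))"
  have \<theta>r: "0 < \<theta> * (r / 2)" using \<theta> r by simp
  have le: "exp (x \<bullet> a - \<phi> x) \<le> exp (legendre a + A + 1) * ?E x" for x
    unfolding exp_add[symmetric] using key[of x] by simp
  have meas: "(\<lambda>x. exp (x \<bullet> a - \<phi> x)) \<in> borel_measurable borel"
    by (intro borel_measurable_continuous_onI continuous_intros continuous_\<phi>)
  have intE: "integrable lborel (\<lambda>x. exp (legendre a + A + 1) * ?E x)"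
    by (rule integrable_mult_right[OF exp_l1_translate(1)[OF \<theta>r]])
  show int: "integrable lborel (\<lambda>x. exp (x \<bullet> a - \<phi> x))"
    by (rule Bochner_Integration.integrable_bound[OF intE]) (use meas le in auto)
  have "(LINT x|lborel. exp (x \<bullet> a - \<phi> x)) \<le> (LINT x|lborel. exp (legendre a + A + 1) * ?E x)"
    by (rule integral_mono[OF int intE le])
  also have "\<dots> = exp (legendre a + A + 1) * exp_l1_integral TYPE('n) (\<theta> * (r / 2))"
    by (simp only: integral_mult_right_zero exp_l1_translate(2)[OF \<theta>r])
  also have "\<dots> = kernel_const TYPE('n) r c * exp (LINT p|lborel. q p * legendre p)"
    by (simp add: A_def kernel_const_def \<theta>_def V_def exp_add)
  finally show "(LINT x|lborel. exp (x \<bullet> a - \<phi> x)) \<le> kernel_const TYPE('n) r c * exp (LINT p|lborel. q p * legendre p)" .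
qed

end

section \<open>Wedge products of constant forms\<close>

text \<open>Forms of even degree commute: reordering the factors composes both permutations with
  \<pi>, and its sign enters twice.\<close>

lemma wedge_top_permute:
  fixes A :: "'n::finite \<Rightarrow> complex^'n^'n"
  assumes \<pi>: "\<pi> permutes UNIV"
  shows "wedge_top (\<lambda>k. A (\<pi> k)) = wedge_top A"
proof -
  have s: "of_int (sign (p \<circ> \<pi>)) * of_int (sign (q \<circ> \<pi>)) * (\<Prod>k\<in>UNIV. A (\<pi> k) $ (p \<circ> \<pi>) k $ (q \<circ> \<pi>) k)
     = of_int (sign p) * of_int (sign q) * (\<Prod>k\<in>UNIV. A k $ p k $ q k)"
    if "p permutes UNIV" "q permutes UNIV" for p q
  proof -
    have "(\<Prod>k\<in>UNIV. A (\<pi> k) $ p (\<pi> k) $ q (\<pi> k)) = (\<Prod>k\<in>UNIV. A k $ p k $ q k)"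
      by (rule prod.reindex_bij_betw[OF permutes_bij[OF \<pi>]])
    moreover have "sign (r \<circ> \<pi>) = sign r * sign \<pi>" if "r permutes UNIV" for r
      using that \<pi> by (intro sign_compose) (auto simp: permutation_permutes)
    moreover have "of_int (sign \<pi>) * of_int (sign \<pi>) = (1::complex)"
      by (metis of_int_1 of_int_mult sign_idempotent)
    ultimately show ?thesis using that by (simp add: algebra_simps)
  qed
  show ?thesis
    unfolding wedge_top_def
    by (subst sum_permutations_compose_right[OF \<pi>], rule sum.cong[OF refl],
        subst sum_permutations_compose_right[OF \<pi>], rule sum.cong[OF refl]) (use s in auto)
qed

text \<open>After replacing \<open>q\<close> by its composition with \<open>p\<close>, each of the
  n! permutations \<open>p\<close> contributes one determinant.\<close>

lemma wedge_top_const: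
  fixes A :: "complex^'n::finite^'n"
  shows "wedge_top (\<lambda>_. A) = fact CARD('n) * Determinants.det A"
proof -
  have "(\<Sum>q | q permutes UNIV. of_int (sign p) * of_int (sign q) * (\<Prod>k\<in>UNIV. A $ p k $ q k)) = Determinants.det A"
    if p: "p permutes UNIV" for p
  proof -
    have "(\<Sum>q | q permutes UNIV. of_int (sign p) * of_int (sign q) * (\<Prod>k\<in>UNIV. A $ p k $ q k))
      = (\<Sum>q | q permutes UNIV. of_int (sign q) * (\<Prod>k\<in>UNIV. A $ k $ q k))"
    proof (subst sum_permutations_compose_right[OF p], rule sum.cong[OF refl])
      fix q assume "q \<in> {q. q permutes (UNIV :: 'n set)}"
      then have "sign (q \<circ> p) = sign q * sign p"
        using p by (intro sign_compose) (auto simp: permutation_permutes)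
      moreover have "(\<Prod>k\<in>UNIV. A $ p k $ q (p k)) = (\<Prod>k\<in>UNIV. A $ k $ q k)"
        by (rule prod.reindex_bij_betw[OF permutes_bij[OF p]])
      moreover have "of_int (sign p) * of_int (sign p) = (1::complex)"
        by (metis of_int_1 of_int_mult sign_idempotent)
      ultimately show "of_int (sign p) * of_int (sign (q \<circ> p)) * (\<Prod>k\<in>UNIV. A $ p k $ (q \<circ> p) k) =
          of_int (sign q) * (\<Prod>k\<in>UNIV. A $ k $ q k)"
        by (simp add: algebra_simps)
    qed
    then show ?thesis by (simp add: Determinants.det_def)
  qed
  then show ?thesis unfolding wedge_top_def by (simp add: card_permutations)
qed

lemma wedge_top_scale:
  fixes A :: "'n::finite \<Rightarrow> complex^'n^'n"
  shows "wedge_top (\<lambda>k. \<chi> i j. a i * b j * A k $ i $ j) = (\<Prod>i\<in>UNIV. a i) * (\<Prod>j\<in>UNIV. b j) * wedge_top A"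
proof -
  have "(\<Prod>k\<in>UNIV. a (p k)) = (\<Prod>i\<in>UNIV. a i)" if "p permutes UNIV" for p and a :: "'n \<Rightarrow> complex"
    by (rule prod.reindex_bij_betw[OF permutes_bij[OF that]])
  then show ?thesis
    unfolding wedge_top_def sum_distrib_left
    by (intro sum.cong refl) (simp add: prod.distrib algebra_simps)
qed

lemma wedge_powers_scale:
  fixes A B :: "complex^'n::finite^'n"
  shows "wedge_powers l (\<chi> i j. a i * b j * A $ i $ j) (\<chi> i j. a i * b j * B $ i $ j) =
    (\<Prod>i\<in>UNIV. a i) * (\<Prod>j\<in>UNIV. b j) * wedge_powers l A B"
  unfolding wedge_powers_def
  by (subst wedge_top_scale[symmetric], rule arg_cong[where f = wedge_top]) auto

lemma prod_add_Pow:
  fixes f g :: "'a \<Rightarrow> 'b::comm_semiring_1"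
  assumes "finite A"
  shows "(\<Prod>k\<in>A. f k + g k) = (\<Sum>S\<in>Pow A. \<Prod>k\<in>A. if k \<in> S then g k else f k)"
  using assms
proof (induction A)
  case (insert x A)
  have inj: "inj_on (insert x) (Pow A)" using insert by (auto simp: inj_on_def)
  have disj: "Pow A \<inter> insert x ` Pow A = {}" using insert by auto
  have 1: "(\<Prod>k\<in>insert x A. if k \<in> S then g k else f k) = f x * (\<Prod>k\<in>A. if k \<in> S then g k else f k)" if "S \<in> Pow A" for S
    using that insert by auto
  have 2: "(\<Prod>k\<in>insert x A. if k \<in> insert x S then g k else f k) = g x * (\<Prod>k\<in>A. if k \<in> S then g k else f k)" if "S \<in> Pow A" for S
  proof -
    have "(\<Prod>k\<in>A. if k \<in> insert x S then g k else f k) = (\<Prod>k\<in>A. if k \<in> S then g k else f k)"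
      using insert by (intro prod.cong) auto
    then show ?thesis using insert by simp
  qed
  let ?P = "\<lambda>S. \<Prod>k\<in>insert x A. if k \<in> S then g k else f k"
  have "(\<Sum>S\<in>Pow (insert x A). ?P S) = (\<Sum>S\<in>Pow A. ?P S) + (\<Sum>S\<in>insert x ` Pow A. ?P S)"
    unfolding Pow_insert using insert by (intro sum.union_disjoint disj) auto
  also have "(\<Sum>S\<in>insert x ` Pow A. ?P S) = (\<Sum>S\<in>Pow A. ?P (insert x S))"
    by (simp only: sum.reindex[OF inj] o_def)
  also have "(\<Sum>S\<in>Pow A. ?P (insert x S)) = g x * (\<Sum>S\<in>Pow A. \<Prod>k\<in>A. if k \<in> S then g k else f k)"
    unfolding sum_distrib_left by (intro sum.cong refl 2)
  also have "(\<Sum>S\<in>Pow A. ?P S) = f x * (\<Sum>S\<in>Pow A. \<Prod>k\<in>A. if k \<in> S then g k else f k)"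
    unfolding sum_distrib_left by (intro sum.cong refl 1)
  finally show ?case using insert by (simp add: distrib_right)
qed auto

lemma sum_Pow_card:
  assumes "finite A"
  shows "(\<Sum>S\<in>Pow A. f (card S)) = (\<Sum>j\<le>card A. of_nat (card A choose j) * (f j :: 'b::comm_semiring_1))"
proof -
  have "(\<Sum>S\<in>Pow A. f (card S)) = (\<Sum>j\<le>card A. \<Sum>S | S \<in> Pow A \<and> card S = j. f (card S))"
    by (rule sum.group[symmetric]) (use assms in \<open>auto intro: card_mono\<close>)
  also have "\<dots> = (\<Sum>j\<le>card A. of_nat (card A choose j) * f j)"
    using n_subsets[OF assms] by (intro sum.cong refl) (simp add: Pow_def)
  finally show ?thesis .
qed

text \<open>A permutation of the factors carries \<open>S\<close> to the first \<open>card S\<close>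
  slots of the enumeration in \<open>wedge_powers\<close>, so only the number of factors
  \<open>B\<close> counts.\<close>

lemma wedge_top_subset:
  fixes A B :: "complex^'n::finite^'n"
  shows "wedge_top (\<lambda>k. if k \<in> S then B else A) = wedge_powers (card S) B A"
proof -
  let ?e = "to_nat_on (UNIV :: 'n set)"
  define T where "T = {k. ?e k < card S}"
  have e: "bij_betw ?e UNIV {..<CARD('n)}" by (rule to_nat_on_finite) simp
  have "card T = card (?e ` T)" using e by (metis bij_betw_def card_image inj_on_subset subset_UNIV)
  also have "?e ` T = {..<card S}"
  proof
    show "{..<card S} \<subseteq> ?e ` T"
    proof
      fix i assume i: "i \<in> {..<card S}"
      then have "i \<in> {..<CARD('n)}" using card_mono[of UNIV S] by auto
      then show "i \<in> ?e ` T" using e i by (auto simp: bij_betw_def T_def)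
    qed
  qed (auto simp: T_def)
  finally have card: "card S = card T" by simp
  then have "card (- S) = card (- T)" by (simp add: Compl_eq_Diff_UNIV card_Diff_subset)
  then obtain f h where f: "bij_betw f S T" and h: "bij_betw h (- S) (- T)"
    using card by (metis finite finite_same_card_bij)
  define \<pi> where "\<pi> = (\<lambda>k. if k \<in> S then f k else h k)"
  have "bij_betw \<pi> (S \<union> - S) (T \<union> - T)"
    unfolding \<pi>_def by (rule bij_betw_disjoint_Un[OF f h]) auto
  then have \<pi>: "\<pi> permutes UNIV" by (auto intro: bij_imp_permutes)
  have "k \<in> S \<longleftrightarrow> \<pi> k \<in> T" for k
    using f h by (auto simp: \<pi>_def bij_betw_def)
  then have "wedge_top (\<lambda>k. if k \<in> S then B else A) = wedge_top (\<lambda>k. (\<lambda>k. if k \<in> T then B else A) (\<pi> k))"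
    by simp
  also have "\<dots> = wedge_powers (card S) B A"
    by (subst wedge_top_permute[OF \<pi>]) (simp add: wedge_powers_def T_def)
  finally show ?thesis .
qed

lemma wedge_top_affine:
  fixes A B :: "complex^'n::finite^'n"
  shows "wedge_top (\<lambda>_. \<chi> i j. a * A $ i $ j + b * B $ i $ j) =
    (\<Sum>l\<le>CARD('n). of_nat (CARD('n) choose l) * (b ^ l * a ^ (CARD('n) - l) * wedge_powers l B A))"
proof -
  have split: "(\<Prod>k\<in>UNIV. (a * A $ p k $ q k + b * B $ p k $ q k)) =
     (\<Sum>S\<in>Pow UNIV. (b ^ card S * a ^ (CARD('n) - card S)) * (\<Prod>k\<in>UNIV. (if k \<in> S then B else A) $ p k $ q k))" for p q :: "'n \<Rightarrow> 'n"
    unfolding prod_add_Pow[OF finite_class.finite_UNIV, of "\<lambda>k. a * A $ p k $ q k" "\<lambda>k. b * B $ p k $ q k"]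
  proof (rule sum.cong[OF refl])
    fix S :: "'n set"
    have "(\<Prod>k\<in>UNIV. if k \<in> S then b else a) = b ^ card S * a ^ (CARD('n) - card S)"
      by (simp add: prod.If_cases Collect_neg_eq[symmetric] Compl_eq_Diff_UNIV card_Diff_subset)
    moreover have "(\<Prod>k\<in>UNIV. if k \<in> S then b * B $ p k $ q k else a * A $ p k $ q k) =
       (\<Prod>k\<in>UNIV. (if k \<in> S then b else a) * (if k \<in> S then B else A) $ p k $ q k)"
      by (intro prod.cong) auto
    ultimately show "(\<Prod>k\<in>UNIV. if k \<in> S then b * B $ p k $ q k else a * A $ p k $ q k) =
       b ^ card S * a ^ (CARD('n) - card S) * (\<Prod>k\<in>UNIV. (if k \<in> S then B else A) $ p k $ q k)"
      by (simp only: prod.distrib)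
  qed
  have "wedge_top (\<lambda>_. \<chi> i j. a * A $ i $ j + b * B $ i $ j) =
    (\<Sum>S\<in>Pow UNIV. (b ^ card S * a ^ (CARD('n) - card S)) * wedge_top (\<lambda>k. if k \<in> S then B else A))"
    unfolding wedge_top_def sum_distrib_left
    apply (subst sum.swap[where A = "Pow UNIV"])
    apply (rule sum.cong[OF refl])
    apply (subst sum.swap[where A = "Pow UNIV"])
    apply (rule sum.cong[OF refl])
    apply (simp only: vec_lambda_beta split sum_distrib_left)
    apply (intro sum.cong refl)
    apply (simp add: algebra_simps)
    done
  also have "\<dots> = (\<Sum>S\<in>Pow UNIV. (\<lambda>l. b ^ l * a ^ (CARD('n) - l) * wedge_powers l B A) (card (S :: 'n set)))"
    by (simp add: wedge_top_subset)
  finally show ?thesis by (subst (asm) sum_Pow_card) auto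
qed

definition complex_matrix :: "real^'n^'n \<Rightarrow> complex^'n^'n" where
  "complex_matrix A = (\<chi> i j. of_real (A $ i $ j))"

lemma det_complex_matrix: "Determinants.det (complex_matrix A) = of_real (Determinants.det A)"
  by (simp add: Determinants.det_def complex_matrix_def)

text \<open>Expanding the wedge power of a combination is polarisation. It identifies the mixed
  discriminants, up to the factor n!, with the mixed wedge products that occur in the
  energy.\<close>

lemma det_affine:
  fixes A B :: "real^'n::finite^'n"
  shows "fact CARD('n) * Determinants.det ((1 - t) *\<^sub>R A + t *\<^sub>R B) =
    (\<Sum>l\<le>CARD('n). of_nat (CARD('n) choose l) * (t ^ l * (1 - t) ^ (CARD('n) - l) *
       Re (wedge_powers l (complex_matrix B) (complex_matrix A))))"
proof -
  let ?M = "(1 - t) *\<^sub>R A + t *\<^sub>R B"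
  have "complex_of_real (fact CARD('n) * Determinants.det ?M) = wedge_top (\<lambda>_. complex_matrix ?M)"
    by (simp add: wedge_top_const det_complex_matrix)
  also have "complex_matrix ?M = (\<chi> i j. of_real (1 - t) * complex_matrix A $ i $ j + of_real t * complex_matrix B $ i $ j)"
    by (simp add: complex_matrix_def Finite_Cartesian_Product.vec_eq_iff)
  also have "wedge_top (\<lambda>_. \<dots>) = (\<Sum>l\<le>CARD('n). of_nat (CARD('n) choose l) * (of_real t ^ l * of_real (1 - t) ^ (CARD('n) - l) *
       wedge_powers l (complex_matrix B) (complex_matrix A)))"
    by (rule wedge_top_affine)
  finally have "fact CARD('n) * Determinants.det ?M = Re (\<Sum>l\<le>CARD('n). of_nat (CARD('n) choose l) * (of_real t ^ l * of_real (1 - t) ^ (CARD('n) - l) *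
       wedge_powers l (complex_matrix B) (complex_matrix A)))"
    by (metis Re_complex_of_real)
  also have "\<dots> = (\<Sum>l\<le>CARD('n). Re (of_real (of_nat (CARD('n) choose l) * (t ^ l * (1 - t) ^ (CARD('n) - l))) *
       wedge_powers l (complex_matrix B) (complex_matrix A)))"
    by (simp add: mult.assoc)
  also have "\<dots> = (\<Sum>l\<le>CARD('n). of_nat (CARD('n) choose l) * (t ^ l * (1 - t) ^ (CARD('n) - l) *
       Re (wedge_powers l (complex_matrix B) (complex_matrix A))))"
    by (intro sum.cong refl) (simp add: mult.assoc)
  finally show ?thesis .
qed

section \<open>Dirichlet densities on the simplex\<close>

lemma convex_open_simplex: "convex (open_simplex m :: (real^'n) set)"
proof -
  have "open_simplex m = (\<Inter>k. {p::real^'n. p $ k > 0}) \<inter> {p. (\<Sum>k\<in>UNIV. p $ k) < m}"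
    by (auto simp: open_simplex_def)
  moreover have "{p::real^'n. p $ k > 0} = {p. axis k 1 \<bullet> p > 0}" for k by (simp add: inner_axis')
  moreover have "{p::real^'n. (\<Sum>k\<in>UNIV. p $ k) < m} = {p. (\<chi> k. 1) \<bullet> p < m}" by (simp add: inner_vec_def)
  ultimately show ?thesis
    by (simp only:) (intro convex_Int convex_INT convex_halfspace_gt convex_halfspace_lt)
qed

lemma sets_open_simplex [measurable]: "(open_simplex m :: (real^'n) set) \<in> sets borel"
  by (simp add: borel_open open_open_simplex)

lemma emeasure_open_simplex_finite: "emeasure lborel (open_simplex m :: (real^'n) set) < \<infinity>"
  by (rule emeasure_bounded_finite[OF bounded_open_simplex])

lemma measure_open_simplex_pos:
  assumes "0 < m"
  shows "0 < measure lborel (open_simplex m :: (real^'n) set)"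
proof -
  let ?U = "open_simplex m :: (real^'n) set" and ?n = "real CARD('n)"
  have "(\<chi> k. m / (2 * ?n)) \<in> ?U" using assms by (simp add: open_simplex_def)
  then have "\<not> negligible ?U" using open_not_negligible open_open_simplex by blast
  then have "emeasure lborel ?U \<noteq> 0"
    by (auto simp: negligible_iff_null_sets null_sets_completion_iff null_sets_def)
  then show ?thesis
    using emeasure_open_simplex_finite[of m, where 'n = 'n] by (simp add: measure_def enn2real_positive_iff less_top zero_less_iff_neq_zero)
qed

lemma integrable_on_open_simplex:
  fixes f :: "real^'n \<Rightarrow> real"
  assumes "(\<lambda>p. indicator (open_simplex m) p * f p) \<in> borel_measurable borel"
    and "\<And>p. p \<in> open_simplex m \<Longrightarrow> \<bar>f p\<bar> \<le> B"
  shows "integrable lborel (\<lambda>p. indicator (open_simplex m) p * f p)"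
  by (rule integrableI_bounded_set[where A = "open_simplex m" and B = "B"])
     (use assms emeasure_open_simplex_finite in \<open>auto intro!: AE_I2\<close>)

text \<open>Integration by parts in the direction e_k. The integrand is the derivative of p_k^(b+1)
  s^(a+1) R, where s is m minus the sum of the coordinates. Extended by zero, this function vanishes
  on the two facets that are not parallel to e_k and is Lipschitz along e_k. By translation
  invariance its difference quotients have integral 0, and dominated convergence passes to the
  limit.\<close>

lemma integral_derivative_open_simplex:
  fixes R :: "real^'n \<Rightarrow> real"
  assumes R_meas [measurable]: "R \<in> borel_measurable borel"
    and R_const: "\<And>p h. R (p + h *\<^sub>R axis k 1) = R p"
    and R_bound: "\<And>p. p \<in> open_simplex m \<Longrightarrow> \<bar>R p\<bar> \<le> M"
  shows "(LINT p|lborel. indicator (open_simplex m) p *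
      ((real (Suc b) * p $ k ^ b * (m - (\<Sum>j\<in>UNIV. p $ j)) ^ Suc a
        - real (Suc a) * p $ k ^ Suc b * (m - (\<Sum>j\<in>UNIV. p $ j)) ^ a) * R p)) = 0"
    (is "(LINT p|lborel. ?D p) = 0")
proof -
  let ?U = "open_simplex m :: (real^'n) set"
  define s where "s p = m - (\<Sum>j\<in>UNIV. p $ j)" for p :: "real^'n"
  define T where "T h p = p + h *\<^sub>R axis k 1" for h and p :: "real^'n"
  have s_meas [measurable]: "s \<in> borel_measurable borel" unfolding s_def by measurable
  have T_nth: "T h p $ j = p $ j + (if j = k then h else 0)" for h p j by (auto simp: T_def axis_def)
  have s_T: "s (T h p) = s p - h" for h p
    by (simp add: s_def T_nth sum.distrib)
  have mem: "p \<in> ?U \<longleftrightarrow> (\<forall>j. 0 < p $ j) \<and> 0 < s p" for p by (auto simp: open_simplex_def s_def)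
  have lt: "0 < p $ k" "p $ k \<le> m" "0 < s p" "s p \<le> m" if "p \<in> ?U" for p
  proof -
    have pos: "\<forall>j. 0 < p $ j" and s: "0 < s p" using that mem by auto
    have "p $ k \<le> (\<Sum>j\<in>UNIV. p $ j)" using pos by (intro member_le_sum) (auto intro: less_imp_le)
    then show "0 < p $ k" "p $ k \<le> m" "0 < s p" "s p \<le> m" using pos[rule_format, of k] s by (auto simp: s_def)
  qed
  define F where "F p = indicator ?U p * (p $ k ^ Suc b * s p ^ Suc a * R p)" for p
  define f where "f x y t = (x + t) ^ Suc b * (y - t) ^ Suc a" for x y t :: real
  define f' where "f' x y t = real (Suc b) * (x + t) ^ b * (y - t) ^ Suc a - real (Suc a) * (x + t) ^ Suc b * (y - t) ^ a" for x y t :: real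
  have f_deriv: "(f x y has_real_derivative f' x y t) (at t)" for x y t
  proof -
    have d1: "((\<lambda>t. (x + t) ^ Suc b) has_real_derivative real (Suc b) * (x + t) ^ b) (at t)"
      by (rule DERIV_cong[OF DERIV_power[of "\<lambda>t. x + t" 1]]) (auto intro!: derivative_eq_intros)
    have d2: "((\<lambda>t. (y - t) ^ Suc a) has_real_derivative - (real (Suc a) * (y - t) ^ a)) (at t)"
      by (rule DERIV_cong[OF DERIV_power[of "\<lambda>t. y - t" "-1"]]) (auto intro!: derivative_eq_intros)
    show ?thesis unfolding f_def f'_def
      by (rule DERIV_cong[OF DERIV_mult[OF d1 d2]]) (simp add: algebra_simps)
  qed
  define P where "P = \<bar>m\<bar> ^ Suc (a + b)"
  \<comment> \<open>A Lipschitz constant along e_k: \<open>P\<close> bounds every monomial of degree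
    a + b + 1 in p_k and s, and \<open>M\<close> bounds \<open>R\<close>.\<close>
  define L where "L = (real (Suc a) + real (Suc b)) * P * \<bar>M\<bar>"
  have P: "0 \<le> P" by (simp add: P_def)
  have R_bound': "\<bar>R p\<bar> \<le> \<bar>M\<bar>" if "p \<in> ?U" for p using R_bound[OF that] by simp
  have f'_bound: "\<bar>f' x y t\<bar> \<le> (real (Suc a) + real (Suc b)) * P"
    if "0 \<le> x + t" "x + t \<le> m" "0 \<le> y - t" "y - t \<le> m" for x y t
  proof -
    have "0 \<le> m" using that by linarith
    then have mP: "m ^ b * m ^ Suc a = P" "m ^ Suc b * m ^ a = P" by (simp_all add: P_def power_add mult_ac)
    have 1: "(x + t) ^ b * (y - t) ^ Suc a \<le> P" 
      using mult_mono[OF power_mono[OF that(2,1), of b] power_mono[OF that(4,3), of "Suc a"]] that 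
      unfolding mP by simp
    have 2: "(x + t) ^ Suc b * (y - t) ^ a \<le> P"
      using mult_mono[OF power_mono[OF that(2,1), of "Suc b"] power_mono[OF that(4,3), of a]] that 
      unfolding mP by simp
    have 3: "0 \<le> (x + t) ^ b * (y - t) ^ Suc a" "0 \<le> (x + t) ^ Suc b * (y - t) ^ a" using that by auto
    have "\<bar>f' x y t\<bar> \<le> real (Suc b) * ((x + t) ^ b * (y - t) ^ Suc a) + real (Suc a) * ((x + t) ^ Suc b * (y - t) ^ a)"
    proof -
      have "\<bar>real (Suc b) * v - real (Suc a) * w\<bar> \<le> real (Suc b) * v + real (Suc a) * w" if "0 \<le> v" "0 \<le> w" for v w :: real
      proof -
        have "0 \<le> real (Suc b) * v" "0 \<le> real (Suc a) * w" using that by auto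
        then show ?thesis by linarith
      qed
      from this[OF 3] show ?thesis unfolding f'_def mult.assoc .
    qed
    also have "\<dots> \<le> real (Suc b) * P + real (Suc a) * P"
      using 1 2 by (intro add_mono mult_left_mono) auto
    finally show ?thesis by (simp add: algebra_simps)
  qed
  have F_f: "F (T h p) = f (p $ k) (s p) h * R p" if "T h p \<in> ?U" for h p
    using that R_const[of p h] by (simp add: F_def f_def s_T T_nth) (simp add: T_def)
  have F_0: "F p = f (p $ k) (s p) 0 * R p" if "p \<in> ?U" for p
    using that by (simp add: F_def f_def)
  \<comment> \<open>Within distance \<open>h\<close> of a facet one of the factors is at most
    \<open>h\<close>; this settles the cases in which the translation crosses the boundary.\<close>
  have edge: "x * y * z \<le> h * P" if "0 \<le> x" "x \<le> h" "0 \<le> y" "y \<le> m ^ i" "0 \<le> z" "z \<le> m ^ j" "i + j = Suc (a + b)" "0 \<le> m" "0 \<le> h" for x y z h i j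
  proof -
    have "x * (y * z) \<le> h * (m ^ i * m ^ j)" using that by (intro mult_mono mult_nonneg_nonneg) auto
    then show ?thesis using that by (simp add: P_def power_add[symmetric] mult.assoc)
  qed
  have lip: "\<bar>F (T h p) - F p\<bar> \<le> h * L" if h: "0 < h" for h p
  proof (cases "p \<in> ?U")
    case p: True
    note ltp = lt[OF p]
    have m0: "0 \<le> m" using ltp by linarith
    show ?thesis
    proof (cases "T h p \<in> ?U")
      case True
      note ltT = lt[OF True]
      obtain t where t: "0 < t" "t < h" "f (p $ k) (s p) h - f (p $ k) (s p) 0 = (h - 0) * f' (p $ k) (s p) t"
        using MVT2[OF h, of "f (p $ k) (s p)" "f' (p $ k) (s p)"] f_deriv by blast
      have "\<bar>f' (p $ k) (s p) t\<bar> \<le> (real (Suc a) + real (Suc b)) * P"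
        using t ltp ltT by (intro f'_bound) (auto simp: s_T T_nth)
      then have "\<bar>f' (p $ k) (s p) t\<bar> * \<bar>R p\<bar> \<le> L"
        unfolding L_def using R_bound'[OF p] by (intro mult_mono) auto
      moreover have "F (T h p) - F p = h * (f' (p $ k) (s p) t * R p)"
        using F_f[OF True] F_0[OF p] t(3) by (simp add: algebra_simps)
      ultimately show ?thesis using h by (simp add: abs_mult)
    next
      case False
      \<comment> \<open>Moving forward along e_k lowers no coordinate, so the simplex can be left
        only through the facet s = 0.\<close>
      have "0 < T h p $ j" for j using p h unfolding mem by (simp add: T_nth add_pos_pos)
      then have "s p \<le> h" using False unfolding mem s_T by (simp add: not_less)
      then have "s p * p $ k ^ Suc b * s p ^ a \<le> h * P"
        using ltp m0 h by (intro edge[of _ _ _ "Suc b" _ a]) (auto intro!: power_mono zero_le_power mult_nonneg_nonneg simp del: power_Suc)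
      then have "\<bar>p $ k ^ Suc b * s p ^ Suc a\<bar> * \<bar>R p\<bar> \<le> (h * P) * \<bar>M\<bar>"
        using R_bound'[OF p] ltp h P by (intro mult_mono) (auto simp: abs_mult mult_ac)
      also have "\<dots> \<le> h * L" unfolding L_def using h P by (simp add: algebra_simps)
      finally show ?thesis using False p by (simp add: F_def abs_mult)
    qed
  next
    case p: False
    show ?thesis
    proof (cases "T h p \<in> ?U")
      case True
      note ltT = lt[OF True]
      have m0: "0 \<le> m" using ltT by linarith
      \<comment> \<open>Conversely, it can be entered only through the facet p_k = 0.\<close>
      have "p $ k \<le> 0"
      proof (rule ccontr)
        assume "\<not> p $ k \<le> 0"
        then have "0 < p $ j" for j using True[unfolded mem, THEN conjunct1, rule_format, of j] by (cases "j = k") (auto simp: T_nth)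
        moreover have "0 < s p" using True h unfolding mem s_T by auto
        ultimately show False using p mem by blast
      qed
      then have "T h p $ k \<le> h" by (simp add: T_nth)
      then have "T h p $ k * T h p $ k ^ b * s (T h p) ^ Suc a \<le> h * P"
        using ltT m0 h by (intro edge[of _ _ _ b _ "Suc a"]) (auto intro!: power_mono zero_le_power mult_nonneg_nonneg simp del: power_Suc)
      then have "\<bar>T h p $ k ^ Suc b * s (T h p) ^ Suc a\<bar> * \<bar>R (T h p)\<bar> \<le> (h * P) * \<bar>M\<bar>"
        using R_bound'[OF True] ltT h P by (intro mult_mono) (auto simp: abs_mult mult_ac)
      also have "\<dots> \<le> h * L" unfolding L_def using h P by (simp add: algebra_simps)
      finally show ?thesis using True p by (simp add: F_def abs_mult)
    next
      case False
      then show ?thesis using p h P by (simp add: F_def L_def)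
    qed
  qed
  have F_meas [measurable]: "F \<in> borel_measurable borel" unfolding F_def by measurable
  have T_meas [measurable]: "T h \<in> borel_measurable borel" for h unfolding T_def by measurable
  have int_F: "integrable lborel F"
    unfolding F_def
  proof (rule integrable_on_open_simplex)
    show "(\<lambda>p. indicator ?U p * (p $ k ^ Suc b * s p ^ Suc a * R p)) \<in> borel_measurable borel" by measurable
    fix p :: "real^'n" assume p: "p \<in> ?U"
    have "\<bar>p $ k ^ Suc b\<bar> * \<bar>s p ^ Suc a\<bar> * \<bar>R p\<bar> \<le> m ^ Suc b * m ^ Suc a * \<bar>M\<bar>"
      unfolding power_abs using lt[OF p] R_bound'[OF p] by (intro mult_mono power_mono) (auto simp del: power_Suc)
    then show "\<bar>p $ k ^ Suc b * s p ^ Suc a * R p\<bar> \<le> m ^ Suc b * m ^ Suc a * \<bar>M\<bar>" by (simp only: abs_mult)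
  qed
  have shift: "distr lborel borel (T h) = lborel" for h
  proof -
    have "T h = (+) (h *\<^sub>R axis k 1)" by (simp add: T_def fun_eq_iff)
    then show ?thesis by (simp only: lborel_distr_plus)
  qed
  have int_FT: "integrable lborel (\<lambda>p. F (T h p))" for h
  proof -
    have "integrable (distr lborel borel (T h)) F" unfolding shift by (rule int_F)
    then show ?thesis by (subst (asm) integrable_distr_eq) auto
  qed
  have LINT_FT: "(LINT p|lborel. F (T h p)) = (LINT p|lborel. F p)" for h
  proof -
    have "(LINT p|distr lborel borel (T h). F p) = (LINT p|lborel. F (T h p))" by (subst integral_distr) auto
    then show ?thesis unfolding shift by simp
  qed
  define hh where "hh i = inverse (real (Suc i))" for i
  have hh: "0 < hh i" "hh i \<le> 1" for i by (auto simp: hh_def field_simps)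
  have hh_lim: "filterlim hh (at 0) sequentially"
    unfolding hh_def by (rule filterlim_atI[OF LIMSEQ_inverse_real_of_nat]) auto
  obtain r where r: "\<And>p. p \<in> ?U \<Longrightarrow> norm p \<le> r" using bounded_open_simplex[of m] unfolding bounded_iff by blast
  have "(\<lambda>i. LINT p|lborel. (F (T (hh i) p) - F p) / hh i) \<longlonglongrightarrow> (LINT p|lborel. ?D p)"
  \<comment> \<open>The steps \<open>hh i\<close> are at most 1, so all difference quotients vanish
    outside the ball of radius r + 1.\<close>
  proof (rule integral_dominated_convergence[where w = "\<lambda>p. L * indicator (cball 0 (r + 1)) p"])
    show "?D \<in> borel_measurable lborel" by measurable
    show "(\<lambda>p. (F (T (hh i) p) - F p) / hh i) \<in> borel_measurable lborel" for i by measurable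
    show "integrable lborel (\<lambda>p. L * indicat_real (cball 0 (r + 1)) p)"
      by (intro integrable_mult_right integrable_real_indicator emeasure_bounded_finite bounded_cball) simp
    show "AE p in lborel. norm ((F (T (hh i) p) - F p) / hh i) \<le> L * indicator (cball 0 (r + 1)) p" for i
    proof (rule AE_I2)
      fix p :: "real^'n"
      show "norm ((F (T (hh i) p) - F p) / hh i) \<le> L * indicator (cball 0 (r + 1)) p"
      proof (cases "p \<in> cball 0 (r + 1)")
        case True
        then show ?thesis using lip[OF hh(1), of i p] hh(1)[of i] by (simp add: divide_le_eq mult.commute)
      next
        case False
        then have n: "r + 1 < norm p" by simp
        have "norm p \<le> norm (T (hh i) p) + hh i"
          using norm_triangle_sub[of p "T (hh i) p"] hh(1)[of i] by (simp add: T_def)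
        then have "r < norm (T (hh i) p)" using n hh(2)[of i] by linarith
        then have "p \<notin> ?U" "T (hh i) p \<notin> ?U" using n r by force+
        then show ?thesis using False by (simp add: F_def)
      qed
    qed
    \<comment> \<open>Pointwise convergence is shown off the boundary, which is null because the
      simplex is convex.\<close>
    have "frontier ?U \<in> null_sets lborel"
      by (simp flip: null_sets_completion_iff add: null_sets_completion_iff[symmetric] negligible_iff_null_sets[symmetric] negligible_convex_frontier convex_open_simplex)
    then have "AE p in lborel. p \<notin> frontier ?U" by (rule AE_not_in)
    then show "AE p in lborel. (\<lambda>i. (F (T (hh i) p) - F p) / hh i) \<longlonglongrightarrow> ?D p"
    proof eventually_elim
      case (elim p)
      have Tlim: "(\<lambda>i. T (hh i) p) \<longlonglongrightarrow> p"
      proof -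
        have "hh \<longlonglongrightarrow> 0" unfolding hh_def by (rule LIMSEQ_inverse_real_of_nat)
        then show ?thesis unfolding T_def by (auto intro!: tendsto_eq_intros)
      qed
      show ?case
      proof (cases "p \<in> ?U")
        case True
        have "eventually (\<lambda>i. T (hh i) p \<in> ?U) sequentially"
          using topological_tendstoD[OF Tlim open_open_simplex True] .
        then have ev: "eventually (\<lambda>i. (f (p $ k) (s p) (0 + hh i) - f (p $ k) (s p) 0) / hh i * R p = (F (T (hh i) p) - F p) / hh i) sequentially"
          by eventually_elim (simp add: F_f F_0[OF True] algebra_simps diff_divide_distrib)
        have "((\<lambda>h. (f (p $ k) (s p) (0 + h) - f (p $ k) (s p) 0) / h) \<longlongrightarrow> f' (p $ k) (s p) 0) (at 0)"
          using f_deriv[of "p $ k" "s p" 0] by (simp only: DERIV_def)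
        from tendsto_mult[OF filterlim_compose[OF this hh_lim] tendsto_const[of "R p"]]
        have "(\<lambda>i. (F (T (hh i) p) - F p) / hh i) \<longlonglongrightarrow> f' (p $ k) (s p) 0 * R p"
          using ev by (rule Lim_transform_eventually)
        then show ?thesis using True by (simp add: f'_def s_def)
      next
        case False
        then have "p \<in> - closure ?U" using elim by (auto simp: frontier_def interior_open open_open_simplex)
        then have "eventually (\<lambda>i. T (hh i) p \<in> - closure ?U) sequentially"
          by (intro topological_tendstoD[OF Tlim]) auto
        then have "eventually (\<lambda>i. 0 = (F (T (hh i) p) - F p) / hh i) sequentially"
        proof eventually_elim
          case (elim i)
          then have "T (hh i) p \<notin> ?U" using closure_subset[of ?U] by auto
          then show ?case using False by (simp add: F_def)
        qed
        then have "(\<lambda>i. (F (T (hh i) p) - F p) / hh i) \<longlonglongrightarrow> 0"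
          by (rule Lim_transform_eventually[OF tendsto_const])
        then show ?thesis using False by simp
      qed
    qed
  qed
  moreover have "(LINT p|lborel. (F (T (hh i) p) - F p) / hh i) = 0" for i
    using int_F int_FT LINT_FT by simp
  ultimately have "(\<lambda>i::nat. 0::real) \<longlonglongrightarrow> (LINT p|lborel. ?D p)" by (simp only:)
  from LIMSEQ_unique[OF this tendsto_const] show ?thesis .
qed

section \<open>Homogeneous coordinates of the simplex and moments of monomials\<close>

definition hom_coord :: "real \<Rightarrow> real^'n \<Rightarrow> 'n option \<Rightarrow> real" where
  "hom_coord m p j = (case j of None \<Rightarrow> m - (\<Sum>k\<in>UNIV. p $ k) | Some k \<Rightarrow> p $ k)"

lemma hom_coord_simps [simp]:
  "hom_coord m p None = m - (\<Sum>k\<in>UNIV. p $ k)" "hom_coord m p (Some k) = p $ k"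
  by (simp_all add: hom_coord_def)

lemma sum_option: "(\<Sum>j\<in>UNIV. f j) = f None + (\<Sum>k\<in>UNIV. f (Some k))" for f :: "'n::finite option \<Rightarrow> 'b::comm_monoid_add"
  by (simp add: UNIV_option_conv sum.reindex)

lemma prod_option: "(\<Prod>j\<in>UNIV. f j) = f None * (\<Prod>k\<in>UNIV. f (Some k))" for f :: "'n::finite option \<Rightarrow> 'b::comm_monoid_mult"
  by (simp add: UNIV_option_conv prod.reindex)

lemma sum_hom_coord: "(\<Sum>j\<in>UNIV. hom_coord m p j) = m"
  by (simp add: sum_option)

lemma mem_open_simplex_iff: "p \<in> open_simplex m \<longleftrightarrow> (\<forall>j. 0 < hom_coord m p j)"
  by (simp add: open_simplex_def split_option_all conj_commute)

lemma hom_coord_bounds: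
  assumes "p \<in> open_simplex m"
  shows "0 < hom_coord m p j" "hom_coord m p j \<le> m"
proof -
  show "0 < hom_coord m p j" using assms by (simp add: mem_open_simplex_iff)
  have "hom_coord m p j \<le> (\<Sum>j\<in>UNIV. hom_coord m p j)"
    using assms by (intro member_le_sum) (auto simp: mem_open_simplex_iff less_imp_le)
  then show "hom_coord m p j \<le> m" by (simp only: sum_hom_coord)
qed

lemma measurable_hom_coord [measurable]: "(\<lambda>p::real^'n. hom_coord m p j) \<in> borel_measurable borel"
  by (cases j) auto

definition simplex_moment :: "real \<Rightarrow> ('n::finite option \<Rightarrow> nat) \<Rightarrow> real" where
  "simplex_moment m \<beta> = (LINT p|lborel. indicator (open_simplex m) (p::real^'n) * (\<Prod>j\<in>UNIV. hom_coord m p j ^ \<beta> j))"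

lemma monomial_le:
  fixes p :: "real^'n"
  assumes "p \<in> open_simplex m"
  shows "(\<Prod>j\<in>UNIV. hom_coord m p j ^ \<beta> j) \<le> m ^ (\<Sum>j\<in>UNIV. \<beta> j)" "0 \<le> (\<Prod>j\<in>UNIV. hom_coord m p j ^ \<beta> j)"
proof -
  have "(\<Prod>j\<in>UNIV. hom_coord m p j ^ \<beta> j) \<le> (\<Prod>j\<in>UNIV. m ^ \<beta> j)"
    using hom_coord_bounds[OF assms] by (intro prod_mono conjI power_mono zero_le_power) (auto intro: less_imp_le)
  then show "(\<Prod>j\<in>UNIV. hom_coord m p j ^ \<beta> j) \<le> m ^ (\<Sum>j\<in>UNIV. \<beta> j)" by (simp add: power_sum)
  show "0 \<le> (\<Prod>j\<in>UNIV. hom_coord m p j ^ \<beta> j)"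
    using hom_coord_bounds[OF assms] by (intro prod_nonneg) (auto intro: less_imp_le)
qed

lemma integrable_moment:
  "integrable lborel (\<lambda>p::real^'n. indicator (open_simplex m) p * (\<Prod>j\<in>UNIV. hom_coord m p j ^ \<beta> j))"
proof (rule integrable_on_open_simplex[where B = "m ^ (\<Sum>j\<in>UNIV. \<beta> j)"])
  show "(\<lambda>p::real^'n. indicator (open_simplex m) p * (\<Prod>j\<in>UNIV. hom_coord m p j ^ \<beta> j)) \<in> borel_measurable borel"
    by measurable
  fix p :: "real^'n" assume "p \<in> open_simplex m"
  from monomial_le[OF this, of \<beta>]
  show "\<bar>\<Prod>j\<in>UNIV. hom_coord m p j ^ \<beta> j\<bar> \<le> m ^ (\<Sum>j\<in>UNIV. \<beta> j)" by (simp only: abs_of_nonneg)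
qed

lemma prod_power_upd:
  fixes x :: "'a::finite \<Rightarrow> 'b::comm_semiring_1"
  shows "(\<Prod>j\<in>UNIV. x j ^ (\<beta>(i := Suc (\<beta> i))) j) = x i * (\<Prod>j\<in>UNIV. x j ^ \<beta> j)"
proof -
  have "(\<Prod>j\<in>UNIV. x j ^ (\<beta>(i := Suc (\<beta> i))) j) = x i ^ Suc (\<beta> i) * (\<Prod>j\<in>UNIV - {i}. x j ^ \<beta> j)"
    by (subst prod.remove[of _ i]) (auto intro!: prod.cong)
  also have "\<dots> = x i * (x i ^ \<beta> i * (\<Prod>j\<in>UNIV - {i}. x j ^ \<beta> j))" by (simp add: mult.assoc)
  also have "x i ^ \<beta> i * (\<Prod>j\<in>UNIV - {i}. x j ^ \<beta> j) = (\<Prod>j\<in>UNIV. x j ^ \<beta> j)"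
    by (rule prod.remove[symmetric]) auto
  finally show ?thesis .
qed

lemma prod_fact_upd:
  fixes \<beta> :: "'a::finite \<Rightarrow> nat"
  shows "(\<Prod>j\<in>UNIV. fact ((\<beta>(i := Suc (\<beta> i))) j)) = real (Suc (\<beta> i)) * (\<Prod>j\<in>UNIV. fact (\<beta> j))"
proof -
  have "(\<Prod>j\<in>UNIV. fact ((\<beta>(i := Suc (\<beta> i))) j)) = real (Suc (\<beta> i)) * fact (\<beta> i) * (\<Prod>j\<in>UNIV - {i}. fact (\<beta> j))"
    by (subst prod.remove[of _ i]) (auto intro!: prod.cong)
  also have "\<dots> = real (Suc (\<beta> i)) * (fact (\<beta> i) * (\<Prod>j\<in>UNIV - {i}. fact (\<beta> j)))" by (simp add: mult.assoc)
  also have "fact (\<beta> i) * (\<Prod>j\<in>UNIV - {i}. fact (\<beta> j)) = (\<Prod>j\<in>UNIV. fact (\<beta> j) :: real)"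
    by (rule prod.remove[symmetric]) auto
  finally show ?thesis .
qed

text \<open>Integration by parts in the direction e_k trades one power of the coordinate
  \<open>Some k\<close> for one of the coordinate \<open>None\<close>.\<close>

lemma moment_swap:
  fixes \<beta> :: "'n::finite option \<Rightarrow> nat"
  shows "real (Suc (\<beta> (Some k))) * simplex_moment m (\<beta>(None := Suc (\<beta> None))) =
    real (Suc (\<beta> None)) * simplex_moment m (\<beta>(Some k := Suc (\<beta> (Some k))))"
proof -
  let ?P = "\<lambda>p::real^'n. \<Prod>j\<in>UNIV. hom_coord m p j ^ \<beta> j"
  define R where "R p = (\<Prod>j\<in>UNIV - {k}. p $ j ^ \<beta> (Some j))" for p :: "real^'n"
  have P: "?P p = hom_coord m p None ^ \<beta> None * (p $ k ^ \<beta> (Some k) * R p)" for p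
    unfolding prod_option R_def by (subst prod.remove[of UNIV k]) auto
  have "(LINT p|lborel. indicator (open_simplex m) p *
      ((real (Suc (\<beta> (Some k))) * p $ k ^ \<beta> (Some k) * (m - (\<Sum>j\<in>UNIV. p $ j)) ^ Suc (\<beta> None)
        - real (Suc (\<beta> None)) * p $ k ^ Suc (\<beta> (Some k)) * (m - (\<Sum>j\<in>UNIV. p $ j)) ^ \<beta> None) * R p)) = 0"
  proof (rule integral_derivative_open_simplex[where M = "\<bar>m\<bar> ^ (\<Sum>j\<in>UNIV - {k}. \<beta> (Some j))"])
    show "R \<in> borel_measurable borel" unfolding R_def by measurable
    show "R (p + h *\<^sub>R axis k 1) = R p" for p h
      unfolding R_def by (intro prod.cong) (auto simp: axis_def)
    fix p :: "real^'n" assume p: "p \<in> open_simplex m"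
    have "\<bar>R p\<bar> = (\<Prod>j\<in>UNIV - {k}. \<bar>p $ j\<bar> ^ \<beta> (Some j))" by (simp add: R_def abs_prod power_abs)
    also have "\<dots> \<le> (\<Prod>j\<in>UNIV - {k}. \<bar>m\<bar> ^ \<beta> (Some j))"
    proof (intro prod_mono conjI power_mono zero_le_power)
      fix j show "\<bar>p $ j\<bar> \<le> \<bar>m\<bar>" using hom_coord_bounds[OF p, of "Some j"] by simp
    qed auto
    finally show "\<bar>R p\<bar> \<le> \<bar>m\<bar> ^ (\<Sum>j\<in>UNIV - {k}. \<beta> (Some j))" by (simp add: power_sum)
  qed
  also have "(\<lambda>p. indicator (open_simplex m) p *
      ((real (Suc (\<beta> (Some k))) * p $ k ^ \<beta> (Some k) * (m - (\<Sum>j\<in>UNIV. p $ j)) ^ Suc (\<beta> None)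
        - real (Suc (\<beta> None)) * p $ k ^ Suc (\<beta> (Some k)) * (m - (\<Sum>j\<in>UNIV. p $ j)) ^ \<beta> None) * R p)) =
    (\<lambda>p. real (Suc (\<beta> (Some k))) * (indicator (open_simplex m) p * (\<Prod>j\<in>UNIV. hom_coord m p j ^ (\<beta>(None := Suc (\<beta> None))) j))
      - real (Suc (\<beta> None)) * (indicator (open_simplex m) p * (\<Prod>j\<in>UNIV. hom_coord m p j ^ (\<beta>(Some k := Suc (\<beta> (Some k)))) j)))"
    unfolding prod_power_upd P hom_coord_simps by (simp add: fun_eq_iff algebra_simps)
  finally show ?thesis
    unfolding simplex_moment_def
    by (subst (asm) Bochner_Integration.integral_diff) (auto intro!: integrable_mult_right integrable_moment)
qed

text \<open>Iterating \<open>moment_swap\<close> moves the whole exponent into the coordinate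
  \<open>None\<close>; the factors collected are those of the product of factorials. Hence the
  normalised moment depends on the degree alone, and no Dirichlet integral has to be
  evaluated.\<close>

lemma normalized_moment_const:
  fixes \<beta> :: "'n::finite option \<Rightarrow> nat"
  shows "simplex_moment m \<beta> / (\<Prod>j\<in>UNIV. fact (\<beta> j)) =
    simplex_moment m ((\<lambda>_. 0)(None := \<Sum>j\<in>UNIV. \<beta> j) :: 'n option \<Rightarrow> nat) / fact (\<Sum>j\<in>UNIV. \<beta> j)"
proof (induction "\<Sum>k\<in>UNIV. \<beta> (Some k)" arbitrary: \<beta>)
  case 0
  then have z: "\<beta> (Some k) = 0" for k by auto
  then have "\<beta> = (\<lambda>_. 0)(None := \<Sum>j\<in>UNIV. \<beta> j)" 
    by (auto simp: fun_eq_iff sum_option split_option_all)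
  moreover have "(\<Prod>j\<in>UNIV. fact (\<beta> j)) = (fact (\<Sum>j\<in>UNIV. \<beta> j) :: real)" by (simp add: prod_option sum_option z)
  ultimately show ?case by simp
next
  case (Suc x)
  then obtain k where k: "\<beta> (Some k) \<noteq> 0" by (metis Zero_not_Suc sum.neutral)
  define \<gamma> where "\<gamma> = \<beta>(Some k := \<beta> (Some k) - 1)"
  have \<beta>: "\<beta> = \<gamma>(Some k := Suc (\<gamma> (Some k)))" using k by (auto simp: \<gamma>_def fun_eq_iff)
  let ?\<gamma>' = "\<gamma>(None := Suc (\<gamma> None))"
  have upd: "(\<Sum>j\<in>UNIV. (\<gamma>(i := Suc (\<gamma> i))) j) = Suc (\<Sum>j\<in>UNIV. \<gamma> j)" for i
    by (subst (1 2) sum.remove[of _ i]) (auto intro!: sum.cong)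
  have s: "(\<Sum>j\<in>UNIV. ?\<gamma>' j) = (\<Sum>j\<in>UNIV. \<beta> j)" by (subst (2) \<beta>) (simp only: upd)
  have "(\<Sum>j\<in>UNIV. \<gamma> (Some j)) + Suc (\<gamma> None) = \<beta> None + (\<Sum>j\<in>UNIV. \<beta> (Some j))"
    using s unfolding sum_option by simp
  then have "x = (\<Sum>j\<in>UNIV. ?\<gamma>' (Some j))" using Suc(2) by (simp add: \<gamma>_def)
  from Suc(1)[OF this] have IH: "simplex_moment m ?\<gamma>' / (\<Prod>j\<in>UNIV. fact (?\<gamma>' j)) =
    simplex_moment m ((\<lambda>_. 0)(None := \<Sum>j\<in>UNIV. \<beta> j) :: 'n option \<Rightarrow> nat) / fact (\<Sum>j\<in>UNIV. \<beta> j)"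
    unfolding s .
  have "simplex_moment m \<beta> / (\<Prod>j\<in>UNIV. fact (\<beta> j)) = simplex_moment m ?\<gamma>' / (\<Prod>j\<in>UNIV. fact (?\<gamma>' j))"
    using moment_swap[of \<gamma> k m] unfolding \<beta>[symmetric] prod_fact_upd
    by (subst \<beta>, subst prod_fact_upd) (simp add: field_simps del: of_nat_Suc fun_upd_apply flip: \<beta>)
  then show ?case using IH by simp
qed

section \<open>Exponents of fixed degree and the multinomial theorem\<close>

definition compositions :: "nat \<Rightarrow> ('a::finite \<Rightarrow> nat) set" where
  "compositions d = {\<beta>. (\<Sum>j\<in>UNIV. \<beta> j) = d}"

lemma finite_compositions: "finite (compositions d :: ('a::finite \<Rightarrow> nat) set)"
proof (rule finite_subset)
  show "compositions d \<subseteq> (PiE UNIV (\<lambda>_. {..d}) :: ('a \<Rightarrow> nat) set)"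
  proof
    fix \<beta> :: "'a \<Rightarrow> nat" assume "\<beta> \<in> compositions d"
    then have "\<beta> j \<le> d" for j using member_le_sum[of j UNIV \<beta>] by (auto simp: compositions_def)
    then show "\<beta> \<in> PiE UNIV (\<lambda>_. {..d})" by auto
  qed
qed (auto intro: finite_PiE)

lemma sum_upd: "(\<Sum>j\<in>UNIV. (\<gamma>(i := Suc (\<gamma> i))) j) = Suc (\<Sum>j\<in>UNIV. \<gamma> j)" for \<gamma> :: "'a::finite \<Rightarrow> nat"
  by (subst (1 2) sum.remove[of _ i]) (auto intro!: sum.cong)

text \<open>Write t_\<beta> for x^\<beta> divided by the product of the factorials. Then \<beta>_i
  t_\<beta> is x_i times the term with one unit of \<beta>_i removed; summing over i, where the
  \<beta>_i add up to d + 1, gives the induction step.\<close>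

lemma multinomial:
  fixes x :: "'a::finite \<Rightarrow> real"
  shows "(\<Sum>j\<in>UNIV. x j) ^ d = (\<Sum>\<beta>\<in>compositions d. fact d / (\<Prod>j\<in>UNIV. fact (\<beta> j)) * (\<Prod>j\<in>UNIV. x j ^ \<beta> j))"
proof (induction d)
  case 0
  have "compositions 0 = {\<lambda>_::'a. 0}" by (auto simp: compositions_def)
  then show ?case by simp
next
  case (Suc d)
  let ?t = "\<lambda>\<beta>. (\<Prod>j\<in>UNIV. x j ^ \<beta> j) / (\<Prod>j\<in>UNIV. fact (\<beta> j))"
  have shift: "(\<Sum>\<beta>\<in>compositions (Suc d). real (\<beta> i) * ?t \<beta>) = x i * (\<Sum>\<beta>\<in>compositions d. ?t \<beta>)" for i
  proof -
    have "(\<Sum>\<beta>\<in>compositions (Suc d). real (\<beta> i) * ?t \<beta>) = (\<Sum>\<beta>\<in>{\<beta>\<in>compositions (Suc d). \<beta> i \<noteq> 0}. real (\<beta> i) * ?t \<beta>)"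
      by (rule sum.mono_neutral_right) (auto simp: finite_compositions)
    also have "\<dots> = (\<Sum>\<beta>\<in>compositions d. x i * ?t \<beta>)"
    proof (rule sum.reindex_bij_witness[where i = "\<lambda>\<gamma>. \<gamma>(i := Suc (\<gamma> i))" and j = "\<lambda>\<beta>. \<beta>(i := \<beta> i - 1)"])
      fix \<beta> :: "'a \<Rightarrow> nat" assume \<beta>: "\<beta> \<in> {\<beta>\<in>compositions (Suc d). \<beta> i \<noteq> 0}"
      define \<gamma> where "\<gamma> = \<beta>(i := \<beta> i - 1)"
      have eq: "\<beta> = \<gamma>(i := Suc (\<gamma> i))" using \<beta> by (auto simp: \<gamma>_def fun_eq_iff)
      show "(\<beta>(i := \<beta> i - 1))(i := Suc ((\<beta>(i := \<beta> i - 1)) i)) = \<beta>" using eq by (simp add: \<gamma>_def)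
      have "(\<Sum>j\<in>UNIV. \<beta> j) = Suc (\<Sum>j\<in>UNIV. \<gamma> j)" by (subst eq) (rule sum_upd)
      then show "\<beta>(i := \<beta> i - 1) \<in> compositions d" using \<beta> by (auto simp: compositions_def \<gamma>_def)
      have "\<beta> i = Suc (\<gamma> i)" using \<beta> by (simp add: \<gamma>_def)
      moreover have "?t \<beta> = (x i * (\<Prod>j\<in>UNIV. x j ^ \<gamma> j)) / (real (Suc (\<gamma> i)) * (\<Prod>j\<in>UNIV. fact (\<gamma> j)))"
        by (subst (1 2) eq) (simp only: prod_power_upd prod_fact_upd)
      ultimately show "x i * ?t (\<beta>(i := \<beta> i - 1)) = real (\<beta> i) * ?t \<beta>"
        unfolding \<gamma>_def[symmetric] by (simp del: of_nat_Suc)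
    next
      fix \<gamma> :: "'a \<Rightarrow> nat" assume \<gamma>: "\<gamma> \<in> compositions d"
      show "(\<gamma>(i := Suc (\<gamma> i)))(i := (\<gamma>(i := Suc (\<gamma> i))) i - 1) = \<gamma>" by simp
      have "(\<Sum>j\<in>UNIV. (\<gamma>(i := Suc (\<gamma> i))) j) = Suc d" using \<gamma> unfolding sum_upd by (simp add: compositions_def)
      then show "\<gamma>(i := Suc (\<gamma> i)) \<in> {\<beta>\<in>compositions (Suc d). \<beta> i \<noteq> 0}" by (simp add: compositions_def del: fun_upd_apply) simp
    qed
    finally show ?thesis by (simp add: sum_distrib_left)
  qed
  have "(\<Sum>j\<in>UNIV. x j) ^ Suc d = (\<Sum>j\<in>UNIV. x j) * (fact d * (\<Sum>\<beta>\<in>compositions d. ?t \<beta>))"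
    using Suc by (simp add: sum_distrib_left)
  also have "\<dots> = fact d * (\<Sum>i\<in>UNIV. x i * (\<Sum>\<beta>\<in>compositions d. ?t \<beta>))"
    by (simp add: sum_distrib_right mult.left_commute)
  also have "\<dots> = fact d * (\<Sum>\<beta>\<in>compositions (Suc d). (\<Sum>i\<in>UNIV. real (\<beta> i)) * ?t \<beta>)"
    unfolding shift[symmetric] by (subst sum.swap) (simp only: sum_distrib_right)
  also have "\<dots> = fact d * (\<Sum>\<beta>\<in>compositions (Suc d). real (Suc d) * ?t \<beta>)"
    by (intro arg_cong[where f = "(*) (fact d)"] sum.cong refl) (simp add: compositions_def flip: of_nat_sum)
  also have "\<dots> = (\<Sum>\<beta>\<in>compositions (Suc d). fact (Suc d) / (\<Prod>j\<in>UNIV. fact (\<beta> j)) * (\<Prod>j\<in>UNIV. x j ^ \<beta> j))"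
    unfolding sum_distrib_left by (intro sum.cong refl) (simp add: mult_ac)
  finally show ?case .
qed

definition simplex_volume :: "'n::finite itself \<Rightarrow> real \<Rightarrow> real" where
  "simplex_volume _ m = measure lborel (open_simplex m :: (real^'n) set)"

text \<open>The constant that gives the density total mass 1, in the form in which
  \<open>moment_value\<close> produces it: through the number of compositions and the volume, so
  that the sum over \<beta> is visibly multinomial.\<close>

definition dirichlet_coeff :: "real \<Rightarrow> ('n::finite option \<Rightarrow> nat) \<Rightarrow> real" where
  "dirichlet_coeff m \<beta> = real (card (compositions (\<Sum>j\<in>UNIV. \<beta> j) :: ('n option \<Rightarrow> nat) set)) * fact (\<Sum>j\<in>UNIV. \<beta> j) /
     ((\<Prod>j\<in>UNIV. fact (\<beta> j)) * m ^ (\<Sum>j\<in>UNIV. \<beta> j) * simplex_volume TYPE('n) m)"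

definition dirichlet :: "real \<Rightarrow> ('n::finite option \<Rightarrow> nat) \<Rightarrow> real^'n \<Rightarrow> real" where
  "dirichlet m \<beta> p = dirichlet_coeff m \<beta> * (indicator (open_simplex m) p * (\<Prod>j\<in>UNIV. hom_coord m p j ^ \<beta> j))"

text \<open>The multinomial theorem expands the constant m^d, the power of the sum of the
  homogeneous coordinates. After integration all terms are equal by
  \<open>normalized_moment_const\<close>.\<close>

lemma moment_value:
  fixes \<beta> :: "'n::finite option \<Rightarrow> nat"
  assumes \<beta>: "\<beta> \<in> compositions d"
  shows "real (card (compositions d :: ('n option \<Rightarrow> nat) set)) * fact d * (simplex_moment m \<beta> / (\<Prod>j\<in>UNIV. fact (\<beta> j))) =
    m ^ d * simplex_volume TYPE('n) m"
proof -
  have c: "simplex_moment m \<gamma> / (\<Prod>j\<in>UNIV. fact (\<gamma> j)) = simplex_moment m \<beta> / (\<Prod>j\<in>UNIV. fact (\<beta> j))"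
    if "\<gamma> \<in> compositions d" for \<gamma> :: "'n option \<Rightarrow> nat"
    using normalized_moment_const[of m \<gamma>] normalized_moment_const[of m \<beta>] that \<beta> by (simp add: compositions_def)
  have "m ^ d * simplex_volume TYPE('n) m = (LINT p|lborel. indicator (open_simplex m) (p::real^'n) * m ^ d)"
    using emeasure_open_simplex_finite[of m, where 'n = 'n] by (simp add: simplex_volume_def less_top)
  also have "\<dots> = (LINT p|lborel. (\<Sum>\<gamma>\<in>compositions d. fact d / (\<Prod>j\<in>UNIV. fact (\<gamma> j)) * (indicator (open_simplex m) (p::real^'n) * (\<Prod>j\<in>UNIV. hom_coord m p j ^ \<gamma> j))))"
  proof (rule Bochner_Integration.integral_cong[OF refl])
    fix p :: "real^'n"
    show "indicator (open_simplex m) p * m ^ d = (\<Sum>\<gamma>\<in>compositions d. fact d / (\<Prod>j\<in>UNIV. fact (\<gamma> j)) * (indicator (open_simplex m) p * (\<Prod>j\<in>UNIV. hom_coord m p j ^ \<gamma> j)))"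
      using multinomial[of "hom_coord m p" d] by (simp add: sum_hom_coord sum_distrib_left mult.left_commute)
  qed
  also have "\<dots> = (\<Sum>\<gamma>\<in>(compositions d :: ('n option \<Rightarrow> nat) set). fact d * (simplex_moment m \<gamma> / (\<Prod>j\<in>UNIV. fact (\<gamma> j))))"
    unfolding simplex_moment_def by (subst Bochner_Integration.integral_sum) (auto intro!: integrable_mult_right integrable_moment)
  also have "\<dots> = (\<Sum>\<gamma>\<in>(compositions d :: ('n option \<Rightarrow> nat) set). fact d * (simplex_moment m \<beta> / (\<Prod>j\<in>UNIV. fact (\<beta> j))))"
    by (intro sum.cong refl) (simp only: c)
  finally show ?thesis by simp
qed

lemma card_compositions_pos: "0 < card (compositions d :: ('n::finite option \<Rightarrow> nat) set)"
proof -
  have "(\<lambda>_. 0)(None := d) \<in> (compositions d :: ('n option \<Rightarrow> nat) set)"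
    by (simp add: compositions_def sum_option)
  then show ?thesis using finite_compositions card_gt_0_iff by blast
qed

context
  fixes m :: real and \<beta> :: "'n::finite option \<Rightarrow> nat" and d :: nat
  assumes d: "\<beta> \<in> compositions d" and m: "m = real (d + CARD('n) + 1)"
begin

private abbreviation "c \<equiv> dirichlet_coeff m \<beta>"

private lemma sum_\<beta>: "(\<Sum>j\<in>UNIV. \<beta> j) = d" using d by (simp add: compositions_def)

private lemmas dirichlet_eq = dirichlet_def[of m \<beta>]

private lemma m_pos: "0 < m" using m by simp
private lemma V_pos: "0 < simplex_volume TYPE('n) m"
  unfolding simplex_volume_def by (rule measure_open_simplex_pos[OF m_pos])
private lemma fact_prod_pos: "0 < (\<Prod>j\<in>UNIV. fact (\<gamma> j) :: real)" by (simp add: prod_pos)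
private lemma c_pos: "0 < c"
  unfolding dirichlet_coeff_def
  using m_pos V_pos fact_prod_pos card_compositions_pos[where 'n = 'n] by (intro divide_pos_pos mult_pos_pos) simp_all

lemma measurable_dirichlet: "dirichlet m \<beta> \<in> borel_measurable borel"
  unfolding dirichlet_eq[abs_def] by measurable

lemma dirichlet_nonneg: "0 \<le> dirichlet m \<beta> p"
  unfolding dirichlet_eq using c_pos monomial_le(2)[of p m \<beta>] by (cases "p \<in> open_simplex m") auto

lemma dirichlet_bound: "\<exists>Q. \<forall>p. dirichlet m \<beta> p \<le> Q * indicator (open_simplex m) p"
proof (intro exI allI)
  fix p show "dirichlet m \<beta> p \<le> (c * m ^ d) * indicator (open_simplex m) p"
    unfolding dirichlet_eq using c_pos monomial_le(1)[of p m \<beta>] by (cases "p \<in> open_simplex m") (auto simp: sum_\<beta>)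
qed

lemma dirichlet_mass: "(LINT p|lborel. dirichlet m \<beta> p) = 1"
proof -
  have "(LINT p|lborel. dirichlet m \<beta> p) = c * simplex_moment m \<beta>"
    unfolding dirichlet_eq simplex_moment_def by simp
  also have "\<dots> = 1"
    using moment_value[OF d, of m] V_pos m_pos fact_prod_pos[of \<beta>]
    unfolding dirichlet_coeff_def sum_\<beta> by (simp add: field_simps)
  finally show ?thesis .
qed

text \<open>By \<open>moment_swap\<close> the means of the n + 1 homogeneous coordinates are
  proportional to \<beta>_j + 1. The means add up to m, and so do these numbers since m = d + n + 1;
  hence the factor is 1.\<close>

lemma dirichlet_mean: "(LINT p|lborel. dirichlet m \<beta> p * p $ k) = real (\<beta> (Some k)) + 1"
proof -
  define K where "K = simplex_moment m (\<beta>(None := Suc (\<beta> None))) / real (Suc (\<beta> None))"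
  have upd: "simplex_moment m (\<beta>(j := Suc (\<beta> j))) = real (Suc (\<beta> j)) * K" for j
    using moment_swap[of \<beta> _ m] by (cases j) (auto simp: K_def field_simps)
  have "(LINT p|lborel. dirichlet m \<beta> p * hom_coord m p j) = c * simplex_moment m (\<beta>(j := Suc (\<beta> j)))"
    and int: "integrable lborel (\<lambda>p. dirichlet m \<beta> p * hom_coord m p j)" for j
  proof -
    have *: "dirichlet m \<beta> p * hom_coord m p j = c * (indicator (open_simplex m) p * (\<Prod>i\<in>UNIV. hom_coord m p i ^ (\<beta>(j := Suc (\<beta> j))) i))" for p
      unfolding dirichlet_eq prod_power_upd by (simp only: mult_ac)
    show "(LINT p|lborel. dirichlet m \<beta> p * hom_coord m p j) = c * simplex_moment m (\<beta>(j := Suc (\<beta> j)))"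
      unfolding * simplex_moment_def by (rule integral_mult_right_zero)
    show "integrable lborel (\<lambda>p. dirichlet m \<beta> p * hom_coord m p j)"
      unfolding * by (intro integrable_mult_right integrable_moment)
  qed
  then have mean: "(LINT p|lborel. dirichlet m \<beta> p * hom_coord m p j) = real (Suc (\<beta> j)) * (c * K)" for j
    by (simp only: upd mult_ac)
  have "m = (LINT p|lborel. dirichlet m \<beta> p * m)" by (simp add: dirichlet_mass)
  also have "\<dots> = (LINT p|lborel. (\<Sum>j\<in>UNIV. dirichlet m \<beta> p * hom_coord m p j))"
    by (simp only: sum_distrib_left[symmetric] sum_hom_coord)
  also have "\<dots> = (\<Sum>j\<in>UNIV. real (Suc (\<beta> j)) * (c * K))"
    by (subst Bochner_Integration.integral_sum) (simp_all only: int mean)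
  also have "\<dots> = (\<Sum>j\<in>UNIV. real (Suc (\<beta> j))) * (c * K)" by (simp only: sum_distrib_right)
  also have "(\<Sum>j\<in>UNIV. real (Suc (\<beta> j))) = m"
    by (simp add: m sum.distrib sum_\<beta>[symmetric])
  finally have "c * K = 1" using m_pos by simp
  then show ?thesis using mean[of "Some k"] by simp
qed

text \<open>The homogeneous coordinates of the barycentre are at least 1. A deviation of 1 / (2n) in
  each of the n coordinates lowers each of them, and also the remaining one, by at most 1/2.\<close>

lemma dirichlet_lower:
  assumes "\<And>k. \<bar>p $ k - (real (\<beta> (Some k)) + 1)\<bar> \<le> 2 * (1 / (4 * real CARD('n)))"
  shows "p \<in> open_simplex m \<and> c * (1 / 2) ^ d \<le> dirichlet m \<beta> p"
proof -
  let ?n = "real CARD('n)"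
  have n: "1 \<le> ?n" by (simp add: Suc_leI)
  have near: "\<bar>p $ k - (real (\<beta> (Some k)) + 1)\<bar> \<le> 1 / (2 * ?n)" for k using assms[of k] by simp
  have half: "1 / 2 \<le> hom_coord m p j" for j
  proof (cases j)
    case None
    have "(\<Sum>k\<in>UNIV. p $ k) \<le> (\<Sum>k\<in>(UNIV::'n set). real (\<beta> (Some k)) + 1 + 1 / (2 * ?n))"
    proof (rule sum_mono)
      fix k show "p $ k \<le> real (\<beta> (Some k)) + 1 + 1 / (2 * ?n)" using near[of k] by linarith
    qed
    also have "\<dots> = (\<Sum>k\<in>UNIV. real (\<beta> (Some k))) + ?n + 1 / 2" using n by (simp add: sum.distrib)
    also have "(\<Sum>k\<in>UNIV. real (\<beta> (Some k))) = real d - real (\<beta> None)"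
      using sum_\<beta> unfolding sum_option by (simp flip: of_nat_sum)
    finally show ?thesis using None m by simp
  next
    case (Some k)
    have "1 / (2 * ?n) \<le> 1 / 2" using n by (simp add: field_simps)
    then have "1 / 2 \<le> p $ k" using near[of k] of_nat_0_le_iff[of "\<beta> (Some k)", where 'a = real] by linarith
    then show ?thesis using Some by simp
  qed
  have "0 < hom_coord m p j" for j using half[of j] by linarith
  then have mem: "p \<in> open_simplex m" by (simp add: mem_open_simplex_iff)
  have "(\<Prod>j\<in>UNIV. (1 / 2) ^ \<beta> j) \<le> (\<Prod>j\<in>UNIV. hom_coord m p j ^ \<beta> j)"
    by (intro prod_mono conjI power_mono half) auto
  then have "(1 / 2) ^ d \<le> (\<Prod>j\<in>UNIV. hom_coord m p j ^ \<beta> j)" by (simp only: power_sum[symmetric] sum_\<beta>)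
  then show ?thesis using mem c_pos unfolding dirichlet_eq by simp
qed

lemma dirichlet_lower_bound:
  "\<exists>r c. 0 < r \<and> 0 < c \<and> (\<forall>p. (\<forall>k. \<bar>p $ k - (real (\<beta> (Some k)) + 1)\<bar> \<le> 2 * r) \<longrightarrow> p \<in> open_simplex m \<and> c \<le> dirichlet m \<beta> p)"
proof (intro exI conjI)
  show "0 < 1 / (4 * real CARD('n))" by simp
  show "0 < c * (1 / 2) ^ d" using c_pos by simp
qed (use dirichlet_lower in blast)

end

lemma sum_dirichlet:
  fixes p :: "real^'n"
  assumes "0 < m"
  shows "(\<Sum>\<beta>\<in>compositions d. dirichlet m \<beta> p) =
    real (card (compositions d :: ('n option \<Rightarrow> nat) set)) / simplex_volume TYPE('n) m * indicator (open_simplex m) p"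
proof -
  let ?N = "real (card (compositions d :: ('n option \<Rightarrow> nat) set))" and ?V = "simplex_volume TYPE('n) m"
  have "(\<Sum>\<beta>\<in>compositions d. dirichlet m \<beta> p) =
      (\<Sum>\<beta>\<in>compositions d. ?N / (m ^ d * ?V) * indicator (open_simplex m) p * (fact d / (\<Prod>j\<in>UNIV. fact (\<beta> j)) * (\<Prod>j\<in>UNIV. hom_coord m p j ^ \<beta> j)))"
    by (intro sum.cong refl) (simp add: dirichlet_def dirichlet_coeff_def compositions_def mult_ac)
  also have "\<dots> = ?N / (m ^ d * ?V) * indicator (open_simplex m) p * m ^ d"
    unfolding sum_distrib_left[symmetric] multinomial[symmetric] sum_hom_coord ..
  also have "\<dots> = ?N / ?V * indicator (open_simplex m) p" using assms by simp
  finally show ?thesis .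
qed

section \<open>Torus-invariant functions\<close>

lemma has_derivative_vec_lambda:
  fixes f :: "'n::finite \<Rightarrow> 'a::real_normed_vector \<Rightarrow> 'b::euclidean_space"
  assumes "\<And>k. (f k has_derivative f' k) (at x within S)"
  shows "((\<lambda>x. \<chi> k. f k x) has_derivative (\<lambda>v. \<chi> k. f' k v)) (at x within S)"
proof (subst has_derivative_componentwise_within, intro ballI)
  fix b :: "'b^'n" assume "b \<in> Basis"
  then obtain k u where b: "b = axis k u" by (auto simp: Basis_vec_def)
  show "((\<lambda>x. (\<chi> k. f k x) \<bullet> b) has_derivative (\<lambda>v. (\<chi> k. f' k v) \<bullet> b)) (at x within S)"
    unfolding b inner_axis using assms[of k] by (auto intro!: derivative_eq_intros)
qed

lemma has_derivative_vec_nth: "((\<lambda>x::'a::real_normed_vector^'n. x $ k) has_derivative (\<lambda>v. v $ k)) (at x within S)"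
  by (rule bounded_linear_imp_has_derivative[OF bounded_linear_vec_nth])

definition C2 :: "(real^'n \<Rightarrow> real) \<Rightarrow> (real^'n \<Rightarrow> real^'n) \<Rightarrow> (real^'n \<Rightarrow> real^'n^'n) \<Rightarrow> bool" where
  "C2 F g H \<longleftrightarrow> (\<forall>x. (F has_derivative (\<lambda>v. g x \<bullet> v)) (at x)) \<and>
     (\<forall>x. (g has_derivative (\<lambda>v. H x *v v)) (at x)) \<and> continuous_on UNIV H"

lemma C2_D:
  assumes "C2 F g H"
  shows "(F has_derivative (\<lambda>v. g x \<bullet> v)) (at x)" "(g has_derivative (\<lambda>v. H x *v v)) (at x)" "continuous_on UNIV H"
    "continuous_on UNIV F" "continuous_on UNIV g"
proof -
  show 1: "(F has_derivative (\<lambda>v. g x \<bullet> v)) (at x)" and 2: "(g has_derivative (\<lambda>v. H x *v v)) (at x)" for x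
    using assms by (simp_all add: C2_def)
  show "continuous_on UNIV H" using assms by (simp add: C2_def)
  show "continuous_on UNIV F" by (intro continuous_at_imp_continuous_on ballI has_derivative_continuous[OF 1])
  show "continuous_on UNIV g" by (intro continuous_at_imp_continuous_on ballI has_derivative_continuous[OF 2])
qed

lemma has_derivative_exp_half:
  "(exp_half has_derivative (\<lambda>v. \<Sum>j\<in>UNIV. (exp (x $ j / 2) / 2 * v $ j) *\<^sub>R axis j 1)) (at x)"
proof -
  have "(exp_half has_derivative (\<lambda>v. \<chi> k. complex_of_real (exp (x $ k / 2) / 2 * v $ k))) (at x)"
    unfolding exp_half_def[abs_def]
    by (rule has_derivative_vec_lambda) (auto intro!: derivative_eq_intros has_derivative_vec_nth)
  moreover have "(\<chi> k. complex_of_real (exp (x $ k / 2) / 2 * v $ k)) = (\<Sum>j\<in>UNIV. (exp (x $ j / 2) / 2 * v $ j) *\<^sub>R axis j 1)" for v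
  proof (intro Finite_Cartesian_Product.vec_eq_iff[THEN iffD2] allI)
    fix k
    have "(\<Sum>j\<in>UNIV. (exp (x $ j / 2) / 2 * v $ j) *\<^sub>R axis j 1) $ k =
        (\<Sum>j\<in>UNIV. if j = k then complex_of_real (exp (x $ k / 2) / 2 * v $ k) else 0)"
      unfolding sum_component
    proof (intro sum.cong refl)
      fix j
      have "(r *\<^sub>R axis j 1) $ k = (if j = k then complex_of_real r else 0)" for r :: real
        by (simp add: axis_def of_real_def)
      then show "((exp (x $ j / 2) / 2 * v $ j) *\<^sub>R axis j 1) $ k = (if j = k then complex_of_real (exp (x $ k / 2) / 2 * v $ k) else 0)"
        by (simp only: split: if_split) blast
    qed
    then show "(\<chi> k. complex_of_real (exp (x $ k / 2) / 2 * v $ k)) $ k = (\<Sum>j\<in>UNIV. (exp (x $ j / 2) / 2 * v $ j) *\<^sub>R axis j 1) $ k"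
      by simp
  qed
  ultimately show ?thesis by (simp only:)
qed

lemma continuous_on_exp_half: "continuous_on S exp_half"
  by (rule has_derivative_continuous_on) (use has_derivative_exp_half in \<open>auto intro: has_derivative_at_withinI\<close>)

lemma has_derivative_comp_exp_half:
  fixes f :: "complex^'n \<Rightarrow> real"
  assumes "\<And>w. f differentiable (at w)"
  shows "((\<lambda>x. f (exp_half x)) has_derivative
    (\<lambda>v. \<Sum>j\<in>UNIV. exp (x $ j / 2) / 2 * v $ j * frechet_derivative f (at (exp_half x)) (axis j 1))) (at x)"
proof -
  have D: "(f has_derivative frechet_derivative f (at w)) (at w)" for w
    using assms[of w] by (simp add: frechet_derivative_works)
  then have lin: "linear (frechet_derivative f (at w))" for w by (rule has_derivative_linear)
  from diff_chain_at[OF has_derivative_exp_half D]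
  have "((\<lambda>x. f (exp_half x)) has_derivative
      (\<lambda>v. frechet_derivative f (at (exp_half x)) (\<Sum>j\<in>UNIV. (exp (x $ j / 2) / 2 * v $ j) *\<^sub>R axis j 1))) (at x)"
    unfolding o_def .
  then show ?thesis unfolding linear_sum[OF lin] linear_scale[OF lin] real_scaleR_def .
qed

lemma has_derivative_log_sq:
  assumes w: "\<And>k. w $ k \<noteq> 0"
  shows "(log_sq has_derivative (\<lambda>v. \<chi> k. 2 * (w $ k \<bullet> v $ k) / (norm (w $ k))\<^sup>2)) (at w)"
  unfolding log_sq_def[abs_def]
proof (rule has_derivative_vec_lambda)
  fix k
  have "((\<lambda>w. w $ k \<bullet> w $ k) has_derivative (\<lambda>v. 2 * (w $ k \<bullet> v $ k))) (at w)"
    by (rule has_derivative_eq_rhs[OF has_derivative_inner[OF has_derivative_vec_nth has_derivative_vec_nth]]) (simp add: inner_commute)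
  moreover have "0 < w $ k \<bullet> w $ k" using w by simp
  ultimately have this: "((\<lambda>w. w $ k \<bullet> w $ k) has_derivative (\<lambda>v. 2 * (w $ k \<bullet> v $ k))) (at w)" "0 < w $ k \<bullet> w $ k" .
  from has_derivative_compose[OF this(1) DERIV_ln[OF this(2), THEN has_field_derivative_imp_has_derivative]]
  have "((\<lambda>w. ln (w $ k \<bullet> w $ k)) has_derivative (\<lambda>v. inverse (w $ k \<bullet> w $ k) * (2 * (w $ k \<bullet> v $ k)))) (at w)" .
  then have "((\<lambda>w. ln (w $ k \<bullet> w $ k)) has_derivative (\<lambda>v. 2 * (w $ k \<bullet> v $ k) / (w $ k \<bullet> w $ k))) (at w)"
    by (simp only: divide_inverse mult.commute)
  then show "((\<lambda>w. ln ((norm (w $ k))\<^sup>2)) has_derivative (\<lambda>v. 2 * (w $ k \<bullet> v $ k) / (norm (w $ k))\<^sup>2)) (at w)"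
    unfolding power2_norm_eq_inner .
qed

lemma open_nonzero_coords: "open {w::complex^'n. \<forall>k. w $ k \<noteq> 0}"
proof -
  have "{w::complex^'n. \<forall>k. w $ k \<noteq> 0} = (\<Inter>k. {w. w $ k \<noteq> 0})" by auto
  moreover have "open \<dots>" by (intro open_INT ballI finite open_Collect_neq continuous_intros)
  ultimately show ?thesis by simp
qed

lemma dz_eq: "(f has_derivative D) (at w) \<Longrightarrow> dz k f w = (D (axis k 1) - \<i> * D (axis k \<i>)) / 2"
  and dzbar_eq: "(f has_derivative D) (at w) \<Longrightarrow> dzbar k f w = (D (axis k 1) + \<i> * D (axis k \<i>)) / 2"
  by (simp_all add: dz_def dzbar_def flip: frechet_derivative_at)

text \<open>The derivatives of log |w_k|^2 with respect to w_k and its conjugate are 1 / w_k and 1 /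
  \<open>cnj\<close> (w_k), so the complex Hessian is the real one up to these factors and 1 / pi.
  \<open>C2\<close> does not record symmetry of \<open>H\<close>, hence the order \<open>k\<close>,
  \<open>j\<close> of its indices.\<close>

lemma ddc_torus_invariant:
  fixes f :: "complex^'n \<Rightarrow> real"
  assumes f: "\<And>w. (\<forall>k. w $ k \<noteq> 0) \<Longrightarrow> f w = F (log_sq w)" and C2: "C2 F g H" and w: "\<forall>k. w $ k \<noteq> 0"
  shows "ddc f w = (\<chi> j k. (1 / (of_real pi * w $ j)) * (1 / cnj (w $ k)) * of_real (H (log_sq w) $ k $ j))"
proof -
  let ?O = "{w::complex^'n. \<forall>k. w $ k \<noteq> 0}"
  define L where "L w v = (\<chi> k. 2 * (w $ k \<bullet> v $ k) / (norm (w $ k))\<^sup>2)" for w v :: "complex^'n"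
  have L1: "L w (axis j 1) = axis j (2 * Re (w $ j) / (norm (w $ j))\<^sup>2)" and Li: "L w (axis j \<i>) = axis j (2 * Im (w $ j) / (norm (w $ j))\<^sup>2)" for w j
    by (auto simp: L_def Finite_Cartesian_Product.vec_eq_iff axis_def inner_complex_def)
  have norm2: "complex_of_real ((norm z)\<^sup>2) = z * cnj z" for z by (simp only: complex_norm_square)
  have ReIm: "z = of_real (Re z) + \<i> * of_real (Im z)" "cnj z = of_real (Re z) - \<i> * of_real (Im z)" for z
    by (simp_all add: complex_eq_iff)
  have plus: "(complex_of_real (G * (2 * a / N)) + \<i> * of_real (G * (2 * b / N))) / 2 = of_real G * (of_real a + \<i> * of_real b) / of_real N"
    and minus: "(complex_of_real (G * (2 * a / N)) - \<i> * of_real (G * (2 * b / N))) / c / 2 = of_real G * (of_real a - \<i> * of_real b) / of_real N / c"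
    for G a b N :: real and c :: complex
    by (simp_all add: diff_divide_distrib add_divide_distrib distrib_left right_diff_distrib mult_ac)
  have dlog: "(log_sq has_derivative (\<lambda>v. L w v)) (at w)" if "w \<in> ?O" for w
    unfolding L_def by (rule has_derivative_log_sq) (use that in blast)
  have first: "dzbar k (\<lambda>x. of_real (f x)) w = of_real (g (log_sq w) $ k) / cnj (w $ k)" if w: "w \<in> ?O" for w k
  proof -
    have "((\<lambda>x. F (log_sq x)) has_derivative (\<lambda>v. g (log_sq w) \<bullet> L w v)) (at w)"
      using has_derivative_compose[OF dlog[OF w] C2_D(1)[OF C2]] .
    then have "(f has_derivative (\<lambda>v. g (log_sq w) \<bullet> L w v)) (at w)"
      by (rule has_derivative_transform_within_open[OF _ open_nonzero_coords w]) (simp add: f)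
    then have "((\<lambda>x. complex_of_real (f x)) has_derivative (\<lambda>v. of_real (g (log_sq w) \<bullet> L w v))) (at w)"
      by (rule has_derivative_of_real)
    from dzbar_eq[OF this, of k]
    have "dzbar k (\<lambda>x. of_real (f x)) w = of_real (g (log_sq w) $ k) * (of_real (Re (w $ k)) + \<i> * of_real (Im (w $ k))) / of_real ((norm (w $ k))\<^sup>2)"
      unfolding L1 Li inner_axis inner_real_def by (simp only: plus)
    also have "\<dots> = of_real (g (log_sq w) $ k) / cnj (w $ k)"
      unfolding ReIm(1)[symmetric] norm2 using w by (simp add: field_simps)
    finally show ?thesis .
  qed
  have second: "dz j (dzbar k (\<lambda>x. of_real (f x))) w = of_real (H (log_sq w) $ k $ j) / (w $ j * cnj (w $ k))" for j k
  proof -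
    have wO: "w \<in> ?O" using w by simp
    have "((\<lambda>x. g (log_sq x)) has_derivative (\<lambda>v. H (log_sq w) *v L w v)) (at w)"
      using has_derivative_compose[OF dlog[OF wO] C2_D(2)[OF C2]] .
    from bounded_linear.has_derivative[OF bounded_linear_vec_nth[of k] this]
    have 1: "((\<lambda>x. complex_of_real (g (log_sq x) $ k)) has_derivative (\<lambda>v. of_real ((H (log_sq w) *v L w v) $ k))) (at w)"
      by (rule has_derivative_of_real)
    have 2: "((\<lambda>x. cnj (x $ k)) has_derivative (\<lambda>v. cnj (v $ k))) (at w)"
      by (intro bounded_linear_imp_has_derivative bounded_linear_compose[OF bounded_linear_cnj bounded_linear_vec_nth])
    have "((\<lambda>x. of_real (g (log_sq x) $ k) / cnj (x $ k)) has_derivative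
      (\<lambda>v. of_real ((H (log_sq w) *v L w v) $ k) / cnj (w $ k) - of_real (g (log_sq w) $ k) * cnj (v $ k) / (cnj (w $ k))\<^sup>2)) (at w)"
      by (rule has_derivative_eq_rhs[OF has_derivative_divide'[OF 1 2]]) (use w in \<open>simp_all add: power2_eq_square diff_divide_distrib\<close>)
    then have "(dzbar k (\<lambda>x. of_real (f x)) has_derivative
      (\<lambda>v. of_real ((H (log_sq w) *v L w v) $ k) / cnj (w $ k) - of_real (g (log_sq w) $ k) * cnj (v $ k) / (cnj (w $ k))\<^sup>2)) (at w)"
      by (rule has_derivative_transform_within_open[OF _ open_nonzero_coords wO]) (simp add: first)
    from dz_eq[OF this, of j]
    have "dz j (dzbar k (\<lambda>x. of_real (f x))) w =
      (of_real ((H (log_sq w) *v L w (axis j 1)) $ k) - \<i> * of_real ((H (log_sq w) *v L w (axis j \<i>)) $ k)) / cnj (w $ k) / 2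
       - of_real (g (log_sq w) $ k) * (cnj (axis j 1 $ k) - \<i> * cnj (axis j \<i> $ k)) / (cnj (w $ k))\<^sup>2 / 2"
      by (simp add: algebra_simps diff_divide_distrib add_divide_distrib)
    \<comment> \<open>The factor 1 / \<open>cnj\<close> (w_k) is antiholomorphic, so its derivative
      with respect to w_j vanishes.\<close>
    also have "cnj (axis j 1 $ k) - \<i> * cnj (axis j \<i> $ k) = 0" by (simp add: axis_def)
    also have "(H (log_sq w) *v L w (axis j 1)) $ k = H (log_sq w) $ k $ j * (2 * Re (w $ j) / (norm (w $ j))\<^sup>2)"
      unfolding L1 by (simp add: matrix_vector_mult_def axis_def if_distrib[of "\<lambda>z. _ * z"] cong: if_cong)
    also have "(H (log_sq w) *v L w (axis j \<i>)) $ k = H (log_sq w) $ k $ j * (2 * Im (w $ j) / (norm (w $ j))\<^sup>2)"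
      unfolding Li by (simp add: matrix_vector_mult_def axis_def if_distrib[of "\<lambda>z. _ * z"] cong: if_cong)
    also have "(of_real (H (log_sq w) $ k $ j * (2 * Re (w $ j) / (norm (w $ j))\<^sup>2)) - \<i> * of_real (H (log_sq w) $ k $ j * (2 * Im (w $ j) / (norm (w $ j))\<^sup>2))) / cnj (w $ k) / 2 =
      of_real (H (log_sq w) $ k $ j) * (of_real (Re (w $ j)) - \<i> * of_real (Im (w $ j))) / of_real ((norm (w $ j))\<^sup>2) / cnj (w $ k)"
      by (rule minus)
    also have "\<dots> = of_real (H (log_sq w) $ k $ j) / (w $ j * cnj (w $ k))"
      unfolding ReIm(2)[symmetric] norm2 using w by (simp add: field_simps)
    finally show ?thesis by simp
  qed
  show ?thesis
    unfolding ddc_def second by (simp add: Finite_Cartesian_Product.vec_eq_iff)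
qed

text \<open>Testing the form on the vector with entries w_k v_k cancels the factors 1 / w_j and 1 /
  \<open>cnj\<close> (w_k).\<close>

lemma pos_def_of_positive_form:
  fixes H :: "real^'n^'n"
  assumes pos: "positive_form (\<chi> j k. (1 / (of_real pi * w $ j)) * (1 / cnj (w $ k)) * of_real (H $ k $ j))"
    and w: "\<forall>k. w $ k \<noteq> 0" and v: "v \<noteq> 0"
  shows "0 < v \<bullet> (H *v v)"
proof -
  define u :: "complex^'n" where "u = (\<chi> k. w $ k * of_real (v $ k))"
  obtain k where "v $ k \<noteq> 0" using v by (auto simp: Finite_Cartesian_Product.vec_eq_iff)
  then have "u \<noteq> 0" using w by (auto simp: u_def Finite_Cartesian_Product.vec_eq_iff)
  with pos have "0 < Re (\<Sum>j\<in>UNIV. \<Sum>k\<in>UNIV. (\<chi> j k. (1 / (of_real pi * w $ j)) * (1 / cnj (w $ k)) * of_real (H $ k $ j)) $ j $ k * u $ j * cnj (u $ k))"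
    unfolding positive_form_def by blast
  then have "0 < Re (\<Sum>j\<in>UNIV. \<Sum>k\<in>UNIV. (1 / (of_real pi * w $ j)) * (1 / cnj (w $ k)) * of_real (H $ k $ j) * u $ j * cnj (u $ k))"
    by (simp only: vec_lambda_beta)
  also have "(\<Sum>j\<in>UNIV. \<Sum>k\<in>UNIV. (1 / (of_real pi * w $ j)) * (1 / cnj (w $ k)) * of_real (H $ k $ j) * u $ j * cnj (u $ k)) =
      (\<Sum>j\<in>UNIV. \<Sum>k\<in>UNIV. of_real (H $ k $ j * v $ j * v $ k / pi))"
    using w by (intro sum.cong refl) (simp add: u_def field_simps)
  also have "\<dots> = of_real ((v \<bullet> (H *v v)) / pi)"
    by (subst sum.swap) (simp add: inner_vec_def matrix_vector_mult_def sum_distrib_left sum_divide_distrib mult_ac)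
  finally show ?thesis by (simp add: zero_less_divide_iff)
qed

text \<open>In the double sum the vector is contracted with the first index, so a kernel vector of
  the transpose would make it vanish.\<close>

lemma det_nonzero_of_positive_form:
  fixes A :: "complex^'n^'n"
  assumes "positive_form A"
  shows "Determinants.det A \<noteq> 0"
proof
  assume "Determinants.det A = 0"
  then have "Determinants.det (Finite_Cartesian_Product.transpose A) = 0" by (simp add: Determinants.det_transpose)
  then obtain v where v: "v \<noteq> 0" "Finite_Cartesian_Product.transpose A *v v = 0"
    using invertible_det_nz invertible_left_inverse matrix_left_invertible_ker by metis
  have "(\<Sum>j\<in>UNIV. \<Sum>k\<in>UNIV. A $ j $ k * v $ j * cnj (v $ k)) = (\<Sum>k\<in>UNIV. cnj (v $ k) * (Finite_Cartesian_Product.transpose A *v v) $ k)"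
    by (subst sum.swap) (simp add: matrix_vector_mult_def Finite_Cartesian_Product.transpose_def sum_distrib_left mult_ac)
  also have "\<dots> = 0" using v by simp
  finally have "Re (\<Sum>j\<in>UNIV. \<Sum>k\<in>UNIV. A $ j $ k * v $ j * cnj (v $ k)) = 0" by (simp only: zero_complex.sel)
  moreover have "0 < Re (\<Sum>j\<in>UNIV. \<Sum>k\<in>UNIV. A $ j $ k * v $ j * cnj (v $ k))"
    using assms v(1) unfolding positive_form_def by blast
  ultimately show False by linarith
qed

section \<open>Adjoint sections\<close>

lemma chart_lift_transition:
  assumes "chart_lift i w $ j \<noteq> 0"
  shows "chart_lift j (transition i j w) $ a = chart_lift i w $ a / chart_lift i w $ j"
proof -
  obtain z where z: "z = chart_lift i w" by blast
  have "chart_lift j (chart_coord j z) $ a = z $ a / z $ j" if "z $ j \<noteq> 0"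
    using that by (cases a; cases j) (auto simp: chart_lift_def chart_coord_def)
  then show ?thesis using assms by (simp add: transition_def z)
qed

section \<open>Complex derivatives and holomorphic functions of several variables\<close>

definition clinear_at :: "(complex^'n \<Rightarrow> complex) \<Rightarrow> (complex^'n \<Rightarrow> complex) \<Rightarrow> complex^'n \<Rightarrow> bool" where
  "clinear_at f D w \<longleftrightarrow> (f has_derivative D) (at w) \<and> (\<forall>c v. D (c *s v) = c * D v)"

lemma holomorphic_iff: "holomorphic f \<longleftrightarrow> (\<forall>w. \<exists>D. clinear_at f D w)"
  by (simp add: holomorphic_def clinear_at_def)

lemma dz_clinear_at:
  assumes "clinear_at f D w"
  shows "dz k f w = D (axis k 1)"
proof -
  have "axis k \<i> = \<i> *s axis k (1::complex)" by (simp add: Finite_Cartesian_Product.vec_eq_iff axis_def)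
  then have "D (axis k \<i>) = \<i> * D (axis k 1)" using assms by (simp only: clinear_at_def)
  then show ?thesis using assms dz_eq[of f D w k] by (simp add: clinear_at_def)
qed

lemma clinear_at_const: "clinear_at (\<lambda>_. c) (\<lambda>_. 0) w"
  by (simp add: clinear_at_def)

lemma clinear_at_nth: "clinear_at (\<lambda>w. w $ k) (\<lambda>v. v $ k) w"
  by (simp add: clinear_at_def has_derivative_vec_nth)

lemma clinear_at_mult:
  assumes "clinear_at f D w" "clinear_at g E w"
  shows "clinear_at (\<lambda>w. f w * g w) (\<lambda>v. f w * E v + D v * g w) w"
  using assms has_derivative_mult[of f D w UNIV g E] by (auto simp: clinear_at_def algebra_simps)

lemma clinear_at_divide:
  assumes "clinear_at f D w" "clinear_at g E w" "g w \<noteq> 0"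
  shows "clinear_at (\<lambda>w. f w / g w) (\<lambda>v. (D v * g w - f w * E v) / (g w * g w)) w"
  unfolding clinear_at_def
proof (intro conjI allI)
  show "((\<lambda>w. f w / g w) has_derivative (\<lambda>v. (D v * g w - f w * E v) / (g w * g w))) (at w)"
    using assms by (intro has_derivative_divide') (auto simp: clinear_at_def)
  fix c v
  have "D (c *s v) = c * D v" "E (c *s v) = c * E v" using assms by (auto simp: clinear_at_def)
  then show "(D (c *s v) * g w - f w * E (c *s v)) / (g w * g w) = c * ((D v * g w - f w * E v) / (g w * g w))"
    by (simp add: algebra_simps)
qed

lemma holomorphic_const: "holomorphic (\<lambda>_. c)"
  using clinear_at_const by (auto simp: holomorphic_iff)

lemma holomorphic_mult: "holomorphic f \<Longrightarrow> holomorphic g \<Longrightarrow> holomorphic (\<lambda>w. f w * g w)"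
  using clinear_at_mult unfolding holomorphic_iff by blast

lemma holomorphic_power: "holomorphic f \<Longrightarrow> holomorphic (\<lambda>w. f w ^ n)"
  by (induction n) (auto intro: holomorphic_const holomorphic_mult)

lemma holomorphic_prod: "(\<And>k. k \<in> A \<Longrightarrow> holomorphic (f k)) \<Longrightarrow> holomorphic (\<lambda>w. \<Prod>k\<in>A. f k w)"
  by (induction A rule: infinite_finite_induct) (auto intro: holomorphic_const holomorphic_mult)

lemma holomorphic_imp_continuous_on: "holomorphic f \<Longrightarrow> continuous_on S f"
  by (intro continuous_at_imp_continuous_on ballI) (auto simp: holomorphic_def intro: has_derivative_continuous)

text \<open>For \<open>a\<close> other than \<open>i\<close>, the index of the affine coordinate of
  chart \<open>i\<close> that carries the homogeneous coordinate \<open>a\<close>.\<close>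

definition slot :: "'n option \<Rightarrow> 'n option \<Rightarrow> 'n" where
  "slot i a = (case a of Some k \<Rightarrow> k | None \<Rightarrow> the i)"

lemma chart_lift_nth: "chart_lift i w $ a = (if a = i then 1 else w $ slot i a)"
  by (simp add: chart_lift_def slot_def split: option.split)

lemma clinear_at_chart_lift: "clinear_at (\<lambda>w. chart_lift i w $ a) (\<lambda>v. if a = i then 0 else v $ slot i a) w"
  unfolding chart_lift_nth by (cases "a = i") (simp_all add: clinear_at_const clinear_at_nth)

text \<open>A permutation with nonzero product must send \<open>l0\<close> to \<pi> l0. Any other
  row has its entries in the columns \<pi> l and \<pi> l0 only, and the latter is taken.\<close>

lemma det_single_permutation:
  fixes M :: "'a::comm_ring_1^'n^'n"
  assumes \<pi>: "\<pi> permutes UNIV"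
    and row: "\<And>q. q \<noteq> \<pi> l0 \<Longrightarrow> M $ l0 $ q = 0"
    and other: "\<And>l q. q \<noteq> \<pi> l \<Longrightarrow> q \<noteq> \<pi> l0 \<Longrightarrow> M $ l $ q = 0"
  shows "Determinants.det M = of_int (sign \<pi>) * (\<Prod>l\<in>UNIV. M $ l $ \<pi> l)"
proof -
  have "Determinants.det M = (\<Sum>p\<in>{\<pi>}. of_int (sign p) * (\<Prod>l\<in>UNIV. M $ l $ p l))"
    unfolding Determinants.det_def
  proof (rule sum.mono_neutral_right)
    show "finite {p. p permutes (UNIV :: 'n set)}" by (simp add: finite_permutations)
    show "{\<pi>} \<subseteq> {p. p permutes UNIV}" using \<pi> by simp
    show "\<forall>p\<in>{p. p permutes UNIV} - {\<pi>}. of_int (sign p) * (\<Prod>l\<in>UNIV. M $ l $ p l) = 0"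
    proof
      fix p :: "'n \<Rightarrow> 'n" assume p: "p \<in> {p. p permutes UNIV} - {\<pi>}"
      then obtain l where l: "p l \<noteq> \<pi> l" by auto
      have "\<exists>l. M $ l $ p l = 0"
      proof (rule ccontr)
        assume "\<nexists>l. M $ l $ p l = 0"
        then have nz: "M $ l $ p l \<noteq> 0" for l by blast
        then have "p l0 = \<pi> l0" using row by blast
        moreover have "p l = \<pi> l0" using other l nz by blast
        ultimately have "p l = p l0" by simp
        then have "l = l0" using p by (metis DiffE mem_Collect_eq permutes_inj injD)
        then show False using \<open>p l0 = \<pi> l0\<close> l by simp
      qed
      then have "(\<Prod>l\<in>UNIV. M $ l $ p l) = 0" by (intro prod_zero) (simp, blast)
      then show "of_int (sign p) * (\<Prod>l\<in>UNIV. M $ l $ p l) = 0" by simp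
    qed
  qed
  then show ?thesis by simp
qed

text \<open>Every chart except \<open>None\<close> puts the homogeneous coordinate
  \<open>None\<close> in the slot of the omitted one; the orientation of the coordinate volume form
  changes accordingly.\<close>

definition chart_sign :: "'n option \<Rightarrow> complex" where
  "chart_sign i = (if i = None then 1 else -1)"

lemma chart_sign_square [simp]: "chart_sign i * chart_sign i = 1"
  by (simp add: chart_sign_def)

text \<open>Component \<open>l\<close> of the transition map is the quotient of two homogeneous
  coordinates with denominator B. For i \<noteq> j the row whose numerator is z_i = 1 contributes -
  1 / B^2, every other row 1 / B from its own coordinate, and the column of the denominator is the
  only one with further entries. So a single permutation survives in the determinant.\<close>

lemma jacobian_transition:
  fixes w :: "complex^'n"
  assumes B: "chart_lift i w $ j \<noteq> 0"
  shows "jacobian (transition i j) w = chart_sign i * chart_sign j / (chart_lift i w $ j) ^ (CARD('n) + 1)"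
proof -
  define B where "B = chart_lift i w $ j"
  define idx where "idx l = (if j = Some l then None else Some l)" for l
  define M where "M = (\<chi> l q. dz q (\<lambda>x. transition i j x $ l) w)"
  have M: "M $ l $ q = ((if idx l = i then 0 else axis q 1 $ slot i (idx l)) * B
      - chart_lift i w $ idx l * (if j = i then 0 else axis q 1 $ slot i j)) / (B * B)" for l q
  proof -
    have "clinear_at (\<lambda>x. transition i j x $ l) (\<lambda>v. ((if idx l = i then 0 else v $ slot i (idx l)) * B
      - chart_lift i w $ idx l * (if j = i then 0 else v $ slot i j)) / (B * B)) w"
      using clinear_at_divide[OF clinear_at_chart_lift[of i "idx l" w] clinear_at_chart_lift[of i j w] B]
      by (simp add: transition_def chart_coord_def idx_def B_def)
    from dz_clinear_at[OF this] show ?thesis by (simp add: M_def)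
  qed
  have jac: "jacobian (transition i j) w = Determinants.det M" by (simp add: jacobian_def M_def)
  show ?thesis
  proof (cases "i = j")
    case True
    have "M $ l $ q = (if l = q then 1 else 0)" for l q
      using True unfolding M by (cases j) (auto simp: B_def chart_lift_nth idx_def slot_def axis_def)
    then have "M = Finite_Cartesian_Product.mat 1" by (simp add: Finite_Cartesian_Product.vec_eq_iff Finite_Cartesian_Product.mat_def)
    then show ?thesis unfolding jac using True by (simp add: chart_lift_nth)
  next
    case False
    \<comment> \<open>\<open>r\<close> is the column of the denominator, \<open>l0\<close> the row
      of the constant numerator, and \<pi> matches each row with the coordinate in its numerator. It
      is a transposition exactly if neither chart is \<open>None\<close>.\<close>
    define r where "r = slot i j"
    define l0 where "l0 = (case i of None \<Rightarrow> the j | Some k \<Rightarrow> k)"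
    define \<pi> where "\<pi> = (if i = None \<or> j = None then id else Transposition.transpose (the i) (the j))"
    have \<pi>: "\<pi> permutes UNIV" by (auto simp: \<pi>_def permutes_id intro: permutes_swap_id)
    have idx0: "idx l = i \<longleftrightarrow> l = l0" for l
      using False by (cases i; cases j) (auto simp: idx_def l0_def)
    have \<pi>0: "\<pi> l0 = r" using False by (cases i; cases j) (auto simp: \<pi>_def l0_def r_def slot_def)
    have \<pi>l: "\<pi> l = slot i (idx l)" if "l \<noteq> l0" for l
      using False that by (cases i; cases j) (auto simp: \<pi>_def l0_def slot_def idx_def Transposition.transpose_def)
    have Bnz: "B \<noteq> 0" using B by (simp add: B_def)
    have "Determinants.det M = of_int (sign \<pi>) * (\<Prod>l\<in>UNIV. M $ l $ \<pi> l)"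
    proof (rule det_single_permutation[OF \<pi>, of l0])
      show "M $ l0 $ q = 0" if "q \<noteq> \<pi> l0" for q
        using that False idx0[of l0] unfolding M \<pi>0 by (simp add: axis_def r_def)
      show "M $ l $ q = 0" if "q \<noteq> \<pi> l" "q \<noteq> \<pi> l0" for l q
        using that False idx0[of l] \<pi>l[of l] unfolding M \<pi>0 by (auto simp: axis_def r_def)
    qed
    also have "(\<Prod>l\<in>UNIV. M $ l $ \<pi> l) = M $ l0 $ \<pi> l0 * (\<Prod>l\<in>UNIV - {l0}. M $ l $ \<pi> l)"
      by (rule prod.remove) auto
    also have "M $ l0 $ \<pi> l0 = - 1 / (B * B)"
      using False idx0[of l0] unfolding M \<pi>0 by (simp add: axis_def r_def chart_lift_nth)
    also have "(\<Prod>l\<in>UNIV - {l0}. M $ l $ \<pi> l) = (\<Prod>l\<in>UNIV - {l0}. 1 / B)"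
    proof (rule prod.cong[OF refl])
      fix l assume l: "l \<in> UNIV - {l0}"
      have "\<pi> l \<noteq> \<pi> l0" using \<pi> l by (metis DiffE injD insertI1 permutes_inj)
      then show "M $ l $ \<pi> l = 1 / B"
        using l False idx0[of l] \<pi>l[of l] Bnz unfolding M \<pi>0 by (simp add: axis_def r_def)
    qed
    also have "\<dots> = 1 / B ^ (CARD('n) - 1)" by (simp add: power_divide card_Diff_subset)
    also have "of_int (sign \<pi>) * (- 1 / (B * B) * (1 / B ^ (CARD('n) - 1))) = - of_int (sign \<pi>) / B ^ (CARD('n) + 1)"
    proof -
      have "CARD('n) + 1 = Suc (Suc (CARD('n) - 1))" by simp
      then have eq: "B ^ (CARD('n) + 1) = B * B * B ^ (CARD('n) - 1)" by (simp only: power_Suc mult.assoc)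
      show ?thesis unfolding eq by simp
    qed
    also have "- of_int (sign \<pi>) = chart_sign i * chart_sign j"
      using False by (cases i; cases j) (auto simp: \<pi>_def chart_sign_def sign_id sign_swap_id)
    finally show ?thesis by (simp add: jac B_def)
  qed
qed

text \<open>The sign compensates that of the Jacobian determinants of the transition maps.\<close>

definition monomial_section :: "('n::finite option \<Rightarrow> nat) \<Rightarrow> 'n option \<Rightarrow> complex^'n \<Rightarrow> complex" where
  "monomial_section \<beta> i w = chart_sign i * (\<Prod>a\<in>UNIV. chart_lift i w $ a ^ \<beta> a)"

lemma monomial_section_None: "monomial_section \<beta> None w = (\<Prod>k\<in>UNIV. w $ k ^ \<beta> (Some k))"
  by (simp add: monomial_section_def prod_option chart_lift_nth chart_sign_def slot_def)

text \<open>A monomial of degree d scales with B^(-d) under a change of charts and the Jacobian with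
  B^(-n-1); together they compensate B^m.\<close>

lemma monomial_section_adjoint:
  fixes \<beta> :: "'n::finite option \<Rightarrow> nat"
  assumes \<beta>: "\<beta> \<in> compositions d"
  shows "monomial_section \<beta> \<in> adjoint_sections (d + CARD('n) + 1)"
  unfolding adjoint_sections_def mem_Collect_eq
proof (intro conjI allI impI)
  show "holomorphic (monomial_section \<beta> i)" for i :: "'n option"
    unfolding monomial_section_def[abs_def]
    by (intro holomorphic_mult holomorphic_const holomorphic_prod holomorphic_power)
       (use clinear_at_chart_lift in \<open>auto simp: holomorphic_iff\<close>)
  fix i j and w :: "complex^'n" assume B: "chart_lift i w $ j \<noteq> 0"
  let ?B = "chart_lift i w $ j" and ?P = "\<Prod>a\<in>UNIV. chart_lift i w $ a ^ \<beta> a"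
  have "(\<Prod>a\<in>UNIV. chart_lift j (transition i j w) $ a ^ \<beta> a) = ?P / ?B ^ d"
    using \<beta> unfolding chart_lift_transition[OF B] power_divide prod_dividef by (simp add: compositions_def flip: power_sum)
  then have "monomial_section \<beta> j (transition i j w) = chart_sign j * (?P / ?B ^ d)"
    by (simp add: monomial_section_def)
  then have "monomial_section \<beta> j (transition i j w) * ?B ^ (d + CARD('n) + 1) * jacobian (transition i j) w
      = chart_sign j * (?P / ?B ^ d) * (?B ^ d * ?B ^ (CARD('n) + 1)) * (chart_sign i * chart_sign j / ?B ^ (CARD('n) + 1))"
    unfolding jacobian_transition[OF B] by (simp only: power_add[symmetric] add.assoc)
  also have "\<dots> = (chart_sign j * chart_sign j) * (chart_sign i * ?P)"
    using B by (simp add: field_simps)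
  finally show "monomial_section \<beta> i w = monomial_section \<beta> j (transition i j w) * ?B ^ (d + CARD('n) + 1) * jacobian (transition i j) w"
    by (simp add: monomial_section_def)
qed

section \<open>Separately polynomial functions of bounded growth\<close>

definition upd :: "'n \<Rightarrow> 'a \<Rightarrow> 'a^'n \<Rightarrow> 'a^'n" where
  "upd k z w = (\<chi> l. if l = k then z else w $ l)"

lemma upd_nth [simp]: "upd k z w $ l = (if l = k then z else w $ l)"
  by (simp add: upd_def)

lemma upd_upd [simp]: "upd k z (upd k y w) = upd k z w"
  by (simp add: Finite_Cartesian_Product.vec_eq_iff)

lemma upd_same [simp]: "upd k (w $ k) w = w"
  by (simp add: Finite_Cartesian_Product.vec_eq_iff)

lemma upd_commute: "k \<noteq> l \<Longrightarrow> upd k z (upd l y w) = upd l y (upd k z w)"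
  by (simp add: Finite_Cartesian_Product.vec_eq_iff)

lemma roots_of_unity_orthogonal:
  assumes e: "e < K" and a: "a < K"
  shows "(\<Sum>j<K. (cis (2 * pi * real j / real K)) ^ e * (cnj (cis (2 * pi * real j / real K))) ^ a) = (if e = a then of_nat K else 0)"
proof -
  define x where "x = cis (2 * pi * (real e - real a) / real K)"
  have summand: "(cis (2 * pi * real j / real K)) ^ e * (cnj (cis (2 * pi * real j / real K))) ^ a = x ^ j" for j
  proof -
    define A where "A = 2 * pi * real j / real K"
    have "cis A ^ e * cnj (cis A) ^ a = cis (real e * A + real a * - A)"
      by (simp only: cis_cnj Complex.DeMoivre cis_mult)
    also have "real e * A + real a * - A = real j * (2 * pi * (real e - real a) / real K)"
      unfolding A_def by (simp add: divide_inverse algebra_simps)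
    finally show ?thesis by (simp only: A_def x_def Complex.DeMoivre)
  qed
  show ?thesis
  proof (cases "e = a")
    case True
    then show ?thesis unfolding summand by (simp add: x_def)
  next
    case False
    have K: "0 < K" using e by simp
    have "x ^ K = cis (2 * pi * (real e - real a))" unfolding x_def Complex.DeMoivre using K by simp
    also have "\<dots> = 1"
    proof -
      have "2 * pi * (real e - real a) = 2 * pi * of_int (int e - int a)" by simp
      then show ?thesis by (simp only: cis_multiple_2pi Ints_of_int)
    qed
    finally have xK: "x ^ K = 1" .
    have x1: "x \<noteq> 1"
    proof
      assume "x = 1"
      then have "cos (2 * pi * (real e - real a) / real K) = 1" unfolding x_def by (metis cis.sel(1) one_complex.sel(1))
      then obtain n :: int where "2 * pi * (real e - real a) / real K = of_int n * 2 * pi" by (auto simp: cos_one_2pi_int)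
      then have "(2 * pi) * (real e - real a) = (2 * pi) * (of_int n * real K)" using K by (simp add: field_simps)
      then have "real e - real a = of_int n * real K" by simp
      then have "real_of_int (int e - int a) = of_int (n * int K)" by simp
      then have "int e - int a = n * int K" by (simp only: of_int_eq_iff)
      moreover have "\<bar>int e - int a\<bar> < int K" using e a by linarith
      ultimately have "n = 0" using zdvd_imp_le[of "int K" "\<bar>int e - int a\<bar>"] by (metis abs_mult abs_of_nat dvd_triv_right mult_eq_0_iff not_le zero_less_abs_iff zdvd_not_zless)
      then show False using \<open>int e - int a = n * int K\<close> False by simp
    qed
    have "(\<Sum>j<K. x ^ j) = 0" using sum_gp_strict[of x K] x1 xK by simp
    then show ?thesis using False by (simp add: summand)
  qed
qed

text \<open>The first condition bounds the degree in each variable separately, the growth on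
  polydiscs bounds the total degree. Both survive rotations and linear combinations.\<close>

definition poly_growth :: "nat \<Rightarrow> (complex^'n::finite \<Rightarrow> complex) \<Rightarrow> bool" where
  "poly_growth d f \<longleftrightarrow>
     (\<forall>k w. \<exists>c. \<forall>z. f (upd k z w) = (\<Sum>e\<le>d. c e * z ^ e)) \<and>
     (\<exists>M. \<forall>R\<ge>1. \<forall>w. (\<forall>k. norm (w $ k) \<le> R) \<longrightarrow> norm (f w) \<le> M * R ^ d)"

lemma poly_growth_poly: "poly_growth d f \<Longrightarrow> \<exists>c. \<forall>z. f (upd k z w) = (\<Sum>e\<le>d. c e * z ^ e)"
  by (simp only: poly_growth_def)

lemma poly_growth_bound:
  "poly_growth d f \<Longrightarrow> \<exists>M. \<forall>R\<ge>1. \<forall>w. (\<forall>k. norm (w $ k) \<le> R) \<longrightarrow> norm (f w) \<le> M * R ^ d"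
  by (simp only: poly_growth_def)

lemma poly_growth_scale: 
  assumes "poly_growth d f" 
  shows "poly_growth d (\<lambda>w. a * f w)"
  unfolding poly_growth_def
proof (intro conjI allI)
  fix k w
  obtain c where "\<forall>z. f (upd k z w) = (\<Sum>e\<le>d. c e * z ^ e)" using assms unfolding poly_growth_def by blast
  then show "\<exists>c. \<forall>z. a * f (upd k z w) = (\<Sum>e\<le>d. c e * z ^ e)"
    by (intro exI[of _ "\<lambda>e. a * c e"]) (simp add: sum_distrib_left mult.assoc)
next
  obtain M where M: "\<And>R w. R \<ge> 1 \<Longrightarrow> (\<forall>k. norm (w $ k) \<le> R) \<Longrightarrow> norm (f w) \<le> M * R ^ d" using assms unfolding poly_growth_def by blast
  then show "\<exists>M. \<forall>R\<ge>1. \<forall>w. (\<forall>k. norm (w $ k) \<le> R) \<longrightarrow> norm (a * f w) \<le> M * R ^ d"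
    by (intro exI[of _ "norm a * M"]) (auto simp: norm_mult mult.assoc intro!: mult_left_mono)
qed

lemma poly_growth_add:
  fixes f g :: "complex^'n::finite \<Rightarrow> complex"
  assumes "poly_growth d f" "poly_growth d g"
  shows "poly_growth d (\<lambda>w. f w + g w)"
  unfolding poly_growth_def
proof (intro conjI allI)
  fix k w
  obtain c where "\<And>z. f (upd k z w) = (\<Sum>e\<le>d. c e * z ^ e)" using poly_growth_poly[OF assms(1), of k w] by blast
  moreover obtain c' where "\<And>z. g (upd k z w) = (\<Sum>e\<le>d. c' e * z ^ e)" using poly_growth_poly[OF assms(2), of k w] by blast
  ultimately show "\<exists>c. \<forall>z. f (upd k z w) + g (upd k z w) = (\<Sum>e\<le>d. c e * z ^ e)"
    by (intro exI[of _ "\<lambda>e. c e + c' e"]) (simp add: sum.distrib distrib_right)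
next
  obtain M where M: "\<And>R w. R \<ge> 1 \<Longrightarrow> (\<forall>k. norm (w $ k) \<le> R) \<Longrightarrow> norm (f w) \<le> M * R ^ d"
    using poly_growth_bound[OF assms(1)] by blast
  obtain M' where M': "\<And>R w. R \<ge> 1 \<Longrightarrow> (\<forall>k. norm (w $ k) \<le> R) \<Longrightarrow> norm (g w) \<le> M' * R ^ d"
    using poly_growth_bound[OF assms(2)] by blast
  show "\<exists>M. \<forall>R\<ge>1. \<forall>w. (\<forall>k. norm (w $ k) \<le> R) \<longrightarrow> norm (f w + g w) \<le> M * R ^ d"
  proof (intro exI[of _ "M + M'"] allI impI)
    fix R and w :: "complex^'n" assume R: "1 \<le> (R::real)" and w: "\<forall>k. norm (w $ k) \<le> R"
    show "norm (f w + g w) \<le> (M + M') * R ^ d"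
      using norm_triangle_mono[OF M[OF R w] M'[OF R w]] by (simp only: distrib_right)
  qed
qed

lemma poly_growth_sum:
  assumes "finite A" "\<And>j. j \<in> A \<Longrightarrow> poly_growth d (f j)"
  shows "poly_growth d (\<lambda>w. \<Sum>j\<in>A. f j w)"
  using assms
proof (induction A)
  case empty
  then show ?case unfolding poly_growth_def by (auto intro!: exI[of _ "\<lambda>_. 0"] exI[of _ 0])
qed (auto intro: poly_growth_add)

lemma poly_growth_rotate:
  assumes f: "poly_growth d f" and t: "norm t = 1"
  shows "poly_growth d (\<lambda>w. f (upd k (t * w $ k) w))"
  unfolding poly_growth_def
proof (intro conjI allI)
  fix l w
  show "\<exists>c. \<forall>z. f (upd k (t * upd l z w $ k) (upd l z w)) = (\<Sum>e\<le>d. c e * z ^ e)"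
  proof (cases "k = l")
    case True
    obtain c where "\<forall>z. f (upd k z w) = (\<Sum>e\<le>d. c e * z ^ e)" using f unfolding poly_growth_def by blast
    then show ?thesis using True by (intro exI[of _ "\<lambda>e. c e * t ^ e"]) (simp add: power_mult_distrib mult.assoc)
  next
    case False
    obtain c where "\<forall>z. f (upd l z (upd k (t * w $ k) w)) = (\<Sum>e\<le>d. c e * z ^ e)" using f unfolding poly_growth_def by blast
    then show ?thesis using False by (intro exI[of _ c]) (simp add: upd_commute)
  qed
next
  obtain M where M: "\<And>R w. R \<ge> 1 \<Longrightarrow> (\<forall>k. norm (w $ k) \<le> R) \<Longrightarrow> norm (f w) \<le> M * R ^ d" using f unfolding poly_growth_def by blast
  show "\<exists>M. \<forall>R\<ge>1. \<forall>w. (\<forall>k. norm (w $ k) \<le> R) \<longrightarrow> norm (f (upd k (t * w $ k) w)) \<le> M * R ^ d"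
    by (intro exI[of _ M] allI impI M) (auto simp: norm_mult t)
qed

text \<open>Induction on a set \<open>S\<close> outside of which \<open>f\<close> is homogeneous in
  each single variable. Averaging over the rotations of one more variable by roots of unity of order
  d + 1 splits \<open>f\<close> into d + 1 parts homogeneous in that variable and keeps the
  homogeneity already reached. With \<open>S\<close> empty, \<open>f\<close> is a multiple of one
  monomial, whose degree the growth bounds by d.\<close>

lemma poly_growth_monomials:
  fixes f :: "complex^'n::finite \<Rightarrow> complex"
  assumes "finite S" "poly_growth d f"
    and "\<And>k. k \<notin> S \<Longrightarrow> \<exists>a\<le>d. \<forall>w. f w = w $ k ^ a * f (upd k 1 w)"
  shows "\<exists>c. \<forall>w. f w = (\<Sum>\<beta>\<in>compositions d. c \<beta> * monomial_section \<beta> None w)"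
  using assms
proof (induction S arbitrary: f)
  case empty
  then have "\<forall>k. \<exists>a. \<forall>w. f w = w $ k ^ a * f (upd k 1 w)" by blast
  then obtain \<alpha> where \<alpha>: "\<And>k w. f w = w $ k ^ \<alpha> k * f (upd k 1 w)" by metis
  have prod: "f w = (\<Prod>k\<in>A. w $ k ^ \<alpha> k) * f (\<chi> k. if k \<in> A then 1 else w $ k)" if "finite A" for A w
    using that
  proof (induction A)
    case (insert l A)
    have "f (\<chi> k. if k \<in> A then 1 else w $ k) = w $ l ^ \<alpha> l * f (upd l 1 (\<chi> k. if k \<in> A then 1 else w $ k))"
      using \<alpha>[of "\<chi> k. if k \<in> A then 1 else w $ k" l] insert by simp
    also have "upd l 1 (\<chi> k. if k \<in> A then 1 else w $ k) = (\<chi> k. if k \<in> insert l A then 1 else w $ k)"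
      by (auto simp: Finite_Cartesian_Product.vec_eq_iff)
    finally show ?case using insert by (simp add: mult_ac)
  qed simp
  have f: "f w = f (\<chi> k. 1) * (\<Prod>k\<in>UNIV. w $ k ^ \<alpha> k)" for w
    using prod[of UNIV w] by (simp only: finite UNIV_I if_True mult.commute)
  show ?case
  proof (cases "f (\<chi> k. 1) = 0")
    case True
    have "f w = 0" for w by (subst f) (simp add: True)
    then show ?thesis by (intro exI[of _ "\<lambda>_. 0"]) simp
  next
    case False
    define s where "s = (\<Sum>k\<in>UNIV. \<alpha> k)"
    obtain M where M: "\<And>R w. R \<ge> 1 \<Longrightarrow> (\<forall>k. norm (w $ k) \<le> R) \<Longrightarrow> norm (f w) \<le> M * R ^ d"
      using poly_growth_bound[OF empty(1)] by blast
    have bound: "norm (f (\<chi> k. 1)) * R ^ s \<le> M * R ^ d" if R: "R \<ge> 1" for R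
    proof -
      have "f (\<chi> k. of_real R) = f (\<chi> k. 1) * of_real (R ^ s)"
        by (subst f) (simp add: s_def power_sum)
      then show ?thesis using M[OF R, of "\<chi> k. of_real R"] R by (simp add: norm_mult norm_power)
    qed
    have s: "s \<le> d"
    proof (rule ccontr)
      assume "\<not> s \<le> d"
      then have sd: "Suc d \<le> s" by simp
      define N where "N = norm (f (\<chi> k. 1))"
      have N: "0 < N" using False by (simp add: N_def)
      \<comment> \<open>At this radius N R = |M| + N exceeds M, whereas a degree above d would force
        N R \<le> M.\<close>
      define R where "R = \<bar>M\<bar> / N + 1"
      have R: "1 \<le> R" using N by (simp add: R_def)
      have "N * R ^ Suc d \<le> N * R ^ s" using R N sd by (intro mult_left_mono power_increasing) auto
      also have "\<dots> \<le> M * R ^ d" using bound[OF R] by (simp add: N_def)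
      finally have "(N * R) * R ^ d \<le> M * R ^ d" by (simp add: mult_ac)
      then have "N * R \<le> M" using R by (simp add: mult_le_cancel_right)
      moreover have "N * R = \<bar>M\<bar> + N" using N by (simp add: R_def field_simps)
      ultimately show False using N by linarith
    qed
    \<comment> \<open>The missing degree goes to the homogeneous coordinate \<open>None\<close>,
      which equals 1 in this chart.\<close>
    define \<beta> where "\<beta> = case_option (d - s) \<alpha>"
    have \<beta>: "\<beta> \<in> compositions d" using s by (simp add: compositions_def sum_option \<beta>_def s_def)
    have "f w = (\<Sum>\<gamma>\<in>compositions d. (if \<gamma> = \<beta> then f (\<chi> k. 1) else 0) * monomial_section \<gamma> None w)" for w
    proof -
      have "(\<Sum>\<gamma>\<in>compositions d. (if \<gamma> = \<beta> then f (\<chi> k. 1) else 0) * monomial_section \<gamma> None w) =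
          (\<Sum>\<gamma>\<in>compositions d. if \<gamma> = \<beta> then f (\<chi> k. 1) * monomial_section \<beta> None w else 0)"
        by (intro sum.cong) auto
      also have "\<dots> = f (\<chi> k. 1) * monomial_section \<beta> None w" using \<beta> by (simp add: finite_compositions)
      also have "\<dots> = f w" unfolding f[of w] by (simp add: monomial_section_None \<beta>_def)
      finally show ?thesis ..
    qed
    then show ?thesis by (intro exI[of _ "\<lambda>\<gamma>. if \<gamma> = \<beta> then f (\<chi> k. 1) else 0"] allI)
  qed
next
  case (insert k S)
  let ?K = "Suc d"
  define \<zeta> where "\<zeta> j = cis (2 * pi * real j / real ?K)" for j :: nat
  have \<zeta>: "norm (\<zeta> j) = 1" for j by (simp add: \<zeta>_def)
  \<comment> \<open>The discrete Fourier coefficient that extracts the part of degree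
    \<open>a\<close> in w_k; d + 1 roots suffice to separate the degrees 0, ..., d.\<close>
  define F where "F a w = (\<Sum>j<?K. (1 / of_nat ?K * cnj (\<zeta> j) ^ a) * f (upd k (\<zeta> j * w $ k) w))" for a w
  have F_eq: "\<exists>c. \<forall>z. \<forall>a\<le>d. F a (upd k z w) = c a * z ^ a" for w
  proof -
    obtain c where c: "\<And>z. f (upd k z w) = (\<Sum>e\<le>d. c e * z ^ e)" using poly_growth_poly[OF insert.prems(1), of k w] by blast
    have "F a (upd k z w) = c a * z ^ a" if a: "a \<le> d" for a z
    proof -
      have "F a (upd k z w) = (\<Sum>j<?K. \<Sum>e\<le>d. (1 / of_nat ?K) * (c e * z ^ e) * (\<zeta> j ^ e * cnj (\<zeta> j) ^ a))"
        by (simp add: F_def c sum_distrib_left power_mult_distrib mult_ac del: of_nat_Suc)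
      also have "\<dots> = (\<Sum>e\<le>d. (1 / of_nat ?K) * (c e * z ^ e) * (\<Sum>j<?K. \<zeta> j ^ e * cnj (\<zeta> j) ^ a))"
        by (subst sum.swap) (simp only: sum_distrib_left)
      also have "\<dots> = (\<Sum>e\<le>d. (1 / of_nat ?K) * (c e * z ^ e) * (if e = a then of_nat ?K else 0))"
        unfolding \<zeta>_def by (intro sum.cong refl arg_cong2[where f = "(*)"] roots_of_unity_orthogonal) (use a in auto)
      also have "\<dots> = (\<Sum>e\<le>d. if e = a then c a * z ^ a else 0)"
        by (intro sum.cong refl) (auto simp del: of_nat_Suc)
      also have "\<dots> = c a * z ^ a" using a by simp
      finally show ?thesis .
    qed
    then show ?thesis by (intro exI[of _ c]) blast
  qed
  have sumF: "f w = (\<Sum>a\<le>d. F a w)" for w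
  proof -
    have "(\<Sum>a\<le>d. F a w) = (\<Sum>j<?K. (1 / of_nat ?K) * f (upd k (\<zeta> j * w $ k) w) * (\<Sum>a\<le>d. cnj (\<zeta> j) ^ a))"
      unfolding F_def
      by (subst sum.swap, intro sum.cong refl, simp only: sum_distrib_left, intro sum.cong refl, simp only: mult_ac)
    also have "\<dots> = (\<Sum>j<?K. if j = 0 then f w else 0)"
    proof (intro sum.cong refl)
      fix j assume j: "j \<in> {..<?K}"
      \<comment> \<open>Index and exponent exchange roles: the \<open>a\<close>-th power of \<zeta>
        j is the \<open>j\<close>-th power of \<zeta> a.\<close>
      have "(\<Sum>a\<le>d. cnj (\<zeta> j) ^ a) = (\<Sum>a<?K. (cis (2 * pi * real a / real ?K)) ^ 0 * (cnj (cis (2 * pi * real a / real ?K))) ^ j)"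
        unfolding \<zeta>_def cis_cnj Complex.DeMoivre lessThan_Suc_atMost by (intro sum.cong refl) (simp add: mult_ac)
      also have "\<dots> = (if 0 = j then of_nat ?K else 0)" by (rule roots_of_unity_orthogonal) (use j in auto)
      finally show "1 / of_nat ?K * f (upd k (\<zeta> j * w $ k) w) * (\<Sum>a\<le>d. cnj (\<zeta> j) ^ a) = (if j = 0 then f w else 0)"
        by (auto simp: \<zeta>_def simp del: of_nat_Suc)
    qed
    also have "\<dots> = f w" by simp
    finally show ?thesis ..
  qed
  have "\<exists>c. \<forall>w. F a w = (\<Sum>\<beta>\<in>compositions d. c \<beta> * monomial_section \<beta> None w)" if a: "a \<le> d" for a
  proof (rule insert.IH)
    show "poly_growth d (F a)"
      unfolding F_def by (intro poly_growth_sum poly_growth_scale poly_growth_rotate insert.prems \<zeta>) auto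
    fix l assume l: "l \<notin> S"
    show "\<exists>b\<le>d. \<forall>w. F a w = w $ l ^ b * F a (upd l 1 w)"
    proof (cases "l = k")
      case True
      have "F a w = w $ k ^ a * F a (upd k 1 w)" for w
      proof -
        obtain c where "\<And>z a. a \<le> d \<Longrightarrow> F a (upd k z w) = c a * z ^ a" using F_eq by blast
        from this[OF a, of "w $ k"] this[OF a, of 1] show ?thesis by simp
      qed
      then show ?thesis using a True by blast
    next
      case False
      then obtain b where b: "b \<le> d" "\<And>w. f w = w $ l ^ b * f (upd l 1 w)" using insert.prems(2)[of l] l by auto
      have "F a w = w $ l ^ b * F a (upd l 1 w)" for w
      proof -
        have "f (upd k z w) = w $ l ^ b * f (upd k z (upd l 1 w))" for z
          using b(2)[of "upd k z w"] False by (simp add: upd_commute)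
        then show ?thesis using False not_sym[OF False] unfolding F_def by (simp only: sum_distrib_left upd_nth if_False) (simp only: mult_ac)
      qed
      then show ?thesis using b(1) by blast
    qed
  qed
  then obtain c where c: "\<And>a w. a \<le> d \<Longrightarrow> F a w = (\<Sum>\<beta>\<in>compositions d. c a \<beta> * monomial_section \<beta> None w)" by metis
  have "f w = (\<Sum>\<beta>\<in>compositions d. (\<Sum>a\<le>d. c a \<beta>) * monomial_section \<beta> None w)" for w
    unfolding sumF[of w] by (simp add: c sum_distrib_right) (rule sum.swap)
  then show ?case by (intro exI[of _ "\<lambda>\<beta>. \<Sum>a\<le>d. c a \<beta>"]) blast
qed

lemma compact_polydisc: "compact {w::complex^'n::finite. \<forall>k. norm (w $ k) \<le> 1}"
proof -
  let ?K = "{w::complex^'n. \<forall>k. norm (w $ k) \<le> 1}"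
  have "?K = (\<Inter>k. {w. norm (w $ k) \<le> 1})" by auto
  moreover have "closed \<dots>" by (intro closed_INT ballI closed_Collect_le continuous_intros)
  moreover have "bounded ?K"
    unfolding bounded_iff
  proof (intro exI ballI)
    fix w assume "w \<in> ?K"
    then have "(\<Sum>k\<in>UNIV. norm (w $ k)) \<le> (\<Sum>k\<in>(UNIV::'n set). 1)" by (intro sum_mono) auto
    moreover have "norm w \<le> (\<Sum>k\<in>UNIV. norm (w $ k))" unfolding norm_vec_def by (rule L2_set_le_sum) simp
    ultimately show "norm w \<le> real CARD('n)" by simp
  qed
  ultimately show ?thesis by (simp add: compact_eq_bounded_closed)
qed

text \<open>In the unit polydisc of any chart a section is bounded by compactness. A point outside
  the polydisc of the chart \<open>None\<close> lies in that of the chart of its largest coordinate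
  w_k, and the change of frames costs |w_k|^m / |w_k|^(n+1) = |w_k|^d.\<close>

lemma adjoint_section_growth:
  fixes s :: "'n::finite option \<Rightarrow> complex^'n \<Rightarrow> complex"
  assumes s: "s \<in> adjoint_sections (d + CARD('n) + 1)"
  shows "\<exists>M. \<forall>R\<ge>1. \<forall>w. (\<forall>k. norm (w $ k) \<le> R) \<longrightarrow> norm (s None w) \<le> M * R ^ d"
proof -
  let ?K = "{w::complex^'n. \<forall>k. norm (w $ k) \<le> 1}"
  have hol: "holomorphic (s i)" for i using s by (simp add: adjoint_sections_def)
  have "compact ?K" by (rule compact_polydisc)
  then have "\<exists>M. \<forall>w\<in>?K. norm (s i w) \<le> M" for i
    using compact_imp_bounded[OF compact_continuous_image[OF holomorphic_imp_continuous_on[OF hol], of ?K i]]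
    by (auto simp: bounded_iff)
  then obtain M0 where M0: "\<And>i w. w \<in> ?K \<Longrightarrow> norm (s i w) \<le> M0 i" by metis
  define M where "M = (\<Sum>i\<in>UNIV. \<bar>M0 i\<bar>)"
  have M: "norm (s i w) \<le> M" if "w \<in> ?K" for i w
    using M0[OF that, of i] member_le_sum[of i UNIV "\<lambda>i. \<bar>M0 i\<bar>"] by (simp add: M_def)
  have M_nonneg: "0 \<le> M" by (simp add: M_def sum_nonneg)
  have "norm (s None w) \<le> M * R ^ d" if R: "R \<ge> 1" and w: "\<forall>k. norm (w $ k) \<le> R" for R w
  proof (cases "w \<in> ?K")
    case True
    then have "norm (s None w) \<le> M * 1" using M by simp
    also have "\<dots> \<le> M * R ^ d" using R M_nonneg by (intro mult_left_mono) auto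
    finally show ?thesis .
  next
    case False
    have "Max (range (\<lambda>k. norm (w $ k))) \<in> range (\<lambda>k. norm (w $ k))" by (rule Max_in) auto
    then obtain k where k': "Max (range (\<lambda>k. norm (w $ k))) = norm (w $ k)" by blast
    have k: "norm (w $ l) \<le> norm (w $ k)" for l unfolding k'[symmetric] by (rule Max_ge) auto
    have B1: "1 < norm (w $ k)"
    proof -
      obtain l where "1 < norm (w $ l)" using False by (auto simp: not_le)
      then show ?thesis using k[of l] by linarith
    qed
    let ?B = "chart_lift None w $ Some k"
    have B: "?B = w $ k" by (simp add: chart_lift_nth slot_def)
    have Bnz: "?B \<noteq> 0" using B B1 by auto
    have "transition None (Some k) w \<in> ?K"
    proof (intro CollectI allI)
      fix l
      have *: "chart_lift (Some k) v $ (if l = k then None else Some l) = v $ l" for v :: "complex^'n"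
        by (simp add: chart_lift_nth slot_def)
      have "transition None (Some k) w $ l = chart_lift None w $ (if l = k then None else Some l) / w $ k"
        using chart_lift_transition[OF Bnz, of "if l = k then None else Some l"] unfolding * B .
      moreover have "norm (chart_lift None w $ (if l = k then None else Some l)) \<le> norm (w $ k)"
        using B1 k by (simp add: chart_lift_nth slot_def)
      ultimately show "norm (transition None (Some k) w $ l) \<le> 1"
        using B1 by (simp add: norm_divide divide_le_eq)
    qed
    then have "norm (s (Some k) (transition None (Some k) w)) \<le> M" by (rule M)
    moreover have "s None w = s (Some k) (transition None (Some k) w) * ?B ^ (d + CARD('n) + 1) * jacobian (transition None (Some k)) w"
      using s Bnz unfolding adjoint_sections_def by blast
    then have "norm (s None w) = norm (s (Some k) (transition None (Some k) w)) * norm (w $ k) ^ d"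
      unfolding jacobian_transition[OF Bnz] B using B1 Bnz[unfolded B]
      by (simp add: norm_mult norm_divide norm_power chart_sign_def power_add)
    ultimately have "norm (s None w) \<le> M * norm (w $ k) ^ d" using B1 by (simp add: mult_right_mono)
    also have "\<dots> \<le> M * R ^ d" using w M_nonneg by (intro mult_left_mono power_mono) auto
    finally show ?thesis .
  qed
  then show ?thesis by blast
qed

lemma holomorphic_upd:
  fixes f :: "complex^'n \<Rightarrow> complex"
  assumes f: "holomorphic f"
  shows "(\<lambda>z. f (upd k z w)) holomorphic_on UNIV"
proof (rule holomorphic_onI)
  fix z :: complex
  obtain D where D: "(f has_derivative D) (at (upd k z w))" "\<And>c v. D (c *s v) = c * D v"
    using f unfolding holomorphic_def by blast
  have "((\<lambda>z. upd k z w) has_derivative (\<lambda>v. \<chi> l. if l = k then v else 0)) (at z)"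
    unfolding upd_def
  proof (rule has_derivative_vec_lambda)
    fix l show "((\<lambda>x. if l = k then x else w $ l) has_derivative (\<lambda>v. if l = k then v else 0)) (at z)"
      by (cases "l = k") auto
  qed
  moreover have "(\<chi> l. if l = k then v else 0) = v *s axis k 1" for v :: complex
    by (simp add: Finite_Cartesian_Product.vec_eq_iff axis_def)
  ultimately have "((\<lambda>z. upd k z w) has_derivative (\<lambda>v. v *s axis k 1)) (at z)" by simp
  from has_derivative_compose[OF this D(1)]
  have "((\<lambda>z. f (upd k z w)) has_field_derivative D (axis k 1)) (at z)"
    unfolding has_field_derivative_def D(2) by (rule has_derivative_eq_rhs) (simp add: fun_eq_iff)
  then show "(\<lambda>z. f (upd k z w)) field_differentiable at z within UNIV"
    by (auto simp: field_differentiable_def)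
qed

text \<open>Liouville's theorem in one variable at a time turns the growth of the section into
  polynomial dependence of degree at most d.\<close>

lemma adjoint_section_None:
  fixes s :: "'n::finite option \<Rightarrow> complex^'n \<Rightarrow> complex"
  assumes s: "s \<in> adjoint_sections (d + CARD('n) + 1)"
  shows "\<exists>c. \<forall>w. s None w = (\<Sum>\<beta>\<in>compositions d. c \<beta> * monomial_section \<beta> None w)"
proof (rule poly_growth_monomials[of UNIV])
  obtain M where M: "\<And>R w. R \<ge> 1 \<Longrightarrow> (\<forall>k. norm (w $ k) \<le> R) \<Longrightarrow> norm (s None w) \<le> M * R ^ d"
    using adjoint_section_growth[OF s] by blast
  have "\<exists>c. \<forall>z. s None (upd k z w) = (\<Sum>e\<le>d. c e * z ^ e)" for k w
  proof -
    let ?f = "\<lambda>z. s None (upd k z w)"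
    \<comment> \<open>Once |z| \<ge> W, all coordinates of the updated point are bounded by |z|, and
      the growth bound applies with R = |z|.\<close>
    define W where "W = 1 + (\<Sum>l\<in>UNIV. norm (w $ l))"
    have W: "1 \<le> W" "norm (w $ l) \<le> W" for l
      using member_le_sum[of l UNIV "\<lambda>l. norm (w $ l)"] by (auto simp: W_def sum_nonneg)
    have "norm (?f z) \<le> M * norm z ^ d" if z: "W \<le> norm z" for z
      using W(1) order_trans[OF W(2) z] z by (intro M) auto
    moreover have "?f holomorphic_on UNIV"
      using s by (intro holomorphic_upd) (simp add: adjoint_sections_def)
    ultimately have "?f z = (\<Sum>e\<le>d. (deriv ^^ e) ?f 0 / fact e * z ^ e)" for z
      by (rule Liouville_polynomial[rotated])
    then show ?thesis by (intro exI[of _ "\<lambda>e. (deriv ^^ e) ?f 0 / fact e"] allI)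
  qed
  then show "poly_growth d (s None)" using M unfolding poly_growth_def by blast
qed auto

text \<open>The transition rule settles the points of the other charts that also lie in the chart
  \<open>None\<close>. In the chart \<open>Some k\<close> the rest is the zero set of the coordinate
  \<open>k\<close>, reached by continuity in that coordinate.\<close>

lemma adjoint_section_eqI:
  fixes s t :: "'n::finite option \<Rightarrow> complex^'n \<Rightarrow> complex"
  assumes s: "s \<in> adjoint_sections m" and t: "t \<in> adjoint_sections m" and eq: "s None = t None"
  shows "s = t"
proof (intro ext)
  fix i and w :: "complex^'n"
  have trans: "s i w = t i w" if "chart_lift i w $ None \<noteq> 0" for w
  proof -
    have "r i w = r None (transition i None w) * (chart_lift i w $ None) ^ m * jacobian (transition i None) w"
      if "r \<in> adjoint_sections m" for r
      using that \<open>chart_lift i w $ None \<noteq> 0\<close> unfolding adjoint_sections_def by blast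
    from this[OF s] this[OF t] show ?thesis by (simp only: eq)
  qed
  show "s i w = t i w"
  proof (cases i)
    case (Some k)
    have "(\<lambda>z. s i (upd k z w) - t i (upd k z w)) holomorphic_on UNIV"
      using s t by (intro holomorphic_on_diff holomorphic_upd) (auto simp: adjoint_sections_def)
    from holomorphic_on_imp_continuous_on[OF this]
    have "isCont (\<lambda>z. s i (upd k z w) - t i (upd k z w)) (w $ k)"
      by (simp only: continuous_on_eq_continuous_at[OF open_UNIV] UNIV_I ball_UNIV)
    then have lim: "((\<lambda>z. s i (upd k z w) - t i (upd k z w)) \<longlongrightarrow> s i w - t i w) (at (w $ k))"
      by (simp add: isCont_def)
    have "eventually (\<lambda>z. s i (upd k z w) - t i (upd k z w) = 0) (at (w $ k))"
    proof -
      have "eventually (\<lambda>z. z \<noteq> 0) (at (w $ k))" by (rule eventually_neq_at_within)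
      then show ?thesis
      proof eventually_elim
        case (elim z)
        then have "chart_lift i (upd k z w) $ None \<noteq> 0" using Some by (simp add: chart_lift_nth slot_def)
        then show ?case using trans by simp
      qed
    qed
    then have "((\<lambda>z. s i (upd k z w) - t i (upd k z w)) \<longlongrightarrow> 0) (at (w $ k))"
      by (rule tendsto_eventually)
    with lim have "s i w - t i w = 0" using tendsto_unique[OF trivial_limit_at] by blast
    then show ?thesis by simp
  qed (use eq in simp)
qed

section \<open>Orthogonality of monomials\<close>

text \<open>Real coordinates turn rotations of the coordinates into orthogonal maps.\<close>

definition of_coords :: "real^(('n::finite \<times> bool) wo) \<Rightarrow> complex^'n" where
  "of_coords y = (\<chi> k. Complex (y $ wo (k, True)) (y $ wo (k, False)))"

definition to_coords :: "complex^'n::finite \<Rightarrow> real^(('n \<times> bool) wo)" where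
  "to_coords w = (\<chi> i. case unwo i of (k, b) \<Rightarrow> if b then Re (w $ k) else Im (w $ k))"

lemma of_to_coords [simp]: "of_coords (to_coords w) = w"
  by (simp add: of_coords_def to_coords_def Finite_Cartesian_Product.vec_eq_iff)

lemma to_of_coords [simp]: "to_coords (of_coords y) = y"
proof -
  have "to_coords (of_coords y) $ i = y $ i" for i
  proof -
    obtain k b where i: "i = wo (k, b)" by (metis surj_pair wo_unwo)
    show ?thesis unfolding i by (cases b) (simp_all add: of_coords_def to_coords_def)
  qed
  then show ?thesis by (simp add: Finite_Cartesian_Product.vec_eq_iff)
qed

lemma prod_wo_pairs:
  fixes f :: "('n::finite \<times> bool) wo \<Rightarrow> 'b::comm_monoid_mult"
  shows "(\<Prod>i\<in>UNIV. f i) = (\<Prod>k\<in>UNIV. f (wo (k, True)) * f (wo (k, False)))"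
proof -
  have "(\<Prod>i\<in>UNIV. f i) = (\<Prod>kb\<in>UNIV. f (wo kb))"
    by (rule prod.reindex_bij_betw[OF bij_wo, symmetric])
  also have "\<dots> = (\<Prod>k\<in>UNIV. \<Prod>b\<in>UNIV. f (wo (k, b)))"
    unfolding UNIV_Times_UNIV[symmetric] prod.cartesian_product by (intro prod.cong) auto
  finally show ?thesis by (simp add: UNIV_bool mult.commute)
qed

lemma sum_wo_pairs:
  fixes f :: "('n::finite \<times> bool) wo \<Rightarrow> 'b::comm_monoid_add"
  shows "(\<Sum>i\<in>UNIV. f i) = (\<Sum>k\<in>UNIV. f (wo (k, True)) + f (wo (k, False)))"
proof -
  have "(\<Sum>i\<in>UNIV. f i) = (\<Sum>kb\<in>UNIV. f (wo kb))"
    by (rule sum.reindex_bij_betw[OF bij_wo, symmetric])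
  also have "\<dots> = (\<Sum>k\<in>UNIV. \<Sum>b\<in>UNIV. f (wo (k, b)))"
    unfolding UNIV_Times_UNIV[symmetric] sum.cartesian_product by (intro sum.cong) auto
  finally show ?thesis by (simp add: UNIV_bool add.commute)
qed

lemma norm_of_coords: "norm (of_coords y) = norm y"
proof -
  have "(norm (of_coords y))\<^sup>2 = (\<Sum>k\<in>UNIV. (norm (of_coords y $ k))\<^sup>2)"
    by (simp add: norm_vec_def L2_set_def sum_nonneg)
  also have "\<dots> = (\<Sum>k\<in>UNIV. (y $ wo (k, True))\<^sup>2 + (y $ wo (k, False))\<^sup>2)"
    by (intro sum.cong refl) (simp add: of_coords_def cmod_power2)
  also have "\<dots> = (\<Sum>i\<in>UNIV. (y $ i)\<^sup>2)"
    by (rule sum_wo_pairs[symmetric])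
  also have "\<dots> = (norm y)\<^sup>2"
    by (simp add: norm_vec_def L2_set_def sum_nonneg)
  finally show ?thesis by simp
qed

lemma linear_of_coords: "linear of_coords"
  by (rule linearI) (auto simp: of_coords_def Finite_Cartesian_Product.vec_eq_iff complex_eq_iff)

lemma linear_to_coords: "linear to_coords"
  by (rule linearI) (auto simp: to_coords_def Finite_Cartesian_Product.vec_eq_iff split: prod.split)

lemma measurable_of_coords [measurable]: "of_coords \<in> borel_measurable borel"
  by (intro borel_measurable_continuous_onI linear_continuous_on linear_conv_bounded_linear[THEN iffD1] linear_of_coords)

lemma distr_of_coords: "distr lborel borel (of_coords :: _ \<Rightarrow> complex^'n::finite) = lborel"
proof (rule lborel_eqI[symmetric])
  fix l u :: "complex^'n" assume lu: "\<And>b. b \<in> Basis \<Longrightarrow> l \<bullet> b \<le> u \<bullet> b"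
  have le: "Re (l $ k) \<le> Re (u $ k)" "Im (l $ k) \<le> Im (u $ k)" for k
    using lu[of "axis k 1"] lu[of "axis k \<i>"] by (auto simp: Basis_vec_def Basis_complex_def inner_axis)
  have le': "to_coords l $ i \<le> to_coords u $ i" for i
    using le by (simp add: to_coords_def split: prod.split)
  have mem: "of_coords y \<in> box l u \<longleftrightarrow> y \<in> box (to_coords l) (to_coords u)" for y
  proof -
    have "of_coords y \<in> box l u \<longleftrightarrow> (\<forall>k. Re (l $ k) < y $ wo (k, True) \<and> y $ wo (k, True) < Re (u $ k) \<and>
        Im (l $ k) < y $ wo (k, False) \<and> y $ wo (k, False) < Im (u $ k))"
      by (simp add: mem_box Basis_vec_def Basis_complex_def inner_axis of_coords_def inner_complex_def ball_Un) blast
    also have "\<dots> \<longleftrightarrow> (\<forall>i. to_coords l $ i < y $ i \<and> y $ i < to_coords u $ i)"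
    proof safe
      fix i :: "('n \<times> bool) wo" assume *: "\<forall>k. Re (l $ k) < y $ wo (k, True) \<and> y $ wo (k, True) < Re (u $ k) \<and>
        Im (l $ k) < y $ wo (k, False) \<and> y $ wo (k, False) < Im (u $ k)"
      obtain k b where i: "i = wo (k, b)" by (metis surj_pair wo_unwo)
      show "to_coords l $ i < y $ i" "y $ i < to_coords u $ i" using *[rule_format, of k] unfolding i by (cases b; simp add: to_coords_def)+
    next
      fix k assume *: "\<forall>i. to_coords l $ i < y $ i \<and> y $ i < to_coords u $ i"
      show "Re (l $ k) < y $ wo (k, True)" "y $ wo (k, True) < Re (u $ k)" "Im (l $ k) < y $ wo (k, False)" "y $ wo (k, False) < Im (u $ k)"
        using *[rule_format, of "wo (k, True)"] *[rule_format, of "wo (k, False)"] by (simp_all add: to_coords_def)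
    qed
    finally show ?thesis by (simp add: mem_box_cart)
  qed
  have "emeasure (distr lborel borel of_coords) (box l u) = emeasure lborel (box (to_coords l) (to_coords u))"
    by (subst emeasure_distr) (auto simp: vimage_def mem box_def[symmetric] intro!: arg_cong[where f = "emeasure lborel"])
  also have "\<dots> = (\<Prod>b\<in>Basis. (to_coords u - to_coords l) \<bullet> b)"
    using le' by (intro emeasure_lborel_box) (auto simp: Basis_vec_def inner_axis)
  also have "(\<Prod>b\<in>Basis. (to_coords u - to_coords l) \<bullet> b) = (\<Prod>i\<in>UNIV. to_coords u $ i - to_coords l $ i)"
    by (simp add: Basis_vec_prod inner_axis)
  also have "\<dots> = (\<Prod>k\<in>UNIV. (Re (u $ k) - Re (l $ k)) * (Im (u $ k) - Im (l $ k)))"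
    unfolding prod_wo_pairs by (simp add: to_coords_def)
  also have "\<dots> = (\<Prod>b\<in>Basis. (u - l) \<bullet> b)"
    by (simp add: Basis_vec_prod Basis_complex_def inner_axis)
  finally show "emeasure (distr lborel borel of_coords) (box l u) = (\<Prod>b\<in>Basis. (u - l) \<bullet> b)" .
qed auto

section \<open>Invariance of Lebesgue measure under rotations of the coordinates\<close>

definition rotation :: "complex^'n \<Rightarrow> complex^'n \<Rightarrow> complex^'n" where
  "rotation t w = (\<chi> k. t $ k * w $ k)"

lemma linear_rotation: "linear (rotation t)"
  by (rule linearI) (auto simp: rotation_def Finite_Cartesian_Product.vec_eq_iff distrib_left)

lemma measurable_rotation [measurable]: "rotation t \<in> borel_measurable borel"
  by (intro borel_measurable_continuous_onI linear_continuous_on linear_conv_bounded_linear[THEN iffD1] linear_rotation)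

lemma distr_rotation:
  fixes t :: "complex^'n::finite"
  assumes t: "\<And>k. norm (t $ k) = 1"
  shows "distr lborel borel (rotation t) = lborel"
proof -
  define R where "R s y = to_coords (rotation s (of_coords y))" for s :: "complex^'n" and y
  have lin: "linear (R s)" for s
    unfolding R_def using linear_compose[OF linear_compose[OF linear_of_coords linear_rotation] linear_to_coords]
    by (simp add: o_def)
  have norm_rot: "norm (rotation s w) = norm w" if "\<And>k. norm (s $ k) = 1" for s w :: "complex^'n"
    by (simp add: norm_vec_def L2_set_def rotation_def norm_mult that)
  have norm_to: "norm (to_coords w) = norm w" for w :: "complex^'n"
    by (metis norm_of_coords of_to_coords)
  \<comment> \<open>The inverse rotation: preimages of boxes under \<open>R t\<close> become images
    under the orthogonal map \<open>R s\<close>, whose measure is known.\<close>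
  define s where "s = (\<chi> k. cnj (t $ k))"
  have s: "norm (s $ k) = 1" for k using t by (simp add: s_def)
  have orth: "orthogonal_transformation (R s)"
    unfolding orthogonal_transformation using lin by (simp add: R_def norm_rot[OF s] norm_to norm_of_coords)
  have ts: "t $ k * s $ k = 1" for k
    using t[of k] by (simp add: s_def complex_norm_square[symmetric])
  have rts: "rotation t (rotation s w) = w" "rotation s (rotation t w) = w" for w
    using ts by (simp_all add: rotation_def Finite_Cartesian_Product.vec_eq_iff mult.assoc[symmetric] mult.commute[of "s $ _"])
  have inv: "R t (R s y) = y" "R s (R t y) = y" for y by (simp_all add: R_def rts)
  have R_meas [measurable]: "R t \<in> borel_measurable borel"
    by (intro borel_measurable_continuous_onI linear_continuous_on linear_conv_bounded_linear[THEN iffD1] lin)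
  have distr_R: "distr lborel borel (R t) = lborel"
  proof (rule lborel_eqI[symmetric])
    fix l u :: "real^(('n \<times> bool) wo)" assume lu: "\<And>b. b \<in> Basis \<Longrightarrow> l \<bullet> b \<le> u \<bullet> b"
    have pre: "R t -` box l u = R s ` box l u"
    proof safe
      fix y assume "R t y \<in> box l u"
      then show "y \<in> R s ` box l u" using inv(2)[of y] by (metis imageI)
    qed (simp add: inv)
    have meas: "R s ` box l u \<in> sets borel"
    proof -
      have "R t -` box l u \<inter> space borel \<in> sets borel" by (rule measurable_sets[OF R_meas]) simp
      then show ?thesis by (simp add: pre)
    qed
    have lm: "box l u \<in> lmeasurable" by (rule lmeasurable_box)
    have "emeasure (distr lborel borel (R t)) (box l u) = emeasure lborel (R s ` box l u)"
      by (subst emeasure_distr) (auto simp: pre)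
    also have "\<dots> = emeasure lebesgue (R s ` box l u)" using meas by simp
    also have "\<dots> = measure lebesgue (R s ` box l u)"
      using measurable_orthogonal_image[OF orth lm] by (simp add: emeasure_eq_measure2)
    also have "\<dots> = measure lebesgue (box l u)" by (simp only: measure_orthogonal_image[OF orth lm])
    also have "\<dots> = emeasure lebesgue (box l u)" using lm by (simp add: emeasure_eq_measure2)
    also have "\<dots> = emeasure lborel (box l u)" by simp
    also have "\<dots> = (\<Prod>b\<in>Basis. (u - l) \<bullet> b)" using lu by (rule emeasure_lborel_box)
    finally show "emeasure (distr lborel borel (R t)) (box l u) = (\<Prod>b\<in>Basis. (u - l) \<bullet> b)" .
  qed auto
  have "distr lborel borel (rotation t) = distr (distr lborel borel of_coords) borel (rotation t)"
    by (simp only: distr_of_coords)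
  also have "\<dots> = distr lborel borel (rotation t \<circ> of_coords)" by (rule distr_distr) auto
  also have "rotation t \<circ> of_coords = of_coords \<circ> R t" by (auto simp: R_def)
  also have "distr lborel borel (of_coords \<circ> R t) = distr (distr lborel borel (R t)) borel of_coords"
    by (rule distr_distr[symmetric]) auto
  also have "\<dots> = lborel" by (simp only: distr_R distr_of_coords)
  finally show ?thesis .
qed

lemma measurable_cnj [measurable]: "cnj \<in> borel_measurable borel"
  by (intro borel_measurable_continuous_onI continuous_on_cnj continuous_on_id)

lemma measurable_complex_of_real [measurable]: "complex_of_real \<in> borel_measurable borel"
  by (intro borel_measurable_continuous_onI continuous_on_of_real continuous_on_id)

text \<open>The weight is an invariant metric on O(m) in the chart \<open>None\<close>. In
  \<open>l2_product\<close> the metric on K and the volume form leave only a constant, so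
  \<open>ip\<close> is that product up to a factor.\<close>

locale toric_weight =
  fixes \<rho> :: "complex^'n::finite \<Rightarrow> real" and d :: nat
  assumes weight_meas [measurable]: "\<rho> \<in> borel_measurable borel"
    and weight_nonneg: "\<And>w. 0 \<le> \<rho> w"
    and weight_rotation: "\<And>t w. (\<And>k. norm (t $ k) = 1) \<Longrightarrow> \<rho> (rotation t w) = \<rho> w"
    and integrable_norm: "\<And>\<beta>. \<beta> \<in> compositions d \<Longrightarrow> integrable lborel (\<lambda>w. (norm (monomial_section \<beta> None w))\<^sup>2 * \<rho> w)"
begin

definition norm_sq :: "('n option \<Rightarrow> nat) \<Rightarrow> real" where
  "norm_sq \<beta> = (LINT w|lborel. (norm (monomial_section \<beta> None w))\<^sup>2 * \<rho> w)"

definition ip :: "('n option \<Rightarrow> complex^'n \<Rightarrow> complex) \<Rightarrow> ('n option \<Rightarrow> complex^'n \<Rightarrow> complex) \<Rightarrow> complex" where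
  "ip s t = (LINT w|lborel. s None w * cnj (t None w) * of_real (\<rho> w))"

lemma measurable_monomial_section [measurable]:
  "(\<lambda>w::complex^'n. monomial_section \<beta> None w) \<in> borel_measurable borel"
  unfolding monomial_section_None by measurable

lemma integrable_monomials:
  assumes \<beta>: "\<beta> \<in> compositions d" and \<gamma>: "\<gamma> \<in> compositions d"
  shows "integrable lborel (\<lambda>w. monomial_section \<beta> None w * cnj (monomial_section \<gamma> None w) * of_real (\<rho> w))"
proof (rule Bochner_Integration.integrable_bound)
  show "integrable lborel (\<lambda>w. (norm (monomial_section \<beta> None w))\<^sup>2 * \<rho> w + (norm (monomial_section \<gamma> None w))\<^sup>2 * \<rho> w)"
    by (intro Bochner_Integration.integrable_add integrable_norm assms)
  show "(\<lambda>w. monomial_section \<beta> None w * cnj (monomial_section \<gamma> None w) * of_real (\<rho> w)) \<in> borel_measurable lborel"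
    by measurable
  show "AE w in lborel. norm (monomial_section \<beta> None w * cnj (monomial_section \<gamma> None w) * of_real (\<rho> w)) \<le>
     norm ((norm (monomial_section \<beta> None w))\<^sup>2 * \<rho> w + (norm (monomial_section \<gamma> None w))\<^sup>2 * \<rho> w)"
  proof (rule AE_I2)
    fix w
    have ab: "a * b \<le> a\<^sup>2 + b\<^sup>2" if "0 \<le> a" "0 \<le> b" for a b :: real
    proof -
      have "2 * (a * b) \<le> a\<^sup>2 + b\<^sup>2" using sum_squares_bound[of a b] by (simp add: mult.assoc)
      moreover have "0 \<le> a * b" using that by simp
      ultimately show ?thesis by linarith
    qed
    have "norm (monomial_section \<beta> None w) * norm (monomial_section \<gamma> None w) * \<rho> w \<le>
        ((norm (monomial_section \<beta> None w))\<^sup>2 + (norm (monomial_section \<gamma> None w))\<^sup>2) * \<rho> w"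
      by (intro mult_right_mono ab weight_nonneg) auto
    then show "norm (monomial_section \<beta> None w * cnj (monomial_section \<gamma> None w) * of_real (\<rho> w)) \<le>
     norm ((norm (monomial_section \<beta> None w))\<^sup>2 * \<rho> w + (norm (monomial_section \<gamma> None w))\<^sup>2 * \<rho> w)"
      using weight_nonneg[of w] by (simp add: norm_mult distrib_right abs_of_nonneg)
  qed
qed

lemma ip_monomial_self: "ip (monomial_section \<beta>) (monomial_section \<beta>) = of_real (norm_sq \<beta>)"
proof -
  have "monomial_section \<beta> None w * cnj (monomial_section \<beta> None w) * of_real (\<rho> w) =
      complex_of_real ((norm (monomial_section \<beta> None w))\<^sup>2 * \<rho> w)" for w
    by (simp add: complex_norm_square[symmetric])
  then show ?thesis unfolding ip_def norm_sq_def by (simp only: integral_complex_of_real)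
qed

text \<open>Rotating one coordinate in which the exponents differ by the angle pi divided by their
  difference preserves the measure and the weight and changes the sign of the integrand.\<close>

lemma ip_monomial_orthogonal:
  assumes \<beta>: "\<beta> \<in> compositions d" and \<gamma>: "\<gamma> \<in> compositions d" and ne: "\<beta> \<noteq> \<gamma>"
  shows "ip (monomial_section \<beta>) (monomial_section \<gamma>) = 0"
proof -
  \<comment> \<open>The exponent at \<open>None\<close> is determined by the others through the
    common degree.\<close>
  have "\<exists>k. \<beta> (Some k) \<noteq> \<gamma> (Some k)"
  proof (rule ccontr)
    assume "\<not> ?thesis"
    then have S: "\<beta> (Some k) = \<gamma> (Some k)" for k by simp
    then have "\<beta> None = \<gamma> None" using \<beta> \<gamma> by (simp add: compositions_def sum_option)
    with S have "\<beta> = \<gamma>" by (simp add: fun_eq_iff split_option_all)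
    then show False using ne by simp
  qed
  then obtain k where k: "\<beta> (Some k) \<noteq> \<gamma> (Some k)" by blast
  define \<theta> where "\<theta> = pi / (real (\<beta> (Some k)) - real (\<gamma> (Some k)))"
  define t :: "complex^'n" where "t = (\<chi> j. if j = k then cis \<theta> else 1)"
  have t: "norm (t $ j) = 1" for j by (simp add: t_def)
  have rot: "monomial_section \<delta> None (rotation t w) = cis \<theta> ^ \<delta> (Some k) * monomial_section \<delta> None w" for \<delta> w
  proof -
    have "monomial_section \<delta> None (rotation t w) = (\<Prod>j\<in>UNIV. t $ j ^ \<delta> (Some j)) * (\<Prod>j\<in>UNIV. w $ j ^ \<delta> (Some j))"
      by (simp add: monomial_section_None rotation_def power_mult_distrib prod.distrib)
    also have "(\<Prod>j\<in>UNIV. t $ j ^ \<delta> (Some j)) = (\<Prod>j\<in>UNIV. if j = k then cis \<theta> ^ \<delta> (Some k) else 1)"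
      by (intro prod.cong) (auto simp: t_def)
    finally show ?thesis by (simp add: monomial_section_None)
  qed
  have minus: "cis \<theta> ^ \<beta> (Some k) * cnj (cis \<theta> ^ \<gamma> (Some k)) = -1"
  proof -
    have "cis \<theta> ^ \<beta> (Some k) * cnj (cis \<theta> ^ \<gamma> (Some k)) = cis (real (\<beta> (Some k)) * \<theta> + - (real (\<gamma> (Some k)) * \<theta>))"
      by (simp only: cis_cnj Complex.DeMoivre cis_mult)
    also have "real (\<beta> (Some k)) * \<theta> + - (real (\<gamma> (Some k)) * \<theta>) = pi"
      using k by (simp add: \<theta>_def left_diff_distrib[symmetric] divide_simps)
    finally show ?thesis by simp
  qed
  let ?F = "\<lambda>w. monomial_section \<beta> None w * cnj (monomial_section \<gamma> None w) * of_real (\<rho> w)"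
  have F: "?F (rotation t w) = - ?F w" for w
  proof -
    have "?F (rotation t w) = (cis \<theta> ^ \<beta> (Some k) * cnj (cis \<theta> ^ \<gamma> (Some k))) * ?F w"
      unfolding rot weight_rotation[OF t] by (simp only: complex_cnj_mult mult_ac)
    then show ?thesis unfolding minus by simp
  qed
  have "(LINT w|lborel. ?F w) = (LINT w|distr lborel borel (rotation t). ?F w)" by (simp only: distr_rotation[OF t])
  also have "\<dots> = (LINT w|lborel. ?F (rotation t w))" by (subst integral_distr) auto
  also have "\<dots> = - (LINT w|lborel. ?F w)" unfolding F by simp
  finally show ?thesis by (simp add: ip_def)
qed

lemma ip_sum_monomials:
  assumes s: "\<And>w. s None w = (\<Sum>\<beta>\<in>compositions d. a \<beta> * monomial_section \<beta> None w)"
    and t: "\<And>w. t None w = (\<Sum>\<beta>\<in>compositions d. b \<beta> * monomial_section \<beta> None w)"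
  shows "ip s t = (\<Sum>\<beta>\<in>compositions d. a \<beta> * cnj (b \<beta>) * of_real (norm_sq \<beta>))"
proof -
  have "ip s t = (LINT w|lborel. (\<Sum>\<beta>\<in>compositions d. \<Sum>\<gamma>\<in>compositions d. (a \<beta> * cnj (b \<gamma>)) *
      (monomial_section \<beta> None w * cnj (monomial_section \<gamma> None w) * of_real (\<rho> w))))"
    unfolding ip_def s t cnj_sum complex_cnj_mult sum_product
    unfolding sum_distrib_right by (simp only: mult_ac)
  also have "\<dots> = (\<Sum>\<beta>\<in>compositions d. \<Sum>\<gamma>\<in>compositions d. (a \<beta> * cnj (b \<gamma>)) * ip (monomial_section \<beta>) (monomial_section \<gamma>))"
    unfolding ip_def using integrable_monomials
    by (subst Bochner_Integration.integral_sum, (intro Bochner_Integration.integrable_sum integrable_mult_right; simp))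
       (intro sum.cong refl, subst Bochner_Integration.integral_sum, auto intro!: integrable_mult_right)
  also have "\<dots> = (\<Sum>\<beta>\<in>compositions d. \<Sum>\<gamma>\<in>compositions d. if \<gamma> = \<beta> then a \<beta> * cnj (b \<beta>) * of_real (norm_sq \<beta>) else 0)"
    by (intro sum.cong refl) (auto simp: ip_monomial_self ip_monomial_orthogonal)
  also have "\<dots> = (\<Sum>\<beta>\<in>compositions d. a \<beta> * cnj (b \<beta>) * of_real (norm_sq \<beta>))"
    by (simp add: finite_compositions)
  finally show ?thesis .
qed

end

section \<open>Gram determinants\<close>

lemma section_sum_apply: "(\<Sum>\<beta>\<in>A. f \<beta>) i w = (\<Sum>\<beta>\<in>A. f \<beta> i w)" for f :: "'b \<Rightarrow> 'c \<Rightarrow> 'd \<Rightarrow> complex"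
  by (induction A rule: infinite_finite_induct) auto

lemma holomorphic_add: "holomorphic f \<Longrightarrow> holomorphic g \<Longrightarrow> holomorphic (\<lambda>w. f w + g w)"
  unfolding holomorphic_def
proof (intro allI)
  fix w assume "\<forall>w. \<exists>D. (f has_derivative D) (at w) \<and> (\<forall>c v. D (c *s v) = c * D v)"
    "\<forall>w. \<exists>D. (g has_derivative D) (at w) \<and> (\<forall>c v. D (c *s v) = c * D v)"
  then obtain D E where "(f has_derivative D) (at w)" "\<forall>c v. D (c *s v) = c * D v"
    "(g has_derivative E) (at w)" "\<forall>c v. E (c *s v) = c * E v" by metis
  then show "\<exists>D. ((\<lambda>w. f w + g w) has_derivative D) (at w) \<and> (\<forall>c v. D (c *s v) = c * D v)"
    by (intro exI[of _ "\<lambda>v. D v + E v"]) (auto intro!: has_derivative_add simp: distrib_left)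
qed

lemma subspace_adjoint_sections: "sections.subspace (adjoint_sections m)"
  unfolding sections.subspace_def
proof (intro conjI ballI allI)
  show "0 \<in> adjoint_sections m" by (simp add: adjoint_sections_def holomorphic_const zero_fun_def)
  fix s t :: "'n option \<Rightarrow> complex^'n \<Rightarrow> complex" and c
  assume s: "s \<in> adjoint_sections m"
  show "(\<lambda>i w. c * s i w) \<in> adjoint_sections m"
    using s by (auto simp: adjoint_sections_def intro!: holomorphic_mult holomorphic_const)
  assume t: "t \<in> adjoint_sections m"
  have st: "(s + t) i = (\<lambda>w. s i w + t i w)" for i by auto
  show "s + t \<in> adjoint_sections m"
    unfolding adjoint_sections_def mem_Collect_eq st
    using s t by (auto simp: adjoint_sections_def distrib_right intro!: holomorphic_add)
qed

context toric_weight
begin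

text \<open>Independence comes from orthogonality: the product of the vanishing combination with one
  monomial isolates its coefficient.\<close>

lemma monomial_coefficients_zero:
  fixes a :: "('n option \<Rightarrow> nat) \<Rightarrow> complex"
  assumes pos: "\<And>\<beta>. \<beta> \<in> compositions d \<Longrightarrow> norm_sq \<beta> \<noteq> 0"
    and zero: "\<And>w. (\<Sum>\<beta>\<in>compositions d. a \<beta> * monomial_section \<beta> None w) = 0" and \<gamma>: "\<gamma> \<in> compositions d"
  shows "a \<gamma> = 0"
proof -
  have "ip (\<lambda>i w. 0) (monomial_section \<gamma>) =
      (\<Sum>\<beta>\<in>compositions d. a \<beta> * cnj (if \<beta> = \<gamma> then 1 else 0) * of_real (norm_sq \<beta>))"
  proof (rule ip_sum_monomials)
    fix w :: "complex^'n"
    show "0 = (\<Sum>\<beta>\<in>compositions d. a \<beta> * monomial_section \<beta> None w)" by (simp add: zero)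
    have "(\<Sum>\<beta>\<in>compositions d. (if \<beta> = \<gamma> then 1 else 0) * monomial_section \<beta> None w) =
        (\<Sum>\<beta>\<in>compositions d. if \<beta> = \<gamma> then monomial_section \<gamma> None w else 0)"
      by (intro sum.cong) auto
    then show "monomial_section \<gamma> None w = (\<Sum>\<beta>\<in>compositions d. (if \<beta> = \<gamma> then 1 else 0) * monomial_section \<beta> None w)"
      using \<gamma> by (simp add: finite_compositions)
  qed
  also have "\<dots> = (\<Sum>\<beta>\<in>compositions d. if \<beta> = \<gamma> then a \<gamma> * of_real (norm_sq \<gamma>) else 0)"
    by (intro sum.cong) auto
  also have "\<dots> = a \<gamma> * of_real (norm_sq \<gamma>)" using \<gamma> by (simp add: finite_compositions)
  finally show ?thesis using pos[OF \<gamma>] by (simp add: ip_def)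
qed

text \<open>Spanning is checked in the chart \<open>None\<close>, which determines a section and
  where it is a combination of monomials.\<close>

lemma scaled_monomials_basis:
  fixes \<kappa> :: "('n option \<Rightarrow> nat) \<Rightarrow> complex"
  assumes pos: "\<And>\<beta>. \<beta> \<in> compositions d \<Longrightarrow> norm_sq \<beta> \<noteq> 0"
    and \<kappa>: "\<And>\<beta>. \<beta> \<in> compositions d \<Longrightarrow> \<kappa> \<beta> \<noteq> 0"
  defines "E \<equiv> \<lambda>\<beta> i w. \<kappa> \<beta> * monomial_section \<beta> i w"
  shows "inj_on E (compositions d)" "sections.independent (E ` compositions d)"
    "sections.span (E ` compositions d) = adjoint_sections (d + CARD('n) + 1)"
proof -
  let ?S = "compositions d :: ('n option \<Rightarrow> nat) set"
  show inj: "inj_on E ?S"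
  proof (rule inj_onI, rule ccontr)
    fix \<beta> \<gamma> assume b: "\<beta> \<in> ?S" and c: "\<gamma> \<in> ?S" and eq: "E \<beta> = E \<gamma>" and ne: "\<beta> \<noteq> \<gamma>"
    define a where "a \<delta> = (if \<delta> = \<beta> then \<kappa> \<beta> else 0) - (if \<delta> = \<gamma> then \<kappa> \<gamma> else 0)" for \<delta>
    have "(\<Sum>\<delta>\<in>?S. a \<delta> * monomial_section \<delta> None w) = 0" for w
    proof -
      have "(\<Sum>\<delta>\<in>?S. a \<delta> * monomial_section \<delta> None w) =
          (\<Sum>\<delta>\<in>?S. (if \<delta> = \<beta> then \<kappa> \<beta> * monomial_section \<beta> None w else 0) - (if \<delta> = \<gamma> then \<kappa> \<gamma> * monomial_section \<gamma> None w else 0))"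
        by (intro sum.cong) (auto simp: a_def left_diff_distrib)
      also have "\<dots> = E \<beta> None w - E \<gamma> None w"
        using b c by (simp add: sum_subtractf finite_compositions E_def)
      finally show ?thesis by (simp add: eq)
    qed
    from monomial_coefficients_zero[OF pos this b] have "a \<beta> = 0" by simp
    then show False using ne \<kappa>[OF b] by (simp add: a_def)
  qed
  show "sections.independent (E ` ?S)"
  proof
    assume "sections.dependent (E ` ?S)"
    then obtain u where u: "\<exists>v\<in>E ` ?S. u v \<noteq> 0" "(\<Sum>v\<in>E ` ?S. (\<lambda>i w. u v * v i w)) = 0"
      using sections.dependent_finite[of "E ` ?S"] finite_compositions by blast
    have "(\<Sum>\<beta>\<in>?S. (u (E \<beta>) * \<kappa> \<beta>) * monomial_section \<beta> None w) = 0" for w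
    proof -
      have "(\<Sum>v\<in>E ` ?S. (\<lambda>i w. u v * v i w)) None w = 0" unfolding u(2) by simp
      then have "(\<Sum>v\<in>E ` ?S. u v * v None w) = 0" unfolding section_sum_apply .
      then have "(\<Sum>\<beta>\<in>?S. u (E \<beta>) * E \<beta> None w) = 0" unfolding sum.reindex[OF inj] o_def .
      then show ?thesis by (simp only: E_def mult.assoc)
    qed
    from monomial_coefficients_zero[OF pos this] have "u (E \<beta>) * \<kappa> \<beta> = 0" if "\<beta> \<in> ?S" for \<beta> using that by blast
    then show False using u(1) \<kappa> by auto
  qed
  have E_adj: "E \<beta> \<in> adjoint_sections (d + CARD('n) + 1)" if "\<beta> \<in> ?S" for \<beta>
    unfolding E_def by (rule sections.subspace_scale[OF subspace_adjoint_sections monomial_section_adjoint[OF that]])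
  show "sections.span (E ` ?S) = adjoint_sections (d + CARD('n) + 1)"
  proof
    show "sections.span (E ` ?S) \<subseteq> adjoint_sections (d + CARD('n) + 1)"
      by (rule sections.span_minimal) (use E_adj subspace_adjoint_sections in auto)
    show "adjoint_sections (d + CARD('n) + 1) \<subseteq> sections.span (E ` ?S)"
    proof
      fix s :: "'n option \<Rightarrow> complex^'n \<Rightarrow> complex" assume s: "s \<in> adjoint_sections (d + CARD('n) + 1)"
      then obtain c where c: "\<And>w. s None w = (\<Sum>\<beta>\<in>?S. c \<beta> * monomial_section \<beta> None w)"
        using adjoint_section_None by blast
      define t where "t = (\<Sum>\<beta>\<in>?S. (\<lambda>i w. (c \<beta> / \<kappa> \<beta>) * E \<beta> i w))"
      have "t \<in> sections.span (E ` ?S)"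
        unfolding t_def by (intro sections.span_sum sections.span_scale sections.span_base) auto
      moreover have "s = t"
      proof (rule adjoint_section_eqI[OF s])
        show "t \<in> adjoint_sections (d + CARD('n) + 1)"
          unfolding t_def by (intro sections.subspace_sum sections.subspace_scale subspace_adjoint_sections E_adj)
        show "s None = t None"
        proof
          fix w
          have "(c \<beta> / \<kappa> \<beta>) * E \<beta> None w = c \<beta> * monomial_section \<beta> None w" if "\<beta> \<in> ?S" for \<beta>
            using \<kappa>[OF that] by (simp add: E_def)
          then show "s None w = t None w" unfolding c t_def section_sum_apply by simp
        qed
      qed
      ultimately show "s \<in> sections.span (E ` ?S)" by simp
    qed
  qed
qed

lemma dim_adjoint_sections:
  assumes pos: "\<And>\<beta>. \<beta> \<in> compositions d \<Longrightarrow> norm_sq \<beta> \<noteq> 0"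
  shows "sections.dim (adjoint_sections (d + CARD('n) + 1) :: ('n option \<Rightarrow> complex^'n \<Rightarrow> complex) set) =
    card (compositions d :: ('n option \<Rightarrow> nat) set)"
proof -
  define E where "E = (\<lambda>\<beta> i (w::complex^'n). 1 * monomial_section \<beta> i w)"
  let ?S = "compositions d :: ('n option \<Rightarrow> nat) set"
  have B: "inj_on E ?S" "sections.independent (E ` ?S)"
    "sections.span (E ` ?S) = adjoint_sections (d + CARD('n) + 1)"
    unfolding E_def by (rule scaled_monomials_basis[where \<kappa> = "\<lambda>_. 1"]; use pos in simp)+
  have "sections.dim (adjoint_sections (d + CARD('n) + 1) :: ('n option \<Rightarrow> complex^'n \<Rightarrow> complex) set) = card (E ` ?S)"
  proof (rule sections.dim_eq_card)
    show "sections.span (E ` ?S) = sections.span (adjoint_sections (d + CARD('n) + 1))"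
      unfolding B(3)[symmetric] by (rule sections.span_span[symmetric])
    show "sections.independent (E ` ?S)" by (rule B(2))
  qed
  also have "\<dots> = card ?S"
    by (rule card_image[OF B(1)])
  finally show ?thesis .
qed

lemma orthonormal_monomials:
  assumes c: "0 < c" and pos: "\<And>\<beta>. \<beta> \<in> compositions d \<Longrightarrow> 0 < norm_sq \<beta>"
    and N: "N = card (compositions d :: ('n option \<Rightarrow> nat) set)"
  shows "\<exists>s. inj_on s {..<N} \<and> sections.independent (s ` {..<N}) \<and>
     sections.span (s ` {..<N}) = adjoint_sections (d + CARD('n) + 1) \<and>
     (\<forall>i<N. \<forall>j<N. of_real c * ip (s i) (s j) = (if i = j then 1 else 0))"
proof -
  let ?S = "compositions d :: ('n option \<Rightarrow> nat) set"
  \<comment> \<open>Here \<open>c\<close> is the factor between \<open>ip\<close> and the L2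
    product, with respect to which the basis must be orthonormal.\<close>
  define \<kappa> where "\<kappa> \<beta> = complex_of_real (1 / sqrt (c * norm_sq \<beta>))" for \<beta>
  define E where "E = (\<lambda>\<beta> i w. \<kappa> \<beta> * monomial_section \<beta> i w)"
  have pos': "norm_sq \<beta> \<noteq> 0" if "\<beta> \<in> ?S" for \<beta> using pos[OF that] by simp
  have \<kappa>: "\<kappa> \<beta> \<noteq> 0" if "\<beta> \<in> ?S" for \<beta> using pos[OF that] c by (simp add: \<kappa>_def)
  note B = scaled_monomials_basis[where \<kappa> = \<kappa>, OF pos' \<kappa>, folded E_def]
  obtain b where b: "bij_betw b {..<N} ?S"
    using ex_bij_betw_nat_finite[OF finite_compositions] unfolding N lessThan_atLeast0 by blast
  have img: "(\<lambda>i. E (b i)) ` {..<N} = E ` ?S" using b by (auto simp: bij_betw_def image_image[symmetric])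
  have ipE: "of_real c * ip (E \<beta>) (E \<gamma>) = (if \<beta> = \<gamma> then 1 else 0)" if \<beta>: "\<beta> \<in> ?S" and \<gamma>: "\<gamma> \<in> ?S" for \<beta> \<gamma>
  proof -
    have E: "E \<delta> None w = (\<Sum>\<epsilon>\<in>?S. (if \<epsilon> = \<delta> then \<kappa> \<delta> else 0) * monomial_section \<epsilon> None w)" if "\<delta> \<in> ?S" for \<delta> w
    proof -
      have "(\<Sum>\<epsilon>\<in>?S. (if \<epsilon> = \<delta> then \<kappa> \<delta> else 0) * monomial_section \<epsilon> None w) = (\<Sum>\<epsilon>\<in>?S. if \<epsilon> = \<delta> then \<kappa> \<delta> * monomial_section \<delta> None w else 0)"
        by (intro sum.cong) auto
      then show ?thesis using that by (simp add: finite_compositions E_def)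
    qed
    have "ip (E \<beta>) (E \<gamma>) = (\<Sum>\<epsilon>\<in>?S. (if \<epsilon> = \<beta> then \<kappa> \<beta> else 0) * cnj (if \<epsilon> = \<gamma> then \<kappa> \<gamma> else 0) * of_real (norm_sq \<epsilon>))"
      by (rule ip_sum_monomials[where s = "E \<beta>" and t = "E \<gamma>" and a = "\<lambda>\<epsilon>. if \<epsilon> = \<beta> then \<kappa> \<beta> else 0" and b = "\<lambda>\<epsilon>. if \<epsilon> = \<gamma> then \<kappa> \<gamma> else 0", OF E[OF \<beta>] E[OF \<gamma>]])
    also have "\<dots> = (\<Sum>\<epsilon>\<in>?S. if \<epsilon> = \<beta> then (if \<beta> = \<gamma> then \<kappa> \<beta> * cnj (\<kappa> \<beta>) * of_real (norm_sq \<beta>) else 0) else 0)"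
      by (intro sum.cong) auto
    also have "\<dots> = (if \<beta> = \<gamma> then \<kappa> \<beta> * cnj (\<kappa> \<beta>) * of_real (norm_sq \<beta>) else 0)" using \<beta> by (simp add: finite_compositions)
    also have "\<kappa> \<beta> * cnj (\<kappa> \<beta>) * of_real (norm_sq \<beta>) = of_real ((1 / (c * norm_sq \<beta>)) * norm_sq \<beta>)"
    proof -
      have "0 \<le> c * norm_sq \<beta>" using c pos[OF \<beta>] by simp
      then have "(1 / sqrt (c * norm_sq \<beta>)) * (1 / sqrt (c * norm_sq \<beta>)) = 1 / (c * norm_sq \<beta>)" by simp
      then show ?thesis unfolding \<kappa>_def complex_cnj_complex_of_real by (metis of_real_mult)
    qed
    finally show ?thesis using c pos[OF \<beta>] by (cases "\<beta> = \<gamma>") simp_all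
  qed
  show ?thesis
  proof (intro exI[of _ "\<lambda>i. E (b i)"] conjI allI impI)
    show "inj_on (\<lambda>i. E (b i)) {..<N}"
    proof -
      have "inj_on E (b ` {..<N})" unfolding bij_betw_imp_surj_on[OF b] by (rule B(1))
      from comp_inj_on[OF bij_betw_imp_inj_on[OF b] this] show ?thesis by (simp only: o_def)
    qed
    show "sections.independent ((\<lambda>i. E (b i)) ` {..<N})" unfolding img by (rule B(2))
    show "sections.span ((\<lambda>i. E (b i)) ` {..<N}) = adjoint_sections (d + CARD('n) + 1)" unfolding img by (rule B(3))
    fix i j assume "i < N" "j < N"
    then have "b i \<in> ?S" "b j \<in> ?S" "b i = b j \<longleftrightarrow> i = j" using b by (auto simp: bij_betw_def inj_on_def)
    then show "of_real c * ip (E (b i)) (E (b j)) = (if i = j then 1 else 0)" by (simp add: ipE)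
  qed
qed

text \<open>As monomials are orthogonal, the Gram matrix is U D U^* with D diagonal. Only D depends
  on the weight.\<close>

lemma gram_matrix_factorization:
  assumes b: "bij_betw b {..<N} (compositions d :: ('n option \<Rightarrow> nat) set)"
    and s: "\<And>i w. i < N \<Longrightarrow> s i None w = (\<Sum>\<beta>\<in>compositions d. U i \<beta> * monomial_section \<beta> None w)"
  shows "Determinant.det (Matrix.mat N N (\<lambda>(i, j). of_real c * ip (s i) (s j))) =
    Determinant.det (Matrix.mat N N (\<lambda>(i, j). U i (b j))) * (\<Prod>\<beta>\<in>compositions d. of_real (c * norm_sq \<beta>)) *
      Determinant.det (Matrix.mat N N (\<lambda>(i, j). cnj (U j (b i))))"
proof -
  define A where "A = Matrix.mat N N (\<lambda>(i, j). U i (b j))"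
  define D where "D = Matrix.mat N N (\<lambda>(i, j). if i = j then complex_of_real (c * norm_sq (b i)) else 0)"
  define A' where "A' = Matrix.mat N N (\<lambda>(i, j). cnj (U j (b i)))"
  have carr: "A \<in> carrier_mat N N" "D \<in> carrier_mat N N" "A' \<in> carrier_mat N N" by (auto simp: A_def D_def A'_def)
  have "Matrix.mat N N (\<lambda>(i, j). of_real c * ip (s i) (s j)) = A * D * A'"
  proof (rule eq_matI)
    fix i j assume ij: "i < dim_row (A * D * A')" "j < dim_col (A * D * A')"
    then have i: "i < N" and j: "j < N" using carr by auto
    have AD: "(A * D) $$ (i, l) = U i (b l) * of_real (c * norm_sq (b l))" if l: "l < N" for l
    proof -
      have "(A * D) $$ (i, l) = (\<Sum>q = 0..<N. U i (b q) * (if q = l then complex_of_real (c * norm_sq (b q)) else 0))"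
        using i l carr by (simp add: A_def D_def scalar_prod_def)
      also have "\<dots> = (\<Sum>q = 0..<N. if q = l then U i (b l) * complex_of_real (c * norm_sq (b l)) else 0)"
        by (intro sum.cong) auto
      finally show ?thesis using l by simp
    qed
    have "(A * D * A') $$ (i, j) = (\<Sum>l = 0..<N. (A * D) $$ (i, l) * A' $$ (l, j))"
    proof -
      define P where "P = A * D"
      have "P \<in> carrier_mat N N" using carr by (simp add: P_def)
      then show ?thesis unfolding P_def[symmetric] using i j carr by (simp add: scalar_prod_def)
    qed
    also have "\<dots> = (\<Sum>l\<in>{..<N}. U i (b l) * of_real (c * norm_sq (b l)) * cnj (U j (b l)))"
      using AD j unfolding lessThan_atLeast0 by (intro sum.cong refl) (auto simp: A'_def)
    also have "\<dots> = (\<Sum>\<beta>\<in>compositions d. U i \<beta> * of_real (c * norm_sq \<beta>) * cnj (U j \<beta>))"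
      by (rule sum.reindex_bij_betw[OF b])
    also have "\<dots> = of_real c * ip (s i) (s j)"
      unfolding ip_sum_monomials[where s = "s i" and t = "s j" and a = "U i" and b = "U j", OF s[OF i] s[OF j]] sum_distrib_left by (intro sum.cong refl) (simp add: mult_ac)
    finally show "Matrix.mat N N (\<lambda>(i, j). of_real c * ip (s i) (s j)) $$ (i, j) = (A * D * A') $$ (i, j)"
      using i j by simp
  qed (use carr in auto)
  then have "Determinant.det (Matrix.mat N N (\<lambda>(i, j). of_real c * ip (s i) (s j))) = Determinant.det A * Determinant.det D * Determinant.det A'"
    using carr by (simp add: det_mult[of _ N])
  also have "Determinant.det D = (\<Prod>\<beta>\<in>compositions d. of_real (c * norm_sq \<beta>))"
  proof -
    have "Determinant.det D = prod_list (diag_mat D)"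
      by (rule det_upper_triangular[OF _ carr(2)]) (auto simp: D_def upper_triangular_def)
    also have "\<dots> = (\<Prod>i\<in>{..<N}. of_real (c * norm_sq (b i)))"
      unfolding prod_list_diag_prod by (auto simp: D_def lessThan_atLeast0 intro!: prod.cong)
    also have "\<dots> = (\<Prod>\<beta>\<in>compositions d. of_real (c * norm_sq \<beta>))"
      by (rule prod.reindex_bij_betw[OF b])
    finally show ?thesis .
  qed
  finally show ?thesis by (simp add: A_def A'_def)
qed

end

text \<open>The matrices that express the \<open>s i\<close> through monomials cancel against those in the Gram matrix of
  \<open>\<rho>0\<close>.\<close>

lemma gram_det:
  fixes \<rho> \<rho>0 :: "complex^'n::finite \<Rightarrow> real"
  assumes "toric_weight \<rho> d" and "toric_weight \<rho>0 d" and c: "0 < c"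
    and pos: "\<And>\<beta>. \<beta> \<in> compositions d \<Longrightarrow> 0 < toric_weight.norm_sq \<rho>0 \<beta>"
    and N: "N = card (compositions d :: ('n option \<Rightarrow> nat) set)"
    and s: "\<And>i. i < N \<Longrightarrow> s i \<in> adjoint_sections (d + CARD('n) + 1)"
    and orth: "\<And>i j. i < N \<Longrightarrow> j < N \<Longrightarrow> of_real c * toric_weight.ip \<rho>0 (s i) (s j) = (if i = j then 1 else 0)"
  shows "Determinant.det (Matrix.mat N N (\<lambda>(i, j). of_real c * toric_weight.ip \<rho> (s i) (s j))) =
    of_real (\<Prod>\<beta>\<in>compositions d. toric_weight.norm_sq \<rho> \<beta> / toric_weight.norm_sq \<rho>0 \<beta>)"
proof -
  interpret W: toric_weight \<rho> d by fact
  interpret W0: toric_weight \<rho>0 d by fact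
  let ?S = "compositions d :: ('n option \<Rightarrow> nat) set"
  obtain b where b: "bij_betw b {..<N} ?S"
    using ex_bij_betw_nat_finite[OF finite_compositions] unfolding N lessThan_atLeast0 by blast
  have "\<forall>i\<in>{..<N}. \<exists>c. \<forall>w. s i None w = (\<Sum>\<beta>\<in>?S. c \<beta> * monomial_section \<beta> None w)"
    using adjoint_section_None[OF s] by blast
  then obtain U where U: "\<And>i w. i < N \<Longrightarrow> s i None w = (\<Sum>\<beta>\<in>?S. U i \<beta> * monomial_section \<beta> None w)"
    by (metis lessThan_iff)
  let ?dA = "Determinant.det (Matrix.mat N N (\<lambda>(i, j). U i (b j)))" and ?dA' = "Determinant.det (Matrix.mat N N (\<lambda>(i, j). cnj (U j (b i))))"
  have "Matrix.mat N N (\<lambda>(i, j). of_real c * W0.ip (s i) (s j)) = (1\<^sub>m N :: complex Matrix.mat)"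
    by (rule eq_matI) (auto simp: orth)
  then have one: "1 = ?dA * (\<Prod>\<beta>\<in>?S. of_real (c * W0.norm_sq \<beta>)) * ?dA'"
    using W0.gram_matrix_factorization[where U = U and s = s and b = b and N = N and c = c, OF b U] by simp
  have P0: "(\<Prod>\<beta>\<in>?S. complex_of_real (c * W0.norm_sq \<beta>)) \<noteq> 0" 
  proof
    assume "(\<Prod>\<beta>\<in>?S. complex_of_real (c * W0.norm_sq \<beta>)) = 0"
    then obtain \<beta> where "\<beta> \<in> ?S" "c * W0.norm_sq \<beta> = 0"
      using finite_compositions[where 'a = "'n option" and d = d] by auto
    then show False using c pos[of \<beta>] by simp
  qed
  then have dd: "?dA * ?dA' = 1 / (\<Prod>\<beta>\<in>?S. of_real (c * W0.norm_sq \<beta>))"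
    using one by (simp add: field_simps)
  have "Determinant.det (Matrix.mat N N (\<lambda>(i, j). of_real c * W.ip (s i) (s j))) =
      (?dA * ?dA') * (\<Prod>\<beta>\<in>?S. of_real (c * W.norm_sq \<beta>))"
    using W.gram_matrix_factorization[where U = U and s = s and b = b and N = N and c = c, OF b U] by (simp add: mult_ac)
  also have "\<dots> = (\<Prod>\<beta>\<in>?S. complex_of_real (c * W.norm_sq \<beta>) / of_real (c * W0.norm_sq \<beta>))"
    by (simp only: dd prod_dividef times_divide_eq_left mult_1_left)
  also have "\<dots> = (\<Prod>\<beta>\<in>?S. complex_of_real (W.norm_sq \<beta> / W0.norm_sq \<beta>))"
    using c by (intro prod.cong) auto
  finally show ?thesis by simp
qed

section \<open>Invariant metrics\<close>

text \<open>Second derivatives are taken in fixed pairs of directions, which is the form that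
  \<open>Ck\<close> provides and that \<open>ddc\<close> evaluates.\<close>

definition C2_complex :: "(complex^'n \<Rightarrow> real) \<Rightarrow> (complex^'n \<Rightarrow> complex^'n \<Rightarrow> real)
    \<Rightarrow> (complex^'n \<Rightarrow> complex^'n \<Rightarrow> complex^'n \<Rightarrow> real) \<Rightarrow> bool" where
  "C2_complex f P Q \<longleftrightarrow> (\<forall>w. (f has_derivative P w) (at w)) \<and>
     (\<forall>v w. ((\<lambda>w. P w v) has_derivative Q w v) (at w)) \<and>
     (\<forall>v v'. continuous_on UNIV (\<lambda>w. Q w v v'))"

lemma C2_complexD:
  assumes "C2_complex f P Q"
  shows "(f has_derivative P w) (at w)" "((\<lambda>w. P w v) has_derivative Q w v) (at w)"
    "continuous_on UNIV (\<lambda>w. Q w v v')" "continuous_on UNIV f" "continuous_on UNIV (\<lambda>w. P w v)"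
proof -
  show 1: "(f has_derivative P w) (at w)" and 2: "((\<lambda>w. P w v) has_derivative Q w v) (at w)" for w v
    using assms by (simp_all add: C2_complex_def)
  show "continuous_on UNIV (\<lambda>w. Q w v v')" using assms by (simp add: C2_complex_def)
  show "continuous_on UNIV f" by (intro continuous_at_imp_continuous_on ballI has_derivative_continuous[OF 1])
  show "continuous_on UNIV (\<lambda>w. P w v)" by (intro continuous_at_imp_continuous_on ballI has_derivative_continuous[OF 2])
qed

lemma smooth_C2_complex:
  fixes f :: "complex^'n \<Rightarrow> real"
  assumes "smooth f"
  shows "\<exists>P Q. C2_complex f P Q"
proof -
  have "Ck (Suc (Suc 0)) f" using assms by (simp add: smooth_def)
  then have "C2_complex f (\<lambda>w. frechet_derivative f (at w))
      (\<lambda>w v. frechet_derivative (\<lambda>w. frechet_derivative f (at w) v) (at w))"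
    by (simp add: C2_complex_def frechet_derivative_works[symmetric])
  then show ?thesis by blast
qed

lemma C2_complex_ln:
  assumes f: "C2_complex f P Q" and pos: "\<And>w. 0 < f w"
  shows "\<exists>P Q. C2_complex (\<lambda>w. ln (f w)) P Q"
proof -
  note D = C2_complexD[OF f]
  have nz: "f w \<noteq> 0" for w using pos[of w] by simp
  have "C2_complex (\<lambda>w. ln (f w)) (\<lambda>w v. P w v / f w)
     (\<lambda>w v v'. (Q w v v' * f w - P w v * P w v') / (f w * f w))"
    unfolding C2_complex_def
  proof (intro conjI allI)
    fix w v v'
    show "((\<lambda>w. ln (f w)) has_derivative (\<lambda>v. P w v / f w)) (at w)"
      by (rule has_derivative_eq_rhs[OF has_derivative_compose[OF D(1) DERIV_ln[OF pos, THEN has_field_derivative_imp_has_derivative]]])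
         (simp add: divide_inverse mult.commute)
    show "((\<lambda>w. P w v / f w) has_derivative (\<lambda>v'. (Q w v v' * f w - P w v * P w v') / (f w * f w))) (at w)"
      by (rule has_derivative_divide'[OF D(2) D(1) nz])
    show "continuous_on UNIV (\<lambda>w. (Q w v v' * f w - P w v * P w v') / (f w * f w))"
      by (intro continuous_on_divide continuous_on_diff continuous_on_mult D ballI) (simp add: nz)
  qed
  then show ?thesis by blast
qed

lemma C2_complex_scale:
  assumes "C2_complex f P Q"
  shows "C2_complex (\<lambda>w. c * f w) (\<lambda>w v. c * P w v) (\<lambda>w v v'. c * Q w v v')"
  using C2_complexD[OF assms] by (auto simp: C2_complex_def intro!: has_derivative_mult_right continuous_on_mult_left)

lemma C2_complex_add:
  assumes "C2_complex f P Q" "C2_complex f' P' Q'"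
  shows "C2_complex (\<lambda>w. f w + f' w) (\<lambda>w v. P w v + P' w v) (\<lambda>w v v'. Q w v v' + Q' w v v')"
  using C2_complexD[OF assms(1)] C2_complexD[OF assms(2)]
  by (auto simp: C2_complex_def intro!: has_derivative_add continuous_on_add)

lemma ddc_C2_complex:
  assumes "C2_complex f P Q"
  shows "ddc f w $ j $ k = ((of_real (Q w (axis k 1) (axis j 1)) + \<i> * of_real (Q w (axis k \<i>) (axis j 1))) -
    \<i> * (of_real (Q w (axis k 1) (axis j \<i>)) + \<i> * of_real (Q w (axis k \<i>) (axis j \<i>)))) / (4 * of_real pi)"
proof -
  note D = C2_complexD[OF assms]
  have first: "dzbar k (\<lambda>x. of_real (f x)) = (\<lambda>w. (of_real (P w (axis k 1)) + \<i> * of_real (P w (axis k \<i>))) * (1 / 2))" for k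
    using dzbar_eq[OF has_derivative_of_real[OF D(1)]] by (auto simp: fun_eq_iff)
  have "((\<lambda>w. (complex_of_real (P w (axis k 1)) + \<i> * of_real (P w (axis k \<i>))) * (1 / 2)) has_derivative
      (\<lambda>v. (of_real (Q w (axis k 1) v) + \<i> * of_real (Q w (axis k \<i>) v)) * (1 / 2))) (at w)"
    by (intro has_derivative_mult_left has_derivative_add has_derivative_mult_right has_derivative_of_real D)
  from dz_eq[OF this, of j] have dz: "ddc f w $ j $ k = ((of_real (Q w (axis k 1) (axis j 1)) + \<i> * of_real (Q w (axis k \<i>) (axis j 1))) * (1 / 2) -
    \<i> * ((of_real (Q w (axis k 1) (axis j \<i>)) + \<i> * of_real (Q w (axis k \<i>) (axis j \<i>))) * (1 / 2))) / 2 / of_real pi"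
    by (simp only: ddc_def first vec_lambda_beta)
  have "a * (1 / 2) - \<i> * (b * (1 / 2)) = (a - \<i> * b) / 2" for a b by (simp add: diff_divide_distrib)
  then show ?thesis unfolding dz by (simp only: divide_divide_eq_left) simp
qed

lemma ddc_scale: "C2_complex f P Q \<Longrightarrow> ddc (\<lambda>w. c * f w) w = c *\<^sub>R ddc f w"
  by (simp add: Finite_Cartesian_Product.vec_eq_iff ddc_C2_complex ddc_C2_complex[OF C2_complex_scale])
    (simp add: scaleR_conv_of_real algebra_simps)

lemma ddc_add: "C2_complex f P Q \<Longrightarrow> C2_complex f' P' Q' \<Longrightarrow> ddc (\<lambda>w. f w + f' w) w = ddc f w + ddc f' w"
  by (simp add: Finite_Cartesian_Product.vec_eq_iff ddc_C2_complex ddc_C2_complex[OF C2_complex_add])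
    (simp add: add_divide_distrib diff_divide_distrib algebra_simps)

lemma continuous_on_ddc: "C2_complex f P Q \<Longrightarrow> continuous_on UNIV (\<lambda>w. ddc f w $ j $ k)"
  unfolding ddc_C2_complex by (intro continuous_intros C2_complexD(3)) auto

text \<open>\<open>exp_half\<close> has real entries, so only derivatives in the directions
  \<open>axis k 1\<close> enter. The diagonal term of the Hessian comes from differentiating exp
  (x_k / 2) a second time.\<close>

lemma C2_comp_exp_half:
  fixes f :: "complex^'n \<Rightarrow> real"
  assumes f: "C2_complex f P' Q'"
  shows "\<exists>g H. C2 (\<lambda>x. f (exp_half x)) g H"
proof -
  note D = C2_complexD[OF f]
  define P where "P k w = P' w (axis k 1)" for k :: 'n and w
  define Q where "Q k j w = Q' w (axis k 1) (axis j 1)" for k j :: 'n and w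
  have f_diff: "f differentiable (at w)" and P_diff: "P k differentiable (at w)" for w k
    using D(1,2) by (auto simp: P_def[abs_def] differentiable_def)
  have fP: "frechet_derivative f (at w) (axis k 1) = P k w" for k w
    unfolding P_def by (rule fun_cong[OF frechet_derivative_at[OF D(1), symmetric]])
  have PQ: "frechet_derivative (P k) (at w) (axis j 1) = Q k j w" for k j w
    unfolding P_def[abs_def] Q_def by (rule fun_cong[OF frechet_derivative_at[OF D(2), symmetric]])
  have Q_cont: "continuous_on UNIV (Q k j)" and P_cont: "continuous_on UNIV (P k)" for k j
    using D(3,5) by (simp_all add: P_def[abs_def] Q_def[abs_def])
  define c where "c k x = exp (x $ k / 2) / 2" for k :: 'n and x :: "real^'n"
  define g where "g x = (\<chi> k. c k x * P k (exp_half x))" for x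
  define H where "H x = (\<chi> k j. c k x * (c j x * Q k j (exp_half x)) + (if j = k then c k x / 2 * P k (exp_half x) else 0))" for x
  have c_der: "(c k has_derivative (\<lambda>v. c k x / 2 * v $ k)) (at x)" for k x
    unfolding c_def by (auto intro!: derivative_eq_intros has_derivative_vec_nth)
  have "C2 (\<lambda>x. f (exp_half x)) g H"
    unfolding C2_def
  proof (intro conjI allI)
    fix x
    show "((\<lambda>x. f (exp_half x)) has_derivative (\<lambda>v. g x \<bullet> v)) (at x)"
      using has_derivative_comp_exp_half[OF f_diff, of x]
      by (rule has_derivative_eq_rhs) (simp add: fun_eq_iff g_def inner_vec_def c_def fP mult_ac)
    have "((\<lambda>x. c k x * P k (exp_half x)) has_derivative
       (\<lambda>v. c k x * (\<Sum>j\<in>UNIV. c j x * v $ j * Q k j (exp_half x)) + c k x / 2 * v $ k * P k (exp_half x))) (at x)" for k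
    proof -
      have pk: "((\<lambda>x. P k (exp_half x)) has_derivative (\<lambda>v. \<Sum>j\<in>UNIV. c j x * v $ j * Q k j (exp_half x))) (at x)"
        unfolding PQ[symmetric] c_def by (rule has_derivative_comp_exp_half) (rule P_diff)
      show ?thesis by (rule has_derivative_mult[OF c_der pk])
    qed
    from has_derivative_vec_lambda[OF this]
    show "(g has_derivative (\<lambda>v. H x *v v)) (at x)"
      unfolding g_def[abs_def]
    proof (rule has_derivative_eq_rhs)
      show "(\<lambda>v. \<chi> k. c k x * (\<Sum>j\<in>UNIV. c j x * v $ j * Q k j (exp_half x)) + c k x / 2 * v $ k * P k (exp_half x)) = (\<lambda>v. H x *v v)"
      proof (intro ext Finite_Cartesian_Product.vec_eq_iff[THEN iffD2] allI)
        fix v k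
        have "(H x *v v) $ k = (\<Sum>j\<in>UNIV. c k x * (c j x * v $ j * Q k j (exp_half x)) + (if j = k then c k x / 2 * v $ k * P k (exp_half x) else 0))"
          unfolding matrix_vector_mult_def H_def by (simp only: vec_lambda_beta) (intro sum.cong refl, auto simp: algebra_simps)
        also have "\<dots> = c k x * (\<Sum>j\<in>UNIV. c j x * v $ j * Q k j (exp_half x)) + c k x / 2 * v $ k * P k (exp_half x)"
          unfolding sum.distrib sum_distrib_left[symmetric] by simp
        finally show "(\<chi> k. c k x * (\<Sum>j\<in>UNIV. c j x * v $ j * Q k j (exp_half x)) + c k x / 2 * v $ k * P k (exp_half x)) $ k = (H x *v v) $ k"
          by simp
      qed
    qed
    have cc: "continuous_on UNIV (c k)" for k
      by (intro continuous_at_imp_continuous_on ballI has_derivative_continuous[OF c_der])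
    have cQ: "continuous_on UNIV (\<lambda>x. Q k j (exp_half x))" and cP: "continuous_on UNIV (\<lambda>x. P k (exp_half x))" for k j
      by (rule continuous_on_compose2[OF Q_cont continuous_on_exp_half] continuous_on_compose2[OF P_cont continuous_on_exp_half]; simp)+
    show "continuous_on UNIV H"
      unfolding H_def[abs_def]
    proof (intro continuous_on_vec_lambda)
      fix k j
      show "continuous_on UNIV (\<lambda>x. c k x * (c j x * Q k j (exp_half x)) + (if j = k then c k x / 2 * P k (exp_half x) else 0))"
        by (cases "j = k") (simp_all, (intro continuous_intros cc cP cQ; simp)+)
    qed
  qed
  then show ?thesis by blast
qed

section \<open>Charts, invariant metrics and their potentials in logarithmic coordinates\<close>

lemma line_scale:
  assumes c: "c \<noteq> 0"
  shows "line (c *s z) = line z"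
proof -
  have "range (\<lambda>a. a *s (c *s z)) = range (\<lambda>a. a *s z)"
  proof (intro subset_antisym subsetI)
    fix y assume "y \<in> range (\<lambda>a. a *s (c *s z))"
    then show "y \<in> range (\<lambda>a. a *s z)" by (auto simp: vector_smult_assoc)
  next
    fix y assume "y \<in> range (\<lambda>a. a *s z)"
    then obtain a where "y = a *s z" by blast
    then have "y = (a / c) *s (c *s z)" using c by (simp add: vector_smult_assoc)
    then show "y \<in> range (\<lambda>a. a *s (c *s z))" by blast
  qed
  then show ?thesis by (simp add: line_def)
qed

lemma chart_lift_nonzero: "chart_lift i w \<noteq> 0"
proof
  assume "chart_lift i w = 0"
  then have "chart_lift i w $ i = 0" by simp
  then show False by (simp add: chart_lift_nth)
qed

text \<open>Dividing by the homogeneous coordinate of largest modulus lands in the unit polydisc of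
  its chart, so finitely many compact polydiscs control all of projective space.\<close>

lemma polydisc_chart:
  fixes w :: "complex^'n::finite"
  shows "\<exists>i v. chart_lift None w $ i \<noteq> 0 \<and> (\<forall>a. norm (chart_lift None w $ a) \<le> norm (chart_lift None w $ i)) \<and>
    (\<forall>k. norm (v $ k) \<le> 1) \<and> chart_lift None w = (chart_lift None w $ i) *s chart_lift i v"
proof -
  let ?z = "chart_lift None w"
  have "Max (range (\<lambda>a. norm (?z $ a))) \<in> range (\<lambda>a. norm (?z $ a))" by (rule Max_in) auto
  then obtain i where i': "Max (range (\<lambda>a. norm (?z $ a))) = norm (?z $ i)" by blast
  have i: "norm (?z $ a) \<le> norm (?z $ i)" for a unfolding i'[symmetric] by (rule Max_ge) auto
  have "norm (?z $ None) = 1" by (simp add: chart_lift_nth)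
  then have nz: "?z $ i \<noteq> 0" using i[of None] by auto
  define v where "v = transition None i w"
  have v: "chart_lift i v $ a = ?z $ a / ?z $ i" for a
    unfolding v_def by (rule chart_lift_transition[OF nz])
  have "norm (v $ k) \<le> 1" for k
  proof -
    have "\<exists>a. chart_lift i v $ a = v $ k"
    proof (cases "i = Some k")
      case True
      then show ?thesis by (intro exI[of _ None]) (simp add: chart_lift_nth slot_def)
    next
      case False
      then show ?thesis by (intro exI[of _ "Some k"]) (auto simp: chart_lift_nth slot_def)
    qed
    then obtain a where a: "v $ k = ?z $ a / ?z $ i" using v by metis
    show ?thesis unfolding a norm_divide using i[of a] nz by (simp add: divide_le_eq)
  qed
  moreover have "?z = (?z $ i) *s chart_lift i v"
    using nz by (simp add: Finite_Cartesian_Product.vec_eq_iff v)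
  ultimately show ?thesis using i nz by blast
qed

text \<open>The mean of the Dirichlet density and at the same time the exponent of the monomial in
  the integral for its norm.\<close>

definition barycentre :: "('n option \<Rightarrow> nat) \<Rightarrow> real^'n" where
  "barycentre \<beta> = (\<chi> k. real (\<beta> (Some k)) + 1)"

text \<open>The order of quantifiers is the point: \<open>r\<close>, \<open>c\<close> and hence K
  come from the Dirichlet density alone, before any potential is given.\<close>

lemma kernel_estimate:
  fixes \<beta> :: "'n::finite option \<Rightarrow> nat"
  assumes \<beta>: "\<beta> \<in> compositions d" and m: "m = real (d + CARD('n) + 1)"
  shows "\<exists>K>0. \<forall>\<phi> g H C. toric_potential \<phi> g H m C \<longrightarrow>
    integrable lborel (\<lambda>x. exp (x \<bullet> barycentre \<beta> - \<phi> x)) \<and>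
    integrable lborel (\<lambda>p. dirichlet m \<beta> p * toric_potential.legendre \<phi> g p) \<and>
    (LINT x|lborel. exp (x \<bullet> barycentre \<beta> - \<phi> x)) \<le>
      K * exp (LINT p|lborel. dirichlet m \<beta> p * toric_potential.legendre \<phi> g p)"
proof -
  obtain r c where r: "0 < r" and c: "0 < c" and rc: "\<And>p. (\<And>k. \<bar>p $ k - (real (\<beta> (Some k)) + 1)\<bar> \<le> 2 * r) \<Longrightarrow>
      p \<in> open_simplex m \<and> c \<le> dirichlet m \<beta> p"
    using dirichlet_lower_bound[OF \<beta> m] by blast
  obtain Q where Q: "\<And>p. dirichlet m \<beta> p \<le> Q * indicator (open_simplex m) p"
    using dirichlet_bound[OF \<beta> m] by blast
  let ?k = "kernel_const TYPE('n) r c"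
  have b: "barycentre \<beta> $ k = real (\<beta> (Some k)) + 1" for k by (simp add: barycentre_def)
  have mem: "barycentre \<beta> \<in> open_simplex m"
    by (rule rc[THEN conjunct1]) (use r in \<open>simp add: b\<close>)
  have mean: "(LINT p|lborel. dirichlet m \<beta> p * p $ k) = barycentre \<beta> $ k" for k
    unfolding b by (rule dirichlet_mean[OF \<beta> m])
  have cube: "p \<in> open_simplex m \<and> c \<le> dirichlet m \<beta> p" if "\<And>k. \<bar>p $ k - barycentre \<beta> $ k\<bar> \<le> 2 * r" for p
    by (rule rc) (use that in \<open>simp add: b\<close>)
  show ?thesis
  \<comment> \<open>The maximum with 1 makes the constant evidently positive, so that its logarithm
    may be taken.\<close>
  proof (intro exI[of _ "max ?k 1"] conjI allI impI)
    fix \<phi> :: "real^'n \<Rightarrow> real" and g H C assume "toric_potential \<phi> g H m C"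
    then interpret T: toric_potential \<phi> g H m C .
    note est = mem measurable_dirichlet[OF \<beta> m] dirichlet_nonneg[OF \<beta> m] Q dirichlet_mass[OF \<beta> m] mean r c cube
    show "integrable lborel (\<lambda>x. exp (x \<bullet> barycentre \<beta> - \<phi> x))" by (rule T.integrable_exp_\<phi>[OF est])
    show "integrable lborel (\<lambda>p. dirichlet m \<beta> p * T.legendre p)" by (rule T.integrable_kernel_legendre[OF est])
    have "(LINT x|lborel. exp (x \<bullet> barycentre \<beta> - \<phi> x)) \<le> ?k * exp (LINT p|lborel. dirichlet m \<beta> p * T.legendre p)"
      by (rule T.integral_exp_\<phi>_le[OF est])
    also have "\<dots> \<le> max ?k 1 * exp (LINT p|lborel. dirichlet m \<beta> p * T.legendre p)" by (intro mult_right_mono) auto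
    finally show "(LINT x|lborel. exp (x \<bullet> barycentre \<beta> - \<phi> x)) \<le> max ?k 1 * exp (LINT p|lborel. dirichlet m \<beta> p * T.legendre p)" .
  qed simp
qed

lemma integral_pos_of_pos:
  fixes f :: "'a::euclidean_space \<Rightarrow> real"
  assumes f: "integrable lborel f" and pos: "\<And>x. 0 < f x"
  shows "0 < (LINT x|lborel. f x)"
proof -
  have "(LINT x|lborel. f x) \<noteq> 0"
  proof
    assume "(LINT x|lborel. f x) = 0"
    then have "AE x in lborel. f x = 0"
      using integral_nonneg_eq_0_iff_AE[OF f] pos by (simp add: less_imp_le)
    then have "AE x::'a in lborel. False" by eventually_elim (use pos in \<open>auto simp: less_le\<close>)
    then have "ae_filter (lborel :: 'a measure) = bot" by (simp only: eventually_False)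
    then show False unfolding ae_filter_eq_bot_iff by simp
  qed
  moreover have "0 \<le> (LINT x|lborel. f x)" using pos by (intro integral_nonneg_AE AE_I2 less_imp_le)
  ultimately show ?thesis by linarith
qed

text \<open>Instances are the powers of the reference metric and their twists by invariant
  potentials. Regularity and curvature are recorded in the chart \<open>None\<close>, where the
  integrals are taken; continuity in all charts supplies the behaviour at infinity.\<close>

locale toric_metric =
  fixes h :: "complex^('n::finite option) \<Rightarrow> real" and d :: nat and m :: real
  assumes m_eq: "m = real (d + CARD('n) + 1)"
    and h_pos: "z \<noteq> 0 \<Longrightarrow> 0 < h z"
    and h_scale: "c \<noteq> 0 \<Longrightarrow> z \<noteq> 0 \<Longrightarrow> h (c *s z) = h z / norm c ^ (2 * (d + CARD('n) + 1))"
    and h_cont: "continuous_on UNIV (\<lambda>w. h (chart_lift i w))"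
    and h_torus: "torus_invariant h"
    and h_C2: "\<exists>P Q. C2_complex (\<lambda>w. ln (h (chart_lift None w))) P Q"
    and h_positive: "positive_form (curvature h None w)"
begin

definition pot :: "complex^'n \<Rightarrow> real" where "pot w = - ln (h (chart_lift None w))"

definition \<phi> :: "real^'n \<Rightarrow> real" where "\<phi> x = pot (exp_half x)"

text \<open>Scaling by the largest homogeneous coordinate, whose 2m-th power has modulus exp (m
  \<open>pos_max\<close> x), leaves the logarithm of the metric on a compact polydisc, where it is
  bounded.\<close>

lemma pot_growth: "\<exists>C. \<forall>x. \<bar>\<phi> x - m * pos_max x\<bar> \<le> C"
proof -
  let ?K = "{w::complex^'n. \<forall>k. norm (w $ k) \<le> 1}"
  have pos: "0 < h (chart_lift i w)" for i w by (rule h_pos[OF chart_lift_nonzero])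
  have "continuous_on ?K (\<lambda>w. ln (h (chart_lift i w)))" for i
    by (intro continuous_on_ln continuous_on_subset[OF h_cont] ballI) (auto simp: less_imp_neq[OF pos, THEN not_sym])
  then have "\<exists>M. \<forall>w\<in>?K. \<bar>ln (h (chart_lift i w))\<bar> \<le> M" for i
    using compact_imp_bounded[OF compact_continuous_image[OF _ compact_polydisc]] by (force simp: bounded_iff)
  then obtain M where M: "\<And>i w. w \<in> ?K \<Longrightarrow> \<bar>ln (h (chart_lift i w))\<bar> \<le> M i" by metis
  define C where "C = (\<Sum>i\<in>UNIV. \<bar>M i\<bar>)"
  have MC: "\<bar>M i\<bar> \<le> C" for i unfolding C_def by (rule member_le_sum) auto
  have "\<bar>\<phi> x - m * pos_max x\<bar> \<le> C" for x
  proof -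
    let ?z = "chart_lift None (exp_half x)"
    obtain i v where nz: "?z $ i \<noteq> 0" and i: "\<And>a. norm (?z $ a) \<le> norm (?z $ i)"
      and v: "\<And>k. norm (v $ k) \<le> 1" and zv: "?z = (?z $ i) *s chart_lift i v"
      using polydisc_chart[of "exp_half x"] by metis
    have zNone: "norm (?z $ None) = exp (0 / 2)" and zSome: "norm (?z $ Some k) = exp (x $ k / 2)" for k
      by (simp_all add: chart_lift_nth slot_def exp_half_def)
    define a where "a = (case i of None \<Rightarrow> 0 | Some k \<Rightarrow> x $ k)"
    have a: "norm (?z $ i) = exp (a / 2)"
      unfolding a_def by (cases i) (simp_all add: zNone zSome del: exp_zero)
    have "0 \<le> a" "x $ k \<le> a" for k using i[of None] i[of "Some k"] unfolding a zNone zSome by simp_all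
    then have "pos_max x \<le> a" by (intro pos_max_le) auto
    moreover have "a \<le> pos_max x" unfolding a_def by (cases i) (simp_all add: pos_max_ge)
    ultimately have ap: "a = pos_max x" by simp
    have "h ?z = h (chart_lift i v) / norm (?z $ i) ^ (2 * (d + CARD('n) + 1))"
      by (subst zv, rule h_scale[OF nz chart_lift_nonzero])
    moreover have "norm (?z $ i) ^ (2 * (d + CARD('n) + 1)) = exp (m * a)"
    proof -
      have "exp (a / 2) ^ (2 * (d + CARD('n) + 1)) = exp (real (2 * (d + CARD('n) + 1)) * (a / 2))"
        by (rule exp_of_nat_mult[symmetric])
      also have "real (2 * (d + CARD('n) + 1)) * (a / 2) = m * a" by (simp add: m_eq)
      finally show ?thesis unfolding a .
    qed
    ultimately have "h ?z = h (chart_lift i v) / exp (m * a)" by simp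
    then have "ln (h ?z) = ln (h (chart_lift i v)) - m * a" using pos[of i v] by (simp add: ln_div)
    then have "\<phi> x - m * pos_max x = - ln (h (chart_lift i v))" by (simp add: \<phi>_def pot_def ap)
    then show ?thesis using M[of v i] MC[of i] v by auto
  qed
  then show ?thesis by blast
qed

lemma h_rotation:
  assumes t: "\<And>k. norm (t $ k) = 1"
  shows "h (chart_lift None (rotation t w)) = h (chart_lift None w)"
proof -
  have "chart_lift None (rotation t w) = torus_action t (chart_lift None w)"
    by (simp add: Finite_Cartesian_Product.vec_eq_iff chart_lift_nth torus_action_def rotation_def slot_def split: option.split)
  then show ?thesis using h_torus t chart_lift_nonzero by (metis torus_invariant_def)
qed

lemma pot_log_sq:
  assumes w: "\<forall>k. w $ k \<noteq> 0"
  shows "pot w = \<phi> (log_sq w)"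
proof -
  define t where "t = (\<chi> k. w $ k / of_real (norm (w $ k)))"
  have t: "norm (t $ k) = 1" for k using w by (simp add: t_def norm_divide)
  have e: "exp_half (log_sq w) $ k = of_real (norm (w $ k))" for k
    using norm_exp_half_log_sq[of w k] w by (simp add: exp_half_def)
  have "w = rotation t (exp_half (log_sq w))"
    using w by (simp add: Finite_Cartesian_Product.vec_eq_iff rotation_def t_def e)
  then have "pot w = pot (rotation t (exp_half (log_sq w)))" by simp
  also have "\<dots> = \<phi> (log_sq w)" unfolding pot_def \<phi>_def h_rotation[OF t] ..
  finally show ?thesis .
qed

lemma pot_C2: "\<exists>P Q. C2_complex pot P Q"
  unfolding pot_def[abs_def] using h_C2 C2_complex_scale[of _ _ _ "-1"] by fastforce

lemma curvature_pot: "curvature h None w = ddc pot w"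
proof -
  obtain P Q where "C2_complex (\<lambda>w. ln (h (chart_lift None w))) P Q" using h_C2 by blast
  from ddc_scale[OF this, of "-1" w] show ?thesis by (simp add: curvature_def pot_def[abs_def])
qed

lemma continuous_on_curvature: "continuous_on UNIV (\<lambda>w. curvature h None w $ j $ k)"
  unfolding curvature_pot using pot_C2 continuous_on_ddc by blast

lemma potential_exists:
  "\<exists>g H C. C2 \<phi> g H \<and> toric_potential \<phi> g H m C \<and> 
    (\<forall>w. (\<forall>k. w $ k \<noteq> 0) \<longrightarrow> curvature h None w = (\<chi> j k. (1 / (of_real pi * w $ j)) * (1 / cnj (w $ k)) *
       complex_matrix (\<chi> j k. H (log_sq w) $ k $ j) $ j $ k))"
proof -
  obtain P Q where "C2_complex pot P Q" using pot_C2 by blast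
  from C2_comp_exp_half[OF this] obtain g H where C2: "C2 \<phi> g H" unfolding \<phi>_def[abs_def] by blast
  obtain C where C: "\<And>x. \<bar>\<phi> x - m * pos_max x\<bar> \<le> C" using pot_growth by blast
  have ddc: "curvature h None w = (\<chi> j k. (1 / (of_real pi * w $ j)) * (1 / cnj (w $ k)) * of_real (H (log_sq w) $ k $ j))"
    if "\<forall>k. w $ k \<noteq> 0" for w
    unfolding curvature_pot by (rule ddc_torus_invariant[where F = \<phi>, OF _ C2 that]) (rule pot_log_sq)
  have "toric_potential \<phi> g H m C"
  proof
    show "0 < v \<bullet> (H x *v v)" if v: "v \<noteq> 0" for x v
    proof (rule pos_def_of_positive_form[OF _ _ v])
      show nz: "\<forall>k. exp_half x $ k \<noteq> 0" by (simp add: exp_half_def)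
      show "positive_form (\<chi> j k. (1 / (of_real pi * exp_half x $ j)) * (1 / cnj (exp_half x $ k)) * of_real (H x $ k $ j))"
        using h_positive[of "exp_half x"] unfolding ddc[OF nz] log_sq_exp_half .
    qed
  qed (use C2_D[OF C2] C m_eq in auto)
  then show ?thesis using C2 ddc by (intro exI[of _ g] exI[of _ H] exI[of _ C]) (simp add: complex_matrix_def)
qed

text \<open>A fixed choice lets \<open>legendre\<close>, which takes the gradient as a parameter, be
  named as a function of the metric; Hessian and constant may stay existential.\<close>

definition grad :: "real^'n \<Rightarrow> real^'n" where "grad = (SOME g. \<exists>H C. C2 \<phi> g H \<and> toric_potential \<phi> g H m C \<and> 
    (\<forall>w. (\<forall>k. w $ k \<noteq> 0) \<longrightarrow> curvature h None w = (\<chi> j k. (1 / (of_real pi * w $ j)) * (1 / cnj (w $ k)) *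
       complex_matrix (\<chi> j k. H (log_sq w) $ k $ j) $ j $ k)))"

lemma grad:
  obtains H C where "C2 \<phi> grad H" "toric_potential \<phi> grad H m C"
    "\<And>w. (\<forall>k. w $ k \<noteq> 0) \<Longrightarrow> curvature h None w = (\<chi> j k. (1 / (of_real pi * w $ j)) * (1 / cnj (w $ k)) *
       complex_matrix (\<chi> j k. H (log_sq w) $ k $ j) $ j $ k)"
  using someI_ex[OF potential_exists, folded grad_def] by blast

definition weight :: "complex^'n \<Rightarrow> real" where "weight w = h (chart_lift None w)"

text \<open>In logarithmic coordinates |w^\<beta>|^2 is exp (\<Sum> \<beta>_k x_k) and the metric is
  exp (- \<phi> x); the density exp (\<Sum> x_k) of the image measure shifts \<beta> to \<beta> +
  1.\<close>

lemma monomial_norm_integral: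
  "(LINT w|lborel. (norm (monomial_section \<beta> None w))\<^sup>2 * weight w) =
     pi ^ CARD('n) * (LINT x|lborel. exp (x \<bullet> barycentre \<beta> - \<phi> x))" (is ?A)
  "integrable lborel (\<lambda>x. exp (x \<bullet> barycentre \<beta> - \<phi> x)) \<Longrightarrow>
     integrable lborel (\<lambda>w. (norm (monomial_section \<beta> None w))\<^sup>2 * weight w)" (is "_ \<Longrightarrow> ?B")
proof -
  obtain H C where "toric_potential \<phi> grad H m C" using grad by blast
  then interpret T: toric_potential \<phi> grad H m C .
  define F where "F x = exp (\<Sum>k\<in>UNIV. real (\<beta> (Some k)) * x $ k) * exp (- \<phi> x)" for x
  let ?f = "\<lambda>w. (norm (monomial_section \<beta> None w))\<^sup>2 * weight w"
  have F: "F \<in> borel_measurable borel"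
    unfolding F_def by (intro borel_measurable_continuous_onI continuous_intros T.continuous_\<phi>)
  have f: "?f \<in> borel_measurable borel"
    unfolding monomial_section_None weight_def by (intro borel_measurable_continuous_onI continuous_intros h_cont)
  have eq: "?f w = F (log_sq w)" if w: "\<forall>k. w $ k \<noteq> 0" for w
  proof -
    have "(norm (monomial_section \<beta> None w))\<^sup>2 = (\<Prod>k\<in>UNIV. exp (real (\<beta> (Some k)) * log_sq w $ k))"
    proof -
      have "(norm (monomial_section \<beta> None w))\<^sup>2 = (\<Prod>k\<in>UNIV. ((norm (w $ k))\<^sup>2) ^ \<beta> (Some k))"
        unfolding monomial_section_None by (simp add: prod_norm[symmetric] norm_power prod_power_distrib power_mult[symmetric] mult.commute)
      also have "\<dots> = (\<Prod>k\<in>UNIV. exp (real (\<beta> (Some k)) * log_sq w $ k))"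
        using w by (intro prod.cong refl) (simp add: log_sq_def exp_of_nat_mult)
      finally show ?thesis .
    qed
    also have "\<dots> = exp (\<Sum>k\<in>UNIV. real (\<beta> (Some k)) * log_sq w $ k)" by (simp add: exp_sum)
    moreover have "weight w = exp (- \<phi> (log_sq w))"
      unfolding pot_log_sq[OF w, symmetric] pot_def weight_def using h_pos[OF chart_lift_nonzero] by simp
    ultimately show ?thesis by (simp add: F_def)
  qed
  have FE: "(pi ^ CARD('n) * exp (\<Sum>k\<in>UNIV. x $ k)) *\<^sub>R F x = pi ^ CARD('n) * exp (x \<bullet> barycentre \<beta> - \<phi> x)" for x
  proof -
    have "x \<bullet> barycentre \<beta> - \<phi> x = (\<Sum>k\<in>UNIV. x $ k) + (\<Sum>k\<in>UNIV. real (\<beta> (Some k)) * x $ k) + - \<phi> x"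
      by (simp add: inner_vec_def barycentre_def sum.distrib[symmetric] algebra_simps)
    then show ?thesis by (simp only: F_def exp_add real_scaleR_def mult.assoc)
  qed
  show ?A using integral_log_sq[OF F f eq] unfolding FE by simp
  show ?B if "integrable lborel (\<lambda>x. exp (x \<bullet> barycentre \<beta> - \<phi> x))"
    using integrable_log_sq[OF F f eq] that unfolding FE by simp
qed

definition monomial_mass :: "('n option \<Rightarrow> nat) \<Rightarrow> real" where
  "monomial_mass \<beta> = (LINT x|lborel. exp (x \<bullet> barycentre \<beta> - \<phi> x))"

lemma integrable_monomial_mass:
  assumes "\<beta> \<in> compositions d"
  shows "integrable lborel (\<lambda>x. exp (x \<bullet> barycentre \<beta> - \<phi> x))"
  using kernel_estimate[OF assms m_eq] grad by metis

lemma monomial_mass_pos: "\<beta> \<in> compositions d \<Longrightarrow> 0 < monomial_mass \<beta>"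
  unfolding monomial_mass_def by (rule integral_pos_of_pos[OF integrable_monomial_mass]) auto

sublocale W: toric_weight weight d
proof
  show "weight \<in> borel_measurable borel"
    unfolding weight_def[abs_def] by (intro borel_measurable_continuous_onI h_cont)
  show "0 \<le> weight w" for w unfolding weight_def by (rule less_imp_le[OF h_pos[OF chart_lift_nonzero]])
  show "weight (rotation t w) = weight w" if "\<And>k. norm (t $ k) = 1" for t w
    unfolding weight_def by (rule h_rotation[OF that])
  show "integrable lborel (\<lambda>w. (norm (monomial_section \<beta> None w))\<^sup>2 * weight w)" if "\<beta> \<in> compositions d" for \<beta>
    by (rule monomial_norm_integral(2)[OF integrable_monomial_mass[OF that]])
qed

lemma norm_sq_eq: "W.norm_sq \<beta> = pi ^ CARD('n) * monomial_mass \<beta>"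
  unfolding W.norm_sq_def monomial_mass_def by (rule monomial_norm_integral(1))

end

section \<open>Volume and energy\<close>

lemma continuous_on_wedge_powers:
  fixes A B :: "'a::topological_space \<Rightarrow> complex^'n::finite^'n"
  assumes A: "\<And>j k. continuous_on S (\<lambda>x. A x $ j $ k)" and B: "\<And>j k. continuous_on S (\<lambda>x. B x $ j $ k)"
  shows "continuous_on S (\<lambda>x. wedge_powers l (A x) (B x))"
proof -
  have "continuous_on S (\<lambda>x. (if c then A x else B x) $ j $ k)" for c j k
    by (cases c) (simp_all add: A B)
  then show ?thesis
    unfolding wedge_powers_def wedge_top_def
    by (intro continuous_on_sum continuous_on_mult continuous_on_const continuous_on_prod)
qed

lemma wedge_powers_zero: "wedge_powers 0 A B = fact CARD('n) * Determinants.det B" for B :: "complex^'n::finite^'n"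
  by (simp add: wedge_powers_def wedge_top_const)

text \<open>The row and column factors of the curvature matrix multiply to the reciprocal of the
  density in \<open>distr_log_sq\<close>, so integrals of wedge products become plain Lebesgue
  integrals of mixed discriminants.\<close>

lemma prod_log_sq:
  fixes w :: "complex^'n::finite"
  assumes w: "\<forall>k. w $ k \<noteq> 0"
  shows "(\<Prod>k\<in>UNIV. 1 / (of_real pi * w $ k)) * (\<Prod>k\<in>UNIV. 1 / cnj (w $ k)) =
    of_real (1 / (pi ^ CARD('n) * exp (\<Sum>k\<in>UNIV. log_sq w $ k)))"
proof -
  have "(\<Prod>k\<in>UNIV. 1 / (of_real pi * w $ k)) * (\<Prod>k\<in>UNIV. 1 / cnj (w $ k)) =
      (\<Prod>k\<in>UNIV. complex_of_real (1 / (pi * exp (log_sq w $ k))))"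
    unfolding prod.distrib[symmetric]
  proof (intro prod.cong refl)
    fix k
    have "exp (log_sq w $ k) = (norm (w $ k))\<^sup>2" using w by (simp add: log_sq_def)
    then have "complex_of_real (exp (log_sq w $ k)) = w $ k * cnj (w $ k)" by (simp only: complex_norm_square)
    then show "1 / (of_real pi * w $ k) * (1 / cnj (w $ k)) = complex_of_real (1 / (pi * exp (log_sq w $ k)))"
      by simp
  qed
  also have "\<dots> = of_real (\<Prod>k\<in>UNIV. 1 / (pi * exp (log_sq w $ k)))" by (rule of_real_prod[symmetric])
  also have "(\<Prod>k\<in>UNIV. 1 / (pi * exp (log_sq w $ k))) = 1 / (pi ^ CARD('n) * exp (\<Sum>k\<in>UNIV. log_sq w $ k))"
    by (simp add: prod_dividef prod.distrib exp_sum)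
  finally show ?thesis .
qed

lemma integral_wedge_powers:
  fixes v :: "complex^'n::finite \<Rightarrow> real" and H H' :: "real^'n \<Rightarrow> complex^'n^'n"
  assumes v: "continuous_on UNIV v" "continuous_on UNIV V" "\<And>w. \<forall>k. w $ k \<noteq> 0 \<Longrightarrow> v w = V (log_sq w)"
    and A: "\<And>j k. continuous_on UNIV (\<lambda>w. A w $ j $ k)" "\<And>j k. continuous_on UNIV (\<lambda>x. H x $ j $ k)"
      "\<And>w. \<forall>k. w $ k \<noteq> 0 \<Longrightarrow> A w = (\<chi> j k. (1 / (of_real pi * w $ j)) * (1 / cnj (w $ k)) * H (log_sq w) $ j $ k)"
    and A': "\<And>j k. continuous_on UNIV (\<lambda>w. A' w $ j $ k)" "\<And>j k. continuous_on UNIV (\<lambda>x. H' x $ j $ k)"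
      "\<And>w. \<forall>k. w $ k \<noteq> 0 \<Longrightarrow> A' w = (\<chi> j k. (1 / (of_real pi * w $ j)) * (1 / cnj (w $ k)) * H' (log_sq w) $ j $ k)"
  shows "(LINT w|lborel. v w * Re (wedge_powers l (A' w) (A w))) =
    (LINT x|lborel. V x * Re (wedge_powers l (H' x) (H x)))"
proof -
  let ?F = "\<lambda>x::real^'n. V x * ((1 / (pi ^ CARD('n) * exp (\<Sum>k\<in>UNIV. x $ k))) * Re (wedge_powers l (H' x) (H x)))"
  let ?f = "\<lambda>w. v w * Re (wedge_powers l (A' w) (A w))"
  have F: "?F \<in> borel_measurable borel"
    by (intro borel_measurable_continuous_onI continuous_intros v continuous_on_wedge_powers A A') simp
  have f: "?f \<in> borel_measurable borel"
    by (intro borel_measurable_continuous_onI continuous_intros v continuous_on_wedge_powers A A')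
  have eq: "?f w = ?F (log_sq w)" if w: "\<forall>k. w $ k \<noteq> 0" for w
    unfolding A(3)[OF w] A'(3)[OF w] v(3)[OF w] wedge_powers_scale prod_log_sq[OF w] by simp
  have "(LINT w|lborel. ?f w) = (LINT x|lborel. (pi ^ CARD('n) * exp (\<Sum>k\<in>UNIV. x $ k)) *\<^sub>R ?F x)"
    by (rule integral_log_sq[OF F f eq])
  also have "(\<lambda>x. (pi ^ CARD('n) * exp (\<Sum>k\<in>UNIV. x $ k)) *\<^sub>R ?F x) = (\<lambda>x. V x * Re (wedge_powers l (H' x) (H x)))"
    by (rule ext) simp
  finally show ?thesis .
qed

lemma continuous_on_matrix_entry:
  "continuous_on UNIV H \<Longrightarrow> continuous_on UNIV (\<lambda>x. complex_matrix (\<chi> j k. H x $ k $ j) $ i $ l)"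
  for H :: "real^'n \<Rightarrow> real^'n^'n"
  by (simp add: complex_matrix_def) (intro continuous_intros)

lemma det_complex_matrix_transpose: "Determinants.det (complex_matrix (\<chi> j k. H $ k $ j)) = of_real (Determinants.det H)"
  for H :: "real^'n::finite^'n"
proof -
  have "(\<chi> j k. H $ k $ j) = Finite_Cartesian_Product.transpose H"
    by (simp add: Finite_Cartesian_Product.transpose_def)
  then show ?thesis by (simp add: det_complex_matrix Determinants.det_transpose)
qed

context toric_metric
begin

lemma continuous_on_pot: "continuous_on UNIV pot"
  using pot_C2 C2_complexD(4) by blast

text \<open>The top power of the curvature is n! times the Monge-Ampere measure of \<phi>, which the
  gradient map sends to Lebesgue measure on the simplex.\<close>

lemma volume_eq: "volume h = simplex_volume TYPE('n) m"
proof -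
  obtain H C where HC: "C2 \<phi> grad H" "toric_potential \<phi> grad H m C"
    "\<And>w. (\<forall>k. w $ k \<noteq> 0) \<Longrightarrow> curvature h None w = (\<chi> j k. (1 / (of_real pi * w $ j)) * (1 / cnj (w $ k)) *
       complex_matrix (\<chi> j k. H (log_sq w) $ k $ j) $ j $ k)" using grad by blast
  interpret T: toric_potential \<phi> grad H m C by (rule HC(2))
  note M = continuous_on_curvature continuous_on_matrix_entry[OF T.continuous_H] HC(3)
  have "(LINT w|lborel. Re (wedge_top (\<lambda>_. curvature h None w))) =
      (LINT w|lborel. 1 * Re (wedge_powers 0 (curvature h None w) (curvature h None w)))"
    by (simp add: wedge_powers_def)
  also have "\<dots> = (LINT x|lborel. 1 * Re (wedge_powers 0 (complex_matrix (\<chi> j k. H x $ k $ j)) (complex_matrix (\<chi> j k. H x $ k $ j))))"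
    by (rule integral_wedge_powers[OF continuous_on_const continuous_on_const refl M M])
  also have "\<dots> = (LINT x|lborel. fact CARD('n) * (Determinants.det (H x) * 1))"
  proof -
    have "Re (fact CARD('n) * complex_of_real y) = fact CARD('n) * y" for y
      by (metis Re_complex_of_real of_real_fact of_real_mult)
    then show ?thesis unfolding wedge_powers_zero det_complex_matrix_transpose by simp
  qed
  also have "\<dots> = fact CARD('n) * (LINT p:(open_simplex m :: (real^'n) set)|lborel. (1::real))"
    using T.change_of_variables(3)[of "\<lambda>_. 1" 1] by simp
  also have "(LINT p:(open_simplex m :: (real^'n) set)|lborel. (1::real)) = simplex_volume TYPE('n) m"
    by (simp add: set_lebesgue_integral_def simplex_volume_def)
  finally show ?thesis unfolding volume_def by simp
qed

end

text \<open>\<open>legendre_energy\<close> along the segment between the two potentials. The factor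
  n! between wedge product and mixed discriminant and the 1 / (n + 1) from the Bernstein integrals
  account for the (n + 1)! of the energy.\<close>

lemma energy_difference:
  fixes h h' :: "complex^('n::finite option) \<Rightarrow> real"
  assumes "toric_metric h d m" and "toric_metric h' d m"
  shows "1 / (fact (CARD('n) + 1) * volume h) * (\<Sum>l=0..CARD('n). LINT w|lborel.
      (toric_metric.pot h' w - toric_metric.pot h w) * Re (wedge_powers l (curvature h' None w) (curvature h None w))) =
    ((LINT p:open_simplex m|lborel. toric_potential.legendre (toric_metric.\<phi> h) (toric_metric.grad h m) p) -
     (LINT p:open_simplex m|lborel. toric_potential.legendre (toric_metric.\<phi> h') (toric_metric.grad h' m) p)) /
     simplex_volume TYPE('n) m"
proof -
  interpret A: toric_metric h d m by fact
  interpret B: toric_metric h' d m by fact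
  obtain H C where HC: "C2 A.\<phi> A.grad H" "toric_potential A.\<phi> A.grad H m C"
    "\<And>w. (\<forall>k. w $ k \<noteq> 0) \<Longrightarrow> curvature h None w = (\<chi> j k. (1 / (of_real pi * w $ j)) * (1 / cnj (w $ k)) *
       complex_matrix (\<chi> j k. H (log_sq w) $ k $ j) $ j $ k)" using A.grad by blast
  obtain H' C' where HC': "C2 B.\<phi> B.grad H'" "toric_potential B.\<phi> B.grad H' m C'"
    "\<And>w. (\<forall>k. w $ k \<noteq> 0) \<Longrightarrow> curvature h' None w = (\<chi> j k. (1 / (of_real pi * w $ j)) * (1 / cnj (w $ k)) *
       complex_matrix (\<chi> j k. H' (log_sq w) $ k $ j) $ j $ k)" using B.grad by blast
  interpret TA: toric_potential A.\<phi> A.grad H m C by (rule HC(2))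
  interpret TB: toric_potential B.\<phi> B.grad H' m C' by (rule HC'(2))
  define M M' where "M x = complex_matrix (\<chi> j k. H x $ k $ j)" and "M' x = complex_matrix (\<chi> j k. H' x $ k $ j)" for x
  \<comment> \<open>The wedge product of equal factors is n! times the determinant, hence the
    division.\<close>
  define mixed where "mixed l x = Re (wedge_powers l (M' x) (M x)) / fact CARD('n)" for l x
  note M = A.continuous_on_curvature continuous_on_matrix_entry[OF TA.continuous_H, folded M_def] HC(3)[folded M_def]
  note M' = B.continuous_on_curvature continuous_on_matrix_entry[OF TB.continuous_H, folded M'_def] HC'(3)[folded M'_def]
  interpret P: toric_pair A.\<phi> A.grad H m C "\<lambda>x. B.\<phi> x - A.\<phi> x" "\<lambda>x. B.grad x - A.grad x" "\<lambda>x. H' x - H x" "C + C'" mixed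
  proof (rule toric_pair.intro[OF HC(2)], unfold_locales)
    fix x
    show "((\<lambda>x. B.\<phi> x - A.\<phi> x) has_derivative (\<lambda>v. (B.grad x - A.grad x) \<bullet> v)) (at x)"
      unfolding inner_diff_left by (rule has_derivative_diff[OF TB.\<phi>_deriv TA.\<phi>_deriv])
    show "((\<lambda>x. B.grad x - A.grad x) has_derivative (\<lambda>v. (H' x - H x) *v v)) (at x)"
      unfolding matrix_vector_mult_diff_rdistrib by (rule has_derivative_diff[OF TB.g_deriv TA.g_deriv])
    show "continuous_on UNIV (\<lambda>x. H' x - H x)" by (rule continuous_on_diff[OF TB.continuous_H TA.continuous_H])
    show "0 < v \<bullet> ((H x + (H' x - H x)) *v v)" if "v \<noteq> 0" for v using TB.pos_def[OF that] by simp
    show "\<bar>B.\<phi> x - A.\<phi> x\<bar> \<le> C + C'" using TA.growth[of x] TB.growth[of x] by linarith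
    show "continuous_on UNIV (mixed l)" for l
      unfolding mixed_def by (intro continuous_intros continuous_on_wedge_powers M(2) M'(2)) simp
    fix t
    have "fact CARD('n) * Determinants.det ((1 - t) *\<^sub>R H x + t *\<^sub>R (H x + (H' x - H x))) =
       fact CARD('n) * Determinants.det ((1 - t) *\<^sub>R (\<chi> j k. H x $ k $ j) + t *\<^sub>R (\<chi> j k. H' x $ k $ j))"
    proof -
      \<comment> \<open>The curvature matrices carry the Hessians transposed.\<close>
      have "(1 - t) *\<^sub>R (\<chi> j k. H x $ k $ j) + t *\<^sub>R (\<chi> j k. H' x $ k $ j) =
          Finite_Cartesian_Product.transpose ((1 - t) *\<^sub>R H x + t *\<^sub>R (H x + (H' x - H x)))"
        by (simp add: Finite_Cartesian_Product.transpose_def Finite_Cartesian_Product.vec_eq_iff)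
      then show ?thesis by (simp only: Determinants.det_transpose)
    qed
    also have "\<dots> = fact CARD('n) * (\<Sum>l\<le>CARD('n). bernstein CARD('n) l t * mixed l x)"
      unfolding det_affine sum_distrib_left
      by (intro sum.cong refl) (simp add: bernstein_def mixed_def M_def M'_def)
    finally show "Determinants.det ((1 - t) *\<^sub>R H x + t *\<^sub>R (H x + (H' x - H x))) =
        (\<Sum>l\<le>CARD('n). bernstein CARD('n) l t * mixed l x)" by simp
  qed
  have int: "(LINT w|lborel. (B.pot w - A.pot w) * Re (wedge_powers l (curvature h' None w) (curvature h None w))) =
      fact CARD('n) * (LINT x|lborel. mixed l x * (B.\<phi> x - A.\<phi> x))" for l
  proof -
    have "(LINT w|lborel. (B.pot w - A.pot w) * Re (wedge_powers l (curvature h' None w) (curvature h None w))) =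
        (LINT x|lborel. (B.\<phi> x - A.\<phi> x) * Re (wedge_powers l (M' x) (M x)))"
    proof (rule integral_wedge_powers[OF _ _ _ M M'])
      show "continuous_on UNIV (\<lambda>w. B.pot w - A.pot w)"
        by (intro continuous_on_diff A.continuous_on_pot B.continuous_on_pot)
      show "continuous_on UNIV (\<lambda>x. B.\<phi> x - A.\<phi> x)"
        by (intro continuous_on_diff TA.continuous_\<phi> TB.continuous_\<phi>)
    qed (simp add: A.pot_log_sq B.pot_log_sq)
    also have "\<dots> = (LINT x|lborel. fact CARD('n) * (mixed l x * (B.\<phi> x - A.\<phi> x)))"
      by (simp add: mixed_def mult.commute)
    finally show ?thesis by simp
  qed
  let ?D = "(LINT p:open_simplex m|lborel. TA.legendre p) - (LINT p:open_simplex m|lborel. TB.legendre p)"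
  have "?D = (\<Sum>l\<le>CARD('n). LINT x|lborel. mixed l x * (B.\<phi> x - A.\<phi> x)) / real (Suc CARD('n))"
    using P.legendre_energy by simp
  moreover have "(\<Sum>l=0..CARD('n). LINT w|lborel. (B.pot w - A.pot w) * Re (wedge_powers l (curvature h' None w) (curvature h None w))) =
     fact CARD('n) * (\<Sum>l\<le>CARD('n). LINT x|lborel. mixed l x * (B.\<phi> x - A.\<phi> x))"
    unfolding int sum_distrib_left atMost_atLeast0 ..
  moreover have "fact (CARD('n) + 1) = (real (Suc CARD('n)) * fact CARD('n) :: real)" by simp
  ultimately show ?thesis unfolding A.volume_eq by (simp only: mult.assoc) simp
qed

section \<open>The Ding functional\<close>

text \<open>The metric on K contributes 1 / det A and the volume form n! det A, where A is the
  curvature matrix.\<close>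

lemma l2_product_eq:
  fixes h :: "complex^('n::finite option) \<Rightarrow> real"
  assumes pos: "\<And>w. positive_form (curvature h None w)" and "toric_metric (twist h u) d m"
  shows "l2_product h u s t = of_real (fact CARD('n)) * toric_weight.ip (toric_metric.weight (twist h u)) s t"
proof -
  interpret T: toric_metric "twist h u" d m by fact
  have "inverse (Determinants.det (curvature h None w)) * wedge_top (\<lambda>_. curvature h None w) = of_real (fact CARD('n))" for w
    using det_nonzero_of_positive_form[OF pos[of w]] by (simp add: wedge_top_const)
  then have "l2_product h u s t = (LINT w|lborel. of_real (fact CARD('n)) * (s None w * cnj (t None w) * of_real (T.weight w)))"
    unfolding l2_product_def mult.assoc by (simp add: T.weight_def mult_ac)
  then show ?thesis unfolding T.W.ip_def by (simp only: integral_mult_right_zero)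
qed

lemma twist_zero: "twist h (\<lambda>_. 0) = h"
  by (simp add: twist_def fun_eq_iff)

text \<open>The value is the same for every orthonormal basis, so the arbitrary one in
  \<open>log_gram\<close> causes no dependence. The factors n! and pi^n cancel in the quotients of
  norms.\<close>

lemma log_gram_eq:
  fixes h :: "complex^('n::finite option) \<Rightarrow> real"
  assumes h: "toric_metric h d m" and hu: "toric_metric (twist h u) d m"
  shows "log_gram (d + CARD('n) + 1) h u = - (1 / real (card (compositions d :: ('n option \<Rightarrow> nat) set))) *
    (\<Sum>\<beta>\<in>compositions d. ln (toric_metric.monomial_mass (twist h u) \<beta>) - ln (toric_metric.monomial_mass h \<beta>))"
proof -
  interpret A: toric_metric h d m by fact
  interpret B: toric_metric "twist h u" d m by fact
  let ?S = "compositions d :: ('n option \<Rightarrow> nat) set"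
  let ?m = "d + CARD('n) + 1"
  define N where "N = card ?S"
  have sq: "0 < A.W.norm_sq \<beta>" if "\<beta> \<in> ?S" for \<beta>
    unfolding A.norm_sq_eq using A.monomial_mass_pos[OF that] by simp
  have dim: "sections.dim (adjoint_sections ?m :: ('n option \<Rightarrow> complex^'n \<Rightarrow> complex) set) = N"
    unfolding N_def by (rule A.W.dim_adjoint_sections) (use sq in \<open>simp add: less_imp_neq[THEN not_sym]\<close>)
  have l2: "l2_product h (\<lambda>_. 0) s t = of_real (fact CARD('n)) * A.W.ip s t" for s t
    using l2_product_eq[of h "\<lambda>_. 0" d m s t] A.h_positive h unfolding twist_zero by blast
  have l2u: "l2_product h u s t = of_real (fact CARD('n)) * B.W.ip s t" for s t
    by (rule l2_product_eq[OF A.h_positive hu])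
  define s where "s = (SOME s. orthonormal_basis ?m h N s)"
  have "\<exists>s. orthonormal_basis ?m h N s"
    unfolding orthonormal_basis_def l2
    by (rule A.W.orthonormal_monomials[OF _ sq N_def]) simp_all
  then have s: "orthonormal_basis ?m h N s" unfolding s_def by (rule someI_ex)
  have mem: "s i \<in> adjoint_sections ?m" if "i < N" for i
  proof -
    have "s i \<in> sections.span (s ` {..<N})" by (rule sections.span_base) (use that in auto)
    then show ?thesis using s by (simp add: orthonormal_basis_def)
  qed
  have orth: "of_real (fact CARD('n)) * A.W.ip (s i) (s j) = (if i = j then 1 else 0)" if "i < N" "j < N" for i j
    using s that unfolding orthonormal_basis_def l2 by blast
  have det: "Determinant.det (Matrix.mat N N (\<lambda>(i, j). l2_product h u (s i) (s j))) =
      of_real (\<Prod>\<beta>\<in>?S. B.W.norm_sq \<beta> / A.W.norm_sq \<beta>)"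
    unfolding l2u by (rule gram_det[OF B.W.toric_weight_axioms A.W.toric_weight_axioms _ sq N_def mem orth]) simp_all
  have ratio: "B.W.norm_sq \<beta> / A.W.norm_sq \<beta> = B.monomial_mass \<beta> / A.monomial_mass \<beta>" for \<beta>
    unfolding A.norm_sq_eq B.norm_sq_eq by simp
  have "ln (\<Prod>\<beta>\<in>?S. B.monomial_mass \<beta> / A.monomial_mass \<beta>) = (\<Sum>\<beta>\<in>?S. ln (B.monomial_mass \<beta> / A.monomial_mass \<beta>))"
  proof (rule ln_prod)
    fix \<beta> assume "\<beta> \<in> ?S"
    then have "0 < B.monomial_mass \<beta> / A.monomial_mass \<beta>"
      by (intro divide_pos_pos A.monomial_mass_pos B.monomial_mass_pos)
    then show "B.monomial_mass \<beta> / A.monomial_mass \<beta> \<noteq> 0" by (rule less_imp_neq[THEN not_sym])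
  qed (rule finite_compositions)
  also have "\<dots> = (\<Sum>\<beta>\<in>?S. ln (B.monomial_mass \<beta>) - ln (A.monomial_mass \<beta>))"
    by (intro sum.cong refl) (simp add: ln_div A.monomial_mass_pos[THEN less_imp_neq, THEN not_sym] B.monomial_mass_pos[THEN less_imp_neq, THEN not_sym])
  finally have "ln (Re (Determinant.det (Matrix.mat N N (\<lambda>(i, j). l2_product h u (s i) (s j))))) =
      (\<Sum>\<beta>\<in>?S. ln (B.monomial_mass \<beta>) - ln (A.monomial_mass \<beta>))"
    unfolding det ratio Re_complex_of_real .
  then show ?thesis unfolding log_gram_def Let_def dim s_def[symmetric] N_def[symmetric] by simp
qed

context toric_metric
begin

text \<open>What remains of energy and Gram determinant once the terms with \<open>u\<close> are
  gone: the contributions of the reference metric and the constants of the kernel estimates.\<close>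

definition ding_bound :: "(('n option \<Rightarrow> nat) \<Rightarrow> real) \<Rightarrow> real" where
  "ding_bound K = (LINT p:open_simplex m|lborel. toric_potential.legendre \<phi> grad p) / simplex_volume TYPE('n) m +
     (1 / real (card (compositions d :: ('n option \<Rightarrow> nat) set))) * (\<Sum>\<beta>\<in>compositions d. ln (K \<beta>) - ln (monomial_mass \<beta>))"

end

text \<open>One K serves all potentials of the given degree, so the bounds for different reference
  metrics can be compared with the same constants.\<close>

definition kernel_bounds :: "nat \<Rightarrow> real \<Rightarrow> (('n::finite option \<Rightarrow> nat) \<Rightarrow> real) \<Rightarrow> bool" where
  "kernel_bounds d m K \<longleftrightarrow> (\<forall>\<beta>\<in>compositions d. 0 < K \<beta> \<and> (\<forall>\<phi> g H C. toric_potential \<phi> g H m C \<longrightarrow>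
    integrable lborel (\<lambda>x. exp (x \<bullet> barycentre \<beta> - \<phi> x)) \<and>
    integrable lborel (\<lambda>p. dirichlet m \<beta> p * toric_potential.legendre \<phi> g p) \<and>
    (LINT x|lborel. exp (x \<bullet> barycentre \<beta> - \<phi> x)) \<le>
      K \<beta> * exp (LINT p|lborel. dirichlet m \<beta> p * toric_potential.legendre \<phi> g p)))"

lemma kernel_bounds_exist: "m = real (d + CARD('n) + 1) \<Longrightarrow> \<exists>K :: ('n::finite option \<Rightarrow> nat) \<Rightarrow> real. kernel_bounds d m K"
  unfolding kernel_bounds_def using kernel_estimate by (intro bchoice) blast

lemma ding_functional_le:
  fixes h :: "complex^('n::finite option) \<Rightarrow> real"
  assumes h: "toric_metric h d m" and hu: "toric_metric (twist h u) d m"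
    and curv: "\<And>w. ddc_function u None w + curvature h None w = curvature (twist h u) None w"
    and K: "kernel_bounds d m K"
  shows "ding_functional (d + CARD('n) + 1) h u \<le> toric_metric.ding_bound h d m K"
proof -
  interpret A: toric_metric h d m by fact
  interpret B: toric_metric "twist h u" d m by fact
  let ?S = "compositions d :: ('n option \<Rightarrow> nat) set"
  let ?V = "simplex_volume TYPE('n) m"
  define N where "N = real (card ?S)"
  have N: "0 < N" unfolding N_def using card_compositions_pos[where 'n = 'n and d = d] by simp
  have m: "0 < m" by (simp add: A.m_eq)
  have V: "0 < ?V" unfolding simplex_volume_def by (rule measure_open_simplex_pos[OF m])
  have u: "u (chart None w) = B.pot w - A.pot w" for w
  proof -
    have "0 < h (chart_lift None w)" by (rule A.h_pos[OF chart_lift_nonzero])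
    then show ?thesis by (simp add: A.pot_def B.pot_def twist_def chart_def ln_mult)
  qed
  let ?LA = "toric_potential.legendre A.\<phi> A.grad" and ?LB = "toric_potential.legendre B.\<phi> B.grad"
  have energy: "energy h u = ((LINT p:open_simplex m|lborel. ?LA p) - (LINT p:open_simplex m|lborel. ?LB p)) / ?V"
    unfolding energy_def curv u by (rule energy_difference[OF h hu])
  obtain H' C' where "toric_potential B.\<phi> B.grad H' m C'" using B.grad by blast
  then have KB: "0 < K \<beta>" "integrable lborel (\<lambda>p. dirichlet m \<beta> p * ?LB p)"
      "B.monomial_mass \<beta> \<le> K \<beta> * exp (LINT p|lborel. dirichlet m \<beta> p * ?LB p)" if "\<beta> \<in> ?S" for \<beta>
    using K that unfolding kernel_bounds_def B.monomial_mass_def by blast+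
  have "(\<Sum>\<beta>\<in>?S. ln (B.monomial_mass \<beta>)) \<le> (\<Sum>\<beta>\<in>?S. ln (K \<beta>) + (LINT p|lborel. dirichlet m \<beta> p * ?LB p))"
  proof (rule sum_mono)
    fix \<beta> assume \<beta>: "\<beta> \<in> ?S"
    have "ln (B.monomial_mass \<beta>) \<le> ln (K \<beta> * exp (LINT p|lborel. dirichlet m \<beta> p * ?LB p))"
      using KB(3)[OF \<beta>] B.monomial_mass_pos[OF \<beta>] by simp
    also have "\<dots> = ln (K \<beta>) + (LINT p|lborel. dirichlet m \<beta> p * ?LB p)"
      using KB(1)[OF \<beta>] by (simp add: ln_mult)
    finally show "ln (B.monomial_mass \<beta>) \<le> ln (K \<beta>) + (LINT p|lborel. dirichlet m \<beta> p * ?LB p)" .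
  qed
  also have "\<dots> = (\<Sum>\<beta>\<in>?S. ln (K \<beta>)) + (LINT p|lborel. (\<Sum>\<beta>\<in>?S. dirichlet m \<beta> p) * ?LB p)"
    unfolding sum.distrib sum_distrib_right using KB(2) by (subst Bochner_Integration.integral_sum) auto
  also have "(LINT p|lborel. (\<Sum>\<beta>\<in>?S. dirichlet m \<beta> p) * ?LB p) = N / ?V * (LINT p:open_simplex m|lborel. ?LB p)"
    unfolding sum_dirichlet[OF m] N_def[symmetric] set_lebesgue_integral_def by (simp add: mult.assoc)
  finally have le: "(\<Sum>\<beta>\<in>?S. ln (B.monomial_mass \<beta>)) \<le> (\<Sum>\<beta>\<in>?S. ln (K \<beta>)) + N / ?V * (LINT p:open_simplex m|lborel. ?LB p)" .
  have "ding_functional (d + CARD('n) + 1) h u = ((LINT p:open_simplex m|lborel. ?LA p) - (LINT p:open_simplex m|lborel. ?LB p)) / ?V +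
      (1 / N) * ((\<Sum>\<beta>\<in>?S. ln (B.monomial_mass \<beta>)) - (\<Sum>\<beta>\<in>?S. ln (A.monomial_mass \<beta>)))"
    unfolding ding_functional_def energy log_gram_eq[OF h hu] N_def sum_subtractf by simp
  also have "\<dots> \<le> ((LINT p:open_simplex m|lborel. ?LA p) - (LINT p:open_simplex m|lborel. ?LB p)) / ?V +
      (1 / N) * ((\<Sum>\<beta>\<in>?S. ln (K \<beta>)) + N / ?V * (LINT p:open_simplex m|lborel. ?LB p) - (\<Sum>\<beta>\<in>?S. ln (A.monomial_mass \<beta>)))"
    using le N by (intro add_left_mono mult_left_mono) auto
  also have "\<dots> = A.ding_bound K"
    unfolding A.ding_bound_def N_def[symmetric] sum_subtractf using N V by (simp add: field_simps)
  finally show ?thesis .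
qed

section \<open>Powers and twists of the reference metric\<close>

lemma smooth_imp_continuous: "smooth f \<Longrightarrow> continuous_on UNIV f"
  unfolding smooth_def by (metis Ck.simps(1))

lemma positive_form_scale:
  assumes A: "positive_form A" and c: "0 < c"
  shows "positive_form (c *\<^sub>R A)"
  unfolding positive_form_def
proof (intro conjI allI impI)
  fix j k
  have "A $ k $ j = cnj (A $ j $ k)" using A unfolding positive_form_def by blast
  then show "(c *\<^sub>R A) $ k $ j = cnj ((c *\<^sub>R A) $ j $ k)"
    by (simp only: vector_scaleR_component complex_cnj_scaleR)
next
  fix v :: "complex^'a" assume v: "v \<noteq> 0"
  have "(\<Sum>j\<in>UNIV. \<Sum>k\<in>UNIV. (c *\<^sub>R A) $ j $ k * v $ j * cnj (v $ k)) =
      of_real c * (\<Sum>j\<in>UNIV. \<Sum>k\<in>UNIV. A $ j $ k * v $ j * cnj (v $ k))"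
  proof -
    have "(c *\<^sub>R A) $ j $ k = of_real c * A $ j $ k" for j k
      unfolding vector_scaleR_component by (rule scaleR_conv_of_real)
    then show ?thesis unfolding sum_distrib_left by (intro sum.cong refl) (simp only: mult.assoc)
  qed
  moreover have "0 < Re (\<Sum>j\<in>UNIV. \<Sum>k\<in>UNIV. A $ j $ k * v $ j * cnj (v $ k))"
    using A v unfolding positive_form_def by blast
  ultimately show "0 < Re (\<Sum>j\<in>UNIV. \<Sum>k\<in>UNIV. (c *\<^sub>R A) $ j $ k * v $ j * cnj (v $ k))"
    using c by simp
qed

lemma
  fixes h0 :: "complex^('n::finite option) \<Rightarrow> real"
  assumes h0: "smooth_metric 1 h0" "torus_invariant h0" "kaehler (curvature h0)"
    and m: "m = d + CARD('n) + 1"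
  shows curvature_power: "curvature (\<lambda>z. h0 z ^ m) None w = real m *\<^sub>R curvature h0 None w"
    and toric_metric_power: "toric_metric (\<lambda>z. h0 z ^ m) d (real m)"
proof -
  have pos: "0 < h0 z" if "z \<noteq> 0" for z using h0(1) that by (simp add: smooth_metric_def)
  have scale: "h0 (c *s z) = h0 z / norm c ^ (2 * 1)" if "c \<noteq> 0" "z \<noteq> 0" for c z
    using h0(1) that unfolding smooth_metric_def by blast
  have smooth: "smooth (\<lambda>w. h0 (chart_lift i w))" for i using h0(1) by (simp add: smooth_metric_def)
  obtain P Q where "C2_complex (\<lambda>w. h0 (chart_lift None w)) P Q" using smooth_C2_complex[OF smooth] by blast
  from C2_complex_ln[OF this pos[OF chart_lift_nonzero]]
  obtain P Q where PQ: "C2_complex (\<lambda>w. ln (h0 (chart_lift None w))) P Q" by blast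
  have ln: "(\<lambda>w. ln (h0 (chart_lift None w) ^ m)) = (\<lambda>w. real m * ln (h0 (chart_lift None w)))"
    using pos[OF chart_lift_nonzero] by (simp add: ln_realpow)
  show curv: "curvature (\<lambda>z. h0 z ^ m) None w = real m *\<^sub>R curvature h0 None w" for w
    unfolding curvature_def ln ddc_scale[OF PQ] by simp
  show "toric_metric (\<lambda>z. h0 z ^ m) d (real m)"
  proof
    show "real m = real (d + CARD('n) + 1)" by (simp add: m)
    show "0 < h0 z ^ m" if "z \<noteq> 0" for z using pos[OF that] by simp
    show "h0 (c *s z) ^ m = h0 z ^ m / norm c ^ (2 * (d + CARD('n) + 1))" if "c \<noteq> 0" "z \<noteq> 0" for c z
      unfolding scale[OF that] m[symmetric] by (simp add: power_divide power_mult)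
    show "continuous_on UNIV (\<lambda>w. h0 (chart_lift i w) ^ m)" for i
      by (intro continuous_on_power smooth_imp_continuous smooth)
    show "torus_invariant (\<lambda>z. h0 z ^ m)" using h0(2) by (simp add: torus_invariant_def)
    show "\<exists>P Q. C2_complex (\<lambda>w. ln (h0 (chart_lift None w) ^ m)) P Q"
      unfolding ln using C2_complex_scale[OF PQ] by blast
    show "positive_form (curvature (\<lambda>z. h0 z ^ m) None w)" for w
      unfolding curv by (rule positive_form_scale) (use h0(3) m in \<open>simp_all add: kaehler_def\<close>)
  qed
qed

lemma
  fixes h :: "complex^('n::finite option) \<Rightarrow> real"
  assumes h: "toric_metric h d m" and u: "u \<in> invariant_potentials h"
  shows curvature_twist: "ddc_function u None w + curvature h None w = curvature (twist h u) None w"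
    and toric_metric_twist: "toric_metric (twist h u) d m"
proof -
  interpret A: toric_metric h d m by fact
  have smooth: "smooth (\<lambda>w. u (chart i w))" and pos: "positive_form (ddc_function u None w + curvature h None w)"
    and inv: "torus_invariant (twist h u)" for i w
    using u by (simp_all add: invariant_potentials_def potentials_def smooth_function_def kaehler_def)
  obtain P Q where PQ: "C2_complex (\<lambda>w. u (chart None w)) P Q" using smooth_C2_complex[OF smooth] by blast
  obtain P' Q' where PQ': "C2_complex A.pot P' Q'" using A.pot_C2 by blast
  have ln: "(\<lambda>w. ln (twist h u (chart_lift None w))) = (\<lambda>w. - 1 * (u (chart None w) + A.pot w))"
    using A.h_pos[OF chart_lift_nonzero, THEN less_imp_neq, THEN not_sym]
    by (simp add: twist_def chart_def ln_mult A.pot_def fun_eq_iff)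
  show curv: "ddc_function u None w + curvature h None w = curvature (twist h u) None w" for w
    unfolding curvature_def[of "twist h u"] ln ddc_scale[OF C2_complex_add[OF PQ PQ']] ddc_add[OF PQ PQ']
      A.curvature_pot ddc_function_def by simp
  show "toric_metric (twist h u) d m"
  proof
    show "m = real (d + CARD('n) + 1)" by (rule A.m_eq)
    show "0 < twist h u z" if "z \<noteq> 0" for z using A.h_pos[OF that] by (simp add: twist_def)
    show "twist h u (c *s z) = twist h u z / norm c ^ (2 * (d + CARD('n) + 1))" if "c \<noteq> 0" "z \<noteq> 0" for c z
      unfolding twist_def line_scale[OF that(1)] A.h_scale[OF that] by simp
    show "continuous_on UNIV (\<lambda>w. twist h u (chart_lift i w))" for i
      unfolding twist_def chart_def[symmetric]
      by (intro continuous_on_mult A.h_cont continuous_on_exp continuous_on_minus smooth_imp_continuous smooth)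
    show "torus_invariant (twist h u)" by (rule inv)
    show "\<exists>P Q. C2_complex (\<lambda>w. ln (twist h u (chart_lift None w))) P Q"
      unfolding ln using C2_complex_scale[OF C2_complex_add[OF PQ PQ']] by blast
    show "positive_form (curvature (twist h u) None w)" for w using pos[of w] unfolding curv .
  qed
qed

text \<open>Equal curvature means equal Hessians, so the potentials differ by an affine function.
  Its linear part vanishes because both potentials stay at bounded distance from m
  \<open>pos_max\<close>.\<close>

lemma potential_unique:
  fixes h k :: "complex^('n::finite option) \<Rightarrow> real"
  assumes h: "toric_metric h d m" and k: "toric_metric k d m"
    and eq: "\<And>w. curvature h None w = curvature k None w"
  shows "\<exists>c. \<forall>x. toric_metric.\<phi> k x = toric_metric.\<phi> h x + c \<and> toric_metric.grad k m x = toric_metric.grad h m x"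
proof -
  interpret A: toric_metric h d m by fact
  interpret B: toric_metric k d m by fact
  obtain H C where HC: "C2 A.\<phi> A.grad H" "toric_potential A.\<phi> A.grad H m C"
    "\<And>w. (\<forall>k. w $ k \<noteq> 0) \<Longrightarrow> curvature h None w = (\<chi> j k. (1 / (of_real pi * w $ j)) * (1 / cnj (w $ k)) *
       complex_matrix (\<chi> j k. H (log_sq w) $ k $ j) $ j $ k)" using A.grad by blast
  obtain H' C' where HC': "C2 B.\<phi> B.grad H'" "toric_potential B.\<phi> B.grad H' m C'"
    "\<And>w. (\<forall>k. w $ k \<noteq> 0) \<Longrightarrow> curvature k None w = (\<chi> j k. (1 / (of_real pi * w $ j)) * (1 / cnj (w $ k)) *
       complex_matrix (\<chi> j k. H' (log_sq w) $ k $ j) $ j $ k)" using B.grad by blast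
  interpret TA: toric_potential A.\<phi> A.grad H m C by (rule HC(2))
  interpret TB: toric_potential B.\<phi> B.grad H' m C' by (rule HC'(2))
  have HH: "H' x = H x" for x
  proof -
    let ?w = "exp_half x"
    have nz: "\<forall>k. ?w $ k \<noteq> 0" by (simp add: exp_half_def)
    have "H' x $ i $ j = H x $ i $ j" for i j
    proof -
      have "curvature h None ?w $ j $ i = curvature k None ?w $ j $ i" by (simp add: eq)
      then show ?thesis unfolding HC(3)[OF nz] HC'(3)[OF nz] using nz by (simp add: complex_matrix_def)
    qed
    then show ?thesis by (simp add: Finite_Cartesian_Product.vec_eq_iff)
  qed
  have "((\<lambda>x. B.grad x - A.grad x) has_derivative (\<lambda>v. 0)) (at x)" for x
    using has_derivative_diff[OF TB.g_deriv TA.g_deriv, of x] unfolding HH by simp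
  then obtain b where b: "\<And>x. B.grad x - A.grad x = b"
    using has_derivative_zero_constant[of UNIV "\<lambda>x. B.grad x - A.grad x"] by auto
  have "((\<lambda>x. B.\<phi> x - A.\<phi> x - b \<bullet> x) has_derivative (\<lambda>v. 0)) (at x)" for x
  proof (rule has_derivative_eq_rhs)
    show "((\<lambda>x. B.\<phi> x - A.\<phi> x - b \<bullet> x) has_derivative (\<lambda>v. B.grad x \<bullet> v - A.grad x \<bullet> v - b \<bullet> v)) (at x)"
      by (intro has_derivative_diff TB.\<phi>_deriv TA.\<phi>_deriv has_derivative_inner_right has_derivative_ident)
    show "(\<lambda>v. B.grad x \<bullet> v - A.grad x \<bullet> v - b \<bullet> v) = (\<lambda>v. 0)"
      by (simp add: b[of x, symmetric] inner_diff_left)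
  qed
  then obtain c where c: "\<And>x. B.\<phi> x - A.\<phi> x - b \<bullet> x = c"
    using has_derivative_zero_constant[of UNIV "\<lambda>x. B.\<phi> x - A.\<phi> x - b \<bullet> x"] by auto
  have "b = 0"
  proof (rule ccontr)
    assume "b \<noteq> 0"
    then have bb: "0 < b \<bullet> b" by simp
    \<comment> \<open>Far enough in the direction \<open>b\<close> that the linear part exceeds the
      bound C + C' on the difference even after subtracting |c|.\<close>
    define x where "x = ((C + C' + \<bar>c\<bar> + 1) / (b \<bullet> b)) *\<^sub>R b"
    have "b \<bullet> x = C + C' + \<bar>c\<bar> + 1" using bb by (simp add: x_def)
    moreover have "\<bar>B.\<phi> x - A.\<phi> x\<bar> \<le> C + C'" using TA.growth[of x] TB.growth[of x] by linarith
    ultimately show False using c[of x] by linarith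
  qed
  then show ?thesis using b c by (intro exI[of _ c] allI) (simp add: algebra_simps)
qed

text \<open>Adding c to the potential lowers the mean of the Legendre transform by c and the
  logarithm of each monomial mass by c; in the bound these enter with opposite signs.\<close>

lemma ding_bound_cong:
  fixes h k :: "complex^('n::finite option) \<Rightarrow> real"
  assumes h: "toric_metric h d m" and k: "toric_metric k d m"
    and eq: "\<And>w. curvature h None w = curvature k None w"
  shows "toric_metric.ding_bound k d m K = toric_metric.ding_bound h d m K"
proof -
  interpret A: toric_metric h d m by fact
  interpret B: toric_metric k d m by fact
  obtain c where \<phi>: "\<And>x. B.\<phi> x = A.\<phi> x + c" and "\<And>x. B.grad x = A.grad x"
    using potential_unique[OF assms] by blast
  then have g: "B.grad = A.grad" by blast
  obtain H C where "toric_potential A.\<phi> A.grad H m C" using A.grad by blast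
  then interpret TA: toric_potential A.\<phi> A.grad H m C .
  obtain H' C' where "toric_potential B.\<phi> B.grad H' m C'" using B.grad by blast
  then interpret TB: toric_potential B.\<phi> B.grad H' m C' .
  let ?S = "compositions d :: ('n option \<Rightarrow> nat) set" and ?V = "simplex_volume TYPE('n) m"
  define N where "N = real (card ?S)"
  have N: "0 < N" unfolding N_def using card_compositions_pos[where 'n = 'n and d = d] by simp
  have V: "0 < ?V" unfolding simplex_volume_def by (rule measure_open_simplex_pos[OF TA.m_pos])
  have L: "TB.legendre p = TA.legendre p - c" for p
  proof -
    have "TB.arg p = TA.arg p" unfolding TB.arg_def TA.arg_def g ..
    then show ?thesis unfolding TB.legendre_def TA.legendre_def \<phi>[of "TB.arg p"] by simp
  qed
  have mass: "ln (B.monomial_mass \<beta>) = ln (A.monomial_mass \<beta>) - c" if "\<beta> \<in> ?S" for \<beta>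
  proof -
    have "B.monomial_mass \<beta> = (LINT x|lborel. exp (- c) * exp (x \<bullet> barycentre \<beta> - A.\<phi> x))"
      unfolding B.monomial_mass_def \<phi> by (simp add: exp_add[symmetric] algebra_simps)
    also have "\<dots> = exp (- c) * A.monomial_mass \<beta>" by (simp add: A.monomial_mass_def)
    finally show ?thesis using A.monomial_mass_pos[OF that] by (simp add: ln_mult)
  qed
  have "(LINT p:open_simplex m|lborel. TB.legendre p) =
      (LINT p:open_simplex m|lborel. TA.legendre p) - (LINT p:(open_simplex m :: (real^'n) set)|lborel. c)"
    unfolding L by (rule set_integral_diff(2)[OF TA.set_integrable_legendre TA.change_of_variables(2)[OF continuous_on_const]]) (rule order_refl)
  also have "(LINT p:(open_simplex m :: (real^'n) set)|lborel. c) = c * ?V"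
    by (simp add: set_lebesgue_integral_def simplex_volume_def)
  finally have int: "(LINT p:open_simplex m|lborel. TB.legendre p) = (LINT p:open_simplex m|lborel. TA.legendre p) - c * ?V" .
  have "(\<Sum>\<beta>\<in>?S. ln (K \<beta>) - ln (B.monomial_mass \<beta>)) = (\<Sum>\<beta>\<in>?S. (ln (K \<beta>) - ln (A.monomial_mass \<beta>)) + c)"
    by (intro sum.cong refl) (simp add: mass)
  also have "\<dots> = (\<Sum>\<beta>\<in>?S. ln (K \<beta>) - ln (A.monomial_mass \<beta>)) + N * c"
    by (simp add: sum.distrib N_def)
  finally have sum: "(\<Sum>\<beta>\<in>?S. ln (K \<beta>) - ln (B.monomial_mass \<beta>)) = (\<Sum>\<beta>\<in>?S. ln (K \<beta>) - ln (A.monomial_mass \<beta>)) + N * c" .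
  show ?thesis
    unfolding A.ding_bound_def B.ding_bound_def int sum N_def[symmetric]
    using N V by (simp add: distrib_left diff_divide_distrib)
qed

theorem mainTheorem6:
  shows "\<exists>c :: nat \<Rightarrow> ('n::finite option \<Rightarrow> complex^'n \<Rightarrow> complex^'n^'n) \<Rightarrow> real.
    \<forall>h0 :: complex^('n option) \<Rightarrow> real.
      smooth_metric 1 h0 \<longrightarrow> torus_invariant h0 \<longrightarrow> kaehler (curvature h0) \<longrightarrow>
      (\<exists>N. \<forall>m\<ge>N. \<forall>u \<in> invariant_potentials (\<lambda>z. h0 z ^ m).
        ding_functional m (\<lambda>z. h0 z ^ m) u \<le> c m (curvature h0))"
proof -
  let ?good = "\<lambda>h0 :: complex^('n option) \<Rightarrow> real. smooth_metric 1 h0 \<and> torus_invariant h0 \<and> kaehler (curvature h0)"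
  \<comment> \<open>The bound is stated for all reference metrics with curvature \<omega> at once; a
    choice of \<open>c\<close> for each \<open>m\<close> and \<omega> then depends on nothing
    else.\<close>
  define P where "P m \<omega> c \<longleftrightarrow> (\<forall>h0. ?good h0 \<longrightarrow> curvature h0 = \<omega> \<longrightarrow> CARD('n) + 1 \<le> m \<longrightarrow>
      (\<forall>u\<in>invariant_potentials (\<lambda>z. h0 z ^ m). ding_functional m (\<lambda>z. h0 z ^ m) u \<le> c))" for m \<omega> c
  have ex: "\<exists>c. P m \<omega> c" for m \<omega>
  \<comment> \<open>A fixed representative \<open>h1\<close> supplies the constant; without one, or
    for small \<open>m\<close>, every constant satisfies \<open>P\<close>.\<close>
  proof (cases "CARD('n) + 1 \<le> m \<and> (\<exists>h1. ?good h1 \<and> curvature h1 = \<omega>)")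
    case True
    then obtain h1 where h1: "?good h1" "curvature h1 = \<omega>" and "CARD('n) + 1 \<le> m" by blast
    then obtain d where m: "m = d + CARD('n) + 1" by (metis add.assoc add.commute le_Suc_ex)
    obtain K :: "('n option \<Rightarrow> nat) \<Rightarrow> real" where K: "kernel_bounds d (real m) K"
      using kernel_bounds_exist[where 'n = 'n and d = d and m = "real m"] m by blast
    have T1: "toric_metric (\<lambda>z. h1 z ^ m) d (real m)" by (rule toric_metric_power) (use h1 m in auto)
    show ?thesis
      unfolding P_def
    proof (intro exI allI impI ballI)
      fix h0 u assume h0: "?good h0" "curvature h0 = \<omega>" and u: "u \<in> invariant_potentials (\<lambda>z. h0 z ^ m)"
      have T0: "toric_metric (\<lambda>z. h0 z ^ m) d (real m)" by (rule toric_metric_power) (use h0 m in auto)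
      have "curvature (\<lambda>z. h1 z ^ m) None w = real m *\<^sub>R \<omega> None w" for w
        using curvature_power[of h1 m d w] h1 m by simp
      moreover have "curvature (\<lambda>z. h0 z ^ m) None w = real m *\<^sub>R \<omega> None w" for w
        using curvature_power[of h0 m d w] h0 m by simp
      ultimately have eq: "curvature (\<lambda>z. h1 z ^ m) None w = curvature (\<lambda>z. h0 z ^ m) None w" for w by simp
      have "ding_functional m (\<lambda>z. h0 z ^ m) u \<le> toric_metric.ding_bound (\<lambda>z. h0 z ^ m) d (real m) K"
        using ding_functional_le[OF T0 toric_metric_twist[OF T0 u] curvature_twist[OF T0 u] K] by (simp only: m[symmetric])
      also have "\<dots> = toric_metric.ding_bound (\<lambda>z. h1 z ^ m) d (real m) K" by (rule ding_bound_cong[OF T1 T0 eq])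
      finally show "ding_functional m (\<lambda>z. h0 z ^ m) u \<le> toric_metric.ding_bound (\<lambda>z. h1 z ^ m) d (real m) K" .
    qed
  qed (unfold P_def, blast)
  define c where "c m \<omega> = (SOME c. P m \<omega> c)" for m \<omega>
  have c: "P m \<omega> (c m \<omega>)" for m \<omega> unfolding c_def by (rule someI_ex[OF ex])
  show ?thesis
  \<comment> \<open>From m = n + 1 on, d = m - n - 1 is a natural number and there are non-zero
    sections.\<close>
  proof (intro exI[of _ c] allI impI exI[of _ "CARD('n) + 1"] ballI)
    fix h0 :: "complex^('n option) \<Rightarrow> real" and m u
    assume "smooth_metric 1 h0" "torus_invariant h0" "kaehler (curvature h0)" "CARD('n) + 1 \<le> m"
      "u \<in> invariant_potentials (\<lambda>z. h0 z ^ m)"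
    then show "ding_functional m (\<lambda>z. h0 z ^ m) u \<le> c m (curvature h0)"
      using c[of m "curvature h0"] unfolding P_def by blast
  qed
qed

end
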